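(* Let $g(\tau)=\eta^2(4\tau)\eta^2(8\tau)=\sum_{n\ge1}b(n)q^n\in S_2(\Gamma_0(32))$ and let $p\equiv 3\pmod 4$ be a prime. Let $\mathcal{E}_g=\sum_{n\ge1}\frac{b(n)}{n}q^n$ and let $\mathcal{F}=f^+=\sum_n\frac{d(n)}{n}q^n\in\mathbb{Q}(\!(q)\!)$ be the holomorphic part of the weak harmonic Maass form of El-Guindy–Ono, characterized by $q\frac{d}{dq}f^+=-g(\tau)L(2\tau)$, where $L(\tau)=\frac{\eta^6(8\tau)}{\eta^2(4\tau)\eta^4(16\tau)}$. Let $\beta,\gamma\in\mathbb{Q}_p$ be the unique pair with $$\operatorname{ord}_p\Bigl(f^+-\beta\mathcal{E}_g-\gamma\tfrac1p\,\mathcal{E}_g|V\Bigr)>-\infty$$ (so $\gamma$ is the exceptional value). Then $$\gamma=\Bigl(\frac{2}{p}\Bigr)\lim_{m\to\infty}\frac{5\,C\bigl((p^{2m+1}+1)/4\bigr)}{3\,C\bigl((p^{2m}-1)/4\bigr)}=8\Bigl(\frac{2}{p}\Bigr)\frac{\Gamma_p(1/2)}{\Gamma_p(1/4)^2}=\begin{cases}\bigl(\frac{2}{p}\bigr)(-1)^{(3+h(-p))/2}\dfrac{8}{\Gamma_p(1/4)^2}, & p>3,\\[2mm] \dfrac{8}{\Gamma_p(1/4)^2}, & p=3.\end{cases}$$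
   Context: $\eta$ is the Dedekind eta function, $q=e^{2\pi i\tau}$. $V$ acts on Laurent series by $\bigl(\sum a(n)q^n\bigr)|V=\sum a(n)q^{pn}$; for $\sum c(n)q^n\in\mathbb{Q}_p(\!(q)\!)$, $\operatorname{ord}_p(\sum c(n)q^n)=\inf_n\operatorname{ord}_p(c(n))$. Equivalently, $\gamma$ is the unique value for which the $p$-adic limit $\lim_{m\to\infty}(Df^+-\beta g-\gamma g|V)|U^{2m+1}/C_{\beta,\gamma}(p^{2m+1})=g$ fails, where $Uf$ is Atkin's operator $\sum a(n)q^n\mapsto\sum a(pn)q^n$ and $C_{\beta,\gamma}(n)$ is the $n$-th coefficient of $Df^+-\beta g-\gamma g|V$. $C(n)=\frac{1}{n+1}\binom{2n}{n}$ is the $n$-th Catalan number; $\bigl(\frac{2}{p}\bigr)$ is the Legendre symbol; $\Gamma_p$ is Morita's $p$-adic Gamma function; $h(-p)$ is the class number of $\mathbb{Q}(\sqrt{-p})$. The limit is $p$-adic.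
   Formalization: The first two expressions for γ (the Catalan limit and 8(2/p)Γ_p(1/2)/Γ_p(1/4)^2) carry an added minus sign: as printed they equal −γ and contradict the final case formula (for p=3 the second is 1 and the third 2 mod 3). The final case formula is as printed. *)

theory Defs
  imports
    "HOL-Complex_Analysis.Complex_Analysis"
    "HOL-Number_Theory.Number_Theory"
    "HOL-Algebra.Ideal"
    "Berlekamp_Zassenhaus.Finite_Field"
begin

section \<open>The \<open>p\<close>-adic absolute value on the rationals\<close>

definition rat_ord :: "nat \<Rightarrow> rat \<Rightarrow> int" where
  "rat_ord p x = int (multiplicity (int p) (fst (quotient_of x)))
               - int (multiplicity (int p) (snd (quotient_of x)))"

definition rat_pabs :: "nat \<Rightarrow> rat \<Rightarrow> real" where
  "rat_pabs p x = (if x = 0 then 0 else real p powi (- rat_ord p x))"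

lemma rat_ord_frac:
  assumes p: "prime p" and a: "a \<noteq> 0" and b: "b \<noteq> 0"
  shows "rat_ord p (of_int a / of_int b) = int (multiplicity (int p) a) - int (multiplicity (int p) b)"
proof -
  obtain c d where q: "quotient_of (of_int a / of_int b) = (c, d)" by (cases "quotient_of (of_int a / of_int b)") auto
  have d: "d > 0" using quotient_of_denom_pos[OF q] .
  have e: "(of_int a / of_int b :: rat) = of_int c / of_int d" using quotient_of_div[OF q] .
  hence "of_int (a * d) = (of_int (c * b) :: rat)" using b d by (simp add: field_simps)
  hence eq: "a * d = c * b" by (simp only: of_int_eq_iff)
  have c: "c \<noteq> 0" using eq a d by auto
  have pr: "prime_elem (int p)" using p by auto
  have "multiplicity (int p) a + multiplicity (int p) d = multiplicity (int p) c + multiplicity (int p) b"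
    using eq a b c d pr
    by (metis prime_elem_multiplicity_mult_distrib less_irrefl)
  thus ?thesis by (simp add: rat_ord_def q)
qed

lemma rat_common_denom:
  fixes x y :: rat
  obtains a b d :: int where "x = of_int a / of_int d" "y = of_int b / of_int d" "d \<noteq> 0"
proof -
  obtain a c where x: "x = of_int a / of_int c" "c > 0"
    by (metis quotient_of_denom_pos quotient_of_div surj_pair)
  obtain b e where y: "y = of_int b / of_int e" "e > 0"
    by (metis quotient_of_denom_pos quotient_of_div surj_pair)
  show thesis
    by (rule that[of "a * e" "c * e" "b * c"]) (use x y in \<open>auto simp: field_simps\<close>)
qed

lemma rat_ord_mult:
  assumes p: "prime p" and "x \<noteq> 0" "y \<noteq> 0"
  shows "rat_ord p (x * y) = rat_ord p x + rat_ord p y"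
proof -
  obtain a b d where 1: "x = of_int a / of_int d" "y = of_int b / of_int d" "d \<noteq> 0"
    by (rule rat_common_denom)
  have ab: "a \<noteq> 0" "b \<noteq> 0" using 1 assms by auto
  have pr: "prime_elem (int p)" using p by auto
  have "x * y = of_int (a * b) / of_int (d * d)" using 1 by simp
  hence "rat_ord p (x * y) = int (multiplicity (int p) (a * b)) - int (multiplicity (int p) (d * d))"
    using rat_ord_frac[OF p, of "a * b" "d * d"] ab 1 by simp
  thus ?thesis
    using rat_ord_frac[OF p ab(1) 1(3)] rat_ord_frac[OF p ab(2) 1(3)] 1 ab pr
    by (simp add: prime_elem_multiplicity_mult_distrib)
qed

lemma rat_ord_add:
  assumes p: "prime p" and "x \<noteq> 0" "y \<noteq> 0" "x + y \<noteq> 0"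
  shows "rat_ord p (x + y) \<ge> min (rat_ord p x) (rat_ord p y)"
proof -
  obtain a b d where 1: "x = of_int a / of_int d" "y = of_int b / of_int d" "d \<noteq> 0"
    by (rule rat_common_denom)
  have s: "x + y = of_int (a + b) / of_int d" using 1 by (simp add: add_divide_distrib)
  have ab: "a \<noteq> 0" "b \<noteq> 0" "a + b \<noteq> 0" using 1 s assms by auto
  have nu: "\<not> is_unit (int p)" using p by (auto simp: prime_nat_iff)
  have "min (multiplicity (int p) a) (multiplicity (int p) b) \<le> multiplicity (int p) (a + b)"
    by (rule multiplicity_geI[OF ab(3) nu]) (intro dvd_add multiplicity_dvd'; simp)
  thus ?thesis
    using rat_ord_frac[OF p ab(1) 1(3)] rat_ord_frac[OF p ab(2) 1(3)] rat_ord_frac[OF p ab(3) 1(3)] s 1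
    by auto
qed

lemma rat_pabs_0 [simp]: "rat_pabs p 0 = 0"
  by (simp add: rat_pabs_def)

lemma rat_pabs_eq_0 [simp]: "prime p \<Longrightarrow> rat_pabs p x = 0 \<longleftrightarrow> x = 0"
  by (auto simp: rat_pabs_def prime_gt_0_nat)

lemma rat_pabs_nonneg [simp]: "rat_pabs p x \<ge> 0"
  by (auto simp: rat_pabs_def)

lemma rat_pabs_mult: "prime p \<Longrightarrow> rat_pabs p (x * y) = rat_pabs p x * rat_pabs p y"
  using power_int_add[of "real p" "- rat_ord p x" "- rat_ord p y"]
  by (auto simp: rat_pabs_def rat_ord_mult prime_gt_0_nat)

lemma rat_pabs_1 [simp]: "prime p \<Longrightarrow> rat_pabs p 1 = 1"
  using rat_pabs_mult[of p 1 1] by (metis mult_cancel_left2 mult_1 rat_pabs_eq_0 zero_neq_one)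

lemma rat_pabs_minus [simp]: "prime p \<Longrightarrow> rat_pabs p (- x) = rat_pabs p x"
proof -
  assume p: "prime p"
  have "(rat_pabs p (- 1))\<^sup>2 = 1"
    using rat_pabs_mult[OF p, of "-1" "-1"] p by (simp add: power2_eq_square)
  hence "rat_pabs p (- 1) = 1"
    using rat_pabs_nonneg[of p "-1"] by (simp add: power2_eq_1_iff)
  thus ?thesis using rat_pabs_mult[OF p, of "-1" x] by simp
qed

lemma rat_pabs_inverse: "prime p \<Longrightarrow> rat_pabs p (inverse x) = inverse (rat_pabs p x)"
proof (cases "x = 0")
  case False
  assume p: "prime p"
  have "rat_pabs p x * rat_pabs p (inverse x) = 1"
    using rat_pabs_mult[OF p, of x "inverse x"] False p by simp
  thus ?thesis by (metis inverse_unique)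
qed simp

lemma rat_pabs_ultra:
  assumes p: "prime p"
  shows "rat_pabs p (x + y) \<le> max (rat_pabs p x) (rat_pabs p y)"
proof (cases "x = 0 \<or> y = 0 \<or> x + y = 0")
  case True
  thus ?thesis by (auto simp: le_max_iff_disj)
next
  case False
  have p1: "real p \<ge> 1" using prime_ge_1_nat[OF p] by simp
  have "rat_ord p (x + y) \<ge> rat_ord p x \<or> rat_ord p (x + y) \<ge> rat_ord p y"
    using rat_ord_add[OF p, of x y] False by auto
  hence "rat_pabs p (x + y) \<le> rat_pabs p x \<or> rat_pabs p (x + y) \<le> rat_pabs p y"
    using False p1 by (auto simp: rat_pabs_def intro!: power_int_increasing)
  thus ?thesis by auto
qed

lemma rat_pabs_triangle: "prime p \<Longrightarrow> rat_pabs p (x + y) \<le> rat_pabs p x + rat_pabs p y"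
  using rat_pabs_ultra[of p x y] rat_pabs_nonneg[of p x] rat_pabs_nonneg[of p y] by linarith

lemma rat_pabs_diff_ineq: "prime p \<Longrightarrow> \<bar>rat_pabs p x - rat_pabs p y\<bar> \<le> rat_pabs p (x - y)"
  using rat_pabs_triangle[of p "x - y" y] rat_pabs_triangle[of p "y - x" x]
    rat_pabs_minus[of p "x - y"] by simp


section \<open>The field of \<open>p\<close>-adic numbers\<close>

text \<open>
  The prime \<open>p\<close> is the cardinality of the type parameter, so that there is one field
  \<open>'p padic\<close> for each prime. It is the completion of the rationals
  with respect to the \<open>p\<close>-adic absolute value, as Cauchy sequences modulo null sequences.
\<close>

definition pcauchy_seq :: "nat \<Rightarrow> (nat \<Rightarrow> rat) \<Rightarrow> bool" where
  "pcauchy_seq p X \<longleftrightarrow> (\<forall>e>0. \<exists>N. \<forall>m\<ge>N. \<forall>n\<ge>N. rat_pabs p (X m - X n) < e)"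

definition pnull_seq :: "nat \<Rightarrow> (nat \<Rightarrow> rat) \<Rightarrow> bool" where
  "pnull_seq p X \<longleftrightarrow> (\<lambda>n. rat_pabs p (X n)) \<longlonglongrightarrow> 0"

lemma pcauchy_const: "pcauchy_seq p (\<lambda>_. c)"
  by (auto simp: pcauchy_seq_def)

lemma pcauchy_minus: "prime p \<Longrightarrow> pcauchy_seq p X \<Longrightarrow> pcauchy_seq p (\<lambda>n. - X n)"
  unfolding pcauchy_seq_def
  by (metis (no_types, lifting) minus_diff_minus rat_pabs_minus)

lemma pcauchy_add:
  assumes p: "prime p" and X: "pcauchy_seq p X" and Y: "pcauchy_seq p Y"
  shows "pcauchy_seq p (\<lambda>n. X n + Y n)"
  unfolding pcauchy_seq_def
proof (intro allI impI)
  fix e :: real assume e: "e > 0"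
  obtain M where M: "\<forall>m\<ge>M. \<forall>n\<ge>M. rat_pabs p (X m - X n) < e"
    using X e unfolding pcauchy_seq_def by blast
  obtain N where N: "\<forall>m\<ge>N. \<forall>n\<ge>N. rat_pabs p (Y m - Y n) < e"
    using Y e unfolding pcauchy_seq_def by blast
  have "rat_pabs p (X m + Y m - (X n + Y n)) < e" if "m \<ge> max M N" "n \<ge> max M N" for m n
  proof -
    have "rat_pabs p (X m - X n) < e" "rat_pabs p (Y m - Y n) < e" using M N that by auto
    moreover have eq: "X m + Y m - (X n + Y n) = (X m - X n) + (Y m - Y n)" by simp
    ultimately show ?thesis
      using rat_pabs_ultra[OF p, of "X m - X n" "Y m - Y n"] unfolding eq by linarith
  qed
  thus "\<exists>N. \<forall>m\<ge>N. \<forall>n\<ge>N. rat_pabs p (X m + Y m - (X n + Y n)) < e" by blast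
qed

lemma pcauchy_abs_Cauchy:
  assumes p: "prime p" and X: "pcauchy_seq p X"
  shows "Cauchy (\<lambda>n. rat_pabs p (X n))"
proof (rule CauchyI)
  fix e :: real assume "e > 0"
  then obtain N where N: "\<forall>m\<ge>N. \<forall>n\<ge>N. rat_pabs p (X m - X n) < e"
    using X unfolding pcauchy_seq_def by blast
  thus "\<exists>M. \<forall>m\<ge>M. \<forall>n\<ge>M. norm (rat_pabs p (X m) - rat_pabs p (X n)) < e"
    using rat_pabs_diff_ineq[OF p] by (metis le_less_trans real_norm_def)
qed

lemma pcauchy_abs_convergent:
  "prime p \<Longrightarrow> pcauchy_seq p X \<Longrightarrow> convergent (\<lambda>n. rat_pabs p (X n))"
  by (intro Cauchy_convergent pcauchy_abs_Cauchy)

lemma pcauchy_bounded: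
  assumes p: "prime p" and X: "pcauchy_seq p X"
  obtains B where "B > 0" "\<And>n. rat_pabs p (X n) \<le> B"
proof -
  have "Bseq (\<lambda>n. rat_pabs p (X n))"
    by (rule convergent_imp_Bseq[OF pcauchy_abs_convergent[OF assms]])
  thus thesis using that unfolding Bseq_def by auto
qed

lemma pcauchy_mult:
  assumes p: "prime p" and X: "pcauchy_seq p X" and Y: "pcauchy_seq p Y"
  shows "pcauchy_seq p (\<lambda>n. X n * Y n)"
  unfolding pcauchy_seq_def
proof (intro allI impI)
  fix e :: real assume e: "e > 0"
  obtain A where A: "A > 0" "\<And>n. rat_pabs p (X n) \<le> A" using pcauchy_bounded[OF p X] by blast
  obtain B where B: "B > 0" "\<And>n. rat_pabs p (Y n) \<le> B" using pcauchy_bounded[OF p Y] by blast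
  obtain M where M: "\<forall>m\<ge>M. \<forall>n\<ge>M. rat_pabs p (X m - X n) < e / B"
    using X e B(1) unfolding pcauchy_seq_def by (meson divide_pos_pos)
  obtain N where N: "\<forall>m\<ge>N. \<forall>n\<ge>N. rat_pabs p (Y m - Y n) < e / A"
    using Y e A(1) unfolding pcauchy_seq_def by (meson divide_pos_pos)
  have "rat_pabs p (X m * Y m - X n * Y n) < e" if mn: "m \<ge> max M N" "n \<ge> max M N" for m n
  proof -
    have "rat_pabs p ((X m - X n) * Y m) = rat_pabs p (X m - X n) * rat_pabs p (Y m)"
      by (rule rat_pabs_mult[OF p])
    also have "\<dots> \<le> rat_pabs p (X m - X n) * B" by (intro mult_left_mono B) simp
    also have "\<dots> < e" using M mn B(1) by (simp add: pos_less_divide_eq)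
    finally have 1: "rat_pabs p ((X m - X n) * Y m) < e" .
    have "rat_pabs p (X n * (Y m - Y n)) = rat_pabs p (Y m - Y n) * rat_pabs p (X n)"
      by (simp add: rat_pabs_mult[OF p])
    also have "\<dots> \<le> rat_pabs p (Y m - Y n) * A" by (intro mult_left_mono A) simp
    also have "\<dots> < e" using N mn A(1) by (simp add: pos_less_divide_eq)
    finally have 2: "rat_pabs p (X n * (Y m - Y n)) < e" .
    have "X m * Y m - X n * Y n = (X m - X n) * Y m + X n * (Y m - Y n)"
      by (simp add: algebra_simps)
    thus ?thesis using rat_pabs_ultra[OF p, of "(X m - X n) * Y m" "X n * (Y m - Y n)"] 1 2 by simp
  qed
  thus "\<exists>N. \<forall>m\<ge>N. \<forall>n\<ge>N. rat_pabs p (X m * Y m - X n * Y n) < e" by blast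
qed

lemma pnull_add:
  assumes p: "prime p" and X: "pnull_seq p X" and Y: "pnull_seq p Y"
  shows "pnull_seq p (\<lambda>n. X n + Y n)"
proof -
  have "(\<lambda>n. rat_pabs p (X n) + rat_pabs p (Y n)) \<longlonglongrightarrow> 0"
    using tendsto_add[OF X[unfolded pnull_seq_def] Y[unfolded pnull_seq_def]] by simp
  thus ?thesis unfolding pnull_seq_def
    by (rule Lim_null_comparison[rotated]) (simp add: rat_pabs_triangle[OF p])
qed

lemma pnull_minus: "prime p \<Longrightarrow> pnull_seq p X \<Longrightarrow> pnull_seq p (\<lambda>n. - X n)"
  by (simp add: pnull_seq_def)

lemma pnull_0 [simp]: "pnull_seq p (\<lambda>_. 0)"
  by (simp add: pnull_seq_def)

lemma pnull_mult:
  assumes p: "prime p" and X: "pnull_seq p X" and Y: "pcauchy_seq p Y"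
  shows "pnull_seq p (\<lambda>n. X n * Y n)"
proof -
  obtain B where B: "B > 0" "\<And>n. rat_pabs p (Y n) \<le> B" using pcauchy_bounded[OF p Y] by blast
  have "(\<lambda>n. rat_pabs p (X n) * B) \<longlonglongrightarrow> 0"
    using tendsto_mult_right[OF X[unfolded pnull_seq_def], of B] by simp
  thus ?thesis unfolding pnull_seq_def
    by (rule Lim_null_comparison[rotated])
       (simp add: rat_pabs_mult[OF p] B mult_left_mono)
qed

lemma pcauchy_not_null:
  assumes p: "prime p" and X: "pcauchy_seq p X" and nz: "\<not> pnull_seq p X"
  obtains c N where "c > 0" "\<And>n. n \<ge> N \<Longrightarrow> rat_pabs p (X n) > c"
proof -
  obtain l where l: "(\<lambda>n. rat_pabs p (X n)) \<longlonglongrightarrow> l"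
    using pcauchy_abs_convergent[OF p X] by (auto simp: convergent_def)
  have "l \<noteq> 0" using l nz by (auto simp: pnull_seq_def)
  moreover have "l \<ge> 0" by (rule LIMSEQ_le_const[OF l]) auto
  ultimately have l0: "l > 0" by simp
  have "\<forall>\<^sub>F n in sequentially. rat_pabs p (X n) > l / 2"
    by (rule order_tendstoD[OF l]) (use l0 in simp)
  thus thesis using that[of "l / 2"] l0 by (auto simp: eventually_sequentially)
qed

lemma pcauchy_inverse:
  assumes p: "prime p" and X: "pcauchy_seq p X" and nz: "\<not> pnull_seq p X"
  shows "pcauchy_seq p (\<lambda>n. inverse (X n))"
  unfolding pcauchy_seq_def
proof (intro allI impI)
  fix e :: real assume e: "e > 0"
  obtain c N where c: "c > 0" "\<And>n. n \<ge> N \<Longrightarrow> rat_pabs p (X n) > c"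
    using pcauchy_not_null[OF assms] by blast
  have "e * c * c > 0" using e c by simp
  then obtain M where M: "\<forall>m\<ge>M. \<forall>n\<ge>M. rat_pabs p (X m - X n) < e * c * c"
    using X unfolding pcauchy_seq_def by blast
  have "rat_pabs p (inverse (X m) - inverse (X n)) < e" if mn: "m \<ge> max M N" "n \<ge> max M N" for m n
  proof -
    have cm: "rat_pabs p (X m) > c" and cn: "rat_pabs p (X n) > c" using c(2) mn by auto
    have nz: "X m \<noteq> 0" "X n \<noteq> 0" using cm cn c(1) by auto
    have "inverse (X m) - inverse (X n) = - (X m - X n) * inverse (X m * X n)"
      using nz by (simp add: field_simps)
    hence "rat_pabs p (inverse (X m) - inverse (X n))
           = rat_pabs p (X m - X n) / (rat_pabs p (X m) * rat_pabs p (X n))"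
      by (simp only: rat_pabs_mult[OF p] rat_pabs_inverse[OF p] rat_pabs_minus[OF p] divide_inverse)
    also have "\<dots> \<le> rat_pabs p (X m - X n) / (c * c)"
      by (intro divide_left_mono mult_mono) (use cm cn c(1) in auto)
    also have "\<dots> < e" using M mn c(1) by (simp add: pos_divide_less_eq mult.assoc)
    finally show ?thesis .
  qed
  thus "\<exists>N. \<forall>m\<ge>N. \<forall>n\<ge>N. rat_pabs p (inverse (X m) - inverse (X n)) < e" by blast
qed

typedef (overloaded) 'p::prime_card pcauchy = "{X. pcauchy_seq CARD('p) X}"
  using pcauchy_const by blast

setup_lifting type_definition_pcauchy

definition padic_rel :: "'p::prime_card pcauchy \<Rightarrow> 'p pcauchy \<Rightarrow> bool" where
  "padic_rel X Y \<longleftrightarrow> pnull_seq CARD('p) (\<lambda>n. Rep_pcauchy X n - Rep_pcauchy Y n)"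

lemma Rep_pcauchy' [simp]: "pcauchy_seq CARD('p) (Rep_pcauchy (X :: 'p::prime_card pcauchy))"
  using Rep_pcauchy by blast

lemma padic_rel_sym: "padic_rel X Y \<Longrightarrow> padic_rel Y (X :: 'p::prime_card pcauchy)"
  unfolding padic_rel_def by (drule pnull_minus[OF prime_card]) simp

lemma padic_rel_trans:
  "padic_rel X Y \<Longrightarrow> padic_rel Y Z \<Longrightarrow> padic_rel X (Z :: 'p::prime_card pcauchy)"
  unfolding padic_rel_def by (drule (1) pnull_add[OF prime_card]) simp

quotient_type (overloaded) 'p padic = "'p::prime_card pcauchy" / padic_rel
proof (rule equivpI)
  show "reflp (padic_rel :: 'p pcauchy \<Rightarrow> _)" by (auto simp: reflp_def padic_rel_def)
  show "symp (padic_rel :: 'p pcauchy \<Rightarrow> _)" by (rule sympI) (rule padic_rel_sym)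
  show "transp (padic_rel :: 'p pcauchy \<Rightarrow> _)" by (rule transpI) (rule padic_rel_trans)
qed

lift_definition pc_const :: "rat \<Rightarrow> 'p::prime_card pcauchy" is "\<lambda>c _. c"
  by (rule pcauchy_const)
lift_definition pc_add :: "'p::prime_card pcauchy \<Rightarrow> 'p pcauchy \<Rightarrow> 'p pcauchy"
  is "\<lambda>X Y n. X n + Y n" by (rule pcauchy_add[OF prime_card])
lift_definition pc_minus :: "'p::prime_card pcauchy \<Rightarrow> 'p pcauchy"
  is "\<lambda>X n. - X n" by (rule pcauchy_minus[OF prime_card])
lift_definition pc_mult :: "'p::prime_card pcauchy \<Rightarrow> 'p pcauchy \<Rightarrow> 'p pcauchy"
  is "\<lambda>X Y n. X n * Y n" by (rule pcauchy_mult[OF prime_card])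
lift_definition pc_inverse :: "'p::prime_card pcauchy \<Rightarrow> 'p pcauchy"
  is "\<lambda>X. if pnull_seq CARD('p) X then (\<lambda>_. 0) else (\<lambda>n. inverse (X n))"
  by (auto intro: pcauchy_inverse[OF prime_card] pcauchy_const)

lemma pnull_cong:
  assumes "padic_rel X (Y :: 'p::prime_card pcauchy)"
  shows "pnull_seq CARD('p) (Rep_pcauchy X) \<longleftrightarrow> pnull_seq CARD('p) (Rep_pcauchy Y)"
proof
  assume "pnull_seq CARD('p) (Rep_pcauchy X)"
  from pnull_add[OF prime_card this assms[THEN padic_rel_sym, unfolded padic_rel_def]]
  show "pnull_seq CARD('p) (Rep_pcauchy Y)" by simp
next
  assume "pnull_seq CARD('p) (Rep_pcauchy Y)"
  from pnull_add[OF prime_card this assms[unfolded padic_rel_def]]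
  show "pnull_seq CARD('p) (Rep_pcauchy X)" by simp
qed

instantiation padic :: (prime_card) field
begin

lift_definition zero_padic :: "'a padic" is "pc_const 0" .
lift_definition one_padic :: "'a padic" is "pc_const 1" .

lift_definition plus_padic :: "'a padic \<Rightarrow> 'a padic \<Rightarrow> 'a padic" is pc_add
proof -
  fix X X' Y Y' :: "'a pcauchy"
  assume "padic_rel X X'" "padic_rel Y Y'"
  from pnull_add[OF prime_card this[unfolded padic_rel_def]]
  show "padic_rel (pc_add X Y) (pc_add X' Y')"
    by (simp add: padic_rel_def pc_add.rep_eq algebra_simps)
qed

lift_definition uminus_padic :: "'a padic \<Rightarrow> 'a padic" is pc_minus
proof -
  fix X X' :: "'a pcauchy"
  assume "padic_rel X X'"
  from pnull_minus[OF prime_card this[unfolded padic_rel_def]]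
  show "padic_rel (pc_minus X) (pc_minus X')"
    by (simp add: padic_rel_def pc_minus.rep_eq)
qed

lift_definition times_padic :: "'a padic \<Rightarrow> 'a padic \<Rightarrow> 'a padic" is pc_mult
proof -
  fix X X' Y Y' :: "'a pcauchy"
  assume XY: "padic_rel X X'" "padic_rel Y Y'"
  have 1: "pnull_seq CARD('a) (\<lambda>n. (Rep_pcauchy X n - Rep_pcauchy X' n) * Rep_pcauchy Y n)"
    by (rule pnull_mult[OF prime_card XY(1)[unfolded padic_rel_def]]) simp
  have 2: "pnull_seq CARD('a) (\<lambda>n. (Rep_pcauchy Y n - Rep_pcauchy Y' n) * Rep_pcauchy X' n)"
    by (rule pnull_mult[OF prime_card XY(2)[unfolded padic_rel_def]]) simp
  from pnull_add[OF prime_card 1 2]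
  show "padic_rel (pc_mult X Y) (pc_mult X' Y')"
    by (simp add: padic_rel_def pc_mult.rep_eq algebra_simps)
qed

lift_definition inverse_padic :: "'a padic \<Rightarrow> 'a padic" is pc_inverse
proof -
  fix X Y :: "'a pcauchy"
  assume XY: "padic_rel X Y"
  show "padic_rel (pc_inverse X) (pc_inverse Y)"
  proof (cases "pnull_seq CARD('a) (Rep_pcauchy X)")
    case True
    thus ?thesis using pnull_cong[OF XY] by (simp add: padic_rel_def pc_inverse.rep_eq)
  next
    case False
    hence FY: "\<not> pnull_seq CARD('a) (Rep_pcauchy Y)" using pnull_cong[OF XY] by simp
    have iX: "pcauchy_seq CARD('a) (\<lambda>n. inverse (Rep_pcauchy X n))"
      by (rule pcauchy_inverse[OF prime_card _ False]) simp
    have iY: "pcauchy_seq CARD('a) (\<lambda>n. inverse (Rep_pcauchy Y n))"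
      by (rule pcauchy_inverse[OF prime_card _ FY]) simp
    have "pnull_seq CARD('a) (\<lambda>n. - ((Rep_pcauchy X n - Rep_pcauchy Y n)
            * (inverse (Rep_pcauchy X n) * inverse (Rep_pcauchy Y n))))" (is "pnull_seq _ ?Z")
      by (rule pnull_minus[OF prime_card
            pnull_mult[OF prime_card XY[unfolded padic_rel_def] pcauchy_mult[OF prime_card iX iY]]])
    moreover have "\<forall>\<^sub>F n in sequentially. rat_pabs CARD('a) (?Z n)
        = rat_pabs CARD('a) (inverse (Rep_pcauchy X n) - inverse (Rep_pcauchy Y n))"
    proof -
      obtain c N where c: "c > 0" "\<And>n. n \<ge> N \<Longrightarrow> rat_pabs CARD('a) (Rep_pcauchy X n) > c"
        using pcauchy_not_null[OF prime_card Rep_pcauchy' False] by blast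
      obtain c' N' where c': "c' > 0" "\<And>n. n \<ge> N' \<Longrightarrow> rat_pabs CARD('a) (Rep_pcauchy Y n) > c'"
        using pcauchy_not_null[OF prime_card Rep_pcauchy' FY] by blast
      have "?Z n = inverse (Rep_pcauchy X n) - inverse (Rep_pcauchy Y n)" if "n \<ge> max N N'" for n
      proof -
        have "rat_pabs CARD('a) (Rep_pcauchy X n) > c" "rat_pabs CARD('a) (Rep_pcauchy Y n) > c'"
          using c(2) c'(2) that by auto
        hence "Rep_pcauchy X n \<noteq> 0" "Rep_pcauchy Y n \<noteq> 0" using c(1) c'(1) by auto
        thus ?thesis by (simp add: field_simps)
      qed
      thus ?thesis by (intro eventually_sequentiallyI[of "max N N'"]) simp
    qed
    ultimately show ?thesis
      using False FY
      by (simp add: padic_rel_def pc_inverse.rep_eq pnull_seq_def tendsto_cong[symmetric])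
  qed
qed

definition minus_padic :: "'a padic \<Rightarrow> 'a padic \<Rightarrow> 'a padic" where
  "minus_padic x y = x + (- y)"
definition divide_padic :: "'a padic \<Rightarrow> 'a padic \<Rightarrow> 'a padic" where
  "divide_padic x y = x * inverse y"

instance
proof
  fix a b c :: "'a padic"
  show "a + b + c = a + (b + c)"
    by transfer (simp add: padic_rel_def pc_add.rep_eq algebra_simps)
  show "a + b = b + a"
    by transfer (simp add: padic_rel_def pc_add.rep_eq algebra_simps)
  show "0 + a = a"
    by transfer (simp add: padic_rel_def pc_add.rep_eq pc_const.rep_eq)
  show "- a + a = 0"
    by transfer (simp add: padic_rel_def pc_add.rep_eq pc_const.rep_eq pc_minus.rep_eq)
  show "a - b = a + - b" by (rule minus_padic_def)
  show "a * b * c = a * (b * c)"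
    by transfer (simp add: padic_rel_def pc_mult.rep_eq algebra_simps)
  show "a * b = b * a"
    by transfer (simp add: padic_rel_def pc_mult.rep_eq algebra_simps)
  show "1 * a = a"
    by transfer (simp add: padic_rel_def pc_mult.rep_eq pc_const.rep_eq)
  show "(a + b) * c = a * c + b * c"
    by transfer (simp add: padic_rel_def pc_mult.rep_eq pc_add.rep_eq algebra_simps)
  show "(0 :: 'a padic) \<noteq> 1"
    by transfer (simp add: padic_rel_def pc_const.rep_eq pnull_seq_def prime_card LIMSEQ_const_iff)
  show "inverse (0 :: 'a padic) = 0"
    by transfer (simp add: padic_rel_def pc_const.rep_eq pc_inverse.rep_eq)
  show "a div b = a * inverse b" by (rule divide_padic_def)
  show "inverse a * a = 1" if "a \<noteq> 0"
    using that
  proof transfer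
    fix X :: "'a pcauchy"
    assume "\<not> padic_rel X (pc_const 0)"
    hence F: "\<not> pnull_seq CARD('a) (Rep_pcauchy X)"
      by (simp add: padic_rel_def pc_const.rep_eq)
    obtain c N where c: "c > 0" "\<And>n. n \<ge> N \<Longrightarrow> rat_pabs CARD('a) (Rep_pcauchy X n) > c"
      using pcauchy_not_null[OF prime_card Rep_pcauchy' F] by blast
    have "inverse (Rep_pcauchy X n) * Rep_pcauchy X n - 1 = 0" if "n \<ge> N" for n
      using c(1) c(2)[OF that] by (cases "Rep_pcauchy X n = 0") auto
    hence "\<forall>\<^sub>F n in sequentially. rat_pabs CARD('a) (inverse (Rep_pcauchy X n) * Rep_pcauchy X n - 1) = 0"
      by (intro eventually_sequentiallyI[of N]) simp
    hence "pnull_seq CARD('a) (\<lambda>n. inverse (Rep_pcauchy X n) * Rep_pcauchy X n - 1)"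
      unfolding pnull_seq_def by (rule tendsto_eventually)
    thus "padic_rel (pc_mult (pc_inverse X) X) (pc_const 1)"
      using F by (simp add: padic_rel_def pc_mult.rep_eq pc_inverse.rep_eq pc_const.rep_eq)
  qed
qed

end

lift_definition padic_abs :: "'p::prime_card padic \<Rightarrow> real" is
  "\<lambda>X. lim (\<lambda>n. rat_pabs CARD('p) (Rep_pcauchy X n))"
proof -
  fix X Y :: "'p pcauchy"
  assume XY: "padic_rel X Y"
  have "(\<lambda>n. rat_pabs CARD('p) (Rep_pcauchy X n)) \<longlonglongrightarrow> lim (\<lambda>n. rat_pabs CARD('p) (Rep_pcauchy X n))"
    using pcauchy_abs_convergent[OF prime_card Rep_pcauchy'[of X]] by (simp add: convergent_LIMSEQ_iff)
  moreover have "(\<lambda>n. rat_pabs CARD('p) (Rep_pcauchy Y n) - rat_pabs CARD('p) (Rep_pcauchy X n)) \<longlonglongrightarrow> 0"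
    using padic_rel_sym[OF XY, unfolded padic_rel_def pnull_seq_def]
    by (rule Lim_null_comparison[rotated]) (simp add: rat_pabs_diff_ineq prime_card)
  ultimately have "(\<lambda>n. rat_pabs CARD('p) (Rep_pcauchy Y n)) \<longlonglongrightarrow> lim (\<lambda>n. rat_pabs CARD('p) (Rep_pcauchy X n))"
    by (rule Lim_transform)
  thus "lim (\<lambda>n. rat_pabs CARD('p) (Rep_pcauchy X n)) = lim (\<lambda>n. rat_pabs CARD('p) (Rep_pcauchy Y n))"
    by (rule limI[symmetric])
qed

lemma padic_abs_limit:
  "(\<lambda>n. rat_pabs CARD('p) (Rep_pcauchy X n)) \<longlonglongrightarrow> padic_abs (abs_padic (X :: 'p::prime_card pcauchy))"
  using pcauchy_abs_convergent[OF prime_card Rep_pcauchy'[of X]]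
  by (simp add: padic_abs.abs_eq convergent_LIMSEQ_iff)

lemma padic_abs_0_iff [simp]: "padic_abs x = 0 \<longleftrightarrow> x = 0"
proof (induction x rule: padic.abs_induct)
  case (1 X)
  have "abs_padic X = 0 \<longleftrightarrow> padic_rel X (pc_const 0)"
    by (simp add: zero_padic_def padic.abs_eq_iff)
  also have "\<dots> \<longleftrightarrow> (\<lambda>n. rat_pabs CARD('a) (Rep_pcauchy X n)) \<longlonglongrightarrow> 0"
    by (simp add: padic_rel_def pc_const.rep_eq pnull_seq_def)
  also have "\<dots> \<longleftrightarrow> padic_abs (abs_padic X) = 0"
    using padic_abs_limit[of X] LIMSEQ_unique by metis
  finally show ?case by simp
qed

lemma padic_abs_nonneg [simp]: "padic_abs x \<ge> 0"
proof (induction x rule: padic.abs_induct)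
  case (1 X)
  show ?case by (rule LIMSEQ_le_const[OF padic_abs_limit]) auto
qed

lemma padic_abs_mult: "padic_abs (x * y) = padic_abs x * padic_abs y"
proof (induction x rule: padic.abs_induct; induction y rule: padic.abs_induct)
  case (1 Y X)
  have "(\<lambda>n. rat_pabs CARD('a) (Rep_pcauchy (pc_mult X Y) n))
          \<longlonglongrightarrow> padic_abs (abs_padic X) * padic_abs (abs_padic Y)"
    using tendsto_mult[OF padic_abs_limit[of X] padic_abs_limit[of Y]]
    by (simp add: pc_mult.rep_eq rat_pabs_mult prime_card)
  thus ?case using padic_abs_limit[of "pc_mult X Y"] LIMSEQ_unique
    by (metis times_padic.abs_eq)
qed

lemma padic_abs_ultra: "padic_abs (x + y) \<le> max (padic_abs x) (padic_abs y)"
proof (induction x rule: padic.abs_induct; induction y rule: padic.abs_induct)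
  case (1 Y X)
  have "padic_abs (abs_padic (pc_add X Y)) \<le> max (padic_abs (abs_padic X)) (padic_abs (abs_padic Y))"
    by (rule LIMSEQ_le[OF padic_abs_limit tendsto_max[OF padic_abs_limit[of X] padic_abs_limit[of Y]]])
       (simp add: pc_add.rep_eq rat_pabs_ultra prime_card)
  thus ?case by (simp add: plus_padic.abs_eq)
qed

lemma padic_abs_minus [simp]: "padic_abs (- x) = padic_abs x"
proof (induction x rule: padic.abs_induct)
  case (1 X)
  have "(\<lambda>n. rat_pabs CARD('a) (Rep_pcauchy (pc_minus X) n)) \<longlonglongrightarrow> padic_abs (abs_padic X)"
    using padic_abs_limit[of X] by (simp add: pc_minus.rep_eq prime_card)
  thus ?case using padic_abs_limit[of "pc_minus X"] LIMSEQ_unique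
    by (metis uminus_padic.abs_eq)
qed

lemma of_nat_padic: "(of_nat n :: 'p::prime_card padic) = abs_padic (pc_const (of_nat n))"
proof (induction n)
  case (Suc n)
  show ?case
    by (simp add: Suc one_padic_def plus_padic.abs_eq padic.abs_eq_iff padic_rel_def
          pc_add.rep_eq pc_const.rep_eq)
qed (simp add: zero_padic_def)

lemma padic_abs_of_nat: "padic_abs (of_nat n :: 'p::prime_card padic) = rat_pabs CARD('p) (of_nat n)"
  by (simp add: of_nat_padic padic_abs.abs_eq pc_const.rep_eq)

instance padic :: (prime_card) field_char_0
proof
  show "inj (of_nat :: nat \<Rightarrow> 'a padic)"
  proof (rule injI)
    fix m n assume "(of_nat m :: 'a padic) = of_nat n"
    hence "padic_rel (pc_const (of_nat m) :: 'a pcauchy) (pc_const (of_nat n))"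
      by (simp add: of_nat_padic padic.abs_eq_iff)
    thus "m = n" by (simp add: padic_rel_def pc_const.rep_eq pnull_seq_def prime_card LIMSEQ_const_iff)
  qed
qed

instantiation padic :: (prime_card) metric_space
begin

definition dist_padic :: "'a padic \<Rightarrow> 'a padic \<Rightarrow> real" where
  "dist_padic x y = padic_abs (x - y)"
definition uniformity_padic :: "('a padic \<times> 'a padic) filter" where
  "uniformity_padic = (INF e\<in>{0 <..}. principal {(x, y). dist x y < e})"
definition open_padic :: "'a padic set \<Rightarrow> bool" where
  "open_padic U \<longleftrightarrow> (\<forall>x\<in>U. eventually (\<lambda>(x', y). x' = x \<longrightarrow> y \<in> U) uniformity)"

instance
proof
  fix x y z :: "'a padic"
  show "dist x y = 0 \<longleftrightarrow> x = y" by (simp add: dist_padic_def)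
  have "padic_abs (x - y) \<le> max (padic_abs (x - z)) (padic_abs (z - y))"
    using padic_abs_ultra[of "x - z" "z - y"] by simp
  moreover have "padic_abs (z - y) = padic_abs (y - z)"
    using padic_abs_minus[of "y - z"] by simp
  ultimately show "dist x y \<le> dist x z + dist y z"
    using padic_abs_nonneg[of "x - z"] padic_abs_nonneg[of "y - z"]
    unfolding dist_padic_def max_def by argo
qed (simp_all add: uniformity_padic_def open_padic_def)

end

text \<open>The valuation, normalised by \<open>ord p = 1\<close> and \<open>ord 0 = \<infinity>\<close>.\<close>

definition padic_ord :: "'p::prime_card padic \<Rightarrow> ereal" where
  "padic_ord x = (if x = 0 then \<infinity> else ereal (- log (real CARD('p)) (padic_abs x)))"

definition fls_ord :: "'p::prime_card padic fls \<Rightarrow> ereal" where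
  "fls_ord F = (INF n. padic_ord (fls_nth F n))"

definition fls_of_rat :: "rat fls \<Rightarrow> 'a::field_char_0 fls" where
  "fls_of_rat F = Abs_fls (\<lambda>n. of_rat (fls_nth F n))"

lemma fls_nth_of_rat [simp]: "fls_nth (fls_of_rat F) n = of_rat (fls_nth F n)"
proof -
  have "\<forall>\<^sub>\<infinity>n. (of_rat (fls_nth F (- int n)) :: 'a) = 0"
    using fls_nth[of F] by simp
  thus ?thesis unfolding fls_of_rat_def by (simp add: Abs_fls_inverse)
qed

text \<open>
  Morita's \<open>p\<close>-adic Gamma function for odd \<open>p\<close>: the limit, as natural numbers \<open>n\<close> tend to \<open>x\<close>
  in the \<open>p\<close>-adic topology, of its values at \<open>n\<close>. Only meaningful for
  \<open>p\<close>-adic integers \<open>x\<close>; elsewhere the filter is trivial.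
\<close>

definition padic_Gamma :: "'p::prime_card padic \<Rightarrow> 'p padic" where
  "padic_Gamma x = Lim (filtercomap of_nat (nhds x))
     (\<lambda>n. (- 1) ^ n * (\<Prod>j | 1 \<le> j \<and> j < n \<and> \<not> CARD('p) dvd j. of_nat j))"


section \<open>Eta quotients and \<open>q\<close>-expansions\<close>

definition dedekind_eta :: "complex \<Rightarrow> complex" where
  "dedekind_eta \<tau> = exp (2 * of_real pi * \<i> * \<tau> / 24) * (\<Prod>n. 1 - exp (2 * of_real pi * \<i> * \<tau>) ^ (n + 1))"

definition cusp_form_32 :: "complex \<Rightarrow> complex" where
  "cusp_form_32 \<tau> = dedekind_eta (4 * \<tau>) ^ 2 * dedekind_eta (8 * \<tau>) ^ 2"

definition eta_L :: "complex \<Rightarrow> complex" where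
  "eta_L \<tau> = dedekind_eta (8 * \<tau>) ^ 6 / (dedekind_eta (4 * \<tau>) ^ 2 * dedekind_eta (16 * \<tau>) ^ 4)"

definition has_q_expansion :: "(complex \<Rightarrow> complex) \<Rightarrow> rat fls \<Rightarrow> bool" where
  "has_q_expansion \<phi> F \<longleftrightarrow> (\<forall>\<tau>. Im \<tau> > 0 \<longrightarrow>
     ((\<lambda>n::int. of_rat (fls_nth F n) * exp (2 * of_real pi * \<i> * \<tau>) powi n) has_sum \<phi> \<tau>) UNIV)"

definition q_deriv :: "'a::comm_ring_1 fls \<Rightarrow> 'a fls" where
  "q_deriv F = fls_X * fls_deriv F"

definition eichler_integral :: "(nat \<Rightarrow> rat) \<Rightarrow> rat fls" where
  "eichler_integral b = fps_to_fls (Abs_fps (\<lambda>n. b n / of_nat n))"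

definition catalan :: "nat \<Rightarrow> 'a::field_char_0" where
  "catalan n = of_nat ((2 * n) choose n) / of_nat (n + 1)"


section \<open>Class numbers\<close>

text \<open>
  Ideal classes are represented by nonzero integral ideals: \<open>I\<close> and \<open>J\<close> are equivalent
  iff \<open>a I = b J\<close> for some nonzero algebraic integers \<open>a, b\<close> of \<open>K\<close>.
\<close>

definition ring_of_integers :: "complex set \<Rightarrow> complex ring" where
  "ring_of_integers K = \<lparr>carrier = {x \<in> K. algebraic_int x},
     monoid.mult = (*), one = 1, zero = 0, add = (+)\<rparr>"

definition nonzero_ideals :: "complex set \<Rightarrow> complex set set" where
  "nonzero_ideals K = {I. ideal I (ring_of_integers K) \<and> I \<noteq> {0}}"

definition ideal_class_rel :: "complex set \<Rightarrow> (complex set \<times> complex set) set" where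
  "ideal_class_rel K = {(I, J). I \<in> nonzero_ideals K \<and> J \<in> nonzero_ideals K \<and>
     (\<exists>a\<in>carrier (ring_of_integers K) - {0}. \<exists>b\<in>carrier (ring_of_integers K) - {0}.
        (\<lambda>x. a * x) ` I = (\<lambda>x. b * x) ` J)}"

definition class_number :: "complex set \<Rightarrow> nat" where
  "class_number K = card (nonzero_ideals K // ideal_class_rel K)"

definition quadratic_field :: "int \<Rightarrow> complex set" where
  "quadratic_field D = {of_rat x + of_rat y * csqrt (of_int D) | x y. True}"

end

theory Submission
  imports Defs
begin

text \<open>
  Write \<open>x = x(q)\<close> for the hauptmodul with \<open>g = q dx/dq \<cdot> (1 + 4 x^4)^(-1/2)\<close>, so that
  the Eichler integral is a lemniscatic logarithm in \<open>x\<close> whose coefficients are central binomial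
  coefficients, while \<open>f\<^sup>+\<close> is a quasi-period integral of the second kind in \<open>1 / x\<close> and \<open>x\<close>.
  Since \<open>x\<close> has integral coefficients, \<open>x(q)^p\<close> and \<open>x(q^p)\<close> agree modulo \<open>p\<close>, and boundedness of
  denominators becomes the supercongruence between central binomial coefficients at \<open>(p n + 1)/4\<close> and
  \<open>(n - 1)/4\<close>, whose unit root is read off from Morita's Gamma function.

  The class number enters through \<open>\<Gamma>\<^sub>p(1/2) \<equiv> ((p - 1)/2)!\<close> modulo \<open>p\<close> and Mordell's congruence.
  Dirichlet's formula \<open>h p = - (\<Sum>a<p. a (a/p))\<close> is obtained by counting ideals: the combination
  \<open>\<theta>(t) - 4 \<theta>(4 t)\<close> of the theta series of an ideal lattice is a sum of alternating Gauss sums and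
  tends to \<open>0\<close> as \<open>t\<close> tends to \<open>0\<close>, and summing over the ideal classes yields a Lambert series.
\<close>

text \<open>The argument turns on exponents modulo 4. With c_k the coefficients of (1 + 4 z)^(-1/2),
  the Eichler integral is the sum of c_k x^(4k+1)/(4k+1), and since L(2 tau) = x^(-2), f^+ is 1/x
  minus the sum over k > 0 of c_k x^(4k-1)/(4k-1). As p = 3 mod 4, multiplication by p carries the
  class 1 modulo 4 to the class 3. Hence the image of the Eichler integral under V, and not the
  Eichler integral itself, can cancel the denominators of f^+: this forces beta = 0, and the minus
  sign before the second sum makes gamma the negative of the unit root. The pair is unique because
  the Eichler integral has unbounded denominators: for 4k+1 = p^(2m) the coefficient c_k has
  valuation only m.

  In the class number part the factor 4 removes the 1/t singularity of theta, so no covolume has to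
  be computed. What survives at t = 0 are the constant terms, 1 - 4 = -3 for each ideal
  class.\<close>

section \<open>Elementary bounds for alternating Gaussian sums\<close>

text \<open>The inequality (1 + v)^2 \<le> 2 (1 + v^2) replaces the integral of 1/(1 + s v^2) by a
  telescoping series. The assumption \<open>s \<le> 1\<close> absorbs the term at 0 into 1 / sqrt
  s.\<close>

lemma inverse_quadratic_sum_bound:
 fixes s :: real
 assumes s: "0 < s" "s \<le> 1"
 shows "(\<Sum>k<n. 1 / (1 + s * (real k)\<^sup>2)) \<le> 3 / sqrt s"
proof -
 define r where "r = sqrt s"
 have r: "r > 0" "r \<le> 1" "s = r\<^sup>2" using s by (auto simp: r_def)
 have tel: "(\<Sum>k<n. 1 / (1 + s * (real (Suc k))\<^sup>2)) \<le> 2 / r * (1 - 1 / (1 + r * real n))" for n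
 proof (induction n)
  case (Suc n)
  define u where "u = 1 + r * real n"
  have u: "u \<ge> 1" using r by (simp add: u_def)
  have v: "1 + r * real (Suc n) = u + r" by (simp add: u_def algebra_simps)
  have "(u + r)\<^sup>2 \<le> 2 * (1 + (u + r - 1)\<^sup>2)"
  proof -
   have "0 \<le> (1 - (u + r - 1))\<^sup>2" by simp
   thus ?thesis by (simp add: power2_eq_square algebra_simps)
  qed
  moreover have "u + r - 1 = r * real (Suc n)" by (simp add: u_def algebra_simps)
  ultimately have "(u + r)\<^sup>2 \<le> 2 * (1 + s * (real (Suc n))\<^sup>2)" by (simp add: r(3) power_mult_distrib)
  hence "1 / (1 + s * (real (Suc n))\<^sup>2) \<le> 2 / (u + r)\<^sup>2"
   using u r s by (simp add: divide_simps add_pos_nonneg)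
  also have "... \<le> 2 / (u * (u + r))"
   using u r by (intro divide_left_mono) (auto simp: power2_eq_square intro!: mult_right_mono)
  also have "... = 2 / r * (1 / u - 1 / (u + r))" using u r by (simp add: field_simps)
  finally have "1 / (1 + s * (real (Suc n))\<^sup>2) \<le> 2 / r * (1 / u - 1 / (u + r))" .
  hence "(\<Sum>k<Suc n. 1 / (1 + s * (real (Suc k))\<^sup>2)) \<le> 2 / r * (1 - 1 / u) + 2 / r * (1 / u - 1 / (u + r))"
   using Suc by (simp add: u_def)
  also have "... = 2 / r * (1 - 1 / (u + r))" by (simp only: distrib_left[symmetric]) simp
  finally show ?case by (simp only: v)
 qed simp
 have "(\<Sum>k<n. 1 / (1 + s * (real k)\<^sup>2)) \<le> (\<Sum>k<Suc n. 1 / (1 + s * (real k)\<^sup>2))" using s by (simp add: add_nonneg_nonneg)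
 also have "... = 1 + (\<Sum>k<n. 1 / (1 + s * (real (Suc k))\<^sup>2))" by (subst sum.lessThan_Suc_shift) simp
 also have "... \<le> 1 + 2 / r * (1 - 1 / (1 + r * real n))" using tel[of n] by simp
 also have "... \<le> 1 / r + 2 / r * 1" using r by (intro add_mono mult_left_mono) (auto simp: field_simps)
 also have "... = 3 / sqrt s" by (simp add: r_def)
 finally show ?thesis .
qed

text \<open>Uniformity in the shift is the point: for a binary form the inner sum over x is shifted
  by a multiple of y. The integers split at minus the floor of \<delta> into two rays, on each of
  which |x + \<delta>| dominates a natural number.\<close>

lemma inverse_quadratic_int_sum_bound:
 fixes s \<delta> :: real
 assumes s: "0 < s" "s \<le> 1" and F: "finite F"
 shows "(\<Sum>x\<in>F. 1 / (1 + s * (real_of_int x + \<delta>)\<^sup>2)) \<le> 6 / sqrt s"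
proof -
 define m where "m = \<lfloor>\<delta>\<rfloor>"
 define \<epsilon> where "\<epsilon> = \<delta> - of_int m"
 have e: "0 \<le> \<epsilon>" "\<epsilon> < 1" unfolding \<epsilon>_def m_def by linarith+
 define g where "g = (%k::nat. 1 / (1 + s * (real k)\<^sup>2))"
 define A B where "A = {x\<in>F. x + m \<ge> 0}" and "B = {x\<in>F. x + m < 0}"
 have AB: "F = A \<union> B" "A \<inter> B = {}" "finite A" "finite B" using F by (auto simp: A_def B_def)
 have le: "1 / (1 + s * y\<^sup>2) \<le> g k" if "real k \<le> \<bar>y\<bar>" for y k
 proof -
  have "(real k)\<^sup>2 \<le> y\<^sup>2" using that by (simp add: abs_le_square_iff[symmetric])
  thus ?thesis unfolding g_def using s by (intro divide_left_mono add_left_mono mult_left_mono mult_pos_pos) (auto intro!: add_pos_nonneg)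
 qed
 have bnd: "sum g C \<le> 3 / sqrt s" if fC: "finite C" for C
 proof -
  obtain n where n: "C \<subseteq> {..<n}" using finite_nat_bounded[OF fC] by blast
  have "sum g C \<le> sum g {..<n}" using n s by (intro sum_mono2) (auto simp: g_def intro!: divide_nonneg_nonneg add_nonneg_nonneg)
  also have "... \<le> 3 / sqrt s" unfolding g_def by (rule inverse_quadratic_sum_bound[OF s])
  finally show ?thesis .
 qed
 have "(\<Sum>x\<in>A. 1 / (1 + s * (real_of_int x + \<delta>)\<^sup>2)) \<le> (\<Sum>x\<in>A. g (nat (x + m)))"
  by (intro sum_mono le) (use e in \<open>auto simp: A_def \<epsilon>_def\<close>)
 also have "... = sum g ((%x. nat (x + m)) ` A)"
  by (subst sum.reindex) (auto simp: inj_on_def A_def)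
 also have "... \<le> 3 / sqrt s" by (rule bnd) (use AB in auto)
 finally have 1: "(\<Sum>x\<in>A. 1 / (1 + s * (real_of_int x + \<delta>)\<^sup>2)) \<le> 3 / sqrt s" .
 have "(\<Sum>x\<in>B. 1 / (1 + s * (real_of_int x + \<delta>)\<^sup>2)) \<le> (\<Sum>x\<in>B. g (nat (- x - m - 1)))"
 proof (intro sum_mono le)
  fix x assume "x \<in> B"
  hence "x + m \<le> -1" by (auto simp: B_def)
  hence "real_of_int (x + m) \<le> - 1" by linarith
  thus "real (nat (- x - m - 1)) \<le> \<bar>real_of_int x + \<delta>\<bar>" using e \<open>x + m \<le> -1\<close> by (simp add: \<epsilon>_def)
 qed
 also have "... = sum g ((%x. nat (- x - m - 1)) ` B)"
  by (subst sum.reindex) (auto simp: inj_on_def B_def)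
 also have "... \<le> 3 / sqrt s" by (rule bnd) (use AB in auto)
 finally have 2: "(\<Sum>x\<in>B. 1 / (1 + s * (real_of_int x + \<delta>)\<^sup>2)) \<le> 3 / sqrt s" .
 have "(\<Sum>x\<in>F. 1 / (1 + s * (real_of_int x + \<delta>)\<^sup>2)) = (\<Sum>x\<in>A. 1 / (1 + s * (real_of_int x + \<delta>)\<^sup>2)) + (\<Sum>x\<in>B. 1 / (1 + s * (real_of_int x + \<delta>)\<^sup>2))"
  unfolding AB(1) using AB by (intro sum.union_disjoint) auto
 thus ?thesis using 1 2 by simp
qed

lemma inverse_quadratic_summable:
 fixes s \<delta> :: real
 assumes s: "0 < s" "s \<le> 1"
 shows "(%x::int. 1 / (1 + s * (real_of_int x + \<delta>)\<^sup>2)) summable_on UNIV"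
  and "(\<Sum>\<^sub>\<infinity>x::int. 1 / (1 + s * (real_of_int x + \<delta>)\<^sup>2)) \<le> 6 / sqrt s"
proof -
 show 1: "(%x::int. 1 / (1 + s * (real_of_int x + \<delta>)\<^sup>2)) summable_on UNIV"
 proof (rule nonneg_bdd_above_summable_on)
  show "bdd_above (sum (%x::int. 1 / (1 + s * (real_of_int x + \<delta>)\<^sup>2)) ` {F. F \<subseteq> UNIV & finite F})"
   using inverse_quadratic_int_sum_bound[OF s] by (auto intro!: bdd_aboveI[of _ "6 / sqrt s"])
 qed (use s in \<open>auto intro!: divide_nonneg_nonneg add_nonneg_nonneg\<close>)
 show "(\<Sum>\<^sub>\<infinity>x::int. 1 / (1 + s * (real_of_int x + \<delta>)\<^sup>2)) \<le> 6 / sqrt s"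
  by (rule infsum_le_finite_sums[OF 1]) (use inverse_quadratic_int_sum_bound[OF s] in auto)
qed

lemma exp_neg_square_le: "exp (- s * w\<^sup>2) \<le> 1 / (1 + s * (w::real)\<^sup>2)" if "s \<ge> 0"
proof -
 have "1 + s * w\<^sup>2 \<le> exp (s * w\<^sup>2)" by (rule exp_ge_add_one_self)
 thus ?thesis using that by (simp add: exp_minus field_simps add_pos_nonneg)
qed

text \<open>The left side is the absolute value of the third derivative of exp(-W^2). After clearing
  the denominator the polynomial has degree 5, so the exponential series up to V^6, with 2ab \<le>
  a^2 + b^2 for the odd powers, suffices.\<close>

lemma gauss_third_deriv_bound:
 fixes W :: real
 shows "\<bar>12 * W - 8 * W ^ 3\<bar> * exp (- W\<^sup>2) \<le> 28 / (1 + W\<^sup>2)"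
proof -
 define V where "V = \<bar>W\<bar>"
 have V: "V \<ge> 0" "V\<^sup>2 = W\<^sup>2" "\<bar>W ^ 3\<bar> = V ^ 3" by (simp_all add: V_def power_abs)
 have e: "1 + V\<^sup>2 + V ^ 4 / 2 + V ^ 6 / 6 \<le> exp (V\<^sup>2)"
 proof -
  have "(\<Sum>k<4. (V\<^sup>2) ^ k /\<^sub>R fact k) \<le> exp (V\<^sup>2)"
   unfolding exp_def by (rule sum_le_suminf[OF summable_exp_generic]) auto
  also have "(\<Sum>k<4. (V\<^sup>2) ^ k /\<^sub>R fact k) = 1 + V\<^sup>2 + V ^ 4 / 2 + V ^ 6 / 6"
   by (simp add: numeral_eq_Suc fact_numeral power2_eq_square)
  finally show ?thesis .
 qed
 have a: "2 * V \<le> 1 + V\<^sup>2" using sum_squares_bound[of V 1] by simp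
 have b: "2 * V ^ 3 \<le> V\<^sup>2 + V ^ 4"
 proof -
  have "V\<^sup>2 * (2 * V) \<le> V\<^sup>2 * (1 + V\<^sup>2)" by (intro mult_left_mono a) simp
  thus ?thesis by (simp add: eval_nat_numeral algebra_simps)
 qed
 have c: "2 * V ^ 5 \<le> V ^ 4 + V ^ 6"
 proof -
  have "V ^ 4 * (2 * V) \<le> V ^ 4 * (1 + V\<^sup>2)" using V by (intro mult_left_mono a) simp
  thus ?thesis by (simp add: eval_nat_numeral algebra_simps)
 qed
 have "\<bar>12 * W - 8 * W ^ 3\<bar> * (1 + W\<^sup>2) \<le> (12 * V + 8 * V ^ 3) * (1 + V\<^sup>2)"
  unfolding V(2) using abs_triangle_ineq4[of "12 * W" "8 * W ^ 3"] V
  by (intro mult_right_mono) (auto simp: V_def abs_mult)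
 also have "... = 12 * V + 20 * V ^ 3 + 8 * V ^ 5" by (simp add: eval_nat_numeral algebra_simps)
 also have "... \<le> 28 * (1 + V\<^sup>2 + V ^ 4 / 2 + V ^ 6 / 6)"
 proof -
  have "12 * v1 + 20 * v3 + 8 * v5 \<le> 28 * (1 + v2 + v4 / 2 + v6 / 6)"
   if "2 * v1 \<le> 1 + v2" "2 * v3 \<le> v2 + v4" "2 * v5 \<le> v4 + v6" "0 \<le> v2" "0 \<le> v4" "0 \<le> v6"
   for v1 v2 v3 v4 v5 v6 :: real
  proof -
   have "28 * (1 + v2 + v4 / 2 + v6 / 6) = 28 + 28 * v2 + 14 * v4 + 14 / 3 * v6" by (simp add: algebra_simps)
   moreover have "12 * v1 \<le> 6 + 6 * v2" using that(1) by linarith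
   moreover have "20 * v3 \<le> 10 * v2 + 10 * v4" using that(2) by linarith
   moreover have "8 * v5 \<le> 4 * v4 + 4 * v6" using that(3) by linarith
   moreover have "0 \<le> 2 / 3 * v6" using that by simp
   ultimately show ?thesis using that(4) by linarith
  qed
  from this[OF a b c] show ?thesis by simp
 qed
 also have "... \<le> 28 * exp (V\<^sup>2)" using e by (intro mult_left_mono) auto
 finally have "\<bar>12 * W - 8 * W ^ 3\<bar> * (1 + W\<^sup>2) \<le> 28 * exp (W\<^sup>2)" unfolding V(2) .
 thus ?thesis by (simp add: exp_minus field_simps add_pos_nonneg)
qed

text \<open>Three applications of the mean value theorem. The final point lies within 3 of x, which
  costs a factor 19 when its denominator is compared with the one at x; 532 is 28 times 19.\<close>

lemma gauss_third_difference:
 fixes s \<delta> x :: real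
 assumes s: "0 < s" "s \<le> 1"
 defines "\<phi> \<equiv> %y. exp (- s * (y + \<delta>)\<^sup>2)"
 shows "\<bar>\<phi> x - 3 * \<phi> (x + 1) + 3 * \<phi> (x + 2) - \<phi> (x + 3)\<bar> \<le> 532 * s * sqrt s / (1 + s * (x + \<delta>)\<^sup>2)"
proof -
 define f1 where "f1 = (%y. (- 2 * s * (y + \<delta>)) * \<phi> y)"
 define f2 where "f2 = (%y. (4 * s\<^sup>2 * (y + \<delta>)\<^sup>2 - 2 * s) * \<phi> y)"
 define f3 where "f3 = (%y. (12 * s\<^sup>2 * (y + \<delta>) - 8 * s ^ 3 * (y + \<delta>) ^ 3) * \<phi> y)"
 have d0: "(\<phi> has_real_derivative f1 y) (at y)" for y
  unfolding \<phi>_def f1_def by (auto intro!: derivative_eq_intros simp: algebra_simps)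
 have d1: "(f1 has_real_derivative f2 y) (at y)" for y
  unfolding f1_def by (auto intro!: derivative_eq_intros d0 simp: f1_def f2_def algebra_simps power2_eq_square)
 have d2: "(f2 has_real_derivative f3 y) (at y)" for y
  unfolding f2_def by (auto intro!: derivative_eq_intros d0 simp: f1_def f3_def algebra_simps power2_eq_square power3_eq_cube)
 have sh: "((%y. f (y + c)) has_real_derivative f' (y + c)) (at y)"
  if "!!y. (f has_real_derivative f' y) (at y)" for f f' :: "real => real" and c y
  using that[of "y + c"] DERIV_shift[of f "f' (y + c)" y c] by simp
 have "\<exists>\<xi>. x < \<xi> & \<xi> < x + 1 &
   (\<phi> (x + 1 + 2) - 2 * \<phi> (x + 1 + 1) + \<phi> (x + 1)) - (\<phi> (x + 2) - 2 * \<phi> (x + 1) + \<phi> x) = (x + 1 - x) * (f1 (\<xi> + 2) - 2 * f1 (\<xi> + 1) + f1 \<xi>)"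
  by (rule MVT2[where f = "%y. \<phi> (y + 2) - 2 * \<phi> (y + 1) + \<phi> y"])
    (auto intro!: derivative_eq_intros sh d0)
 then obtain \<xi>1 where \<xi>1: "x < \<xi>1" "\<xi>1 < x + 1"
   "(\<phi> (x + 1 + 2) - 2 * \<phi> (x + 1 + 1) + \<phi> (x + 1)) - (\<phi> (x + 2) - 2 * \<phi> (x + 1) + \<phi> x) = f1 (\<xi>1 + 2) - 2 * f1 (\<xi>1 + 1) + f1 \<xi>1" by auto
 have "\<exists>\<xi>. \<xi>1 < \<xi> & \<xi> < \<xi>1 + 1 &
   (f1 (\<xi>1 + 1 + 1) - f1 (\<xi>1 + 1)) - (f1 (\<xi>1 + 1) - f1 \<xi>1) = (\<xi>1 + 1 - \<xi>1) * (f2 (\<xi> + 1) - f2 \<xi>)"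
  by (rule MVT2[where f = "%y. f1 (y + 1) - f1 y"]) (auto intro!: derivative_eq_intros sh d1)
 then obtain \<xi>2 where \<xi>2: "\<xi>1 < \<xi>2" "\<xi>2 < \<xi>1 + 1"
   "(f1 (\<xi>1 + 1 + 1) - f1 (\<xi>1 + 1)) - (f1 (\<xi>1 + 1) - f1 \<xi>1) = f2 (\<xi>2 + 1) - f2 \<xi>2" by auto
 have "\<exists>\<xi>. \<xi>2 < \<xi> & \<xi> < \<xi>2 + 1 & f2 (\<xi>2 + 1) - f2 \<xi>2 = (\<xi>2 + 1 - \<xi>2) * f3 \<xi>"
  by (rule MVT2) (auto intro!: d2)
 then obtain \<xi>3 where \<xi>3: "\<xi>2 < \<xi>3" "\<xi>3 < \<xi>2 + 1" "f2 (\<xi>2 + 1) - f2 \<xi>2 = f3 \<xi>3" by auto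
 have "\<phi> x - 3 * \<phi> (x + 1) + 3 * \<phi> (x + 2) - \<phi> (x + 3) = - f3 \<xi>3"
  using \<xi>1(3) \<xi>2(3) \<xi>3(3) by (simp add: algebra_simps)
 hence "\<bar>\<phi> x - 3 * \<phi> (x + 1) + 3 * \<phi> (x + 2) - \<phi> (x + 3)\<bar> = \<bar>f3 \<xi>3\<bar>" by simp
 also have "... \<le> s * sqrt s * (28 / (1 + s * (\<xi>3 + \<delta>)\<^sup>2))"
 proof -
  define w W where "w = \<xi>3 + \<delta>" and "W = sqrt s * w"
  have r: "sqrt s * sqrt s = s" using s by simp
  have W2: "W\<^sup>2 = s * w\<^sup>2" using s by (simp add: W_def power_mult_distrib)
  have "12 * s\<^sup>2 * w - 8 * s ^ 3 * w ^ 3 = s * sqrt s * (12 * W - 8 * W ^ 3)"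
  proof -
   have e1: "s * sqrt s * (12 * W) = 12 * s * s * w"
   proof -
    have "s * sqrt s * (12 * W) = 12 * s * (sqrt s * sqrt s) * w" by (simp only: W_def mult_ac)
    thus ?thesis unfolding r .
   qed
   have e2: "s * sqrt s * (8 * W ^ 3) = 8 * s * s * s * w ^ 3"
   proof -
    have "s * sqrt s * (8 * W ^ 3) = 8 * s * (sqrt s * sqrt s) * (sqrt s * sqrt s) * w ^ 3"
     by (simp only: W_def power_mult_distrib power3_eq_cube mult_ac)
    thus ?thesis unfolding r .
   qed
   show ?thesis unfolding right_diff_distrib e1 e2 by (simp add: power2_eq_square power3_eq_cube)
  qed
  hence "f3 \<xi>3 = (s * sqrt s * (12 * W - 8 * W ^ 3)) * exp (- W\<^sup>2)"
   by (simp only: f3_def \<phi>_def w_def[symmetric] W2) simp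
  hence "\<bar>f3 \<xi>3\<bar> = s * sqrt s * (\<bar>12 * W - 8 * W ^ 3\<bar> * exp (- W\<^sup>2))"
   using s by (simp add: abs_mult)
  also have "... \<le> s * sqrt s * (28 / (1 + W\<^sup>2))" using s by (intro mult_left_mono gauss_third_deriv_bound) auto
  finally show ?thesis unfolding W2 w_def .
 qed
 also have "... \<le> s * sqrt s * (28 * (19 / (1 + s * (x + \<delta>)\<^sup>2)))"
 proof -
  define a b where "a = x + \<delta>" and "b = \<xi>3 + \<delta>"
  have "\<bar>a - b\<bar> \<le> 3" using \<xi>1 \<xi>2 \<xi>3 by (auto simp: a_def b_def)
  hence "(a - b)\<^sup>2 \<le> 3\<^sup>2" using abs_le_square_iff[of "a - b" 3] by simp
  moreover have "a\<^sup>2 \<le> 2 * b\<^sup>2 + 2 * (a - b)\<^sup>2"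
  proof -
   have "0 \<le> (a - 2 * b)\<^sup>2" by simp
   thus ?thesis by (simp add: power2_eq_square algebra_simps)
  qed
  ultimately have "a\<^sup>2 \<le> 2 * b\<^sup>2 + 18" by simp
  hence "s * a\<^sup>2 \<le> s * (2 * b\<^sup>2 + 18)" using s by (intro mult_left_mono) auto
  also have "... \<le> 2 * (s * b\<^sup>2) + 18" using s by (simp add: algebra_simps)
  finally have "s * a\<^sup>2 \<le> 2 * (s * b\<^sup>2) + 18" .
  moreover have "0 \<le> s * b\<^sup>2" using s by simp
  moreover have "1 + u \<le> 19 * (1 + v)" if "u \<le> 2 * v + 18" "0 \<le> v" for u v :: real using that by simp
  ultimately have "1 + s * a\<^sup>2 \<le> 19 * (1 + s * b\<^sup>2)" by blast
  moreover have "1 + s * a\<^sup>2 > 0" "1 + s * b\<^sup>2 > 0" using s by (auto intro!: add_pos_nonneg)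
  ultimately have "1 / (1 + s * b\<^sup>2) \<le> 19 / (1 + s * a\<^sup>2)" by (simp add: field_simps)
  thus ?thesis unfolding a_def b_def using s by (intro mult_left_mono) auto
 qed
 finally show ?thesis by (simp add: mult_ac)
qed

lemma gauss_summable:
 fixes s \<delta> :: real
 assumes s: "0 < s" "s \<le> 1"
 shows "(%x::int. exp (- s * (real_of_int x + \<delta>)\<^sup>2)) summable_on UNIV"
 by (rule summable_on_comparison_test[OF inverse_quadratic_summable(1)[OF s, of \<delta>]])
   (use exp_neg_square_le[of s] s in auto)

text \<open>The sign (-1)^x, as a case distinction because x may be negative.\<close>

definition alt :: "int => real" where "alt x = (if even x then 1 else - 1)"

lemma alt_abs [simp]: "\<bar>alt x\<bar> = 1" by (simp add: alt_def)

text \<open>A shift by 1 changes the sign of the sum S, so the third differences of the Gaussian sum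
  up to (1 + 1)^3 S = 8 S. Each difference gains a factor sqrt s. Third order is the lowest that
  still tends to 0 after the summation over the second variable, which loses 1 / sqrt s.\<close>

lemma alternating_gauss_bound:
 fixes s \<delta> :: real
 assumes s: "0 < s" "s \<le> 1"
 shows "\<bar>\<Sum>\<^sub>\<infinity>x::int. alt x * exp (- s * (real_of_int x + \<delta>)\<^sup>2)\<bar> \<le> 400 * s"
proof -
 define \<phi> where "\<phi> = (%y. exp (- s * (y + \<delta>)\<^sup>2))"
 define S where "S = (\<Sum>\<^sub>\<infinity>x::int. alt x * \<phi> (of_int x))"
 have sum: "(%x::int. alt x * \<phi> (of_int x)) summable_on UNIV"
  by (rule abs_summable_summable, rule summable_on_cong[THEN iffD1, OF _ gauss_summable[OF s, of \<delta>]])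
    (simp add: \<phi>_def abs_mult)
 have hs: "((%x::int. alt x * \<phi> (of_int x)) has_sum S) UNIV"
  unfolding S_def using sum by (rule has_sum_infsum)
 have shift: "((%x::int. alt x * \<phi> (of_int x + of_int c)) has_sum (alt c * S)) UNIV" for c
 proof -
  have "bij (%x::int. x + c)" by (rule bijI) (auto simp: inj_on_def surj_def intro: exI[of _ "_ - c"])
  hence "((%x::int. alt (x + c) * \<phi> (of_int (x + c))) has_sum S) UNIV"
   using has_sum_reindex_bij_betw[of "%x. x + c" UNIV UNIV "%x. alt x * \<phi> (of_int x)" S] hs by simp
  from has_sum_cmult_right[OF this, of "alt c"]
  show ?thesis by (rule has_sum_cong[THEN iffD1, rotated]) (simp add: alt_def)
 qed
 have s0: "((%x::int. alt x * \<phi> (of_int x)) has_sum S) UNIV"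
  and s1: "((%x::int. alt x * \<phi> (of_int x + 1)) has_sum (- S)) UNIV"
  and s2: "((%x::int. alt x * \<phi> (of_int x + 2)) has_sum S) UNIV"
  and s3: "((%x::int. alt x * \<phi> (of_int x + 3)) has_sum (- S)) UNIV"
  using shift[of 0] shift[of 1] shift[of 2] shift[of 3] by (simp_all add: alt_def)
 define D where "D = (%x::int. \<phi> (of_int x) - 3 * \<phi> (of_int x + 1) + 3 * \<phi> (of_int x + 2) - \<phi> (of_int x + 3))"
 have "((%x::int. alt x * \<phi> (of_int x) + (- 3) * (alt x * \<phi> (of_int x + 1)) + 3 * (alt x * \<phi> (of_int x + 2)) + (- 1) * (alt x * \<phi> (of_int x + 3)))
   has_sum (S + (- 3) * (- S) + 3 * S + (- 1) * (- S))) UNIV"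
  by (intro has_sum_add has_sum_cmult_right s0 s1 s2 s3)
 moreover have "(%x::int. alt x * \<phi> (of_int x) + (- 3) * (alt x * \<phi> (of_int x + 1)) + 3 * (alt x * \<phi> (of_int x + 2)) + (- 1) * (alt x * \<phi> (of_int x + 3))) = (%x. alt x * D x)"
  by (simp add: fun_eq_iff D_def algebra_simps)
 moreover have "S + (- 3) * (- S) + 3 * S + (- 1) * (- S) = 8 * S" by simp
 ultimately have h8: "((%x::int. alt x * D x) has_sum (8 * S)) UNIV" by (simp only:)
 have Db: "\<bar>D x\<bar> \<le> 532 * s * sqrt s * (1 / (1 + s * (of_int x + \<delta>)\<^sup>2))" for x
  using gauss_third_difference[OF s, of "of_int x" \<delta>] by (simp add: D_def \<phi>_def)
 have bsum: "(%x::int. 532 * s * sqrt s * (1 / (1 + s * (of_int x + \<delta>)\<^sup>2))) summable_on UNIV"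
  by (intro summable_on_cmult_right inverse_quadratic_summable s)
 have "\<bar>8 * S\<bar> \<le> (\<Sum>\<^sub>\<infinity>x::int. 532 * s * sqrt s * (1 / (1 + s * (of_int x + \<delta>)\<^sup>2)))"
  using norm_infsum_le[OF h8 has_sum_infsum[OF bsum]] Db by (simp add: abs_mult)
 also have "... = 532 * s * sqrt s * (\<Sum>\<^sub>\<infinity>x::int. 1 / (1 + s * (of_int x + \<delta>)\<^sup>2))"
  by (rule infsum_cmult_right) (intro inverse_quadratic_summable s)
 also have "... \<le> 532 * s * sqrt s * (6 / sqrt s)"
  using s by (intro mult_left_mono inverse_quadratic_summable) auto
 also have "... = 3192 * s" using s by simp
 finally have "\<bar>S\<bar> \<le> 399 * s" by simp
 thus ?thesis using s by (simp add: S_def \<phi>_def)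
qed

abbreviation (input) gauss_form :: "real => real => real => int => int => real" where
 "gauss_form a \<beta> \<gamma> x y \<equiv> exp (- (a * (real_of_int x + \<beta> * real_of_int y)\<^sup>2 + \<gamma> * (real_of_int y)\<^sup>2))"

lemma form_gauss_summable:
 fixes a \<beta> \<gamma> :: real
 assumes a: "0 < a" "a \<le> 1" and g: "0 < \<gamma>" "\<gamma> \<le> 1"
 shows "(%(y, x). gauss_form a \<beta> \<gamma> x y) summable_on (UNIV :: (int \<times> int) set)"
proof (rule nonneg_bdd_above_summable_on)
 show "bdd_above (sum (%(y, x). gauss_form a \<beta> \<gamma> x y) ` {F. F \<subseteq> (UNIV :: (int \<times> int) set) & finite F})"
 proof (intro bdd_aboveI2)
  fix F :: "(int \<times> int) set" assume "F \<in> {F. F \<subseteq> UNIV & finite F}"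
  hence F: "finite F" by simp
  define Y X where "Y = fst ` F" and "X = snd ` F"
  have XY: "finite X" "finite Y" "F \<subseteq> Y \<times> X" using F by (force simp: X_def Y_def)+
  have "(\<Sum>(y, x)\<in>F. gauss_form a \<beta> \<gamma> x y)
    \<le> (\<Sum>(y, x)\<in>Y \<times> X. gauss_form a \<beta> \<gamma> x y)"
   using XY by (intro sum_mono2) auto
  also have "... = (\<Sum>y\<in>Y. \<Sum>x\<in>X. exp (- a * (real_of_int x + \<beta> * real_of_int y)\<^sup>2) * exp (- \<gamma> * (real_of_int y + 0)\<^sup>2))"
   by (simp add: sum.cartesian_product exp_add[symmetric])
  also have "... \<le> (\<Sum>y\<in>Y. \<Sum>x\<in>X. (1 / (1 + a * (real_of_int x + \<beta> * real_of_int y)\<^sup>2)) * (1 / (1 + \<gamma> * (real_of_int y + 0)\<^sup>2)))"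
   using a g by (intro sum_mono mult_mono exp_neg_square_le) (auto intro!: divide_nonneg_nonneg add_nonneg_nonneg)
  also have "... = (\<Sum>y\<in>Y. (\<Sum>x\<in>X. 1 / (1 + a * (real_of_int x + \<beta> * real_of_int y)\<^sup>2)) * (1 / (1 + \<gamma> * (real_of_int y + 0)\<^sup>2)))"
   by (simp only: sum_distrib_right)
  also have "... \<le> (\<Sum>y\<in>Y. 6 / sqrt a * (1 / (1 + \<gamma> * (real_of_int y + 0)\<^sup>2)))"
   using a g XY by (intro sum_mono mult_right_mono inverse_quadratic_int_sum_bound) (auto intro!: divide_nonneg_nonneg add_nonneg_nonneg)
  also have "... = 6 / sqrt a * (\<Sum>y\<in>Y. 1 / (1 + \<gamma> * (real_of_int y + 0)\<^sup>2))" by (simp add: sum_distrib_left)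
  also have "... \<le> 6 / sqrt a * (6 / sqrt \<gamma>)"
   using a g XY by (intro mult_left_mono inverse_quadratic_int_sum_bound) auto
  finally show "sum (%(y, x). gauss_form a \<beta> \<gamma> x y) F \<le> 6 / sqrt a * (6 / sqrt \<gamma>)" .
 qed
qed auto

lemma form_alternating_gauss_bound:
 fixes a \<beta> \<gamma> :: real
 assumes a: "0 < a" "a \<le> 1" and g: "0 < \<gamma>" "\<gamma> \<le> 1"
 shows "\<bar>\<Sum>\<^sub>\<infinity>(y, x)\<in>(UNIV :: (int \<times> int) set). alt x * gauss_form a \<beta> \<gamma> x y\<bar> \<le> 2400 * a / sqrt \<gamma>"
proof -
 have sm: "(%(y, x). alt x * gauss_form a \<beta> \<gamma> x y) summable_on (UNIV \<times> UNIV :: (int \<times> int) set)"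
  by (rule abs_summable_summable, rule summable_on_cong[THEN iffD1, OF _ form_gauss_summable[OF assms, of \<beta>, folded UNIV_Times_UNIV]])
    (auto simp: abs_mult)
 define h where "h = (%y::int. \<Sum>\<^sub>\<infinity>x::int. alt x * gauss_form a \<beta> \<gamma> x y)"
 have e: "(\<Sum>\<^sub>\<infinity>(y, x)\<in>(UNIV :: (int \<times> int) set). alt x * gauss_form a \<beta> \<gamma> x y) = (\<Sum>\<^sub>\<infinity>y. h y)"
  using infsum_Sigma'_banach[OF sm] by (simp add: h_def)
 have hs: "h summable_on UNIV"
  using summable_on_Sigma_banach[OF sm] by (simp add: h_def)
 have hb: "\<bar>h y\<bar> \<le> 400 * a * (1 / (1 + \<gamma> * (real_of_int y + 0)\<^sup>2))" for y
 proof -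
  have "h y = (\<Sum>\<^sub>\<infinity>x::int. exp (- \<gamma> * (real_of_int y)\<^sup>2) * (alt x * exp (- a * (real_of_int x + \<beta> * real_of_int y)\<^sup>2)))"
   unfolding h_def by (intro infsum_cong) (simp add: exp_add[symmetric] algebra_simps exp_diff exp_minus divide_inverse)
  also have "... = exp (- \<gamma> * (real_of_int y)\<^sup>2) * (\<Sum>\<^sub>\<infinity>x::int. alt x * exp (- a * (real_of_int x + \<beta> * real_of_int y)\<^sup>2))"
   by (rule infsum_cmult_right')
  finally have "\<bar>h y\<bar> = exp (- \<gamma> * (real_of_int y)\<^sup>2) * \<bar>\<Sum>\<^sub>\<infinity>x::int. alt x * exp (- a * (real_of_int x + \<beta> * real_of_int y)\<^sup>2)\<bar>"
   by (simp add: abs_mult)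
  also have "... \<le> (1 / (1 + \<gamma> * (real_of_int y)\<^sup>2)) * (400 * a)"
   using g a by (intro mult_mono exp_neg_square_le alternating_gauss_bound) (auto intro!: divide_nonneg_nonneg add_nonneg_nonneg)
  finally show ?thesis by (simp add: mult.commute)
 qed
 have bs: "(%y::int. 400 * a * (1 / (1 + \<gamma> * (real_of_int y + 0)\<^sup>2))) summable_on UNIV"
  by (intro summable_on_cmult_right inverse_quadratic_summable g)
 have "\<bar>\<Sum>\<^sub>\<infinity>y. h y\<bar> \<le> (\<Sum>\<^sub>\<infinity>y::int. 400 * a * (1 / (1 + \<gamma> * (real_of_int y + 0)\<^sup>2)))"
  using norm_infsum_le[OF has_sum_infsum[OF hs] has_sum_infsum[OF bs]] hb by simp
 also have "... = 400 * a * (\<Sum>\<^sub>\<infinity>y::int. 1 / (1 + \<gamma> * (real_of_int y + 0)\<^sup>2))"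
  by (rule infsum_cmult_right) (intro inverse_quadratic_summable g)
 also have "... \<le> 400 * a * (6 / sqrt \<gamma>)"
  using a g by (intro mult_left_mono inverse_quadratic_summable) auto
 finally show ?thesis unfolding e by simp
qed

section \<open>A regularised Lambert kernel and its sums against periodic functions\<close>

text \<open>The function y/(1-y) - 4 y^4/(1-y^4) with the factor 1 - y cancelled: the poles at 1
  compensate, leaving the value 3/2. At y = x^d it is the d-th term of a Lambert series in x minus
  four times that of the series in x^4.\<close>

definition theta_kernel :: "real => real" where
 "theta_kernel y = y * (1 + 2 * y + 3 * y\<^sup>2) / ((1 + y) * (1 + y\<^sup>2))"

lemma theta_kernel_0 [simp]: "theta_kernel 0 = 0" and theta_kernel_1 [simp]: "theta_kernel 1 = 3 / 2"
 by (simp_all add: theta_kernel_def)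

lemma theta_kernel_eq:
 assumes "0 \<le> y" "y < 1"
 shows "theta_kernel y = y / (1 - y) - 4 * (y ^ 4 / (1 - y ^ 4))"
proof -
 have d: "1 - y ^ 4 = (1 - y) * ((1 + y) * (1 + y\<^sup>2))" by (simp add: eval_nat_numeral algebra_simps)
 define D where "D = (1 + y) * (1 + y\<^sup>2)"
 have D: "D > 0" using assms by (auto simp: D_def intro!: mult_pos_pos add_pos_nonneg)
 have "y / (1 - y) - 4 * (y ^ 4 / ((1 - y) * D)) = (y * D - 4 * y ^ 4) / ((1 - y) * D)"
  unfolding diff_divide_distrib using D by simp
 also have "y * D - 4 * y ^ 4 = (1 - y) * (y * (1 + 2 * y + 3 * y\<^sup>2))" by (simp add: D_def eval_nat_numeral algebra_simps)
 also have "... / ((1 - y) * D) = theta_kernel y" using assms by (simp add: theta_kernel_def D_def)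
 finally show ?thesis by (simp add: d D_def)
qed

text \<open>A bounded Lipschitz derivative is what a first order expansion with quadratic error
  needs. It comes from two explicit derivatives of P/Q and the compactness of the unit
  interval.\<close>

lemma theta_kernel_smooth:
 obtains K' M where "!!y. 0 \<le> y ==> y \<le> 1 ==> (theta_kernel has_real_derivative K' y) (at y)"
  "!!y. 0 \<le> y ==> y \<le> 1 ==> \<bar>K' y\<bar> \<le> M"
  "!!y z. 0 \<le> y ==> y \<le> 1 ==> 0 \<le> z ==> z \<le> 1 ==> \<bar>K' y - K' z\<bar> \<le> M * \<bar>y - z\<bar>"
proof -
 define P P' where "P = (%y::real. y + 2 * y\<^sup>2 + 3 * y ^ 3)" and "P' = (%y::real. 1 + 4 * y + 9 * y\<^sup>2)"
 define Q Q' where "Q = (%y::real. 1 + y + y\<^sup>2 + y ^ 3)" and "Q' = (%y::real. 1 + 2 * y + 3 * y\<^sup>2)"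
 define K' where "K' = (%y. (P' y * Q y - P y * Q' y) / (Q y)\<^sup>2)"
 define K'' where "K'' = (%y. (((4 + 18 * y) * Q y - P y * (2 + 6 * y)) * (Q y)\<^sup>2 - (P' y * Q y - P y * Q' y) * (2 * Q y * Q' y)) / ((Q y)\<^sup>2 * (Q y)\<^sup>2))"
 have Q0: "Q y > 0" if "y \<ge> 0" for y using that by (auto simp: Q_def intro!: add_pos_nonneg)
 have k: "theta_kernel = (%y. P y / Q y)"
 proof
  fix y :: real
  have "y * (1 + 2 * y + 3 * y\<^sup>2) = P y" "(1 + y) * (1 + y\<^sup>2) = Q y"
   by (simp_all add: P_def Q_def eval_nat_numeral algebra_simps)
  thus "theta_kernel y = P y / Q y" by (simp add: theta_kernel_def)
 qed
 have dP: "(P has_real_derivative P' y) (at y)" for y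
  unfolding P_def P'_def by (auto intro!: derivative_eq_intros simp: power2_eq_square)
 have dQ: "(Q has_real_derivative Q' y) (at y)" for y
  unfolding Q_def Q'_def by (auto intro!: derivative_eq_intros simp: power2_eq_square)
 have dP': "(P' has_real_derivative (4 + 18 * y)) (at y)" for y
  unfolding P'_def by (auto intro!: derivative_eq_intros)
 have dQ': "(Q' has_real_derivative (2 + 6 * y)) (at y)" for y
  unfolding Q'_def by (auto intro!: derivative_eq_intros)
 have d1: "(theta_kernel has_real_derivative K' y) (at y)" if "y \<ge> 0" for y
  unfolding k K'_def using Q0[OF that]
  by (auto intro!: derivative_eq_intros dP dQ simp: power2_eq_square)
 have d2: "(K' has_real_derivative K'' y) (at y)" if "y \<ge> 0" for y
  unfolding K'_def K''_def using Q0[OF that]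
  by (auto intro!: derivative_eq_intros dP dQ dP' dQ' simp: power2_eq_square algebra_simps)
 have c: "continuous_on {0..1} P" "continuous_on {0..1} P'" "continuous_on {0..1} Q" "continuous_on {0..1} Q'"
  unfolding P_def P'_def Q_def Q'_def by (intro continuous_intros)+
 have Qn: "\<forall>y\<in>{0..1}. Q y ~= 0" using Q0 by force
 have "continuous_on {0..1} K'" unfolding K'_def by (intro continuous_intros c) (use Qn in auto)
 then obtain M1 where M1: "!!y. 0 \<le> y ==> y \<le> 1 ==> \<bar>K' y\<bar> \<le> M1"
  using compact_imp_bounded[OF compact_continuous_image[of "{0..1}" K']] by (force simp: bounded_iff)
 have "continuous_on {0..1} K''" unfolding K''_def by (intro continuous_intros c) (use Qn in auto)
 then obtain M2 where M2: "!!y. 0 \<le> y ==> y \<le> 1 ==> \<bar>K'' y\<bar> \<le> M2"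
  using compact_imp_bounded[OF compact_continuous_image[of "{0..1}" K'']] by (force simp: bounded_iff)
 have lip: "\<bar>K' y - K' z\<bar> \<le> M2 * \<bar>y - z\<bar>" if "0 \<le> y" "y \<le> 1" "0 \<le> z" "z \<le> 1" for y z
  using field_differentiable_bound[of "{0..1}" K' K'' M2 y z] d2 M2 that
  by (auto intro: has_field_derivative_at_within)
 show thesis
 proof (rule that[of K' "max M1 M2"])
  fix y z :: real assume a: "0 \<le> y" "y \<le> 1" "0 \<le> z" "z \<le> 1"
  have "M2 * \<bar>y - z\<bar> \<le> max M1 M2 * \<bar>y - z\<bar>" by (intro mult_right_mono) auto
  thus "\<bar>K' y - K' z\<bar> \<le> max M1 M2 * \<bar>y - z\<bar>" using lip[OF a] by linarith
 qed (use d1 M1 in \<open>auto simp: le_max_iff_disj\<close>)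
qed

lemma one_minus_power_bounds:
 fixes x :: real
 assumes "0 \<le> x" "x \<le> 1"
 shows "1 - x ^ n \<le> real n * (1 - x)" "0 \<le> 1 - x ^ n"
proof -
 show "1 - x ^ n \<le> real n * (1 - x)"
 proof (induction n)
  case (Suc n)
  have "1 - x ^ Suc n = (1 - x ^ n) + x ^ n * (1 - x)" by (simp add: algebra_simps)
  also have "... \<le> real n * (1 - x) + 1 * (1 - x)"
   using assms by (intro add_mono Suc mult_right_mono power_le_one) auto
  finally show ?case by (simp add: algebra_simps)
 qed auto
 show "0 \<le> 1 - x ^ n" using power_le_one[of x n] assms by simp
qed

lemma power_diff_linear:
 fixes x :: real
 assumes x: "0 \<le> x" "x \<le> 1" and "a \<le> p"
 shows "\<bar>x ^ a - x ^ p - real (p - a) * (1 - x)\<bar> \<le> real p ^ 2 * (1 - x)\<^sup>2"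
proof -
 have "x ^ a - x ^ p = (1 - x) * (\<Sum>i=a..<p. x ^ i)"
  using assms(3)
 proof (induction p rule: dec_induct)
  case (step n)
  have "x ^ a - x ^ Suc n = (x ^ a - x ^ n) + (1 - x) * x ^ n" by (simp add: algebra_simps)
  thus ?case using step by (simp add: algebra_simps)
 qed auto
 moreover have "real (p - a) = (\<Sum>i=a..<p. 1)" by simp
 ultimately have "x ^ a - x ^ p - real (p - a) * (1 - x) = - ((1 - x) * (\<Sum>i=a..<p. 1 - x ^ i))"
  by (simp add: sum_subtractf algebra_simps)
 hence "\<bar>x ^ a - x ^ p - real (p - a) * (1 - x)\<bar> = (1 - x) * (\<Sum>i=a..<p. 1 - x ^ i)"
  using x one_minus_power_bounds(2)[OF x] by (simp add: abs_mult sum_nonneg)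
 also have "... \<le> (1 - x) * (\<Sum>i=a..<p. real p * (1 - x))"
 proof (intro mult_left_mono sum_mono)
  fix i assume "i \<in> {a..<p}"
  have "1 - x ^ i \<le> real i * (1 - x)" by (rule one_minus_power_bounds[OF x])
  also have "... \<le> real p * (1 - x)" using x \<open>i \<in> _\<close> by (intro mult_right_mono) auto
  finally show "1 - x ^ i \<le> real p * (1 - x)" .
 qed (use x in auto)
 also have "... = real (p - a) * (real p * (1 - x)\<^sup>2)" by (simp add: power2_eq_square)
 also have "... \<le> real p * (real p * (1 - x)\<^sup>2)" using x by (intro mult_right_mono) auto
 finally show ?thesis by (simp add: power2_eq_square mult_ac)
qed

text \<open>Between y0 x^p and y0 the kernel is nearly linear, and 1 - x^a is nearly a (1 - x). The
  factor y0 in the error matters: for y0 = x^(jp) it turns the total over all blocks into a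
  geometric series of order 1/(1 - x), one power less than the gain (1 - x)^2.\<close>

lemma kernel_block_estimate:
 assumes p: "p > 0"
 obtains C where "C \<ge> 0" "!!x y0 a. 0 \<le> x ==> x \<le> 1 ==> 0 \<le> y0 ==> y0 \<le> 1 ==> a \<le> p ==>
   \<bar>theta_kernel (y0 * x ^ a) - theta_kernel (y0 * x ^ p)
    - (real (p - a) / real p) * (theta_kernel y0 - theta_kernel (y0 * x ^ p))\<bar> \<le> C * y0 * (1 - x)\<^sup>2"
proof -
 obtain K' M where d: "!!y. 0 \<le> y ==> y \<le> 1 ==> (theta_kernel has_real_derivative K' y) (at y)"
  and M: "!!y. 0 \<le> y ==> y \<le> 1 ==> \<bar>K' y\<bar> \<le> M"
  and L: "!!y z. 0 \<le> y ==> y \<le> 1 ==> 0 \<le> z ==> z \<le> 1 ==> \<bar>K' y - K' z\<bar> \<le> M * \<bar>y - z\<bar>"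
  using theta_kernel_smooth by blast
 have M0: "M \<ge> 0" using M[of 0] by simp
 have mvt: "\<exists>\<xi>. v \<le> \<xi> & \<xi> \<le> u & theta_kernel u - theta_kernel v = K' \<xi> * (u - v)" if "0 \<le> v" "v \<le> u" "u \<le> 1" for u v
 proof (cases "u = v")
  case False
  hence "v < u" using that by simp
  hence "\<exists>z. v < z & z < u & theta_kernel u - theta_kernel v = (u - v) * K' z"
   by (rule MVT2) (rule d; use that in linarith)
  then obtain z where "v < z" "z < u" "theta_kernel u - theta_kernel v = (u - v) * K' z" by blast
  thus ?thesis by (intro exI[of _ z]) (auto simp: mult.commute)
 qed auto
 define C where "C = M * real p ^ 2 + M * (real p ^ 2 + real p ^ 2)"
 show thesis
 proof (rule that[of C])
  show "C \<ge> 0" using M0 by (simp add: C_def)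
  fix x y0 :: real and a :: nat
  assume x: "0 \<le> x" "x \<le> 1" and y: "0 \<le> y0" "y0 \<le> 1" and a: "a \<le> p"
  define u v where "u = y0 * x ^ a" and "v = y0 * x ^ p"
  define \<epsilon> where "\<epsilon> = 1 - x"
  have xp: "x ^ p \<le> x ^ a" "0 \<le> x ^ p" "x ^ a \<le> 1" using x a by (auto intro: power_decreasing power_le_one)
  have uv: "0 \<le> v" "v \<le> u" "u \<le> y0"
   using y xp by (auto simp: u_def v_def intro!: mult_left_mono mult_left_le)
  obtain \<xi> where \<xi>: "v \<le> \<xi>" "\<xi> \<le> u" "theta_kernel u - theta_kernel v = K' \<xi> * (u - v)" using mvt[of v u] uv y by auto
  obtain \<eta> where \<eta>: "v \<le> \<eta>" "\<eta> \<le> y0" "theta_kernel y0 - theta_kernel v = K' \<eta> * (y0 - v)" using mvt[of v y0] uv y by auto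
  define c where "c = real (p - a) / real p"
  have c: "0 \<le> c" "c \<le> 1" using p by (auto simp: c_def)
  have yv: "y0 - v \<le> y0 * (real p * \<epsilon>)"
   using mult_left_mono[OF one_minus_power_bounds(1)[OF x, of p] y(1)] by (simp add: v_def \<epsilon>_def algebra_simps)
  have e0: "\<epsilon> \<ge> 0" "\<epsilon> \<le> 1" using x by (auto simp: \<epsilon>_def)
  have "(theta_kernel u - theta_kernel v) - c * (theta_kernel y0 - theta_kernel v)
    = (K' \<xi> - K' \<eta>) * (u - v) + K' \<eta> * ((u - v) - c * (y0 - v))"
   unfolding \<xi>(3) \<eta>(3) by (simp add: algebra_simps)
  also have "\<bar>...\<bar> \<le> \<bar>K' \<xi> - K' \<eta>\<bar> * \<bar>u - v\<bar> + \<bar>K' \<eta>\<bar> * \<bar>(u - v) - c * (y0 - v)\<bar>"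
   by (rule order_trans[OF abs_triangle_ineq]) (simp add: abs_mult)
  also have "... \<le> (M * (real p ^ 2)) * y0 * \<epsilon>\<^sup>2 + M * (y0 * ((real p ^ 2 + real p ^ 2) * \<epsilon>\<^sup>2))"
  proof (rule add_mono)
   have 1: "\<bar>K' \<xi> - K' \<eta>\<bar> \<le> M * (y0 * (real p * \<epsilon>))"
   proof -
    have "\<bar>K' \<xi> - K' \<eta>\<bar> \<le> M * \<bar>\<xi> - \<eta>\<bar>" using \<xi> \<eta> uv y by (intro L) auto
    also have "... \<le> M * (y0 - v)" using \<xi> \<eta> uv by (intro mult_left_mono M0) auto
    also have "... \<le> M * (y0 * (real p * \<epsilon>))" by (intro mult_left_mono M0 yv)
    finally show ?thesis .
   qed
   have 2: "\<bar>u - v\<bar> \<le> y0 * (real p * \<epsilon>)" using uv yv by auto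
   have "\<bar>K' \<xi> - K' \<eta>\<bar> * \<bar>u - v\<bar> \<le> (M * (y0 * (real p * \<epsilon>))) * (y0 * (real p * \<epsilon>))"
    by (intro mult_mono 1 2) (use M0 y e0 in auto)
   also have "... = (M * (real p ^ 2)) * (y0 * y0) * \<epsilon>\<^sup>2" by (simp add: power2_eq_square)
   also have "... \<le> (M * (real p ^ 2)) * y0 * \<epsilon>\<^sup>2"
    using y M0 by (intro mult_right_mono mult_left_mono) (auto intro: mult_left_le)
   finally show "\<bar>K' \<xi> - K' \<eta>\<bar> * \<bar>u - v\<bar> \<le> (M * (real p ^ 2)) * y0 * \<epsilon>\<^sup>2" .
   have "(u - v) - c * (y0 - v) = y0 * ((x ^ a - x ^ p - real (p - a) * (1 - x)) - c * (x ^ 0 - x ^ p - real (p - 0) * (1 - x)))"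
    using p by (simp add: u_def v_def c_def field_simps)
   hence "\<bar>(u - v) - c * (y0 - v)\<bar> = y0 * \<bar>(x ^ a - x ^ p - real (p - a) * (1 - x)) - c * (x ^ 0 - x ^ p - real (p - 0) * (1 - x))\<bar>"
    using y by (simp add: abs_mult)
   also have "... \<le> y0 * (real p ^ 2 * \<epsilon>\<^sup>2 + 1 * (real p ^ 2 * \<epsilon>\<^sup>2))"
   proof (intro mult_left_mono y)
    have 3: "\<bar>x ^ a - x ^ p - real (p - a) * (1 - x)\<bar> \<le> real p ^ 2 * \<epsilon>\<^sup>2"
     using power_diff_linear[OF x a] by (simp add: \<epsilon>_def)
    have 4: "\<bar>x ^ 0 - x ^ p - real (p - 0) * (1 - x)\<bar> \<le> real p ^ 2 * \<epsilon>\<^sup>2"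
     using power_diff_linear[OF x, of 0 p] by (simp add: \<epsilon>_def)
    have "\<bar>c * (x ^ 0 - x ^ p - real (p - 0) * (1 - x))\<bar> \<le> 1 * (real p ^ 2 * \<epsilon>\<^sup>2)"
     unfolding abs_mult using c 4 by (intro mult_mono) auto
    thus "\<bar>(x ^ a - x ^ p - real (p - a) * (1 - x)) - c * (x ^ 0 - x ^ p - real (p - 0) * (1 - x))\<bar>
      \<le> real p ^ 2 * \<epsilon>\<^sup>2 + 1 * (real p ^ 2 * \<epsilon>\<^sup>2)" using 3 by linarith
   qed
   finally have 5: "\<bar>(u - v) - c * (y0 - v)\<bar> \<le> y0 * ((real p ^ 2 + real p ^ 2) * \<epsilon>\<^sup>2)" by (simp add: algebra_simps)
   show "\<bar>K' \<eta>\<bar> * \<bar>(u - v) - c * (y0 - v)\<bar> \<le> M * (y0 * ((real p ^ 2 + real p ^ 2) * \<epsilon>\<^sup>2))"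
    by (intro mult_mono 5 M) (use \<eta> uv y M0 in auto)
  qed
  also have "... = C * y0 * \<epsilon>\<^sup>2" by (simp add: C_def algebra_simps)
  finally show "\<bar>theta_kernel (y0 * x ^ a) - theta_kernel (y0 * x ^ p)
    - (real (p - a) / real p) * (theta_kernel y0 - theta_kernel (y0 * x ^ p))\<bar> \<le> C * y0 * (1 - x)\<^sup>2"
   by (simp add: u_def v_def c_def \<epsilon>_def)
 qed
qed

text \<open>Abel summation over the blocks \<open>jp < d \<le> jp + p\<close>.\<close>

lemma periodic_kernel_sum_limit:
 fixes f :: "nat => real"
 assumes p: "p > 0" and per: "!!n. f (n + p) = f n" and zero: "(\<Sum>a=1..p. f a) = 0"
 shows "((%x. \<Sum>d. f (Suc d) * theta_kernel (x ^ Suc d)) \<longlongrightarrow> - 3 / 2 * (\<Sum>a=1..p. real a * f a) / real p) (at_left 1)"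
proof -
 obtain C where C: "C \<ge> 0" "!!x y0 a. 0 \<le> x ==> x \<le> 1 ==> 0 \<le> y0 ==> y0 \<le> 1 ==> a \<le> p ==>
   \<bar>theta_kernel (y0 * x ^ a) - theta_kernel (y0 * x ^ p)
    - (real (p - a) / real p) * (theta_kernel y0 - theta_kernel (y0 * x ^ p))\<bar> \<le> C * y0 * (1 - x)\<^sup>2"
  using kernel_block_estimate[OF p] by blast
 define F where "F = (\<Sum>a=1..p. \<bar>f a\<bar>)"
 \<comment> \<open>Since f sums to 0 over a period, the weights (p - a)/p of the block estimate
   collapse to -a/p.\<close>
 define l where "l = - (\<Sum>a=1..p. real a * f a) / real p"
 have F0: "F \<ge> 0" by (simp add: F_def sum_nonneg)
 have fper: "f (j * p + a) = f a" for j a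
 proof (induction j)
  case (Suc j)
  show ?case using Suc per[of "j * p + a"] by (simp add: algebra_simps)
 qed simp
 have lsum: "(\<Sum>a=1..p. f a * (real (p - a) / real p)) = l"
 proof -
  have "(\<Sum>a=1..p. f a * (real (p - a) / real p)) = (\<Sum>a=1..p. f a - real a * f a / real p)"
   using p by (intro sum.cong) (auto simp: of_nat_diff field_simps)
  thus ?thesis using zero by (simp add: sum_subtractf l_def sum_divide_distrib)
 qed
 have bound: "\<bar>(\<Sum>d. f (Suc d) * theta_kernel (x ^ Suc d)) - l * (3 / 2)\<bar> \<le> F * C * (1 - x)"
  if x: "0 < x" "x < 1" for x
 proof -
  have xp: "0 < x ^ p" "x ^ p < 1" using x p by (auto simp: power_less_one_iff)
  have y01: "0 \<le> (x ^ p) ^ j" "(x ^ p) ^ j \<le> 1" for j using xp by (auto intro: power_le_one)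
  define B where "B = (%j. \<Sum>a=1..p. f (j * p + a) * theta_kernel (x ^ (j * p + a)))"
  define D where "D = (%j. theta_kernel ((x ^ p) ^ j) - theta_kernel ((x ^ p) ^ Suc j))"
  have pw: "x ^ (j * p + a) = (x ^ p) ^ j * x ^ a" for j a by (simp add: power_add power_mult mult.commute[of j])
  have B: "\<bar>B j - l * D j\<bar> \<le> F * C * (1 - x)\<^sup>2 * (x ^ p) ^ j" for j
  proof -
   have "B j = (\<Sum>a=1..p. f a * (theta_kernel ((x ^ p) ^ j * x ^ a) - theta_kernel ((x ^ p) ^ j * x ^ p)))"
    using zero by (simp add: B_def pw fper right_diff_distrib sum_subtractf flip: sum_distrib_right)
   moreover have "(\<Sum>a=1..p. f a * (U a - c a * X)) = (\<Sum>a=1..p. f a * U a) - (\<Sum>a=1..p. f a * c a) * X" for U c and X :: real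
    by (simp only: right_diff_distrib sum_subtractf sum_distrib_right mult.assoc)
   moreover have "D j = theta_kernel ((x ^ p) ^ j) - theta_kernel ((x ^ p) ^ j * x ^ p)" by (simp add: D_def mult.commute)
   ultimately have Bj: "B j - l * D j = (\<Sum>a=1..p. f a * (theta_kernel ((x ^ p) ^ j * x ^ a) - theta_kernel ((x ^ p) ^ j * x ^ p)
      - (real (p - a) / real p) * (theta_kernel ((x ^ p) ^ j) - theta_kernel ((x ^ p) ^ j * x ^ p))))"
    by (simp only: lsum)
   have "\<bar>f a * (theta_kernel ((x ^ p) ^ j * x ^ a) - theta_kernel ((x ^ p) ^ j * x ^ p)
      - (real (p - a) / real p) * (theta_kernel ((x ^ p) ^ j) - theta_kernel ((x ^ p) ^ j * x ^ p)))\<bar>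
     \<le> \<bar>f a\<bar> * (C * (x ^ p) ^ j * (1 - x)\<^sup>2)" if a: "a \<in> {1..p}" for a
   proof -
    have "a \<le> p" using a by simp
    from C(2)[OF less_imp_le[OF x(1)] less_imp_le[OF x(2)] y01[of j] this] show ?thesis
     unfolding abs_mult[of "f a"] by (rule mult_left_mono) (rule abs_ge_zero)
   qed
   hence "\<bar>B j - l * D j\<bar> \<le> (\<Sum>a=1..p. \<bar>f a\<bar> * (C * (x ^ p) ^ j * (1 - x)\<^sup>2))"
    unfolding Bj by (rule sum_norm_le[where 'a = real, unfolded real_norm_def])
   also have "... = F * C * (1 - x)\<^sup>2 * (x ^ p) ^ j" by (simp add: F_def sum_distrib_left sum_distrib_right mult_ac)
   finally show ?thesis .
  qed
  have geo: "(%j. F * C * (1 - x)\<^sup>2 * (x ^ p) ^ j) sums (F * C * (1 - x)\<^sup>2 * (1 / (1 - x ^ p)))"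
   using xp by (intro sums_mult geometric_sums) auto
  \<comment> \<open>The main terms telescope from \<open>theta_kernel 1\<close> = 3/2 down to
    \<open>theta_kernel 0\<close> = 0; this is the 3/2 of the limit.\<close>
  have sD: "D sums (3 / 2)"
  proof -
   have "(%j. theta_kernel ((x ^ p) ^ j)) \<longlonglongrightarrow> theta_kernel 0"
   proof -
    have "isCont theta_kernel 0" unfolding theta_kernel_def by (intro continuous_intros) auto
    moreover have "(%j. (x ^ p) ^ j) \<longlonglongrightarrow> 0" using xp by (intro LIMSEQ_realpow_zero) auto
    ultimately show ?thesis by (rule isCont_tendsto_compose)
   qed
   from telescope_sums'[OF this] show ?thesis by (simp add: D_def)
  qed
  have sBl: "summable (%j. B j - l * D j)"
   by (rule summable_comparison_test'[OF sums_summable[OF geo], of 0]) (use B in auto)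
  have sB: "summable B"
   using summable_add[OF sBl summable_mult[OF sums_summable[OF sD], of l]] by simp
  have "\<bar>(\<Sum>j. B j - l * D j)\<bar> \<le> F * C * (1 - x)\<^sup>2 * (1 / (1 - x ^ p))"
   using norm_suminf_le[of "%j. B j - l * D j" "%j. F * C * (1 - x)\<^sup>2 * (x ^ p) ^ j"] B geo
   by (auto simp: sums_iff)
  also have "(\<Sum>j. B j - l * D j) = suminf B - l * (3 / 2)"
   using suminf_diff[OF sB summable_mult[OF sums_summable[OF sD], of l]] suminf_mult[OF sums_summable[OF sD], of l]
   unfolding sums_unique[OF sD, symmetric] by simp
  also have "F * C * (1 - x)\<^sup>2 * (1 / (1 - x ^ p)) \<le> F * C * (1 - x)"
  proof -
   have "1 - x \<le> 1 - x ^ p" using x p power_decreasing[of 1 p x] by simp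
   hence "(1 - x)\<^sup>2 * (1 / (1 - x ^ p)) \<le> (1 - x)\<^sup>2 * (1 / (1 - x))" using x xp by (intro mult_left_mono divide_left_mono) auto
   also have "... = 1 - x" using x by (simp add: power2_eq_square)
   finally have "(1 - x)\<^sup>2 * (1 / (1 - x ^ p)) \<le> 1 - x" .
   from mult_left_mono[OF this, of "F * C"] show ?thesis using F0 C(1) by (simp add: mult.assoc)
  qed
  also have "suminf B = (\<Sum>d. f (Suc d) * theta_kernel (x ^ Suc d))"
  proof -
   define g where "g = (%d. f (Suc d) * theta_kernel (x ^ Suc d))"
   have "summable g"
   proof (rule summable_comparison_test')
    show "summable (%d. 3 * F * x ^ Suc d)" using x by (intro summable_mult) (auto simp: summable_geometric summable_Suc_iff)
    fix d :: nat assume "d \<ge> 0"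
    have kb: "\<bar>theta_kernel y\<bar> \<le> 3 * y" if "0 \<le> y" "y \<le> 1" for y
    proof -
     have D: "(1 + y) * (1 + y\<^sup>2) \<ge> 1 + y + y\<^sup>2" using that by (simp add: algebra_simps)
     have D1: "(1 + y) * (1 + y\<^sup>2) > 0" using that by (intro mult_pos_pos) (auto intro: add_pos_nonneg)
     have "y * (1 + 2 * y + 3 * y\<^sup>2) \<le> (3 * y) * ((1 + y) * (1 + y\<^sup>2))"
     proof -
      have "1 + 2 * y + 3 * y\<^sup>2 \<le> 3 * ((1 + y) * (1 + y\<^sup>2))" using D that by (auto intro: order_trans)
      from mult_left_mono[OF this that(1)] show ?thesis by (simp add: mult_ac)
     qed
     hence "theta_kernel y \<le> 3 * y" using D1 by (simp add: theta_kernel_def pos_divide_le_eq)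
     moreover have "theta_kernel y \<ge> 0" unfolding theta_kernel_def using that D1 by (intro divide_nonneg_pos) (auto intro!: mult_nonneg_nonneg add_nonneg_nonneg)
     ultimately show ?thesis by simp
    qed
    have "\<bar>f (Suc d)\<bar> \<le> F"
    proof -
     define a where "a = (if Suc d mod p = 0 then p else Suc d mod p)"
     have a: "a \<in> {1..p}" using p by (auto simp: a_def Suc_le_eq intro: less_imp_le)
     have "f (Suc d) = f (Suc d mod p)" using fper[of "Suc d div p" "Suc d mod p"] by simp
     also have "... = f a" using per[of 0] by (simp add: a_def)
     finally show ?thesis unfolding F_def using member_le_sum[OF a, of "%a. \<bar>f a\<bar>"] by simp
    qed
    moreover have "\<bar>theta_kernel (x ^ Suc d)\<bar> \<le> 3 * x ^ Suc d" using x by (intro kb) (auto intro: power_le_one simp del: power_Suc)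
    ultimately have "\<bar>f (Suc d)\<bar> * \<bar>theta_kernel (x ^ Suc d)\<bar> \<le> F * (3 * x ^ Suc d)" using F0 by (intro mult_mono) auto
    thus "norm (g d) \<le> 3 * F * x ^ Suc d" by (simp add: g_def abs_mult mult_ac)
   qed
   from sums_group[OF summable_sums[OF this] p] have "(%n. sum g {n * p..<n * p + p}) sums suminf g" .
   moreover have "sum g {n * p..<n * p + p} = B n" for n
    unfolding B_def g_def
    by (rule sum.reindex_bij_witness[of _ "%a. n * p + a - 1" "%d. Suc d - n * p"]) auto
   ultimately show ?thesis by (simp add: sums_iff g_def)
  qed
  finally show ?thesis .
 qed
 have "((%x. (\<Sum>d. f (Suc d) * theta_kernel (x ^ Suc d)) - l * (3 / 2)) \<longlongrightarrow> 0) (at_left 1)"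
 proof (rule Lim_null_comparison)
  show "\<forall>\<^sub>F x in at_left 1. norm ((\<Sum>d. f (Suc d) * theta_kernel (x ^ Suc d)) - l * (3 / 2)) \<le> F * C * (1 - x)"
   unfolding real_norm_def
   by (rule eventually_mono[OF eventually_at_left_real[of 0 "1 :: real"]]) (simp, rule bound, simp_all only: greaterThanLessThan_iff)
  show "((%x. F * C * (1 - x)) \<longlongrightarrow> 0) (at_left 1)" by (auto intro!: tendsto_eq_intros)
 qed
 hence "((%x. \<Sum>d. f (Suc d) * theta_kernel (x ^ Suc d)) \<longlongrightarrow> l * (3 / 2)) (at_left 1)"
  by (simp add: Lim_null[symmetric])
 thus ?thesis by (simp add: l_def field_simps)
qed

section \<open>Quadratic congruences of discriminant -p\<close>

lemma Legendre_mult_self: "\<not> [a = 0] (mod b) ==> Legendre a b * Legendre a b = 1"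
 by (simp add: Legendre_def)

lemma abs_Legendre_le_1: "\<bar>Legendre a b\<bar> \<le> 1"
 by (simp add: Legendre_def)

lemma bij_betw_preimage: "bij_betw f A B ==> C \<subseteq> B ==> bij_betw f {a \<in> A. f a \<in> C} C"
 by (auto simp: bij_betw_def inj_on_def)

text \<open>The roots of \<open>x\<^sup>2 + x + k\<close> modulo \<open>m\<close>, where \<open>4 k = p + 1\<close>, parametrise the primitive ideals of norm \<open>m\<close>.\<close>

definition quad_roots :: "nat => nat => nat set" where
 "quad_roots k m = {x. x < m & m dvd x\<^sup>2 + x + k}"

lemma finite_quad_roots [simp]: "finite (quad_roots k m)" by (simp add: quad_roots_def)

text \<open>Roots modulo l n lie over roots modulo n, as x + j n with j < l. The coprime case and
  the lifting case differ only in how the inner set of j is counted.\<close>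

lemma quad_roots_mult:
 assumes "l > 0" "n > 0"
 shows "card (quad_roots k (l * n)) = (\<Sum>x\<in>quad_roots k n. card {j. j < l & l * n dvd (x + j * n)\<^sup>2 + (x + j * n) + k})"
proof -
 have "quad_roots k (l * n) = (%(x, j). x + j * n) ` (SIGMA x:quad_roots k n. {j. j < l & l * n dvd (x + j * n)\<^sup>2 + (x + j * n) + k})" (is "?A = ?f ` ?S")
 proof (intro equalityI subsetI)
  fix y assume y: "y \<in> ?A"
  define x j where "x = y mod n" and "j = y div n"
  have e: "y = x + j * n" by (simp add: x_def j_def)
  have d: "l * n dvd y\<^sup>2 + y + k" "y < l * n" using y by (auto simp: quad_roots_def)
  have "n dvd y\<^sup>2 + y + k" using d(1) dvd_mult_right by blast
  hence "[y\<^sup>2 + y + k = 0] (mod n)" by (simp add: cong_0_iff)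
  moreover have "[x\<^sup>2 + x + k = y\<^sup>2 + y + k] (mod n)" by (intro cong_add cong_pow cong_refl) (simp_all add: x_def cong_def)
  ultimately have "n dvd x\<^sup>2 + x + k" using cong_trans cong_0_iff by blast
  moreover have "j < l" using d(2) by (simp add: j_def less_mult_imp_div_less)
  moreover have "x < n" using assms by (simp add: x_def)
  moreover have "l * n dvd (x + j * n)\<^sup>2 + (x + j * n) + k" using d(1) unfolding e[symmetric] .
  ultimately have "(x, j) \<in> ?S" by (simp add: quad_roots_def)
  thus "y \<in> ?f ` ?S" using e by force
 next
  fix y assume "y \<in> ?f ` ?S"
  then obtain x j where *: "y = x + j * n" "x < n" "j < l" "l * n dvd y\<^sup>2 + y + k" by (auto simp: quad_roots_def)
  have "y < Suc j * n" using *(1,2) by simp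
  also have "... \<le> l * n" using *(3) by (intro mult_right_mono) auto
  finally show "y \<in> ?A" using * by (auto simp: quad_roots_def)
 qed
 moreover have "inj_on ?f ?S"
 proof (rule inj_onI, clarify)
  fix x j x' j' assume "x \<in> quad_roots k n" "x' \<in> quad_roots k n" "x + j * n = x' + j' * n"
  hence "x < n" "x' < n" by (auto simp: quad_roots_def)
  hence "x = x'" using \<open>x + j * n = x' + j' * n\<close> by (metis mod_less mod_mult_self1)
  thus "x = x' & j = j'" using \<open>x + j * n = x' + j' * n\<close> assms by auto
 qed
 ultimately show ?thesis by (simp add: card_image card_SigmaI)
qed

lemma coprime_residue_bij:
 assumes "coprime l n" "l > 0"
 shows "bij_betw (%j. (x + j * n) mod l) {..<l} {..<(l::nat)}"
proof -
 have "inj_on (%j. (x + j * n) mod l) {..<l}"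
 proof (rule inj_onI)
  fix i j assume ij: "i \<in> {..<l}" "j \<in> {..<l}" "(x + i * n) mod l = (x + j * n) mod l"
  hence "[x + i * n = x + j * n] (mod l)" by (simp add: cong_def)
  hence "[i * n = j * n] (mod l)" by (simp add: cong_add_lcancel_nat)
  hence "[i = j] (mod l)" using assms(1) by (simp add: cong_mult_rcancel_nat coprime_commute)
  thus "i = j" using ij by (auto simp: cong_less_modulus_unique_nat)
 qed
 moreover have "(%j. (x + j * n) mod l) ` {..<l} \<subseteq> {..<l}" using assms by auto
 ultimately show ?thesis by (simp add: bij_betw_def card_subset_eq card_image endo_inj_surj)
qed

text \<open>Chinese remainder theorem: for coprime l and n the numbers x + j n run through all
  residues modulo l.\<close>

lemma quad_roots_coprime:
 assumes "coprime l n" "l > 0" "n > 0"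
 shows "card (quad_roots k (l * n)) = card (quad_roots k l) * card (quad_roots k n)"
proof -
 have "card {j. j < l & l * n dvd (x + j * n)\<^sup>2 + (x + j * n) + k} = card (quad_roots k l)" if "x \<in> quad_roots k n" for x
 proof -
  have "{j. j < l & l * n dvd (x + j * n)\<^sup>2 + (x + j * n) + k} = {j\<in>{..<l}. (x + j * n) mod l \<in> quad_roots k l}"
  proof -
   have "l * n dvd y\<^sup>2 + y + k \<longleftrightarrow> y mod l \<in> quad_roots k l" if y: "y = x + j * n" for y j
   proof -
    have "[x\<^sup>2 + x + k = y\<^sup>2 + y + k] (mod n)" unfolding y by (intro cong_add cong_pow cong_refl) (simp_all add: cong_def)
    moreover have "[x\<^sup>2 + x + k = 0] (mod n)" using \<open>x \<in> _\<close> by (auto simp: quad_roots_def cong_0_iff)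
    ultimately have "n dvd y\<^sup>2 + y + k" using cong_trans cong_sym cong_0_iff by blast
    hence "l * n dvd y\<^sup>2 + y + k \<longleftrightarrow> l dvd y\<^sup>2 + y + k"
     using assms(1) by (metis divides_mult dvd_mult_left)
    also have "... \<longleftrightarrow> l dvd (y mod l)\<^sup>2 + y mod l + k"
    proof -
     have "[(y mod l)\<^sup>2 + y mod l + k = y\<^sup>2 + y + k] (mod l)" by (intro cong_add cong_pow cong_refl) (simp_all add: cong_def)
     thus ?thesis using cong_dvd_iff by blast
    qed
    finally show ?thesis using assms by (simp add: quad_roots_def)
   qed
   thus ?thesis by auto
  qed
  moreover have "bij_betw (%j. (x + j * n) mod l) {j\<in>{..<l}. (x + j * n) mod l \<in> quad_roots k l} (quad_roots k l)"
  proof -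
   have "quad_roots k l \<subseteq> {..<l}" by (auto simp: quad_roots_def)
   from bij_betw_preimage[OF coprime_residue_bij[OF assms(1,2), of x] this] show ?thesis
    by simp
  qed
  ultimately show ?thesis by (simp add: bij_betw_same_card)
 qed
 thus ?thesis using quad_roots_mult[OF assms(2,3), of k] by simp
qed

context
 fixes p k :: nat
 assumes p: "prime p" "p mod 4 = 3" and k: "4 * k = p + 1"
begin

lemma quad_disc: "4 * (x\<^sup>2 + x + k) = (2 * x + 1)\<^sup>2 + p"
 using k by (simp add: power2_eq_square algebra_simps)

text \<open>Hensel lifting. A prime l dividing the derivative 2x + 1 at a root would divide the
  discriminant -p, so the condition on j is a linear congruence with invertible coefficient.\<close>

lemma quad_roots_lift:
 assumes l: "prime l" "l ~= p" and n: "l dvd n" "n > 0"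
 shows "card (quad_roots k (l * n)) = card (quad_roots k n)"
proof -
 have l0: "l > 0" using l by (simp add: prime_gt_0_nat)
 have "card {j. j < l & l * n dvd (x + j * n)\<^sup>2 + (x + j * n) + k} = 1" if x: "x \<in> quad_roots k n" for x
 proof -
  obtain c where c: "x\<^sup>2 + x + k = n * c" using x by (auto simp: quad_roots_def)
  have ln: "\<not> l dvd 2 * x + 1"
  proof
   assume a: "l dvd 2 * x + 1"
   have "l dvd 4 * (x\<^sup>2 + x + k)" using n(1) c by (simp add: dvd_mult2)
   moreover have "l dvd (2 * x + 1)\<^sup>2" unfolding power2_eq_square using a by (rule dvd_mult2)
   ultimately have "l dvd p" unfolding quad_disc using dvd_add_right_iff by blast
   thus False using l p by (simp add: primes_dvd_imp_eq)
  qed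
  hence cop: "coprime l (2 * x + 1)" using l(1) by (simp add: prime_imp_coprime)
  have "{j. j < l & l * n dvd (x + j * n)\<^sup>2 + (x + j * n) + k} = {j\<in>{..<l}. (c + j * (2 * x + 1)) mod l = 0}"
  proof -
   have "l * n dvd (x + j * n)\<^sup>2 + (x + j * n) + k \<longleftrightarrow> (c + j * (2 * x + 1)) mod l = 0" for j
   proof -
    have "(x + j * n)\<^sup>2 + (x + j * n) + k = (x\<^sup>2 + x + k) + n * (j * (2 * x + 1)) + n * n * j\<^sup>2"
     by (simp add: power2_eq_square algebra_simps)
    also have "... = n * (c + j * (2 * x + 1) + n * j\<^sup>2)" unfolding c by (simp add: algebra_simps)
    finally have "l * n dvd (x + j * n)\<^sup>2 + (x + j * n) + k \<longleftrightarrow> l dvd c + j * (2 * x + 1) + n * j\<^sup>2"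
     using n(2) by (simp add: mult.commute[of l])
    also have "... \<longleftrightarrow> l dvd c + j * (2 * x + 1)" using n(1) by (intro dvd_add_left_iff dvd_mult2)
    finally show ?thesis by (simp add: mod_eq_0_iff_dvd)
   qed
   thus ?thesis by auto
  qed
  moreover have "bij_betw (%j. (c + j * (2 * x + 1)) mod l) {j\<in>{..<l}. (c + j * (2 * x + 1)) mod l = 0} {0}"
   using bij_betw_preimage[OF coprime_residue_bij[OF cop l0, of c], of "{0}"] l0 by simp
  ultimately show ?thesis using bij_betw_same_card by fastforce
 qed
 thus ?thesis using quad_roots_mult[OF l0 n(2), of k] by simp
qed

lemma quad_roots_1 [simp]: "quad_roots k 1 = {0}"
 by (auto simp: quad_roots_def)

lemma quad_roots_prime_power:
 assumes l: "prime l" "l ~= p" and e: "e > 0"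
 shows "card (quad_roots k (l ^ e)) = card (quad_roots k l)"
 using e
proof (induction e)
 case (Suc e)
 show ?case
 proof (cases "e = 0")
  case False
  have "card (quad_roots k (l * l ^ e)) = card (quad_roots k (l ^ e))"
   by (rule quad_roots_lift[OF l]) (use False l in \<open>auto simp: prime_gt_0_nat\<close>)
  thus ?thesis using Suc False by simp
 qed simp
qed auto

text \<open>Gauss's lemma for 2: among the doubles of 1, ..., 2k - 1 those beyond (p - 1)/2 are 2i
  with k \<le> i < 2k, exactly k of them.\<close>

lemma Legendre_2_cong: "Legendre 2 (int p) = (- 1) ^ k"
proof -
 have p2: "p > 2" using p prime_ge_2_nat[of p] by (cases "p = 2") auto
 interpret GAUSS p 2
  by unfold_locales (use p p2 in \<open>auto simp: cong_0_iff dest: zdvd_imp_le\<close>)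
 have h: "(int p - 1) div 2 = 2 * int k - 1" using k by linarith
 have "E = {y. int k * 2 \<le> y & y < int p & even y}"
 proof -
  have C: "C = {y. 0 < y & y < int p & even y}"
  proof (intro equalityI subsetI)
   fix y assume "y \<in> C"
   then obtain x where x: "0 < x" "x \<le> 2 * int k - 1" "y = (x * 2) mod int p"
    by (auto simp: C_def B_def A_def h)
   have "x * 2 < int p" using x(2) k by linarith
   thus "y \<in> {y. 0 < y & y < int p & even y}" using x by simp
  next
   fix y assume "y \<in> {y. 0 < y & y < int p & even y}"
   then obtain x where x: "y = x * 2" "0 < y" "y < int p" by (auto elim!: evenE simp: mult.commute)
   have "x \<in> A" using x k by (auto simp: A_def h)
   moreover have "y = (x * 2) mod int p" using x by simp
   ultimately show "y \<in> C" by (auto simp: C_def B_def)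
  qed
  show ?thesis unfolding E_def C h using k by auto
 qed
 also have "... = (%i. 2 * i) ` {int k..<2 * int k}"
  using k by (auto elim!: evenE simp: image_iff)
 finally have "card E = k" by (simp add: card_image inj_on_def)
 thus ?thesis using gauss_lemma by simp
qed

lemma Legendre_neg_one: "\<not> p dvd a ==> Legendre (- int a) (int p) = - Legendre (int a) (int p)"
proof -
 assume a: "\<not> p dvd a"
 have p2: "p > 2" using p prime_ge_2_nat[of p] by (cases "p = 2") auto
 have o: "odd ((p - 1) div 2)" using p(2) by presburger
 have "[Legendre (- int a) (int p) = (- int a) ^ ((p - 1) div 2)] (mod int p)" using euler_criterion p p2 by blast
 also have "(- int a) ^ ((p - 1) div 2) = - (int a ^ ((p - 1) div 2))" using o by simp
 also have "[- (int a ^ ((p - 1) div 2)) = - Legendre (int a) (int p)] (mod int p)"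
  using euler_criterion[OF p(1) p2, of "int a"] by (simp add: cong_minus_minus_iff cong_sym)
 finally have c: "[Legendre (- int a) (int p) = - Legendre (int a) (int p)] (mod int p)" .
 hence "int p dvd Legendre (- int a) (int p) + Legendre (int a) (int p)" by (simp add: cong_iff_dvd_diff)
 moreover have "\<bar>Legendre (- int a) (int p) + Legendre (int a) (int p)\<bar> \<le> 2"
  using abs_Legendre_le_1[of "- int a" "int p"] abs_Legendre_le_1[of "int a" "int p"] by linarith
 ultimately have "Legendre (- int a) (int p) + Legendre (int a) (int p) = 0"
  using p2 dvd_imp_le_int[of "Legendre (- int a) (int p) + Legendre (int a) (int p)" "int p"] by linarith
 thus ?thesis by simp
qed

text \<open>Roots correspond to square roots of -p modulo l, and reciprocity with p = 3 mod 4 turns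
  (-p/l) into (l/p). For l = 2, where completing the square fails, the parity of k decides.\<close>

lemma quad_roots_prime_card:
 assumes l: "prime l" "l ~= p"
 shows "int (card (quad_roots k l)) = 1 + Legendre (int l) (int p)"
proof (cases "l = 2")
 case True
 have "quad_roots k 2 = (if even k then {0, 1} else {})"
 proof -
  have "quad_roots k 2 = {x \<in> {0, 1}. even (x\<^sup>2 + x + k)}" by (auto simp: quad_roots_def)
  thus ?thesis by auto
 qed
 thus ?thesis using True Legendre_2_cong by (auto simp: minus_one_power_iff)
next
 case False
 have l2: "l > 2" using l False prime_ge_2_nat[of l] by linarith
 have ol: "odd l" using l False by (metis primes_dvd_imp_eq two_is_prime_nat)
 have p2: "p > 2" using p prime_ge_2_nat[of p] by (cases "p = 2") auto
 have npl: "\<not> p dvd l" using l p by (metis primes_dvd_imp_eq)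
 have nlp: "\<not> l dvd p" using l p by (metis primes_dvd_imp_eq)
 have crit: "x \<in> quad_roots k l \<longleftrightarrow> [(2 * int x + 1)\<^sup>2 = - int p] (mod int l)" if "x < l" for x
 proof -
  have "x \<in> quad_roots k l \<longleftrightarrow> l dvd x\<^sup>2 + x + k" using that by (simp add: quad_roots_def)
  also have "... \<longleftrightarrow> l dvd 4 * (x\<^sup>2 + x + k)"
  proof -
   have "coprime l 4" using ol coprime_power_right_iff[of l 2 2] by simp
   from coprime_dvd_mult_right_iff[OF this, of "x\<^sup>2 + x + k"] show ?thesis by blast
  qed
  also have "... \<longleftrightarrow> int l dvd int ((2 * x + 1)\<^sup>2 + p)" unfolding quad_disc by (simp only: int_dvd_int_iff)
  also have "... \<longleftrightarrow> [(2 * int x + 1)\<^sup>2 = - int p] (mod int l)" by (simp add: cong_iff_dvd_diff add.commute)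
  finally show ?thesis .
 qed
 have rec: "Legendre (- int p) (int l) = Legendre (int l) (int p)"
 proof -
  have qr: "Legendre (int p) (int l) * Legendre (int l) (int p) = (-1) ^ ((p - 1) div 2 * ((l - 1) div 2))"
   using Quadratic_Reciprocity[of p l] l p l2 p2 by auto
  have op: "odd ((p - 1) div 2)" using p(2) by presburger
  have "[Legendre (- int p) (int l) = (- int p) ^ ((l - 1) div 2)] (mod int l)" using euler_criterion l l2 by blast
  also have "(- int p) ^ ((l - 1) div 2) = (-1) ^ ((l - 1) div 2) * int p ^ ((l - 1) div 2)"
   by (simp add: power_minus[of "int p"])
  also have "[(-1) ^ ((l - 1) div 2) * int p ^ ((l - 1) div 2) = (-1) ^ ((l - 1) div 2) * Legendre (int p) (int l)] (mod int l)"
   using euler_criterion[OF l(1) l2, of "int p"] by (intro cong_mult cong_refl) (simp add: cong_sym)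
  also have "(-1) ^ ((l - 1) div 2) * Legendre (int p) (int l) = Legendre (int l) (int p)"
  proof -
   have "Legendre (int p) (int l) * Legendre (int p) (int l) = 1"
    using nlp by (simp add: Legendre_mult_self cong_0_iff)
   moreover have "(-1 :: int) ^ ((p - 1) div 2 * ((l - 1) div 2)) = (-1) ^ ((l - 1) div 2)"
    by (simp only: power_mult minus_one_power_iff op if_False)
   ultimately have "(-1) ^ ((l - 1) div 2) = Legendre (int p) (int l) * Legendre (int l) (int p)"
    and "Legendre (int p) (int l) * Legendre (int p) (int l) = 1" using qr by simp_all
   thus ?thesis by (simp add: mult.assoc mult.left_commute)
  qed
  finally have "int l dvd Legendre (- int p) (int l) - Legendre (int l) (int p)" by (simp add: cong_iff_dvd_diff)
  moreover have "\<bar>Legendre (- int p) (int l) - Legendre (int l) (int p)\<bar> \<le> 2"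
   using abs_Legendre_le_1[of "- int p" "int l"] abs_Legendre_le_1[of "int l" "int p"] by linarith
  ultimately show ?thesis
   using l2 dvd_imp_le_int[of "Legendre (- int p) (int l) - Legendre (int l) (int p)" "int l"] by linarith
 qed
 have neq: "\<not> [- int p = 0] (mod int l)" using nlp by (simp add: cong_0_iff)
 show ?thesis
 proof (cases "QuadRes (int l) (- int p)")
  case False
  have "quad_roots k l = {}"
  proof (rule ccontr)
   assume "quad_roots k l ~= {}"
   then obtain x where x: "x \<in> quad_roots k l" by blast
   hence "[(2 * int x + 1)\<^sup>2 = - int p] (mod int l)" using crit by (auto simp: quad_roots_def)
   thus False using False by (auto simp: QuadRes_def)
  qed
  moreover have "Legendre (- int p) (int l) = - 1" using neq False by (simp add: Legendre_def)
  ultimately show ?thesis using rec by simp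
 next
  case True
  then obtain y0 where y0: "[y0\<^sup>2 = - int p] (mod int l)" by (auto simp: QuadRes_def)
  have bij: "bij_betw (%x. (1 + x * 2) mod l) {..<l} {..<l}"
   by (rule coprime_residue_bij) (use ol l in \<open>auto simp: prime_gt_0_nat\<close>)
  define a where "a = nat (y0 mod int l)"
  define b where "b = nat ((- y0) mod int l)"
  have l0: "l > 0" using l2 by simp
  have ab: "a < l" "b < l" "int a = y0 mod int l" "int b = (- y0) mod int l" using l0 by (auto simp: a_def b_def nat_less_iff)
  have anb: "a ~= b"
  proof
   assume "a = b"
   hence "[y0 = - y0] (mod int l)" using ab by (simp add: cong_def)
   hence "int l dvd 2 * y0" by (simp add: cong_iff_dvd_diff)
   hence "int l dvd y0" using ol by (simp add: coprime_dvd_mult_right_iff)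
   hence "int l dvd y0\<^sup>2" by (simp add: power2_eq_square)
   hence "[y0\<^sup>2 = 0] (mod int l)" by (simp only: cong_0_iff)
   hence "[- int p = 0] (mod int l)" using y0 cong_trans cong_sym by blast
   thus False using neq by simp
  qed
  have "x \<in> quad_roots k l \<longleftrightarrow> (1 + x * 2) mod l \<in> {a, b}" if "x < l" for x
  proof -
   have "x \<in> quad_roots k l \<longleftrightarrow> [(2 * int x + 1)\<^sup>2 = y0\<^sup>2] (mod int l)"
    unfolding crit[OF that] using y0 cong_trans cong_sym by blast
   also have "... \<longleftrightarrow> int l dvd (2 * int x + 1 - y0) * (2 * int x + 1 + y0)"
    by (simp add: cong_iff_dvd_diff power2_eq_square algebra_simps)
   also have "... \<longleftrightarrow> int l dvd (2 * int x + 1 - y0) \<or> int l dvd (2 * int x + 1 + y0)"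
    using l(1) by (simp add: prime_dvd_mult_iff)
   also have "... \<longleftrightarrow> (2 * int x + 1) mod int l = y0 mod int l \<or> (2 * int x + 1) mod int l = (- y0) mod int l"
    by (simp add: mod_eq_dvd_iff)
   also have "... \<longleftrightarrow> int ((1 + x * 2) mod l) = int a \<or> int ((1 + x * 2) mod l) = int b"
    unfolding ab by (simp add: of_nat_mod algebra_simps)
   finally show ?thesis by auto
  qed
  hence "quad_roots k l = {x\<in>{..<l}. (1 + x * 2) mod l \<in> {a, b}}" by (auto simp: quad_roots_def)
  moreover have "bij_betw (%x. (1 + x * 2) mod l) {x\<in>{..<l}. (1 + x * 2) mod l \<in> {a, b}} {a, b}"
   by (rule bij_betw_preimage[OF bij]) (use ab(1,2) in simp)
  ultimately have "card (quad_roots k l) = card {a, b}" using bij_betw_same_card by fastforce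
  hence "card (quad_roots k l) = 2" using anb by simp
  moreover have "Legendre (- int p) (int l) = 1" using neq True by (simp add: Legendre_def)
  ultimately show ?thesis using rec by simp
 qed
qed

lemma quad_roots_p: "card (quad_roots k p) = 1"
proof -
 have p2: "p > 2" using p prime_ge_2_nat[of p] by (cases "p = 2") auto
 have op: "odd p" using p(2) by presburger
 have c4: "coprime p 4" using op coprime_power_right_iff[of p 2 2] by simp
 have "x \<in> quad_roots k p \<longleftrightarrow> x = (p - 1) div 2" if "x < p" for x
 proof -
  have "x \<in> quad_roots k p \<longleftrightarrow> p dvd 4 * (x\<^sup>2 + x + k)" using that coprime_dvd_mult_right_iff[OF c4, of "x\<^sup>2 + x + k"] by (auto simp only: quad_roots_def mem_Collect_eq)
  also have "... \<longleftrightarrow> p dvd (2 * x + 1)\<^sup>2" unfolding quad_disc by (simp add: dvd_add_left_iff)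
  also have "... \<longleftrightarrow> p dvd 2 * x + 1" using p(1) by (simp add: prime_dvd_power_iff)
  also have "... \<longleftrightarrow> 2 * x + 1 = p"
  proof
   assume "p dvd 2 * x + 1"
   then obtain c where c: "2 * x + 1 = p * c" by blast
   have "p * c < p * 2" using c that by linarith
   hence "c < 2" by (rule mult_less_cancel1[THEN iffD1, THEN conjunct2])
   hence "c = 0 \<or> c = 1" by linarith
   thus "2 * x + 1 = p" using c by auto
  qed auto
  also have "... \<longleftrightarrow> x = (p - 1) div 2" using op by presburger
  finally show ?thesis .
 qed
 hence "quad_roots k p = {(p - 1) div 2}" using p2 by (auto simp: quad_roots_def)
 thus ?thesis by simp
qed

text \<open>The ramified prime: if p^2 divided 4 (x^2 + x + k) = (2x + 1)^2 + p, then p would divide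
  2x + 1, and so p^2 would divide p.\<close>

lemma quad_roots_p_square: "p\<^sup>2 dvd m ==> quad_roots k m = {}"
proof (rule ccontr)
 assume m: "p\<^sup>2 dvd m" and "quad_roots k m ~= {}"
 then obtain x where "m dvd x\<^sup>2 + x + k" by (auto simp: quad_roots_def)
 hence d: "p\<^sup>2 dvd 4 * (x\<^sup>2 + x + k)" using m by (meson dvd_mult dvd_trans)
 have "p dvd p\<^sup>2" by (simp add: power2_eq_square)
 hence "p dvd (2 * x + 1)\<^sup>2 + p" using d unfolding quad_disc by (rule dvd_trans)
 hence "p dvd 2 * x + 1" using p(1) by (simp add: dvd_add_left_iff prime_dvd_power_iff)
 hence "p\<^sup>2 dvd (2 * x + 1)\<^sup>2" by (simp add: dvd_power_same)
 hence "p\<^sup>2 dvd p" using d unfolding quad_disc by (simp add: dvd_add_right_iff)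
 hence "p * p \<le> p" using p(1) by (auto dest!: dvd_imp_le simp: power2_eq_square prime_gt_0_nat)
 thus False using prime_gt_1_nat[OF p(1)] by simp
qed

end

section \<open>Theta series of positive definite binary quadratic forms\<close>

text \<open>Pairs are ordered (y, x) so that x is the inner variable, with y fixed, when a sum over
  pairs is iterated.\<close>

definition bqf :: "int => int => int => int \<times> int => int" where
 "bqf A B C = (%(y, x). A * x\<^sup>2 + B * x * y + C * y\<^sup>2)"

abbreviation (input) alt_theta :: "int => int => int => real => real" where
 "alt_theta A B C t \<equiv> \<Sum>\<^sub>\<infinity>(y, x)\<in>UNIV. alt x * exp (- t * real_of_int (bqf A B C (y, x)))"

lemma bqf_complete: "4 * A * bqf A B C (y, x) = (2 * A * x + B * y)\<^sup>2 + (4 * A * C - B\<^sup>2) * y\<^sup>2"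
 by (simp add: bqf_def power2_eq_square algebra_simps)

context
 fixes A B C :: int
 assumes A: "A > 0" and D: "4 * A * C - B\<^sup>2 > 0"
begin

lemma bqf_nonneg: "bqf A B C z \<ge> 0"
proof -
 obtain y x where z: "z = (y, x)" by (cases z)
 have "0 \<le> (4 * A * C - B\<^sup>2) * y\<^sup>2" using D by (intro mult_nonneg_nonneg) auto
 hence "0 \<le> 4 * A * bqf A B C (y, x)" unfolding bqf_complete by (intro add_nonneg_nonneg) auto
 thus ?thesis unfolding z using A by (simp add: zero_le_mult_iff)
qed

lemma bqf_C_pos: "C > 0"
proof -
 have "0 < 4 * A * C" using D zero_le_power2[of B] by linarith
 thus ?thesis using A by (simp add: zero_less_mult_iff)
qed

lemma bqf_gauss_form: "t * real_of_int (bqf A B C (y, x))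
 = (t * real_of_int A) * (real_of_int x + real_of_int B / (2 * real_of_int A) * real_of_int y)\<^sup>2
  + t * (real_of_int (4 * A * C - B\<^sup>2) / (4 * real_of_int A)) * (real_of_int y)\<^sup>2"
proof -
 have "a * u\<^sup>2 + b * u * v + c * v\<^sup>2 = a * (u + b / (2 * a) * v)\<^sup>2 + (4 * a * c - b\<^sup>2) / (4 * a) * v\<^sup>2"
  if "a ~= 0" for a b c u v :: real using that by (simp add: field_simps power2_eq_square)
 from this[of "real_of_int A"] A have "real_of_int (bqf A B C (y, x))
  = real_of_int A * (real_of_int x + real_of_int B / (2 * real_of_int A) * real_of_int y)\<^sup>2
  + real_of_int (4 * A * C - B\<^sup>2) / (4 * real_of_int A) * (real_of_int y)\<^sup>2"
  by (simp add: bqf_def)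
 thus ?thesis by (simp only: distrib_left mult.assoc)
qed

lemma bqf_small_parameter:
 obtains t0 :: real where "t0 > 0" "!!t. 0 < t ==> t \<le> t0 ==> 0 < t * real_of_int A & t * real_of_int A \<le> 1 &
  0 < t * (real_of_int (4 * A * C - B\<^sup>2) / (4 * real_of_int A)) & t * (real_of_int (4 * A * C - B\<^sup>2) / (4 * real_of_int A)) \<le> 1"
proof -
 define g where "g = real_of_int (4 * A * C - B\<^sup>2) / (4 * real_of_int A)"
 have D': "real_of_int (4 * A * C - B\<^sup>2) > 0" using D by (simp only: of_int_0_less_iff)
 have g: "g > 0" unfolding g_def using D' A by simp
 have A': "real_of_int A > 0" using A by simp
 define t0 where "t0 = min (1 / real_of_int A) (1 / g)"
 show thesis
 proof (rule that[of t0])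
  show "t0 > 0" using g A' by (simp add: t0_def)
  fix t assume t: "0 < t" "t \<le> t0"
  hence "t \<le> 1 / real_of_int A" "t \<le> 1 / g" by (simp_all add: t0_def)
  hence "t * real_of_int A \<le> 1" "t * g \<le> 1" using A' g by (simp_all add: pos_le_divide_eq)
  moreover have "0 < t * real_of_int A" "0 < t * g" using t A' g by simp_all
  ultimately show "0 < t * real_of_int A & t * real_of_int A \<le> 1 &
   0 < t * (real_of_int (4 * A * C - B\<^sup>2) / (4 * real_of_int A)) & t * (real_of_int (4 * A * C - B\<^sup>2) / (4 * real_of_int A)) \<le> 1"
   unfolding g_def by (intro conjI)
 qed
qed

text \<open>The Gaussian bounds cover small parameters only; for larger t the terms are smaller
  because the form is nonnegative.\<close>

lemma bqf_gauss_summable: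
 assumes t: "t > 0"
 shows "(%z. exp (- t * real_of_int (bqf A B C z))) summable_on UNIV"
proof -
 obtain t0 :: real where t0: "t0 > 0" "!!t. 0 < t ==> t \<le> t0 ==> 0 < t * real_of_int A & t * real_of_int A \<le> 1 &
  0 < t * (real_of_int (4 * A * C - B\<^sup>2) / (4 * real_of_int A)) & t * (real_of_int (4 * A * C - B\<^sup>2) / (4 * real_of_int A)) \<le> 1"
  using bqf_small_parameter by blast
 define s where "s = min t t0"
 have s: "0 < s" "s \<le> t0" "s \<le> t" using t t0 by (simp_all add: s_def)
 have "(%(y, x). exp (- ((s * real_of_int A) * (real_of_int x + real_of_int B / (2 * real_of_int A) * real_of_int y)\<^sup>2
   + s * (real_of_int (4 * A * C - B\<^sup>2) / (4 * real_of_int A)) * (real_of_int y)\<^sup>2))) summable_on UNIV"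
  using t0(2)[OF s(1,2)] by (intro form_gauss_summable) auto
 hence "(%(y, x). exp (- (s * real_of_int (bqf A B C (y, x))))) summable_on UNIV"
  by (simp only: bqf_gauss_form)
 hence "(%z. exp (- (s * real_of_int (bqf A B C z)))) summable_on UNIV"
  by (simp add: case_prod_unfold)
 thus ?thesis
  by (rule summable_on_comparison_test) (use s bqf_nonneg in \<open>auto intro!: mult_right_mono\<close>)
qed

lemma bqf_alternating_limit:
 "((%t. \<Sum>\<^sub>\<infinity>(y, x)\<in>UNIV. alt x * exp (- t * real_of_int (bqf A B C (y, x)))) \<longlongrightarrow> 0) (at_right 0)"
proof -
 obtain t0 :: real where t0: "t0 > 0" "!!t. 0 < t ==> t \<le> t0 ==> 0 < t * real_of_int A & t * real_of_int A \<le> 1 &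
  0 < t * (real_of_int (4 * A * C - B\<^sup>2) / (4 * real_of_int A)) & t * (real_of_int (4 * A * C - B\<^sup>2) / (4 * real_of_int A)) \<le> 1"
  using bqf_small_parameter by blast
 define g where "g = real_of_int (4 * A * C - B\<^sup>2) / (4 * real_of_int A)"
 have bound: "\<bar>\<Sum>\<^sub>\<infinity>(y, x)\<in>UNIV. alt x * exp (- t * real_of_int (bqf A B C (y, x)))\<bar> \<le> 2400 * real_of_int A / sqrt g * sqrt t"
  if t: "0 < t" "t \<le> t0" for t
 proof -
  have e: "- t * real_of_int (bqf A B C (y, x)) = - ((t * real_of_int A) * (real_of_int x + real_of_int B / (2 * real_of_int A) * real_of_int y)\<^sup>2
   + (t * g) * (real_of_int y)\<^sup>2)" for y x
   using bqf_gauss_form[of t y x] by (simp only: g_def minus_mult_left)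
  have "\<bar>\<Sum>\<^sub>\<infinity>(y, x)\<in>UNIV. alt x * exp (- t * real_of_int (bqf A B C (y, x)))\<bar> \<le> 2400 * (t * real_of_int A) / sqrt (t * g)"
   unfolding e by (rule form_alternating_gauss_bound) (use t0(2)[OF t] in \<open>simp_all only: g_def\<close>)
  also have "2400 * (t * real_of_int A) / sqrt (t * g) = 2400 * real_of_int A / sqrt g * (t / sqrt t)"
   by (simp add: real_sqrt_mult mult_ac)
  also have "t / sqrt t = sqrt t" using t by (simp add: real_div_sqrt)
  finally show ?thesis .
 qed
 show ?thesis
 proof (rule Lim_null_comparison)
  show "\<forall>\<^sub>F t in at_right 0. norm (alt_theta A B C t) \<le> 2400 * real_of_int A / sqrt g * sqrt t"
   unfolding real_norm_def
   by (rule eventually_mono[OF eventually_at_right_real[OF t0(1)]]) (rule bound, simp_all)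
  have "((%t. 2400 * real_of_int A / sqrt g * sqrt t) \<longlongrightarrow> 2400 * real_of_int A / sqrt g * sqrt 0) (at_right 0)"
   by (intro tendsto_intros)
  thus "((%t. 2400 * real_of_int A / sqrt g * sqrt t) \<longlongrightarrow> 0) (at_right 0)" by simp
 qed
qed

lemma finite_bqf_level: "finite {z. bqf A B C z = n}"
proof -
 define N where "N = 4 * (A + C) * n"
 have "{z. bqf A B C z = n} \<subseteq> {- N..N} \<times> {- N..N}"
 proof
  fix z assume "z \<in> {z. bqf A B C z = n}"
  moreover obtain y x where z: "z = (y, x)" by (cases z)
  ultimately have n: "bqf A B C (y, x) = n" by simp
  have sq: "\<bar>v\<bar> \<le> v\<^sup>2" for v :: int
  proof -
   have "\<bar>v\<bar> * 1 \<le> \<bar>v\<bar> * \<bar>v\<bar>" by (cases "v = 0") (simp, intro mult_left_mono, simp_all)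
   thus ?thesis by (simp add: power2_eq_square)
  qed
  have n0: "n \<ge> 0" using bqf_nonneg[of "(y, x)"] n by simp
  have Cp: "C > 0" by (rule bqf_C_pos)
  have step: "\<bar>v\<bar> \<le> N" if "4 * E * n = u\<^sup>2 + (4 * A * C - B\<^sup>2) * v\<^sup>2" "E \<le> A + C" for E u v
  proof -
   have "\<bar>v\<bar> \<le> 1 * v\<^sup>2" using sq by simp
   also have "... \<le> (4 * A * C - B\<^sup>2) * v\<^sup>2" using D by (intro mult_right_mono) auto
   also have "... \<le> 4 * E * n" unfolding that(1) by simp
   also have "... \<le> N" unfolding N_def using that(2) n0 by (intro mult_right_mono) auto
   finally show ?thesis .
  qed
  have "\<bar>y\<bar> \<le> N" by (rule step[of A "2 * A * x + B * y"]) (use bqf_complete[of A B C y x] n Cp in auto)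
  moreover have "\<bar>x\<bar> \<le> N"
   by (rule step[of C "2 * C * y + B * x"]) (use n A in \<open>auto simp: bqf_def power2_eq_square algebra_simps\<close>)
  ultimately show "z \<in> {- N..N} \<times> {- N..N}" unfolding z by auto
 qed
 thus ?thesis by (rule finite_subset) simp
qed

text \<open>The theta series at t = -ln x, grouped by the values of the form; the level sets are
  finite, so the coefficients are cardinalities.\<close>

lemma bqf_count_sums:
 assumes x: "0 < x" "x < 1"
 shows "(%n. real (card {z. bqf A B C z = int n}) * x ^ n) sums (\<Sum>\<^sub>\<infinity>z. exp (ln x * real_of_int (bqf A B C z)))"
proof -
 define L where "L = (%n. {z. bqf A B C z = int n})"
 have ex: "exp (ln x * real_of_int (bqf A B C z)) = x ^ n" if "z \<in> L n" for n z
  using that x by (simp add: L_def exp_of_nat2_mult)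
 have bij: "bij_betw snd (SIGMA n:UNIV. L n) UNIV"
  by (rule bij_betw_byWitness[of _ "%z. (nat (bqf A B C z), z)"]) (auto simp: L_def bqf_nonneg)
 have "(%z. exp (ln x * real_of_int (bqf A B C z))) summable_on UNIV"
  using bqf_gauss_summable[of "- ln x"] x by simp
 hence "(%w. exp (ln x * real_of_int (bqf A B C (snd w)))) summable_on (SIGMA n:UNIV. L n)"
  using summable_on_reindex_bij_betw[OF bij, of "%z. exp (ln x * real_of_int (bqf A B C z))"] by simp
 hence sm: "(%(n, z). exp (ln x * real_of_int (bqf A B C z))) summable_on (SIGMA n:UNIV. L n)"
  by (simp add: case_prod_unfold)
 have inner: "(\<Sum>\<^sub>\<infinity>z\<in>L n. exp (ln x * real_of_int (bqf A B C z))) = real (card (L n)) * x ^ n" for n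
 proof -
  have "(\<Sum>\<^sub>\<infinity>z\<in>L n. exp (ln x * real_of_int (bqf A B C z))) = (\<Sum>\<^sub>\<infinity>z\<in>L n. x ^ n)"
   by (rule infsum_cong) (rule ex)
  also have "... = real (card (L n)) * x ^ n"
   by (rule infsum_constant) (simp add: L_def finite_bqf_level)
  finally show ?thesis .
 qed
 have "(\<Sum>\<^sub>\<infinity>z. exp (ln x * real_of_int (bqf A B C z))) = (\<Sum>\<^sub>\<infinity>w\<in>(SIGMA n:UNIV. L n). exp (ln x * real_of_int (bqf A B C (snd w))))"
  by (rule infsum_reindex_bij_betw[OF bij, symmetric])
 also have "... = (\<Sum>\<^sub>\<infinity>(n, z)\<in>(SIGMA n:UNIV. L n). exp (ln x * real_of_int (bqf A B C z)))"
  by (simp add: case_prod_unfold)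
 also have "... = (\<Sum>\<^sub>\<infinity>n. real (card (L n)) * x ^ n)"
  unfolding infsum_Sigma'_banach[OF sm, symmetric] inner ..
 finally have e: "(\<Sum>\<^sub>\<infinity>z. exp (ln x * real_of_int (bqf A B C z))) = (\<Sum>\<^sub>\<infinity>n. real (card (L n)) * x ^ n)" .
 have "(%n. real (card (L n)) * x ^ n) summable_on UNIV"
  using summable_on_Sigma_banach[OF sm] unfolding inner .
 thus ?thesis unfolding e unfolding L_def by (intro has_sum_imp_sums has_sum_infsum)
qed

end

text \<open>Orthogonality on (Z/2)^2: the four characters add up to 4 times the indicator of the
  even pairs, so subtracting that indicator four times from the trivial character leaves minus the
  three others.\<close>

lemma alt_add: "alt (x + y) = alt x * alt y" and alt_even_combination:
 "1 - 4 * of_bool (even x & even y) = - (alt x + alt y + alt (x + y))"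
 by (auto simp: alt_def)

context
 fixes A B C :: int
 assumes A: "A > 0" and D: "4 * A * C - B\<^sup>2 > 0"
begin

text \<open>Replacing t by 4 t restricts the sum to pairs of even numbers. Each nontrivial character
  of (Z/2)^2 becomes the sign of x after a substitution: none, the exchange of x and y, or the shear
  x -> x - y. The coefficients of the three forms record these substitutions.\<close>

lemma bqf_theta_combination:
 fixes t :: real
 assumes t: "t > 0"
 shows "(\<Sum>\<^sub>\<infinity>z. exp (- t * real_of_int (bqf A B C z))) - 4 * (\<Sum>\<^sub>\<infinity>z. exp (- (4 * t) * real_of_int (bqf A B C z)))
  = - ((alt_theta A B C t)
   + (alt_theta C B A t)
   + (alt_theta A (B - 2 * A) (A - B + C) t))"
proof -
 define E where "E = (%z. exp (- t * real_of_int (bqf A B C z)))"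
 have E: "E summable_on UNIV" unfolding E_def by (rule bqf_gauss_summable[OF A D t])
 have sm: "(%z. f z * E z) summable_on UNIV" if "!!z. \<bar>f z\<bar> \<le> 1" for f :: "int \<times> int => real"
 proof (rule abs_summable_summable, rule summable_on_comparison_test[OF E])
  fix z
  have "\<bar>f z\<bar> * E z \<le> 1 * E z" by (rule mult_right_mono[OF that]) (simp add: E_def)
  thus "norm (f z * E z) \<le> E z" by (simp add: abs_mult E_def)
 qed simp
 define e :: "int \<times> int => real" where "e = (%(y, x). of_bool (even x & even y))"
 define f1 f2 f3 :: "int \<times> int => real" where "f1 = (%(y, x). alt x)" and "f2 = (%(y, x). alt y)" and "f3 = (%(y, x). alt (x + y))"
 have "(\<Sum>\<^sub>\<infinity>z. exp (- (4 * t) * real_of_int (bqf A B C z))) = (\<Sum>\<^sub>\<infinity>z. E (2 * fst z, 2 * snd z))"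
  by (rule infsum_cong) (simp add: E_def bqf_def case_prod_unfold power2_eq_square algebra_simps)
 also have "... = infsum E {(y, x). even x & even y}"
  by (rule infsum_reindex_bij_betw, rule bij_betw_byWitness[of _ "%(y, x). (y div 2, x div 2)"]) auto
 also have "... = (\<Sum>\<^sub>\<infinity>z. e z * E z)"
  by (rule infsum_cong_neutral) (auto simp: e_def)
 finally have e4: "(\<Sum>\<^sub>\<infinity>z. exp (- (4 * t) * real_of_int (bqf A B C z))) = (\<Sum>\<^sub>\<infinity>z. e z * E z)" .
 have s2: "(alt_theta C B A t) = (\<Sum>\<^sub>\<infinity>z. f2 z * E z)"
 proof -
  have "bij_betw prod.swap UNIV (UNIV :: (int \<times> int) set)" by simp
  hence "(\<Sum>\<^sub>\<infinity>z. f2 z * E z) = (\<Sum>\<^sub>\<infinity>z. f2 (prod.swap z) * E (prod.swap z))"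
   by (rule infsum_reindex_bij_betw[symmetric])
  also have "... = (alt_theta C B A t)"
  proof (rule infsum_cong, clarsimp)
   fix y x :: int
   have "bqf A B C (x, y) = bqf C B A (y, x)" by (simp add: bqf_def mult_ac)
   thus "f2 (x, y) * E (x, y) = alt x * exp (- (t * real_of_int (bqf C B A (y, x))))"
    by (simp add: f2_def E_def)
  qed
  finally show ?thesis by simp
 qed
 have s3: "(alt_theta A (B - 2 * A) (A - B + C) t) = (\<Sum>\<^sub>\<infinity>z. f3 z * E z)"
 proof -
  have "bij_betw (%(y, x). (y, x - y)) UNIV (UNIV :: (int \<times> int) set)"
   by (rule bij_betw_byWitness[of _ "%(y, x). (y, x + y)"]) auto
  hence "(\<Sum>\<^sub>\<infinity>z. f3 z * E z) = (\<Sum>\<^sub>\<infinity>z. f3 (case z of (y, x) => (y, x - y)) * E (case z of (y, x) => (y, x - y)))"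
   by (rule infsum_reindex_bij_betw[symmetric])
  also have "... = (alt_theta A (B - 2 * A) (A - B + C) t)"
  proof (rule infsum_cong, clarsimp)
   fix y x :: int
   have "bqf A B C (y, x - y) = bqf A (B - 2 * A) (A - B + C) (y, x)"
    by (simp add: bqf_def power2_eq_square algebra_simps)
   thus "f3 (y, x - y) * E (y, x - y) = alt x * exp (- (t * real_of_int (bqf A (B - 2 * A) (A - B + C) (y, x))))"
    by (simp add: f3_def E_def)
  qed
  finally show ?thesis by simp
 qed
 have h: "((%z. f z * E z) has_sum (\<Sum>\<^sub>\<infinity>z. f z * E z)) UNIV" if "!!z. \<bar>f z\<bar> \<le> 1" for f
  using sm[OF that] by (rule has_sum_infsum)
 have "((%z. (- 1) * (f1 z * E z + f2 z * E z + f3 z * E z) + 4 * (e z * E z)) has_sum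
   ((- 1) * ((\<Sum>\<^sub>\<infinity>z. f1 z * E z) + (\<Sum>\<^sub>\<infinity>z. f2 z * E z) + (\<Sum>\<^sub>\<infinity>z. f3 z * E z)) + 4 * (\<Sum>\<^sub>\<infinity>z. e z * E z))) UNIV"
  by (intro has_sum_add has_sum_cmult_right h) (auto simp: f1_def f2_def f3_def e_def)
 moreover have "(%z. (- 1) * (f1 z * E z + f2 z * E z + f3 z * E z) + 4 * (e z * E z)) = E"
 proof
  fix z :: "int \<times> int"
  have "(- 1) * (f1 z * E z + f2 z * E z + f3 z * E z) + 4 * (e z * E z) = (- (f1 z + f2 z + f3 z) + 4 * e z) * E z"
   by (simp add: algebra_simps)
  also have "- (f1 z + f2 z + f3 z) + 4 * e z = 1"
   using alt_even_combination[of "snd z" "fst z"] by (simp add: f1_def f2_def f3_def e_def case_prod_unfold)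
  finally show "(- 1) * (f1 z * E z + f2 z * E z + f3 z * E z) + 4 * (e z * E z) = E z" by simp
 qed
 ultimately have "infsum E UNIV = (- 1) * ((\<Sum>\<^sub>\<infinity>z. f1 z * E z) + (\<Sum>\<^sub>\<infinity>z. f2 z * E z) + (\<Sum>\<^sub>\<infinity>z. f3 z * E z)) + 4 * (\<Sum>\<^sub>\<infinity>z. e z * E z)"
  by (intro infsumI) simp
 moreover have "(alt_theta A B C t) = (\<Sum>\<^sub>\<infinity>z. f1 z * E z)"
  by (simp add: f1_def E_def case_prod_unfold)
 moreover have "(\<Sum>\<^sub>\<infinity>z. exp (- t * real_of_int (bqf A B C z))) = infsum E UNIV" by (simp add: E_def)
 ultimately show ?thesis unfolding e4 s2 s3 by simp
qed

lemma bqf_theta_limit: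
 "((%t. (\<Sum>\<^sub>\<infinity>z. exp (- t * real_of_int (bqf A B C z))) - 4 * (\<Sum>\<^sub>\<infinity>z. exp (- (4 * t) * real_of_int (bqf A B C z)))) \<longlongrightarrow> 0) (at_right 0)"
proof -
 have D2: "4 * C * A - B\<^sup>2 > 0" using D by (simp add: mult_ac)
 have D3: "4 * A * (A - B + C) - (B - 2 * A)\<^sup>2 > 0" using D by (simp add: power2_eq_square algebra_simps)
 note l = tendsto_minus[OF tendsto_add[OF tendsto_add[OF bqf_alternating_limit[OF A D]
   bqf_alternating_limit[OF bqf_C_pos[OF A D] D2]] bqf_alternating_limit[OF A D3]]]
 show ?thesis
 proof (rule Lim_transform_eventually)
  show "((%t. - ((alt_theta A B C t)
   + (alt_theta C B A t)
   + (alt_theta A (B - 2 * A) (A - B + C) t))) \<longlongrightarrow> 0) (at_right 0)"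
   using l by (simp only: add_0 minus_zero)
 qed (rule eventually_at_rightI[of 0 1], simp_all only: greaterThanLessThan_iff bqf_theta_combination zero_less_one)
qed

lemma bqf_count_limit:
 defines "r \<equiv> %n. real (card {z. bqf A B C z = int n})"
 shows "((%x. (\<Sum>n. r n * x ^ n) - 4 * (\<Sum>n. r n * (x ^ 4) ^ n)) \<longlongrightarrow> 0) (at_left 1)"
proof -
 have f: "filterlim (%x::real. - ln x) (at_right 0) (at_left 1)"
 proof (rule filterlim_at[THEN iffD2], intro conjI)
  show "\<forall>\<^sub>F x in at_left 1. - ln x \<in> {0::real<..} & - ln x ~= 0"
   by (rule eventually_mono[OF eventually_at_left_real[of 0 "1 :: real"]]) auto
  show "((%x::real. - ln x) \<longlongrightarrow> 0) (at_left 1)" by (auto intro!: tendsto_eq_intros)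
 qed
 show ?thesis
 proof (rule Lim_transform_eventually[OF filterlim_compose[OF bqf_theta_limit f]])
  show "\<forall>\<^sub>F x in at_left 1. (\<Sum>\<^sub>\<infinity>z. exp (- (- ln x) * real_of_int (bqf A B C z))) -
     4 * (\<Sum>\<^sub>\<infinity>z. exp (- (4 * - ln x) * real_of_int (bqf A B C z))) = (\<Sum>n. r n * x ^ n) - 4 * (\<Sum>n. r n * (x ^ 4) ^ n)"
  proof (rule eventually_mono[OF eventually_at_left_real[of 0 "1 :: real"]])
   fix x :: real assume "x \<in> {0<..<1}"
   hence x: "0 < x" "x < 1" by auto
   have x4: "0 < x ^ 4" "x ^ 4 < 1" using x by (auto simp: power_less_one_iff)
   have "ln (x ^ 4) = 4 * ln x" using x by (simp add: ln_realpow)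
   thus "(\<Sum>\<^sub>\<infinity>z. exp (- (- ln x) * real_of_int (bqf A B C z))) -
     4 * (\<Sum>\<^sub>\<infinity>z. exp (- (4 * - ln x) * real_of_int (bqf A B C z))) = (\<Sum>n. r n * x ^ n) - 4 * (\<Sum>n. r n * (x ^ 4) ^ n)"
    unfolding r_def using sums_unique[OF bqf_count_sums[OF A D x]] sums_unique[OF bqf_count_sums[OF A D x4]] by simp
  qed simp
 qed
qed

end

section \<open>Multiplicativity and the number of ideals of given norm\<close>

text \<open>The summand may depend on n as well as on the divisor, because the summand of
  \<open>ideal_count\<close> involves the quotient of n by g^2.\<close>

lemma sum_divisors_coprime:
 fixes u :: "nat => nat => 'a::comm_semiring_0"
 assumes cop: "coprime a b" and pos: "a > 0" "b > 0"
  and u: "!!x y. x dvd a ==> y dvd b ==> u (a * b) (x * y) = u a x * u b y"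
 shows "(\<Sum>d | d dvd a * b. u (a * b) d) = (\<Sum>d | d dvd a. u a d) * (\<Sum>d | d dvd b. u b d)"
proof -
 have g: "gcd (x * y) a = x" "gcd (x * y) b = y" if xy: "x dvd a" "y dvd b" for x y
 proof -
  have "coprime y a" "coprime x b" using cop xy by (meson coprime_commute coprime_divisors dvd_refl)+
  hence "gcd (x * y) a = gcd x a" "gcd (x * y) b = gcd y b"
   by (simp_all add: gcd_mult_right_right_cancel gcd_mult_left_right_cancel gcd_mult_left_left_cancel coprime_commute)
  thus "gcd (x * y) a = x" "gcd (x * y) b = y" using xy by (simp_all add: gcd_nat.absorb1)
 qed
 have "bij_betw (%(x, y). x * y) ({d. d dvd a} \<times> {d. d dvd b}) {d. d dvd a * b}"
 proof (rule bij_betw_byWitness[of _ "%d. (gcd d a, gcd d b)"])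
  show "\<forall>d\<in>{d. d dvd a * b}. (case (gcd d a, gcd d b) of (x, y) => x * y) = d"
  proof
   fix d assume "d \<in> {d. d dvd a * b}"
   then obtain x y where "d = x * y" "x dvd a" "y dvd b" using division_decomp by blast
   thus "(case (gcd d a, gcd d b) of (x, y) => x * y) = d" using g by simp
  qed
  show "\<forall>z\<in>{d. d dvd a} \<times> {d. d dvd b}. (gcd (case z of (x, y) => x * y) a, gcd (case z of (x, y) => x * y) b) = z"
   using g by auto
 qed (auto intro: mult_dvd_mono)
 hence "(\<Sum>d | d dvd a * b. u (a * b) d) = (\<Sum>z\<in>{d. d dvd a} \<times> {d. d dvd b}. u (a * b) (case z of (x, y) => x * y))"
  by (rule sum.reindex_bij_betw[symmetric])
 also have "... = (\<Sum>(x, y)\<in>{d. d dvd a} \<times> {d. d dvd b}. u a x * u b y)"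
  by (rule sum.cong) (auto simp: u)
 also have "... = (\<Sum>d | d dvd a. u a d) * (\<Sum>d | d dvd b. u b d)"
  by (simp add: sum_product sum.cartesian_product)
 finally show ?thesis .
qed

lemma sum_divisors_prime_power:
 fixes f :: "nat => 'a::comm_monoid_add"
 assumes "prime (l :: nat)"
 shows "(\<Sum>d | d dvd l ^ e. f d) = (\<Sum>i\<le>e. f (l ^ i))"
proof -
 have "{d. d dvd l ^ e} = (%i. l ^ i) ` {..e}" using divides_primepow_nat[OF assms] by auto
 moreover have "inj_on (%i. l ^ i) {..e}" using prime_gt_1_nat[OF assms] by (auto intro!: inj_onI)
 ultimately show ?thesis by (simp add: sum.reindex)
qed

lemma Legendre_mult:
 assumes "prime p" "p > 2"
 shows "Legendre (a * b) (int p) = Legendre a (int p) * Legendre b (int p)"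
proof -
 have "[Legendre (a * b) (int p) = (a * b) ^ ((p - 1) div 2)] (mod int p)" using euler_criterion assms by blast
 also have "(a * b) ^ ((p - 1) div 2) = a ^ ((p - 1) div 2) * b ^ ((p - 1) div 2)" by (rule power_mult_distrib)
 also have "[a ^ ((p - 1) div 2) * b ^ ((p - 1) div 2) = Legendre a (int p) * Legendre b (int p)] (mod int p)"
  by (intro cong_mult) (use euler_criterion[OF assms] cong_sym in blast)+
 finally have "int p dvd Legendre (a * b) (int p) - Legendre a (int p) * Legendre b (int p)" by (simp add: cong_iff_dvd_diff)
 moreover have "\<bar>Legendre (a * b) (int p) - Legendre a (int p) * Legendre b (int p)\<bar> \<le> 2"
 proof -
  have "\<bar>Legendre a (int p) * Legendre b (int p)\<bar> \<le> 1 * 1"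
   unfolding abs_mult by (intro mult_mono abs_Legendre_le_1) auto
  thus ?thesis using abs_Legendre_le_1[of "a * b" "int p"] by linarith
 qed
 ultimately show ?thesis
  using assms(2) dvd_imp_le_int[of "Legendre (a * b) (int p) - Legendre a (int p) * Legendre b (int p)" "int p"] by linarith
qed

text \<open>Every ideal is g times a primitive ideal of norm m, and has norm g^2 m. The sum runs
  over all divisors g of n, with zero terms, so that \<open>sum_divisors_coprime\<close>
  applies.\<close>

definition ideal_count :: "nat => nat => nat" where
 "ideal_count k n = (\<Sum>g | g dvd n. if g\<^sup>2 dvd n then card (quad_roots k (n div g\<^sup>2)) else 0)"

context
 fixes p k :: nat
 assumes p: "prime p" "p mod 4 = 3" and k: "4 * k = p + 1"
begin

lemma ideal_count_coprime:
 assumes cop: "coprime a b" and pos: "a > 0" "b > 0"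
 shows "ideal_count k (a * b) = ideal_count k a * ideal_count k b"
 unfolding ideal_count_def
proof (rule sum_divisors_coprime[OF assms, where u = "%n g. if g\<^sup>2 dvd n then card (quad_roots k (n div g\<^sup>2)) else 0"])
 fix x y assume xy: "x dvd a" "y dvd b"
 have c: "coprime (x\<^sup>2) b" "coprime (y\<^sup>2) a"
  using cop xy coprime_divisors[OF xy(1) dvd_refl cop] coprime_divisors[OF dvd_refl xy(2) cop] by (auto simp: coprime_commute)
 have c2: "coprime (x\<^sup>2) (y\<^sup>2)" using coprime_divisors[OF xy cop] by simp
 have "(x * y)\<^sup>2 dvd a * b \<longleftrightarrow> x\<^sup>2 dvd a * b & y\<^sup>2 dvd a * b"
  unfolding power_mult_distrib using c2 by (meson divides_mult dvd_mult_left dvd_mult_right)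
 also have "... \<longleftrightarrow> x\<^sup>2 dvd a & y\<^sup>2 dvd b" using c by (simp add: coprime_dvd_mult_left_iff coprime_dvd_mult_right_iff)
 finally have iff: "(x * y)\<^sup>2 dvd a * b \<longleftrightarrow> x\<^sup>2 dvd a & y\<^sup>2 dvd b" .
 show "(if (x * y)\<^sup>2 dvd a * b then card (quad_roots k (a * b div (x * y)\<^sup>2)) else 0)
  = (if x\<^sup>2 dvd a then card (quad_roots k (a div x\<^sup>2)) else 0) * (if y\<^sup>2 dvd b then card (quad_roots k (b div y\<^sup>2)) else 0)"
 proof (cases "x\<^sup>2 dvd a & y\<^sup>2 dvd b")
  case True
  then obtain a' b' where a': "a = x\<^sup>2 * a'" and b': "b = y\<^sup>2 * b'" by (auto elim!: dvdE)
  have x0: "x\<^sup>2 > 0" "y\<^sup>2 > 0" "a' > 0" "b' > 0" using pos a' b' by (auto intro: Nat.gr0I)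
  have d: "a div x\<^sup>2 = a'" "b div y\<^sup>2 = b'" using a' b' x0 by simp_all
  have "a * b = (x * y)\<^sup>2 * (a' * b')" unfolding a' b' power_mult_distrib by (simp only: mult_ac)
  hence d2: "a * b div (x * y)\<^sup>2 = a' * b'" using x0 by (simp add: power_mult_distrib)
  have "a' dvd a" "b' dvd b" using a' b' by simp_all
  hence "coprime a' b'" using cop coprime_divisors by blast
  thus ?thesis unfolding iff d d2 using True quad_roots_coprime[of a' b' k] x0 by simp
 qed (auto simp: iff)
qed

text \<open>Both sides satisfy the same two-step recursion: passing from e to e + 2 multiplies the
  old ideals by l and adds one new term, the number of primitive ideals of norm l^(e+2).\<close>

lemma ideal_count_prime_power:
 assumes l: "prime l"
 shows "int (ideal_count k (l ^ e)) = (\<Sum>d | d dvd l ^ e. Legendre (int d) (int p))"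
proof -
 have p2: "p > 2" using p prime_ge_2_nat[of p] by (cases "p = 2") auto
 have l1: "l > 1" using prime_gt_1_nat[OF l] .
 define ch where "ch = Legendre (int l) (int p)"
 have L1: "Legendre 1 (int p) = 1"
  using Legendre_mult[OF p(1) p2, of 1 1] Legendre_mult_self[of 1 "int p"] p2 by (simp add: cong_0_iff)
 have Lp: "Legendre (int (l ^ i)) (int p) = ch ^ i" for i
  by (induction i) (simp_all add: L1 Legendre_mult[OF p(1) p2] ch_def)
 have T0: "ideal_count k (l ^ e) = (\<Sum>i\<le>e. if 2 * i \<le> e then card (quad_roots k (l ^ (e - 2 * i))) else 0)" for e
 proof -
  have "(l ^ i)\<^sup>2 dvd l ^ e \<longleftrightarrow> 2 * i \<le> e" for i
   using l1 by (simp add: power_mult[symmetric] mult.commute[of i] power_dvd_imp_le dvd_power_iff_le)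
  moreover have "l ^ e div (l ^ i)\<^sup>2 = l ^ (e - 2 * i)" if "2 * i \<le> e" for i
   using l1 that by (simp add: power_mult[symmetric] mult.commute[of i] power_diff)
  ultimately show ?thesis unfolding ideal_count_def sum_divisors_prime_power[OF l] by (intro sum.cong) auto
 qed
 have T: "ideal_count k (l ^ e) = (\<Sum>i\<le>e div 2. card (quad_roots k (l ^ (e - 2 * i))))" for e
 proof -
  have "{i \<in> {..e}. 2 * i \<le> e} = {..e div 2}" by auto
  thus ?thesis unfolding T0 by (simp add: sum.inter_filter[symmetric])
 qed
 \<comment> \<open>For l = p both sides vanish. Otherwise the character value is 1 or -1, and two
   consecutive powers of it add up to 1 + ch.\<close>
 have step: "int (card (quad_roots k (l ^ (e + 2)))) = ch ^ (e + 1) + ch ^ (e + 2)" for e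
 proof (cases "l = p")
  case True
  have "ch = 0" unfolding ch_def True by (simp add: Legendre_def cong_0_iff)
  moreover have "quad_roots k (l ^ (e + 2)) = {}"
   by (rule quad_roots_p_square[OF p k], rule dvdI[of _ _ "p ^ e"]) (simp add: True power2_eq_square)
  ultimately show ?thesis by simp
 next
  case False
  have "\<not> p dvd l" using False l p by (metis primes_dvd_imp_eq)
  hence s: "ch * ch = 1" unfolding ch_def by (intro Legendre_mult_self) (simp add: cong_0_iff)
  have "int (card (quad_roots k (l ^ (e + 2)))) = 1 + ch"
   using quad_roots_prime_power[OF p k l False, of "e + 2"] quad_roots_prime_card[OF p k l False] by (simp add: ch_def)
  moreover have "ch ^ (e + 1) + ch ^ (e + 2) = 1 + ch"
  proof -
   have "ch = 1 \<or> ch = - 1" using s by (simp add: square_eq_1_iff)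
   thus ?thesis by auto
  qed
  ultimately show ?thesis by simp
 qed
 have one: "int (card (quad_roots k l)) = 1 + ch"
 proof (cases "l = p")
  case True
  have "ch = 0" unfolding ch_def True by (simp add: Legendre_def cong_0_iff)
  thus ?thesis using quad_roots_p[OF p k] True by simp
 qed (use quad_roots_prime_card[OF p k l] in \<open>simp add: ch_def\<close>)
 have "int (ideal_count k (l ^ e)) = (\<Sum>i\<le>e. ch ^ i)"
 proof (induction e rule: nat_induct2)
  case 0
  show ?case unfolding T using quad_roots_1[OF p k] by simp
 next
  case 1
  show ?case unfolding T using one by simp
 next
  case (step e)
  have "ideal_count k (l ^ (e + 2)) = (\<Sum>i\<le>Suc (e div 2). card (quad_roots k (l ^ (e + 2 - 2 * i))))"
   unfolding T by simp
  also have "... = card (quad_roots k (l ^ (e + 2))) + ideal_count k (l ^ e)"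
   unfolding T sum.atMost_Suc_shift by simp
  finally show ?case using step \<open>int (card (quad_roots k (l ^ (e + 2)))) = _\<close> by simp
 qed
 thus ?thesis unfolding sum_divisors_prime_power[OF l] Lp .
qed

text \<open>The coefficientwise form of zeta_K(s) = zeta(s) L(s, chi) with chi the Legendre symbol
  modulo p.\<close>

theorem ideal_count_eq:
 assumes "n > 0"
 shows "int (ideal_count k n) = (\<Sum>d | d dvd n. Legendre (int d) (int p))"
 using assms
proof (induction n rule: less_induct)
 case (less n)
 have p2: "p > 2" using p prime_ge_2_nat[of p] by (cases "p = 2") auto
 show ?case
 proof (cases "n = 1")
  case True
  have "prime (2 :: nat)" by simp
  from ideal_count_prime_power[OF this, of 0] show ?thesis unfolding True by simp
 next
  case False
  then obtain l where l: "prime l" "l dvd n" using prime_factor_nat by blast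
  have nu: "\<not> is_unit l" using l by auto
  obtain y where y: "n = l ^ multiplicity l n * y" "\<not> l dvd y"
   using multiplicity_decompose'[of n l] less.prems nu by blast
  define e where "e = multiplicity l n"
  have e: "e > 0" using l less.prems nu by (simp add: e_def multiplicity_gt_zero_iff)
  have y0: "y > 0" using y less.prems by (auto intro: Nat.gr0I)
  have "l ^ e > 1" using e prime_gt_1_nat[OF l(1)] by (intro one_less_power)
  hence yn: "y < n" using y y0 unfolding e_def[symmetric] by simp
  have cop: "coprime (l ^ e) y" using y(2) l(1) by (simp add: prime_imp_coprime)
  have l0: "l ^ e > 0" using \<open>l ^ e > 1\<close> by linarith
  have n: "n = l ^ e * y" using y(1) by (simp add: e_def)
  have "int (ideal_count k n) = int (ideal_count k (l ^ e)) * int (ideal_count k y)"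
   unfolding n using ideal_count_coprime[OF cop l0 y0] by simp
  also have "... = (\<Sum>d | d dvd l ^ e. Legendre (int d) (int p)) * (\<Sum>d | d dvd y. Legendre (int d) (int p))"
   unfolding ideal_count_prime_power[OF l(1)] less.IH[OF yn y0] ..
  also have "... = (\<Sum>d | d dvd l ^ e * y. Legendre (int d) (int p))"
   by (rule sum_divisors_coprime[OF cop l0 y0, where u = "%_ d. Legendre (int d) (int p)", symmetric])
     (simp add: Legendre_mult[OF p(1) p2])
  finally show ?thesis unfolding n .
 qed
qed

end

section \<open>The maximal order of the imaginary quadratic field and its ideals\<close>

text \<open>Coordinates with respect to 1 and omega = (1 + sqrt(-p))/2, a root of z^2 - z +
  k.\<close>

definition quad_int :: "nat => int => int => complex" where
 "quad_int p x y = of_int x + of_int y * Complex (1 / 2) (sqrt (real p) / 2)"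

definition quad_order :: "nat => complex set" where
 "quad_order p = {quad_int p x y | x y. True}"

definition quad_ideal :: "nat => complex set => bool" where
 "quad_ideal p I \<longleftrightarrow> I \<subseteq> quad_order p & 0 \<in> I & (\<forall>x\<in>I. \<forall>y\<in>I. x + y \<in> I) &
   (\<forall>r\<in>quad_order p. \<forall>x\<in>I. r * x \<in> I) & I ~= {0}"

text \<open>The lattice g (m Z + (x + omega) Z), written as congruences between the coordinates: the
  Hermite normal form of an ideal.\<close>

definition std_ideal :: "nat => nat => nat => nat => complex set" where
 "std_ideal p g m x = {quad_int p s t | s t. int g dvd t & int (g * m) dvd s - int x * t}"

text \<open>Expresses I = N conj(I)^(-1), that is, I conj(I) = (N), without products or inverses of
  ideals. In this form N is multiplied by |\<delta>|^2 when I is multiplied by a complex number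
  \<delta>.\<close>

definition dual_norm :: "nat => complex set => real => bool" where
 "dual_norm p I N \<longleftrightarrow> N > 0 & I = {z. \<forall>u\<in>I. \<exists>w\<in>quad_order p. z * cnj u = of_real N * w}"

text \<open>A denominator b > 1 would make every b^n \<ge> 2^n a divisor of the fixed number
  c.\<close>

lemma rat_in_Ints_if_powers:
 fixes M :: rat
 assumes c: "c ~= 0" and M: "!!n. of_int c * M ^ n \<in> \<int>"
 shows "M \<in> \<int>"
proof -
 obtain a b where q: "quotient_of M = (a, b)" by (cases "quotient_of M") auto
 have b: "b > 0" using quotient_of_denom_pos[OF q] .
 have cop: "coprime a b" using quotient_of_coprime[OF q] .
 have Mq: "M = of_int a / of_int b" using quotient_of_div[OF q] .
 have d: "b ^ n dvd c" for n
 proof -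
  obtain z where z: "of_int c * M ^ n = of_int z" using M[of n] by (auto elim!: Ints_cases)
  hence "of_int (c * a ^ n) = (of_int (z * b ^ n) :: rat)" using b by (simp add: Mq field_simps)
  hence "c * a ^ n = z * b ^ n" by (simp only: of_int_eq_iff)
  hence "b ^ n dvd c * a ^ n" by simp
  moreover have "coprime (b ^ n) (a ^ n)" using cop by (simp add: coprime_commute)
  ultimately show ?thesis by (simp add: coprime_dvd_mult_left_iff)
 qed
 have "b = 1"
 proof (rule ccontr)
  assume "b ~= 1"
  hence b2: "b \<ge> 2" using b by simp
  define n where "n = nat \<bar>c\<bar>"
  have "int (2 ^ n) \<le> b ^ n" using power_mono[OF b2, of n] by simp
  also have "b ^ n \<le> \<bar>c\<bar>" using dvd_imp_le_int[OF c d[of n]] b by simp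
  also have "\<bar>c\<bar> = int n" by (simp add: n_def)
  finally have "2 ^ n \<le> n" by (simp only: of_nat_le_iff)
  thus False using less_exp[of n] by simp
 qed
 thus ?thesis using Mq by simp
qed

locale prime_3_mod_4 =
 fixes p k :: nat
 assumes p: "prime p" "p mod 4 = 3" and k: "4 * k = p + 1"
begin

lemma p0: "p > 0" using p(1) by (simp add: prime_gt_0_nat)

lemma omega_square: "Complex (1 / 2) (sqrt (real p) / 2) * Complex (1 / 2) (sqrt (real p) / 2)
 = Complex (1 / 2) (sqrt (real p) / 2) - of_nat k"
proof -
 have "4 * real k = real p + 1" using arg_cong[OF k, of real] by simp
 thus ?thesis by (simp add: complex_eq_iff field_simps)
qed

lemma quad_int_add: "quad_int p x y + quad_int p u v = quad_int p (x + u) (y + v)"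
 by (simp add: quad_int_def algebra_simps)

lemma quad_int_diff: "quad_int p x y - quad_int p u v = quad_int p (x - u) (y - v)"
 by (simp add: quad_int_def algebra_simps)

lemma quad_int_mult: "quad_int p x y * quad_int p u v = quad_int p (x * u - int k * y * v) (x * v + y * u + y * v)"
proof -
 define w where "w = Complex (1 / 2) (sqrt (real p) / 2)"
 have w: "w * w = w - of_nat k" unfolding w_def by (rule omega_square)
 have "(of_int x + of_int y * w) * (of_int u + of_int v * w)
   = of_int x * of_int u + (of_int x * of_int v + of_int y * of_int u) * w + of_int y * of_int v * (w * w)"
  by (simp add: algebra_simps)
 thus ?thesis unfolding quad_int_def w_def[symmetric] unfolding w by (simp add: algebra_simps)
qed

lemma quad_int_cnj: "cnj (quad_int p x y) = quad_int p (x + y) (- y)"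
 by (simp add: quad_int_def complex_eq_iff)

lemma quad_int_of_int: "quad_int p n 0 = of_int n"
 by (simp add: quad_int_def)

lemma quad_int_norm: "quad_int p x y * cnj (quad_int p x y) = of_int (x\<^sup>2 + x * y + int k * y\<^sup>2)"
proof -
 have "quad_int p x y * cnj (quad_int p x y) = quad_int p (x\<^sup>2 + x * y + int k * y\<^sup>2) 0"
  unfolding quad_int_cnj quad_int_mult by (simp add: power2_eq_square algebra_simps)
 thus ?thesis by (simp only: quad_int_of_int)
qed

lemma quad_int_eq_iff: "quad_int p x y = quad_int p u v \<longleftrightarrow> x = u & y = v"
proof
 assume e: "quad_int p x y = quad_int p u v"
 have "sqrt (real p) ~= 0" using p0 by simp
 moreover have "real_of_int y * sqrt (real p) = real_of_int v * sqrt (real p)"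
  using arg_cong[OF e, of Im] by (simp add: quad_int_def)
 ultimately have y: "y = v" by simp
 thus "x = u & y = v" using arg_cong[OF e, of Re] by (simp add: quad_int_def)
qed simp

lemma quad_int_in [intro, simp]: "quad_int p x y \<in> quad_order p"
 by (auto simp: quad_order_def)

lemma quad_order_closed:
 "a \<in> quad_order p ==> b \<in> quad_order p ==> a + b \<in> quad_order p"
 "a \<in> quad_order p ==> b \<in> quad_order p ==> a - b \<in> quad_order p"
 "a \<in> quad_order p ==> b \<in> quad_order p ==> a * b \<in> quad_order p"
 "a \<in> quad_order p ==> cnj a \<in> quad_order p"
 "of_int n \<in> quad_order p"
proof -
 have E: "\<exists>x y. a = quad_int p x y" if "a \<in> quad_order p" for a using that by (auto simp: quad_order_def)
 show "a \<in> quad_order p ==> b \<in> quad_order p ==> a + b \<in> quad_order p"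
  "a \<in> quad_order p ==> b \<in> quad_order p ==> a - b \<in> quad_order p"
  "a \<in> quad_order p ==> b \<in> quad_order p ==> a * b \<in> quad_order p"
  "a \<in> quad_order p ==> cnj a \<in> quad_order p"
  by (auto dest!: E simp: quad_int_add quad_int_diff quad_int_mult quad_int_cnj)
 show "of_int n \<in> quad_order p" using quad_int_in[of n 0] by (simp only: quad_int_of_int)
qed

lemma quad_order_simps [simp]: "0 \<in> quad_order p" "1 \<in> quad_order p" "of_nat n \<in> quad_order p"
 using quad_order_closed(5)[of 0] quad_order_closed(5)[of 1] quad_order_closed(5)[of "int n"] by simp_all

lemma quad_order_uminus: "a \<in> quad_order p ==> - a \<in> quad_order p"
 using quad_order_closed(2)[of 0 a] by simp

lemma quad_order_power: "a \<in> quad_order p ==> a ^ n \<in> quad_order p"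
 by (induction n) (auto intro: quad_order_closed)

lemma quad_order_sum: "(!!i. i \<in> A ==> f i \<in> quad_order p) ==> sum f A \<in> quad_order p"
 by (induction A rule: infinite_finite_induct) (auto intro: quad_order_closed)

lemma quad_order_norm:
 assumes "a \<in> quad_order p"
 obtains n :: nat where "a * cnj a = of_nat n"
proof -
 obtain x y where a: "a = quad_int p x y" using assms by (auto simp: quad_order_def)
 have "0 \<le> Re (a * cnj a)" by simp
 hence "0 \<le> x\<^sup>2 + x * y + int k * y\<^sup>2" unfolding a quad_int_norm by (simp only: complex_Re_of_int of_int_0_le_iff)
 then obtain n where "x\<^sup>2 + x * y + int k * y\<^sup>2 = int n" using nonneg_int_cases by blast
 thus thesis using that[of n] unfolding a quad_int_norm by simp
qed

lemma quad_order_ge_1: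
 assumes "a \<in> quad_order p" "a ~= 0"
 shows "norm a \<ge> 1"
proof -
 obtain n :: nat where n: "a * cnj a = of_nat n" using quad_order_norm[OF assms(1)] .
 have "n ~= 0"
 proof
  assume "n = 0"
  hence "a * cnj a = 0" using n by simp
  thus False using assms(2) by simp
 qed
 hence "1 \<le> real n" by simp
 also have "real n = (norm a)\<^sup>2"
  using arg_cong[OF n, of Re] unfolding complex_norm_square[symmetric] by simp
 finally show ?thesis by (simp add: abs_le_square_iff[of 1 "norm a", simplified])
qed

lemma csqrt_neg: "csqrt (of_int (- int p)) = quad_int p (- 1) 2"
 by (subst csqrt_of_real_nonpos) (auto simp: quad_int_def complex_eq_iff)

lemma quad_field_common_denom:
 assumes "\<alpha> \<in> quadratic_field (- int p)"
 obtains d :: int and x y :: rat where "d ~= 0" "of_int d * \<alpha> \<in> quad_order p" "\<alpha> = of_rat x + of_rat y * csqrt (of_int (- int p))"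
proof -
 obtain x y where \<alpha>: "\<alpha> = of_rat x + of_rat y * csqrt (of_int (- int p))"
  using assms by (auto simp: quadratic_field_def)
 obtain a b d :: int where q: "x = of_int a / of_int d" "y = of_int b / of_int d" "d ~= 0" by (rule rat_common_denom)
 have "of_int d * \<alpha> = of_int a + of_int b * csqrt (of_int (- int p))"
  using q(3) by (simp add: \<alpha> q of_rat_divide field_simps)
 also have "... \<in> quad_order p" unfolding csqrt_neg by (intro quad_order_closed quad_int_in)
 finally show thesis using that[OF q(3) _ \<alpha>] by blast
qed

text \<open>A monic integral relation of degree D expresses higher powers through lower ones, so
  d^D, which clears the denominators of the powers below D, clears them all.\<close>

lemma algebraic_int_powers:
 assumes K: "\<alpha> \<in> quadratic_field (- int p)" and int: "algebraic_int \<alpha>"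
 obtains c :: int where "c ~= 0" "!!n. of_int c * \<alpha> ^ n \<in> quad_order p"
proof -
 obtain d :: int where d: "d ~= 0" "of_int d * \<alpha> \<in> quad_order p" using quad_field_common_denom[OF K] by metis
 obtain f where f: "!!i. Polynomial.coeff f i \<in> \<int>" "lead_coeff f = 1" "poly f \<alpha> = 0"
  using int by (auto elim!: algebraic_int.cases)
 define D where "D = Polynomial.degree f"
 have "of_int (d ^ D) * \<alpha> ^ n \<in> quad_order p" for n
 proof (induction n rule: less_induct)
  case (less n)
  show ?case
  proof (cases "n < D")
   case True
   have "of_int (d ^ D) * \<alpha> ^ n = of_int (d ^ (D - n)) * (of_int d * \<alpha>) ^ n"
    using True by (simp add: power_mult_distrib mult.assoc[symmetric] power_add[symmetric])
   thus ?thesis using quad_order_closed quad_order_power d(2) by metis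
  next
   case False
   have "(\<Sum>i\<le>D. Polynomial.coeff f i * \<alpha> ^ i) = 0" using f(3) by (simp add: poly_altdef D_def)
   hence "(\<Sum>i<D. Polynomial.coeff f i * \<alpha> ^ i) + \<alpha> ^ D = 0" using f(2) by (simp add: D_def lessThan_Suc_atMost[symmetric])
   hence "\<alpha> ^ D = - (\<Sum>i<D. Polynomial.coeff f i * \<alpha> ^ i)" by (simp add: eq_neg_iff_add_eq_0 add.commute)
   moreover have "\<alpha> ^ n = \<alpha> ^ D * \<alpha> ^ (n - D)" using False by (simp add: power_add[symmetric])
   ultimately have "of_int (d ^ D) * \<alpha> ^ n = - (\<Sum>i<D. Polynomial.coeff f i * (of_int (d ^ D) * \<alpha> ^ (i + (n - D))))"
    by (simp add: sum_distrib_left sum_distrib_right power_add mult_ac sum_negf)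
   also have "... \<in> quad_order p"
   proof (rule quad_order_uminus, rule quad_order_sum, rule quad_order_closed(3))
    fix i assume i: "i \<in> {..<D}"
    obtain c where "Polynomial.coeff f i = of_int c" using f(1)[of i] by (auto elim!: Ints_cases)
    thus "Polynomial.coeff f i \<in> quad_order p" using quad_order_closed(5) by simp
    show "of_int (d ^ D) * \<alpha> ^ (i + (n - D)) \<in> quad_order p" by (rule less) (use i False in simp)
   qed
   finally show ?thesis .
  qed
 qed
 thus thesis using that[of "d ^ D"] d(1) by simp
qed

lemma norm_in_Ints:
 fixes x y :: rat
 assumes c: "c ~= 0" "!!n. of_int c * \<alpha> ^ n \<in> quad_order p" and \<alpha>: "\<alpha> = of_rat x + of_rat y * csqrt (of_int (- int p))"
 shows "x\<^sup>2 + of_nat p * y\<^sup>2 \<in> \<int>"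
proof (rule rat_in_Ints_if_powers)
 show "c\<^sup>2 ~= 0" using c by simp
 fix n
 define M where "M = x\<^sup>2 + of_nat p * y\<^sup>2"
 have cs: "csqrt (of_int (- int p)) * csqrt (of_int (- int p)) = - of_nat p" "cnj (csqrt (of_int (- int p))) = - csqrt (of_int (- int p))"
  using power2_csqrt[of "of_int (- int p)"] by (simp_all add: power2_eq_square csqrt_neg quad_int_def complex_eq_iff)
 have r: "cnj (of_rat x) = of_rat x" "cnj (of_rat y) = of_rat y"
  by (rule rat_common_denom[of x y], simp add: of_rat_divide)+
 have N: "\<alpha> * cnj \<alpha> = of_rat M"
 proof -
  have "\<alpha> * cnj \<alpha> = of_rat x * of_rat x - of_rat y * of_rat y * (csqrt (of_int (- int p)) * csqrt (of_int (- int p)))"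
   unfolding \<alpha> complex_cnj_add complex_cnj_mult r cs(2) by (simp add: algebra_simps)
  thus ?thesis unfolding cs(1) by (simp add: M_def of_rat_add of_rat_mult power2_eq_square)
 qed
 obtain m :: nat where m: "(of_int c * \<alpha> ^ n) * cnj (of_int c * \<alpha> ^ n) = of_nat m" using quad_order_norm[OF c(2)] .
 have "of_rat (of_int (c\<^sup>2) * M ^ n) = (of_int c * \<alpha> ^ n) * cnj (of_int c * \<alpha> ^ n)"
  by (simp add: of_rat_mult of_rat_power N[symmetric] power_mult_distrib power2_eq_square)
 also have "... = of_rat (of_nat m)" unfolding m by simp
 finally have "of_int (c\<^sup>2) * M ^ n = of_nat m" by (simp only: of_rat_eq_iff)
 thus "of_int (c\<^sup>2) * (x\<^sup>2 + of_nat p * y\<^sup>2) ^ n \<in> \<int>" by (simp add: M_def)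
qed

text \<open>An algebraic integer comes with some monic polynomial, not with its minimal one, so
  trace and norm are reached through the bounded denominators of its powers: the norms of \<alpha>
  and \<alpha> + 1 are integers, and their difference yields the trace. Then p (2y)^2 is an integer,
  and 2y is one too since p is squarefree.\<close>

lemma algebraic_int_in_quad_order:
 assumes K: "\<alpha> \<in> quadratic_field (- int p)" and int: "algebraic_int \<alpha>"
 shows "\<alpha> \<in> quad_order p"
proof -
 obtain x y :: rat where \<alpha>: "\<alpha> = of_rat x + of_rat y * csqrt (of_int (- int p))" using quad_field_common_denom[OF K] by metis
 obtain c :: int where c: "c ~= 0" "!!n. of_int c * \<alpha> ^ n \<in> quad_order p" using algebraic_int_powers[OF assms] by blast
 have c': "of_int c * (\<alpha> + 1) ^ n \<in> quad_order p" for n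
 proof -
  have "of_int c * (\<alpha> + 1) ^ n = (\<Sum>i\<le>n. of_nat (n choose i) * (of_int c * \<alpha> ^ i))"
   by (simp add: binomial_ring sum_distrib_left mult_ac)
  also have "... \<in> quad_order p" by (intro quad_order_sum quad_order_closed(3) c) auto
  finally show ?thesis .
 qed
 have \<alpha>': "\<alpha> + 1 = of_rat (x + 1) + of_rat y * csqrt (of_int (- int p))" by (simp add: \<alpha> of_rat_add)
 obtain M where M: "x\<^sup>2 + of_nat p * y\<^sup>2 = of_int M" using norm_in_Ints[OF c \<alpha>] by (auto elim!: Ints_cases)
 obtain M' where M': "(x + 1)\<^sup>2 + of_nat p * y\<^sup>2 = of_int M'" using norm_in_Ints[OF c(1) c' \<alpha>'] by (auto elim!: Ints_cases)
 define T where "T = M' - M - 1"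
 have T: "2 * x = of_int T"
 proof -
  have "2 * x = ((x + 1)\<^sup>2 + of_nat p * y\<^sup>2) - (x\<^sup>2 + of_nat p * y\<^sup>2) - 1" by (simp add: power2_eq_square algebra_simps)
  thus ?thesis unfolding M M' T_def by simp
 qed
 obtain a b where q: "quotient_of (2 * y) = (a, b)" by (cases "quotient_of (2 * y)") auto
 have b: "b > 0" using quotient_of_denom_pos[OF q] .
 have cop: "coprime a b" using quotient_of_coprime[OF q] .
 have yq: "2 * y = of_int a / of_int b" using quotient_of_div[OF q] .
 have py: "of_nat p * (2 * y)\<^sup>2 = of_int (4 * M - T\<^sup>2)"
 proof -
  have "of_nat p * (2 * y)\<^sup>2 = 4 * (x\<^sup>2 + of_nat p * y\<^sup>2) - (2 * x)\<^sup>2" by (simp add: power2_eq_square algebra_simps)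
  thus ?thesis unfolding M T by simp
 qed
 hence "of_int (int p * a\<^sup>2) = (of_int ((4 * M - T\<^sup>2) * b\<^sup>2) :: rat)"
  using b unfolding yq by (simp add: power_divide field_simps)
 hence e: "int p * a\<^sup>2 = (4 * M - T\<^sup>2) * b\<^sup>2" by (simp only: of_int_eq_iff)
 have "b\<^sup>2 dvd int p * a\<^sup>2" unfolding e by simp
 moreover have "coprime (b\<^sup>2) (a\<^sup>2)" using cop by (simp add: coprime_commute)
 ultimately have "b\<^sup>2 dvd int p" by (simp add: coprime_dvd_mult_left_iff)
 have "b = 1"
 proof (rule ccontr)
  assume "b ~= 1"
  have "nat b dvd p" using \<open>b\<^sup>2 dvd int p\<close> b by (metis dvd_mult_left nat_dvd_iff power2_eq_square of_nat_0_less_iff int_dvd_int_iff zero_less_imp_eq_int nat_int)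
  moreover have "nat b ~= 1" using \<open>b ~= 1\<close> b by (simp add: nat_eq_iff)
  ultimately have "nat b = p" using p(1) unfolding prime_nat_iff by blast
  hence "b = int p" using b by simp
  hence "int p * int p dvd int p * 1" using \<open>b\<^sup>2 dvd int p\<close> by (simp add: power2_eq_square)
  hence "int p dvd 1" using p0 by (simp only: dvd_mult_cancel_left) simp
  thus False using prime_gt_1_nat[OF p(1)] by simp
 qed
 hence y2: "2 * y = of_int a" and e': "int p * a\<^sup>2 = 4 * M - T\<^sup>2" using yq e by simp_all
 \<comment> \<open>The congruence modulo 4 behind this says that the trace T and a have equal
   parity, which is exactly membership in Z + Z omega.\<close>
 have "even (int p * a\<^sup>2 + T\<^sup>2)" unfolding e' by simp
 moreover have "odd p" using p(2) by presburger
 ultimately have "even (T - a)" by simp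
 then obtain s where s: "T = a + 2 * s" by (metis add.commute diff_eq_eq dvdE)
 have "x = of_int s + of_int a / 2" using T s by simp
 moreover have "y = of_int a / 2" using y2 by simp
 ultimately have "\<alpha> = of_rat (of_int s + of_int a / 2) + of_rat (of_int a / 2) * csqrt (of_int (- int p))"
  unfolding \<alpha> by (simp only:)
 also have "... = quad_int p s a"
  unfolding csqrt_neg by (simp add: quad_int_def of_rat_add of_rat_divide complex_eq_iff)
 finally show ?thesis by simp
qed

lemma quad_order_algebraic_int:
 assumes "\<alpha> \<in> quad_order p"
 shows "\<alpha> \<in> quadratic_field (- int p)" "algebraic_int \<alpha>"
proof -
 obtain x y where \<alpha>: "\<alpha> = quad_int p x y" using assms by (auto simp: quad_order_def)
 have "\<alpha> = of_rat (of_int x + of_int y / 2) + of_rat (of_int y / 2) * csqrt (of_int (- int p))"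
  unfolding csqrt_neg by (simp add: \<alpha> quad_int_def of_rat_add of_rat_divide complex_eq_iff)
 thus "\<alpha> \<in> quadratic_field (- int p)" unfolding quadratic_field_def by blast
 have s: "\<alpha> + cnj \<alpha> = of_int (2 * x + y)" unfolding \<alpha> quad_int_cnj quad_int_add by (simp add: quad_int_def)
 have n: "\<alpha> * cnj \<alpha> = of_int (x\<^sup>2 + x * y + int k * y\<^sup>2)" unfolding \<alpha> by (rule quad_int_norm)
 define f where "f = [:of_int (x\<^sup>2 + x * y + int k * y\<^sup>2), - of_int (2 * x + y), 1 :: complex:]"
 have "poly f \<alpha> = 0" unfolding f_def n[symmetric] s[symmetric] by (simp add: algebra_simps)
 moreover have "lead_coeff f = 1" by (simp add: f_def)
 moreover have "Polynomial.coeff f i \<in> \<int>" for i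
  unfolding f_def by (auto simp: coeff_pCons split: nat.splits simp del: of_int_add of_int_mult of_int_power)
 ultimately show "algebraic_int \<alpha>" by (intro algebraic_int.intros[of f]) auto
qed

lemma carrier_ring_of_integers: "carrier (ring_of_integers (quadratic_field (- int p))) = quad_order p"
 using algebraic_int_in_quad_order quad_order_algebraic_int by (auto simp: ring_of_integers_def)

lemma ring_ring_of_integers: "ring (ring_of_integers (quadratic_field (- int p)))"
proof -
 let ?R = "ring_of_integers (quadratic_field (- int p))"
 have ops: "x \<otimes>\<^bsub>?R\<^esub> y = x * y" "x \<oplus>\<^bsub>?R\<^esub> y = x + y" "\<one>\<^bsub>?R\<^esub> = 1" "\<zero>\<^bsub>?R\<^esub> = 0" for x y
  by (simp_all add: ring_of_integers_def)
 show ?thesis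
 proof (rule ringI)
  show "abelian_group ?R"
   by (rule abelian_groupI) (auto simp: ops carrier_ring_of_integers quad_order_closed intro!: bexI[of _ "- _"] quad_order_uminus)
  show "Group.monoid ?R"
   by (rule monoidI) (auto simp: ops carrier_ring_of_integers quad_order_closed)
 qed (auto simp: ops algebra_simps)
qed

lemma nonzero_ideals_iff: "I \<in> nonzero_ideals (quadratic_field (- int p)) \<longleftrightarrow> quad_ideal p I"
proof -
 let ?R = "ring_of_integers (quadratic_field (- int p))"
 have ops: "x \<otimes>\<^bsub>?R\<^esub> y = x * y" "x \<oplus>\<^bsub>?R\<^esub> y = x + y" "\<one>\<^bsub>?R\<^esub> = 1" "\<zero>\<^bsub>?R\<^esub> = 0" for x y
  by (simp_all add: ring_of_integers_def)
 have "ideal I ?R \<longleftrightarrow> I \<subseteq> quad_order p & 0 \<in> I & (\<forall>x\<in>I. \<forall>y\<in>I. x + y \<in> I) & (\<forall>r\<in>quad_order p. \<forall>x\<in>I. r * x \<in> I)"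
 proof
  assume "ideal I ?R"
  then interpret ideal I ?R .
  show "I \<subseteq> quad_order p & 0 \<in> I & (\<forall>x\<in>I. \<forall>y\<in>I. x + y \<in> I) & (\<forall>r\<in>quad_order p. \<forall>x\<in>I. r * x \<in> I)"
   using a_subset additive_subgroup.zero_closed[OF is_additive_subgroup] additive_subgroup.a_closed[OF is_additive_subgroup]
    I_l_closed unfolding ops carrier_ring_of_integers by auto
 next
  assume I: "I \<subseteq> quad_order p & 0 \<in> I & (\<forall>x\<in>I. \<forall>y\<in>I. x + y \<in> I) & (\<forall>r\<in>quad_order p. \<forall>x\<in>I. r * x \<in> I)"
  interpret R: ring ?R by (rule ring_ring_of_integers)
  have minus: "- x \<in> I" if "x \<in> I" for x
   using I that quad_order_uminus[OF quad_order_simps(2)] by (metis mult_minus1)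
  show "ideal I ?R"
  proof (rule idealI[OF ring_ring_of_integers])
   show "subgroup I (add_monoid ?R)"
   proof (rule subgroup.intro)
    fix x assume x: "x \<in> I"
    hence xc: "x \<in> carrier ?R" "- x \<in> carrier ?R" using I minus carrier_ring_of_integers by auto
    have "\<ominus>\<^bsub>?R\<^esub> x = - x" by (rule R.minus_equality) (use xc in \<open>simp_all add: ops\<close>)
    thus "inv\<^bsub>add_monoid ?R\<^esub> x \<in> I" using minus[OF x] by (simp add: a_inv_def)
   qed (use I in \<open>auto simp: ops carrier_ring_of_integers\<close>)
   fix a x assume "a \<in> I" "x \<in> carrier ?R"
   thus "x \<otimes>\<^bsub>?R\<^esub> a \<in> I" using I by (auto simp: ops carrier_ring_of_integers)
   thus "a \<otimes>\<^bsub>?R\<^esub> x \<in> I" by (simp add: ops mult.commute)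
  qed
 qed
 thus ?thesis by (auto simp: nonzero_ideals_def quad_ideal_def)
qed

lemma ideal_class_rel_iff: "(I, J) \<in> ideal_class_rel (quadratic_field (- int p)) \<longleftrightarrow>
 quad_ideal p I & quad_ideal p J & (\<exists>a\<in>quad_order p - {0}. \<exists>b\<in>quad_order p - {0}. (%x. a * x) ` I = (%x. b * x) ` J)"
 unfolding ideal_class_rel_def carrier_ring_of_integers nonzero_ideals_iff by simp

end

context prime_3_mod_4
begin

lemma dual_normI:
 assumes "N > 0" "!!z. z \<in> I \<longleftrightarrow> (\<forall>u\<in>I. \<exists>w\<in>quad_order p. z * cnj u = of_real N * w)"
 shows "dual_norm p I N"
 unfolding dual_norm_def using assms by blast

lemma std_ideal_mem: "quad_int p s t \<in> std_ideal p g m x \<longleftrightarrow> int g dvd t & int (g * m) dvd s - int x * t"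
 by (auto simp: std_ideal_def quad_int_eq_iff)

lemma std_ideal_subset: "std_ideal p g m x \<subseteq> quad_order p"
 by (auto simp: std_ideal_def)

lemma quad_roots_pos: "x \<in> quad_roots k m ==> m > 0" "x \<in> quad_roots k m ==> x < m"
 by (auto simp: quad_roots_def)

lemma quad_roots_cofactor:
 assumes "x \<in> quad_roots k m"
 obtains e where "(int x)\<^sup>2 + int x + int k = int m * e"
proof -
 have "m dvd x\<^sup>2 + x + k" using assms by (simp add: quad_roots_def)
 hence "int m dvd int (x\<^sup>2 + x + k)" by (simp only: int_dvd_int_iff)
 thus thesis using that by (auto elim!: dvdE)
qed

lemma quad_ideal_std:
 assumes g: "g > 0" and x: "x \<in> quad_roots k m"
 shows "quad_ideal p (std_ideal p g m x)"
 unfolding quad_ideal_def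
proof (intro conjI ballI std_ideal_subset)
 have m: "m > 0" using quad_roots_pos[OF x] by simp
 have "quad_int p 0 0 \<in> std_ideal p g m x" by (simp add: std_ideal_mem)
 thus "0 \<in> std_ideal p g m x" by (simp add: quad_int_of_int)
 have "quad_int p (int (g * m)) 0 \<in> std_ideal p g m x" by (simp add: std_ideal_mem)
 moreover have "quad_int p (int (g * m)) 0 ~= 0" using g m by (simp add: quad_int_of_int)
 ultimately show "std_ideal p g m x ~= {0}" by auto
 fix a assume "a \<in> std_ideal p g m x"
 then obtain s t where a: "a = quad_int p s t" "int g dvd t" "int (g * m) dvd s - int x * t" by (auto simp: std_ideal_def)
 {
  fix b assume "b \<in> std_ideal p g m x"
  then obtain u v where b: "b = quad_int p u v" "int g dvd v" "int (g * m) dvd u - int x * v" by (auto simp: std_ideal_def)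
  have "int (g * m) dvd (s - int x * t) + (u - int x * v)" using a(3) b(3) by (rule dvd_add)
  also have "(s - int x * t) + (u - int x * v) = (s + u) - int x * (t + v)" by (simp add: algebra_simps)
  finally show "a + b \<in> std_ideal p g m x" using a b by (simp add: quad_int_add std_ideal_mem)
 }
 fix r assume "r \<in> quad_order p"
 then obtain u v where r: "r = quad_int p u v" by (auto simp: quad_order_def)
 obtain t' where t': "t = int g * t'" using a(2) by blast
 obtain c where c: "s - int x * t = int (g * m) * c" using a(3) by blast
 have s: "s = int g * (int x * t' + int m * c)" using c t' by (simp add: algebra_simps)
 obtain e where e: "(int x)\<^sup>2 + int x + int k = int m * e" by (rule quad_roots_cofactor[OF x])
 have "int g dvd u * t + v * s + v * t" unfolding s t' by (intro dvd_add dvd_mult dvd_triv_left)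
 moreover have "int (g * m) dvd (u * s - int k * v * t) - int x * (u * t + v * s + v * t)"
 proof -
  have "(u * s - int k * v * t) - int x * (u * t + v * s + v * t)
    = int g * (u * int m * c - v * int x * int m * c - v * t' * ((int x)\<^sup>2 + int x + int k))"
   unfolding s t' by (simp add: power2_eq_square algebra_simps)
  also have "... = int (g * m) * (u * c - v * int x * c - v * t' * e)" unfolding e by (simp add: algebra_simps)
  finally show ?thesis by simp
 qed
 ultimately show "r * a \<in> std_ideal p g m x"
  unfolding r a(1) quad_int_mult std_ideal_mem by blast
qed

lemma std_ideal_unique:
 assumes g: "g > 0" "g' > 0" and x: "x \<in> quad_roots k m" "x' \<in> quad_roots k m'" and e: "std_ideal p g m x = std_ideal p g' m' x'"
 shows "g = g'" "m = m'" "x = x'"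
proof -
 have gd: "g' dvd g" "int (g' * m') dvd int (g * x) - int x' * int g" "g' * m' dvd g * m"
  if "std_ideal p g m x \<subseteq> std_ideal p g' m' x'" for g m x g' m' x'
 proof -
  have "quad_int p (int (g * x)) (int g) \<in> std_ideal p g m x" by (simp add: std_ideal_mem mult.commute)
  hence "quad_int p (int (g * x)) (int g) \<in> std_ideal p g' m' x'" using that by blast
  thus "g' dvd g" "int (g' * m') dvd int (g * x) - int x' * int g" unfolding std_ideal_mem by auto
  have "quad_int p (int (g * m)) 0 \<in> std_ideal p g m x" by (simp add: std_ideal_mem)
  hence "quad_int p (int (g * m)) 0 \<in> std_ideal p g' m' x'" using that by blast
  hence "int (g' * m') dvd int (g * m)" unfolding std_ideal_mem by simp
  thus "g' * m' dvd g * m" by (simp only: int_dvd_int_iff)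
 qed
 show gg: "g = g'" using gd(1)[of g m x g' m' x'] gd(1)[of g' m' x' g m x] e dvd_antisym by simp
 have "g * m = g' * m'" using gd(3)[of g m x g' m' x'] gd(3)[of g' m' x' g m x] e dvd_antisym by simp
 thus mm: "m = m'" using gg g by simp
 have "int (g * m) dvd int (g * x) - int x' * int g" using gd(2)[of g m x g' m' x'] e gg mm by simp
 hence "int g * int m dvd int g * (int x - int x')" by (simp add: algebra_simps)
 hence "int m dvd int x - int x'" using g by simp
 moreover have "\<bar>int x - int x'\<bar> < int m" using quad_roots_pos(2)[OF x(1)] quad_roots_pos(2)[OF x(2)] mm by linarith
 ultimately have "int x - int x' = 0" using dvd_imp_le_int[of "int x - int x'" "int m"] by linarith
 thus "x = x'" by simp
qed

lemma int_subgroup_principal: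
 fixes S :: "int set"
 assumes add: "!!a b. a \<in> S ==> b \<in> S ==> a + b \<in> S" and neg: "!!a. a \<in> S ==> - a \<in> S" and ne: "a0 \<in> S" "a0 ~= 0"
 obtains g :: nat where "g > 0" "int g \<in> S" "!!a. a \<in> S ==> int g dvd a"
proof -
 have "\<exists>n :: nat. n > 0 & int n \<in> S"
  using ne neg[OF ne(1)] by (intro exI[of _ "nat \<bar>a0\<bar>"]) (auto simp: abs_if)
 define g where "g = (LEAST n :: nat. n > 0 & int n \<in> S)"
 have g: "g > 0" "int g \<in> S" using LeastI_ex[OF \<open>\<exists>n :: nat. n > 0 & int n \<in> S\<close>] by (auto simp: g_def)
 have least: "g \<le> n" if "n > 0" "int n \<in> S" for n unfolding g_def using that by (intro Least_le) auto
 have mult: "int g * c \<in> S" for c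
 proof -
  have n: "int g * int n \<in> S" for n
  proof (induction n)
   case 0
   show ?case using add[OF g(2) neg[OF g(2)]] by simp
  next
   case (Suc n)
   show ?case using add[OF g(2) Suc] by (simp add: algebra_simps)
  qed
  show ?thesis using n[of "nat c"] neg[OF n[of "nat (- c)"]] by (cases "c \<ge> 0") auto
 qed
 have "int g dvd a" if a: "a \<in> S" for a
 proof (rule ccontr)
  assume nd: "\<not> int g dvd a"
  have "a + int g * (- (a div int g)) \<in> S" by (rule add[OF a mult])
  moreover have "a + int g * (- (a div int g)) = a mod int g" by (simp add: minus_mult_div_eq_mod[symmetric])
  ultimately have "a mod int g \<in> S" by simp
  moreover have "a mod int g ~= 0" using nd by (simp add: dvd_eq_mod_eq_0)
  hence "a mod int g > 0" "a mod int g < int g" using g(1) pos_mod_sign[of "int g" a] pos_mod_bound[of "int g" a] by linarith+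
  ultimately show False using least[of "nat (a mod int g)"] by auto
 qed
 thus thesis using that g by blast
qed

text \<open>Here g generates the group of omega-coordinates of I, and g m generates the intersection
  of I with Z. Stability under omega makes g divide both coordinates and makes x a root modulo
  m.\<close>

lemma quad_ideal_is_std:
 assumes I: "quad_ideal p I"
 obtains g m x where "g > 0" "x \<in> quad_roots k m" "I = std_ideal p g m x"
proof -
 have IO: "!!a. a \<in> I ==> a \<in> quad_order p" and add: "!!a b. a \<in> I ==> b \<in> I ==> a + b \<in> I"
  and mult: "!!r a. r \<in> quad_order p ==> a \<in> I ==> r * a \<in> I" using I by (auto simp: quad_ideal_def)
 obtain a where a: "a \<in> I" "a ~= 0" using I by (auto simp: quad_ideal_def)
 have neg: "- a \<in> I" if "a \<in> I" for a using mult[OF quad_order_uminus[OF quad_order_simps(2)] that] by simp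
 define G where "G = {t. \<exists>s. quad_int p s t \<in> I}"
 define M where "M = {s. quad_int p s 0 \<in> I}"
 have neg': "quad_int p (- s) (- t) \<in> I" if "quad_int p s t \<in> I" for s t
  using neg[OF that] by (simp add: quad_int_def)
 have om: "quad_int p (- int k * t) (s + t) \<in> I" if "quad_int p s t \<in> I" for s t
  using mult[OF quad_int_in[of 0 1] that] by (simp add: quad_int_mult)
 obtain n :: nat where n: "a * cnj a = of_nat n" using quad_order_norm[OF IO[OF a(1)]] .
 have n0: "n ~= 0"
 proof
  assume "n = 0"
  hence "a * cnj a = 0" using n by simp
  thus False using a(2) by simp
 qed
 have "cnj a * a \<in> I" by (rule mult[OF quad_order_closed(4)[OF IO[OF a(1)]] a(1)])
 hence nI: "quad_int p (int n) 0 \<in> I" using n by (simp add: quad_int_of_int mult.commute)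
 obtain M0 :: nat where M0: "M0 > 0" "int M0 \<in> M" "!!s. s \<in> M ==> int M0 dvd s"
 proof (rule int_subgroup_principal[of M "int n"])
  show "a + b \<in> M" if "a \<in> M" "b \<in> M" for a b using add[of "quad_int p a 0" "quad_int p b 0"] that by (simp add: M_def quad_int_add)
  show "- a \<in> M" if "a \<in> M" for a using neg'[of a 0] that by (simp add: M_def)
 qed (use nI n0 in \<open>auto simp: M_def\<close>)
 have nG: "int n \<in> G" unfolding G_def using om[OF nI] by auto
 obtain g :: nat where g: "g > 0" "int g \<in> G" "!!t. t \<in> G ==> int g dvd t"
 proof (rule int_subgroup_principal[of G "int n"])
  show "a + b \<in> G" if "a \<in> G" "b \<in> G" for a b
  proof -
   obtain s s' where "quad_int p s a \<in> I" "quad_int p s' b \<in> I" using \<open>a \<in> G\<close> \<open>b \<in> G\<close> by (auto simp: G_def)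
   from add[OF this] show ?thesis by (auto simp: G_def quad_int_add)
  qed
  show "- a \<in> G" if "a \<in> G" for a using neg' \<open>a \<in> G\<close> by (auto simp: G_def)
 qed (use nG n0 in auto)
 \<comment> \<open>Multiplication by omega sends s + t omega to -k t + (s + t) omega, so s + t is
   again an omega-coordinate of I.\<close>
 have gs: "int g dvd s" if "quad_int p s t \<in> I" for s t
 proof -
  have "s + t \<in> G" using om[OF that] by (auto simp: G_def)
  moreover have "t \<in> G" using that by (auto simp: G_def)
  ultimately show ?thesis using g(3) dvd_diff[of "int g" "s + t" t] by simp
 qed
 have M0I: "quad_int p (int M0) 0 \<in> I" using M0(2) by (simp add: M_def)
 obtain m where m: "M0 = g * m" using gs[OF M0I] by (auto simp: int_dvd_int_iff elim!: dvdE)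
 have m0: "m > 0" using M0(1) m by (auto intro: Nat.gr0I)
 obtain s0 where s0: "quad_int p s0 (int g) \<in> I" using g(2) by (auto simp: G_def)
 obtain x0 where x0: "s0 = int g * x0" using gs[OF s0] by blast
 define x where "x = nat (x0 mod int m)"
 have xm: "int x = x0 mod int m" using m0 by (simp add: x_def)
 have iff: "quad_int p s t \<in> I \<longleftrightarrow> int g dvd t & int (g * m) dvd s - x0 * t" for s t
 proof
  assume st: "quad_int p s t \<in> I"
  hence "t \<in> G" by (auto simp: G_def)
  then obtain t' where t': "t = int g * t'" using g(3) by blast
  have "quad_int p (- t') 0 * quad_int p s0 (int g) \<in> I" by (rule mult[OF quad_int_in s0])
  from add[OF st this] have "quad_int p (s - t' * s0) 0 \<in> I" by (simp add: quad_int_mult quad_int_add t' mult.commute)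
  hence "int M0 dvd s - t' * s0" by (intro M0(3)) (simp add: M_def)
  also have "s - t' * s0 = s - x0 * t" by (simp add: t' x0)
  finally show "int g dvd t & int (g * m) dvd s - x0 * t" using t' m by simp
 next
  assume "int g dvd t & int (g * m) dvd s - x0 * t"
  then obtain t' c where t': "t = int g * t'" and c: "s - x0 * t = int (g * m) * c" by (auto elim!: dvdE)
  have "quad_int p c 0 * quad_int p (int M0) 0 + quad_int p t' 0 * quad_int p s0 (int g) \<in> I"
   by (intro add mult quad_int_in M0I s0)
  also have "quad_int p c 0 * quad_int p (int M0) 0 + quad_int p t' 0 * quad_int p s0 (int g) = quad_int p s t"
   unfolding quad_int_mult quad_int_add using c by (simp add: quad_int_eq_iff t' x0 m algebra_simps)
  finally show "quad_int p s t \<in> I" .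
 qed
 have iff': "int (g * m) dvd s - x0 * t \<longleftrightarrow> int (g * m) dvd s - int x * t" if gt: "int g dvd t" for s t
 proof -
  obtain t' where t': "t = int g * t'" using gt by blast
  have "(s - int x * t) - (s - x0 * t) = int g * t' * (x0 - x0 mod int m)" by (simp add: t' xm algebra_simps)
  also have "... = int (g * m) * (t' * (x0 div int m))" by (simp add: minus_mod_eq_mult_div algebra_simps)
  finally have eq: "s - int x * t = (s - x0 * t) + int (g * m) * (t' * (x0 div int m))" by simp
  show ?thesis unfolding eq by (rule dvd_add_left_iff[OF dvd_triv_left, symmetric])
 qed
 have "I = std_ideal p g m x"
 proof (rule Set.set_eqI)
  fix z
  show "z \<in> I \<longleftrightarrow> z \<in> std_ideal p g m x"
  proof (cases "z \<in> quad_order p")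
   case True
   then obtain s t where z: "z = quad_int p s t" by (auto simp: quad_order_def)
   show ?thesis unfolding z std_ideal_mem iff using iff' by blast
  qed (use IO std_ideal_subset in blast)
 qed
 moreover have "x \<in> quad_roots k m"
 proof -
  have "quad_int p (int (g * x)) (int g) \<in> I" unfolding \<open>I = std_ideal p g m x\<close> by (simp add: std_ideal_mem mult.commute)
  \<comment> \<open>The factor is the conjugate of x + omega, so the product with g (x + omega) is
    the integer g (x^2 + x + k).\<close>
  from mult[OF quad_int_in[of "int x + 1" "- 1"] this]
  have "quad_int p (int g * (int (x\<^sup>2 + x + k))) 0 \<in> I"
   by (simp add: quad_int_mult power2_eq_square algebra_simps)
  hence "int (g * m) dvd int g * (int (x\<^sup>2 + x + k))" unfolding iff by simp
  hence "int m dvd int (x\<^sup>2 + x + k)" using g(1) by (simp only: of_nat_mult dvd_mult_cancel_left) simp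
  hence "m dvd x\<^sup>2 + x + k" by (simp only: int_dvd_int_iff)
  moreover have "x < m" using m0 by (simp add: x_def nat_less_iff)
  ultimately show ?thesis by (simp add: quad_roots_def)
 qed
 ultimately show thesis using that g(1) by blast
qed

text \<open>One inclusion is multiplication of coordinates. For the other it is enough to test z
  against the generators g m and g (x + omega): the first gives divisibility by g, the second the
  congruence modulo g m.\<close>

lemma dual_norm_std:
 assumes g: "g > 0" and x: "x \<in> quad_roots k m"
 shows "dual_norm p (std_ideal p g m x) (real (g\<^sup>2 * m))"
proof -
 have m: "m > 0" using quad_roots_pos[OF x] by simp
 obtain e where e: "(int x)\<^sup>2 + int x + int k = int m * e" by (rule quad_roots_cofactor[OF x])
 have N0: "complex_of_real (real (g\<^sup>2 * m)) = of_int (int (g\<^sup>2 * m))" by simp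
 have scal: "of_int n * quad_int p s t = quad_int p (n * s) (n * t)" for n s t
  by (simp add: quad_int_def algebra_simps)
 have "z \<in> std_ideal p g m x \<longleftrightarrow> (\<forall>u\<in>std_ideal p g m x. \<exists>w\<in>quad_order p. z * cnj u = of_real (real (g\<^sup>2 * m)) * w)" for z
 proof
  assume "z \<in> std_ideal p g m x"
  then obtain s t where z: "z = quad_int p s t" "int g dvd t" "int (g * m) dvd s - int x * t" by (auto simp: std_ideal_def)
  show "\<forall>u\<in>std_ideal p g m x. \<exists>w\<in>quad_order p. z * cnj u = of_real (real (g\<^sup>2 * m)) * w"
  proof
   fix u assume "u \<in> std_ideal p g m x"
   then obtain s' t' where u: "u = quad_int p s' t'" "int g dvd t'" "int (g * m) dvd s' - int x * t'" by (auto simp: std_ideal_def)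
   obtain a c where a: "t = int g * a" and c: "s - int x * t = int (g * m) * c" using z by (auto elim!: dvdE)
   obtain b d where b: "t' = int g * b" and d: "s' - int x * t' = int (g * m) * d" using u by (auto elim!: dvdE)
   have s: "s = int g * (int x * a + int m * c)" using c a by (simp add: algebra_simps)
   have s': "s' = int g * (int x * b + int m * d)" using d b by (simp add: algebra_simps)
   have k': "int k = int m * e - (int x)\<^sup>2 - int x" using e by simp
   have "z * cnj u = quad_int p (s * (s' + t') + int k * t * t') (t * s' - s * t')"
    unfolding z(1) u(1) quad_int_cnj quad_int_mult by (simp add: quad_int_eq_iff algebra_simps)
   also have "... = of_int (int (g\<^sup>2 * m)) * quad_int p (a * b * e + int x * a * d + int x * c * b + int m * c * d + c * b) (a * d - c * b)"
    unfolding scal quad_int_eq_iff s s' a b k' by (simp add: power2_eq_square algebra_simps)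
   finally show "\<exists>w\<in>quad_order p. z * cnj u = of_real (real (g\<^sup>2 * m)) * w" unfolding N0 using quad_int_in by blast
  qed
 next
  assume A: "\<forall>u\<in>std_ideal p g m x. \<exists>w\<in>quad_order p. z * cnj u = of_real (real (g\<^sup>2 * m)) * w"
  have "quad_int p (int (g * m)) 0 \<in> std_ideal p g m x" by (simp add: std_ideal_mem)
  with A obtain w where w: "w \<in> quad_order p" "z * cnj (quad_int p (int (g * m)) 0) = of_real (real (g\<^sup>2 * m)) * w" by blast
  obtain a b where ab: "w = quad_int p a b" using w(1) by (auto simp: quad_order_def)
  have "of_nat (g * m) * z = of_nat (g * m) * (of_int (int g) * w)" using w(2) by (simp add: quad_int_of_int power2_eq_square mult_ac)
  hence "z = of_int (int g) * w" using g m by (simp only: mult_cancel_left of_nat_eq_0_iff) simp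
  hence z: "z = quad_int p (int g * a) (int g * b)" unfolding ab scal .
  have "quad_int p (int (g * x)) (int g) \<in> std_ideal p g m x" by (simp add: std_ideal_mem mult.commute)
  with A obtain w' where w': "w' \<in> quad_order p" "z * cnj (quad_int p (int (g * x)) (int g)) = of_real (real (g\<^sup>2 * m)) * w'" by blast
  obtain c d where cd: "w' = quad_int p c d" using w'(1) by (auto simp: quad_order_def)
  have "int g * b * int (g * x) - int g * a * int g = int (g\<^sup>2 * m) * d"
   using w'(2) unfolding z cd N0 scal quad_int_cnj quad_int_mult quad_int_eq_iff by (simp add: algebra_simps)
  hence "int g * int g * (int x * b - a) = int g * int g * (int m * d)" by (simp add: power2_eq_square algebra_simps)
  hence "int x * b - a = int m * d" using g by simp
  hence "- (int g * (int x * b - a)) = - (int g * (int m * d))" by (simp only:)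
  hence "int g * a - int x * (int g * b) = int (g * m) * (- d)" by (simp add: algebra_simps)
  thus "z \<in> std_ideal p g m x" unfolding z std_ideal_mem by (metis dvd_triv_left)
 qed
 moreover have "real (g\<^sup>2 * m) > 0" using g m by simp
 ultimately show ?thesis by (intro dual_normI)
qed

text \<open>A factor below 1 would produce nonzero elements of I of arbitrarily small absolute
  value, whereas nonzero elements of the order have absolute value at least 1.\<close>

lemma dual_norm_scale_ge:
 assumes I: "quad_ideal p I" and r: "r > 0" "!!z. z \<in> I ==> of_real r * z \<in> I"
 shows "r \<ge> 1"
proof (rule ccontr)
 assume "\<not> r \<ge> 1"
 hence r1: "r < 1" by simp
 obtain a where a: "a \<in> I" "a ~= 0" using I by (auto simp: quad_ideal_def)
 have an: "of_real r ^ n * a \<in> I" for n by (induction n) (use a r(2) in \<open>auto simp: mult.assoc\<close>)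
 have "1 \<le> r ^ n * norm a" for n
 proof -
  have "of_real r ^ n * a \<in> quad_order p" using an[of n] I by (auto simp: quad_ideal_def)
  moreover have "of_real r ^ n * a ~= 0" using a r by simp
  ultimately show ?thesis using quad_order_ge_1[of "of_real r ^ n * a"] r(1) by (simp add: norm_mult norm_power)
 qed
 moreover have "(%n. r ^ n * norm a) \<longlonglongrightarrow> 0 * norm a"
  by (intro tendsto_mult tendsto_const LIMSEQ_realpow_zero) (use r r1 in auto)
 ultimately have "1 \<le> 0 * norm a" by (intro LIMSEQ_le_const[of "%n. r ^ n * norm a"]) auto
 thus False by simp
qed

text \<open>Multiplication by N / N' maps I into itself, so this ratio is at least 1, and likewise
  its inverse.\<close>

lemma dual_norm_unique:
 assumes I: "quad_ideal p I" and N: "dual_norm p I N" "dual_norm p I N'"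
 shows "N = N'"
proof -
 have ge: "N \<ge> N'" if N: "dual_norm p I N" "dual_norm p I N'" for N N'
 proof -
  have pos: "N > 0" "N' > 0" using N by (auto simp: dual_norm_def)
  have "N / N' \<ge> 1"
  proof (rule dual_norm_scale_ge[OF I])
   fix z assume z: "z \<in> I"
   have "\<exists>w\<in>quad_order p. of_real (N / N') * z * cnj u = of_real N * w" if "u \<in> I" for u
   proof -
    obtain w where "w \<in> quad_order p" "z * cnj u = of_real N' * w" using N(2) z \<open>u \<in> I\<close> unfolding dual_norm_def by blast
    thus ?thesis using pos by (intro bexI[of _ w]) (simp_all add: mult.assoc)
   qed
   thus "of_real (N / N') * z \<in> I" using N(1) unfolding dual_norm_def by blast
  qed (use pos in simp)
  thus ?thesis using pos by simp
 qed
 show ?thesis using ge[OF N] ge[OF N(2,1)] by simp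
qed

lemma dual_norm_scale:
 assumes N: "dual_norm p I N" and d: "\<delta> ~= 0"
 shows "dual_norm p ((%z. \<delta> * z) ` I) ((norm \<delta>)\<^sup>2 * N)"
proof -
 have "z \<in> (%z. \<delta> * z) ` I \<longleftrightarrow> (\<forall>u\<in>(%z. \<delta> * z) ` I. \<exists>w\<in>quad_order p. z * cnj u = of_real ((norm \<delta>)\<^sup>2 * N) * w)" for z
 proof -
  have "z \<in> (%z. \<delta> * z) ` I \<longleftrightarrow> z / \<delta> \<in> I" using d by (force simp: image_iff)
  also have "... \<longleftrightarrow> (\<forall>u\<in>I. \<exists>w\<in>quad_order p. z / \<delta> * cnj u = of_real N * w)" using N unfolding dual_norm_def by blast
  also have "... \<longleftrightarrow> (\<forall>u\<in>I. \<exists>w\<in>quad_order p. z * cnj (\<delta> * u) = of_real ((norm \<delta>)\<^sup>2 * N) * w)"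
  proof -
   have "z / \<delta> * cnj u = of_real N * w \<longleftrightarrow> z * cnj (\<delta> * u) = of_real ((norm \<delta>)\<^sup>2 * N) * w" for u w
   proof -
    have "z * cnj (\<delta> * u) = (\<delta> * cnj \<delta>) * (z / \<delta> * cnj u)" using d by simp
    moreover have "of_real ((norm \<delta>)\<^sup>2 * N) * w = (\<delta> * cnj \<delta>) * (of_real N * w)"
     unfolding complex_norm_square[symmetric] by simp
    moreover have "\<delta> * cnj \<delta> ~= 0" using d by simp
    ultimately show ?thesis by (simp only: mult_cancel_left simp_thms)
   qed
   thus ?thesis by simp
  qed
  finally show ?thesis by (simp add: ball_simps)
 qed
 moreover have "(norm \<delta>)\<^sup>2 * N > 0" using N d by (simp add: dual_norm_def)
 ultimately show ?thesis by (intro dual_normI)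
qed

lemma dual_norm_cnj:
 assumes N: "dual_norm p I N"
 shows "dual_norm p (cnj ` I) N"
proof -
 have "z \<in> cnj ` I \<longleftrightarrow> (\<forall>u\<in>cnj ` I. \<exists>w\<in>quad_order p. z * cnj u = of_real N * w)" for z
 proof -
  have "z \<in> cnj ` I \<longleftrightarrow> cnj z \<in> I" by (metis (no_types) complex_cnj_cnj image_iff)
  also have "... \<longleftrightarrow> (\<forall>u\<in>I. \<exists>w\<in>quad_order p. cnj z * cnj u = of_real N * w)" using N unfolding dual_norm_def by blast
  also have "... \<longleftrightarrow> (\<forall>u\<in>I. \<exists>w\<in>quad_order p. z * u = of_real N * w)"
  proof (intro ball_cong refl iffI)
   fix u assume "\<exists>w\<in>quad_order p. cnj z * cnj u = of_real N * w"
   then obtain w where w: "w \<in> quad_order p" and w': "cnj z * cnj u = of_real N * w" by blast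
   from arg_cong[OF w', of cnj]
   show "\<exists>w\<in>quad_order p. z * u = of_real N * w" using quad_order_closed(4)[OF w] by (intro bexI[of _ "cnj w"]) auto
  next
   fix u assume "\<exists>w\<in>quad_order p. z * u = of_real N * w"
   then obtain w where w: "w \<in> quad_order p" and w': "z * u = of_real N * w" by blast
   from arg_cong[OF w', of cnj]
   show "\<exists>w\<in>quad_order p. cnj z * cnj u = of_real N * w" using quad_order_closed(4)[OF w] by (intro bexI[of _ "cnj w"]) auto
  qed
  finally show ?thesis by simp
 qed
 moreover have "N > 0" using N by (simp add: dual_norm_def)
 ultimately show ?thesis by (intro dual_normI)
qed

lemma quad_ideal_cnj:
 assumes "quad_ideal p I"
 shows "quad_ideal p (cnj ` I)"
 unfolding quad_ideal_def
proof (intro conjI ballI)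
 show "cnj ` I \<subseteq> quad_order p" using assms by (auto simp: quad_ideal_def intro: quad_order_closed)
 show "0 \<in> cnj ` I" using assms by (auto simp: quad_ideal_def image_iff intro!: bexI[of _ 0])
 show "cnj ` I ~= {0}"
 proof
  assume "cnj ` I = {0}"
  hence "cnj ` cnj ` I = cnj ` {0}" by simp
  hence "I = {0}" by (simp add: image_image)
  thus False using assms by (simp add: quad_ideal_def)
 qed
 fix x assume x: "x \<in> cnj ` I"
 show "x + y \<in> cnj ` I" if y: "y \<in> cnj ` I" for y
 proof -
  obtain a b where "a \<in> I" "b \<in> I" "x = cnj a" "y = cnj b" using x y by blast
  thus ?thesis using assms by (intro image_eqI[of _ _ "a + b"]) (auto simp: quad_ideal_def)
 qed
 fix r assume r: "r \<in> quad_order p"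
 obtain a where "a \<in> I" "x = cnj a" using x by blast
 thus "r * x \<in> cnj ` I" using assms quad_order_closed(4)[OF r] by (intro image_eqI[of _ _ "cnj r * a"]) (auto simp: quad_ideal_def)
qed

lemma quad_ideal_scale:
 assumes I: "quad_ideal p I" and d: "\<delta> ~= 0" and sub: "(%z. \<delta> * z) ` I \<subseteq> quad_order p"
 shows "quad_ideal p ((%z. \<delta> * z) ` I)"
 unfolding quad_ideal_def
proof (intro conjI ballI sub)
 show "0 \<in> (%z. \<delta> * z) ` I" using I by (auto simp: quad_ideal_def image_iff intro!: bexI[of _ 0])
 obtain a where "a \<in> I" "a ~= 0" using I by (auto simp: quad_ideal_def)
 hence "\<delta> * a \<in> (%z. \<delta> * z) ` I" "\<delta> * a ~= 0" using d by simp_all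
 thus "(%z. \<delta> * z) ` I ~= {0}" by blast
 fix x assume x: "x \<in> (%z. \<delta> * z) ` I"
 show "x + y \<in> (%z. \<delta> * z) ` I" if y: "y \<in> (%z. \<delta> * z) ` I" for y
 proof -
  obtain a b where "a \<in> I" "b \<in> I" "x = \<delta> * a" "y = \<delta> * b" using x y by blast
  thus ?thesis using I by (intro image_eqI[of _ _ "a + b"]) (auto simp: quad_ideal_def distrib_left)
 qed
 fix r assume r: "r \<in> quad_order p"
 obtain a where "a \<in> I" "x = \<delta> * a" using x by blast
 thus "r * x \<in> (%z. \<delta> * z) ` I" using I r by (intro image_eqI[of _ _ "r * a"]) (auto simp: quad_ideal_def mult.left_commute)
qed

text \<open>The form attached to an ideal is primitive because its discriminant \<open>- p\<close> is squarefree;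
 hence the norm is an integral combination of products \<open>z \<cdot> cnj u\<close>.\<close>

lemma quad_form_primitive:
 assumes x: "x \<in> quad_roots k m" and e: "(int x)\<^sup>2 + int x + int k = int m * e"
 obtains a b c :: int where "a * int m + b * (2 * int x + 1) + c * e = 1"
proof -
 define d where "d = gcd (gcd (int m) (2 * int x + 1)) e"
 have dg: "d dvd gcd (int m) (2 * int x + 1)" unfolding d_def by (rule gcd_dvd1)
 have d1: "d dvd int m" by (rule dvd_trans[OF dg gcd_dvd1])
 have d2: "d dvd 2 * int x + 1" by (rule dvd_trans[OF dg gcd_dvd2])
 have d3: "d dvd e" unfolding d_def by (rule gcd_dvd2)
 note d = d1 d2 d3
 have "int p = 4 * (int m * e) - (2 * int x + 1) * (2 * int x + 1)"
  using e k by (simp add: power2_eq_square algebra_simps)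
 moreover have "d * d dvd 4 * (int m * e)" by (rule dvd_mult[OF mult_dvd_mono[OF d1 d3]])
 moreover have "d * d dvd (2 * int x + 1) * (2 * int x + 1)" by (rule mult_dvd_mono[OF d2 d2])
 ultimately have "d * d dvd int p" by (simp only: dvd_diff)
 have "d \<ge> 0" unfolding d_def by simp
 have "d = 1"
 proof (rule ccontr)
  assume "d ~= 1"
  define n where "n = nat d"
  have dn: "d = int n" using \<open>d \<ge> 0\<close> by (simp add: n_def)
  have "int (n * n) dvd int p" using \<open>d * d dvd int p\<close> dn by simp
  hence nn: "n * n dvd p" by (simp only: int_dvd_int_iff)
  hence "n dvd p" by (rule dvd_mult_left)
  moreover have "n ~= 1" using \<open>d ~= 1\<close> dn by simp
  ultimately have "n = p" using p(1) unfolding prime_nat_iff by blast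
  hence "p * p \<le> p" using nn p0 by (auto dest: dvd_imp_le)
  thus False using prime_gt_1_nat[OF p(1)] by simp
 qed
 obtain u v where uv: "u * gcd (int m) (2 * int x + 1) + v * e = 1" using bezout_int[of "gcd (int m) (2 * int x + 1)" e] \<open>d = 1\<close> by (auto simp: d_def)
 obtain s t where st: "s * int m + t * (2 * int x + 1) = gcd (int m) (2 * int x + 1)" using bezout_int by blast
 have "(u * s) * int m + (u * t) * (2 * int x + 1) + v * e = 1"
  using uv unfolding st[symmetric] by (simp add: algebra_simps)
 thus thesis by (rule that)
qed

text \<open>The norm is an integral combination of products of the two generators with their
  conjugates. Multiplying this representation by u and dividing by the norm exhibits u as an element
  of the order.\<close>

lemma quad_ideal_multiplier:
 assumes I: "quad_ideal p I" and u: "!!z. z \<in> I ==> u * z \<in> I"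
 shows "u \<in> quad_order p"
proof -
 obtain g m x where g: "g > 0" and x: "x \<in> quad_roots k m" and Istd: "I = std_ideal p g m x" using quad_ideal_is_std[OF I] .
 have m: "m > 0" using quad_roots_pos[OF x] by simp
 obtain e where e: "(int x)\<^sup>2 + int x + int k = int m * e" by (rule quad_roots_cofactor[OF x])
 obtain a b c :: int where abc: "a * int m + b * (2 * int x + 1) + c * e = 1" using quad_form_primitive[OF x e] .
 define e1 e2 where "e1 = quad_int p (int (g * m)) 0" and "e2 = quad_int p (int (g * x)) (int g)"
 have eI: "e1 \<in> I" "e2 \<in> I" unfolding Istd e1_def e2_def by (simp_all add: std_ideal_mem mult.commute)
 define N where "N = complex_of_real (real (g\<^sup>2 * m))"
 have N0: "N ~= 0" using g m by (simp add: N_def)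
 have dn: "\<exists>w\<in>quad_order p. z * cnj v = N * w" if "z \<in> I" "v \<in> I" for z v
  using dual_norm_std[OF g x] that unfolding Istd[symmetric] dual_norm_def N_def by blast
 have scal: "of_int n * quad_int p s t = quad_int p (n * s) (n * t)" for n s t
  by (simp add: quad_int_def algebra_simps)
 obtain w1 w2 w3 w4 where w: "w1 \<in> quad_order p" "w2 \<in> quad_order p" "w3 \<in> quad_order p" "w4 \<in> quad_order p"
  "u * e1 * cnj e1 = N * w1" "u * e1 * cnj e2 = N * w2" "u * e2 * cnj e1 = N * w3" "u * e2 * cnj e2 = N * w4"
  using dn[OF u[OF eI(1)] eI(1)] dn[OF u[OF eI(1)] eI(2)] dn[OF u[OF eI(2)] eI(1)] dn[OF u[OF eI(2)] eI(2)] by blast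
 have k': "int k = int m * e - (int x)\<^sup>2 - int x" using e by simp
 \<comment> \<open>The products of the generators, with the mixed ones added, are N times m, 2x + 1
   and e: the coefficients of the primitive form.\<close>
 have comb: "of_int a * (e1 * cnj e1) + of_int b * (e1 * cnj e2 + e2 * cnj e1) + of_int c * (e2 * cnj e2) = N"
 proof -
  have "of_int a * (e1 * cnj e1) + of_int b * (e1 * cnj e2 + e2 * cnj e1) + of_int c * (e2 * cnj e2)
    = quad_int p (int (g\<^sup>2 * m) * (a * int m + b * (2 * int x + 1) + c * e)) 0"
   unfolding e1_def e2_def quad_int_cnj quad_int_mult quad_int_add scal quad_int_eq_iff k'
   by (simp add: power2_eq_square algebra_simps)
  thus ?thesis unfolding abc by (simp add: quad_int_of_int N_def)
 qed
 have "N * u = of_int a * (u * e1 * cnj e1) + of_int b * (u * e1 * cnj e2 + u * e2 * cnj e1) + of_int c * (u * e2 * cnj e2)"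
  unfolding comb[symmetric] by (simp add: algebra_simps)
 also have "... = N * (of_int a * w1 + of_int b * (w2 + w3) + of_int c * w4)"
  unfolding w by (simp add: algebra_simps)
 finally have "u = of_int a * w1 + of_int b * (w2 + w3) + of_int c * w4" using N0 by simp
 thus ?thesis using w by (auto intro!: quad_order_closed)
qed

text \<open>By uniqueness of the norm |u| = 1, and (2s + t)^2 + p t^2 = 4 leaves only t = 0 when p >
  3. For p = 3 there are six units; this is the origin of the restriction on p in the class number
  formula.\<close>

lemma quad_ideal_unit:
 assumes I: "quad_ideal p I" and u: "(%z. u * z) ` I = I" and p3: "p > 3"
 shows "u = 1 \<or> u = - 1"
proof -
 obtain g m x where g: "g > 0" and x: "x \<in> quad_roots k m" and Istd: "I = std_ideal p g m x" using quad_ideal_is_std[OF I] .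
 have "u \<in> quad_order p" by (rule quad_ideal_multiplier[OF I]) (use u in blast)
 then obtain s t where st: "u = quad_int p s t" by (auto simp: quad_order_def)
 have u0: "u ~= 0"
 proof
  assume "u = 0"
  hence "I \<subseteq> {0}" using u by auto
  thus False using I by (auto simp: quad_ideal_def)
 qed
 define N where "N = real (g\<^sup>2 * m)"
 have N: "dual_norm p I N" unfolding Istd N_def by (rule dual_norm_std[OF g x])
 have "dual_norm p I ((norm u)\<^sup>2 * N)" using dual_norm_scale[OF N u0] unfolding u .
 from dual_norm_unique[OF I this N] have "(norm u)\<^sup>2 = 1" using N by (simp add: dual_norm_def)
 hence "u * cnj u = 1" unfolding complex_norm_square[symmetric] by simp
 hence "s\<^sup>2 + s * t + int k * t\<^sup>2 = 1" unfolding st quad_int_norm by (metis of_int_1 of_int_eq_iff)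
 hence "(2 * s + t)\<^sup>2 + (4 * int k - 1) * t\<^sup>2 = 4" by (simp add: power2_eq_square algebra_simps)
 moreover have "4 * int k - 1 = int p" using k by linarith
 ultimately have e: "(2 * s + t)\<^sup>2 + int p * t\<^sup>2 = 4" by simp
 have t0: "t = 0"
 proof (rule ccontr)
  assume "t ~= 0"
  hence "0 < t\<^sup>2" by (simp only: zero_less_power2) simp
  hence "1 \<le> t\<^sup>2" by linarith
  hence "int p * 1 \<le> int p * t\<^sup>2" by (intro mult_left_mono) auto
  moreover have "p ~= 4" using p(2) by auto
  ultimately show False using e p3 zero_le_power2[of "2 * s + t"] by linarith
 qed
 hence "s\<^sup>2 = 1" using e by (simp add: power2_eq_square)
 hence "s = 1 \<or> s = - 1" by (simp add: power2_eq_1_iff)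
 thus ?thesis using t0 by (auto simp: st quad_int_of_int)
qed

end

section \<open>Ideal classes and the elements of given norm in their representatives\<close>

definition ideal_norm :: "nat => complex set => nat" where
 "ideal_norm p I = (THE n. dual_norm p I (real n))"

context prime_3_mod_4
begin

lemma dual_normD:
 assumes "dual_norm p I N" "z \<in> I" "u \<in> I"
 obtains w where "w \<in> quad_order p" "z * cnj u = of_real N * w"
 using assms unfolding dual_norm_def by blast

lemma dual_norm_memI:
 assumes "dual_norm p I N" "\<forall>u\<in>I. \<exists>w\<in>quad_order p. z * cnj u = of_real N * w"
 shows "z \<in> I"
 using assms unfolding dual_norm_def by blast

lemma ideal_norm_eq:
 assumes "quad_ideal p I" "dual_norm p I (real n)"
 shows "ideal_norm p I = n"
 unfolding ideal_norm_def
proof (rule the_equality)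
 fix n' assume "dual_norm p I (real n')"
 from dual_norm_unique[OF assms(1) this assms(2)] show "n' = n" by simp
qed (rule assms(2))

lemma ideal_norm_std: "g > 0 ==> x \<in> quad_roots k m ==> ideal_norm p (std_ideal p g m x) = g\<^sup>2 * m"
 by (intro ideal_norm_eq quad_ideal_std dual_norm_std)

lemma dual_norm_ideal_norm:
 assumes "quad_ideal p I"
 shows "dual_norm p I (real (ideal_norm p I))" "ideal_norm p I > 0"
proof -
 obtain g m x where s: "g > 0" "x \<in> quad_roots k m" "I = std_ideal p g m x" using quad_ideal_is_std[OF assms] .
 show "dual_norm p I (real (ideal_norm p I))" using dual_norm_std[OF s(1,2)] ideal_norm_std[OF s(1,2)] by (simp only: s(3))
 show "ideal_norm p I > 0" using s quad_roots_pos[OF s(2)] by (simp add: ideal_norm_std)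
qed

text \<open>The normal form puts the ideals of norm n in bijection with pairs (g, x), where x is a
  root modulo n / g^2.\<close>

lemma card_ideals_of_norm:
 assumes n: "n > 0"
 shows "finite {I. quad_ideal p I & ideal_norm p I = n}" "card {I. quad_ideal p I & ideal_norm p I = n} = ideal_count k n"
proof -
 define G where "G = {g \<in> {g. g dvd n}. g\<^sup>2 dvd n}"
 define S where "S = (SIGMA g:G. quad_roots k (n div g\<^sup>2))"
 define f where "f = (%(g, x). std_ideal p g (n div g\<^sup>2) x)"
 have fin: "finite {g. g dvd n}" using n by (simp add: finite_divisors_nat)
 have g0: "g > 0" if "g \<in> G" for g using that n by (auto simp: G_def intro: Nat.gr0I)
 have inj: "inj_on f S"
 proof (rule inj_onI)
  fix a b assume "a \<in> S" "b \<in> S" and fab: "f a = f b"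
  then obtain g x g' x' where a: "a = (g, x)" "g \<in> G" "x \<in> quad_roots k (n div g\<^sup>2)"
   and b: "b = (g', x')" "g' \<in> G" "x' \<in> quad_roots k (n div g'\<^sup>2)" by (auto simp: S_def)
  have "std_ideal p g (n div g\<^sup>2) x = std_ideal p g' (n div g'\<^sup>2) x'" using fab by (simp add: a b f_def)
  from std_ideal_unique[OF g0[OF a(2)] g0[OF b(2)] a(3) b(3) this] show "a = b" unfolding a b by simp
 qed
 have im: "f ` S = {I. quad_ideal p I & ideal_norm p I = n}"
 proof (intro equalityI subsetI)
  fix I assume "I \<in> f ` S"
  then obtain g x where I: "I = std_ideal p g (n div g\<^sup>2) x" "g \<in> G" "x \<in> quad_roots k (n div g\<^sup>2)" by (auto simp: S_def f_def)
  have "g\<^sup>2 * (n div g\<^sup>2) = n" using I(2) by (simp add: G_def)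
  thus "I \<in> {I. quad_ideal p I & ideal_norm p I = n}"
   using quad_ideal_std[OF g0[OF I(2)] I(3)] ideal_norm_std[OF g0[OF I(2)] I(3)] unfolding I(1) by simp
 next
  fix I assume "I \<in> {I. quad_ideal p I & ideal_norm p I = n}"
  hence I: "quad_ideal p I" "ideal_norm p I = n" by auto
  obtain g m x where s: "g > 0" "x \<in> quad_roots k m" "I = std_ideal p g m x" using quad_ideal_is_std[OF I(1)] .
  have nm: "n = g\<^sup>2 * m" using I(2) ideal_norm_std[OF s(1,2)] by (simp add: s(3))
  have d: "n div g\<^sup>2 = m" using nm s(1) by simp
  have "g\<^sup>2 dvd n" unfolding nm by simp
  moreover have "g dvd g\<^sup>2" by (simp add: power2_eq_square)
  ultimately have "g \<in> G" unfolding G_def using dvd_trans by blast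
  thus "I \<in> f ` S" unfolding S_def f_def using s d by (intro image_eqI[of _ _ "(g, x)"]) auto
 qed
 have finS: "finite S" unfolding S_def using fin by (intro finite_SigmaI) (auto simp: G_def)
 show "finite {I. quad_ideal p I & ideal_norm p I = n}" unfolding im[symmetric] using finS by simp
 have "card S = (\<Sum>g\<in>G. card (quad_roots k (n div g\<^sup>2)))" unfolding S_def by (rule card_SigmaI) (use fin in \<open>auto simp: G_def\<close>)
 also have "... = ideal_count k n" unfolding G_def ideal_count_def by (rule sum.inter_filter[OF fin])
 finally show "card {I. quad_ideal p I & ideal_norm p I = n} = ideal_count k n"
  unfolding im[symmetric] using inj by (simp add: card_image)
qed

abbreviation "cl \<equiv> ideal_class_rel (quadratic_field (- int p))"
abbreviation "ideals \<equiv> nonzero_ideals (quadratic_field (- int p))"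

lemma class_relI:
 assumes "quad_ideal p I" "quad_ideal p J" "a \<in> quad_order p" "b \<in> quad_order p" "a ~= 0" "b ~= 0"
  and "(%z. a * z) ` I = (%z. b * z) ` J"
 shows "(I, J) \<in> cl"
 unfolding ideal_class_rel_iff using assms by blast

lemma class_relE:
 assumes "(I, J) \<in> cl"
 obtains a b where "quad_ideal p I" "quad_ideal p J" "a \<in> quad_order p" "b \<in> quad_order p" "a ~= 0" "b ~= 0"
  "(%z. a * z) ` I = (%z. b * z) ` J"
 using assms unfolding ideal_class_rel_iff by blast

lemma equiv_class_rel: "equiv ideals cl"
proof (rule equivI)
 show "cl \<subseteq> ideals \<times> ideals" by (auto simp: ideal_class_rel_def)
 show "refl_on ideals cl" by (rule refl_onI) (auto simp: nonzero_ideals_iff intro!: class_relI[where a = 1 and b = 1])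
 show "sym cl"
 proof (rule symI)
  fix I J assume "(I, J) \<in> cl"
  then obtain a b where I: "quad_ideal p I" "quad_ideal p J"
   and O: "a \<in> quad_order p" "b \<in> quad_order p" "a ~= 0" "b ~= 0" and e: "(%z. a * z) ` I = (%z. b * z) ` J"
   unfolding ideal_class_rel_iff by blast
  show "(J, I) \<in> cl" by (rule class_relI[OF I(2,1) O(2,1,4,3) e[symmetric]])
 qed
 show "trans cl"
 proof (rule transI)
  fix I J L assume "(I, J) \<in> cl" "(J, L) \<in> cl"
  then have IJ: "(I, J) \<in> cl" and JL: "(J, L) \<in> cl" .
  obtain a b where ab: "quad_ideal p I" "quad_ideal p J" "a \<in> quad_order p" "b \<in> quad_order p" "a ~= 0" "b ~= 0"
   and e1: "(%z. a * z) ` I = (%z. b * z) ` J" using class_relE[OF IJ] .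
  obtain c d where cd: "quad_ideal p J" "quad_ideal p L" "c \<in> quad_order p" "d \<in> quad_order p" "c ~= 0" "d ~= 0"
   and e2: "(%z. c * z) ` J = (%z. d * z) ` L" using class_relE[OF JL] .
  have "(%z. (c * a) * z) ` I = (%z. c * z) ` (%z. a * z) ` I" by (simp add: image_image mult.assoc)
  also have "... = (%z. b * z) ` (%z. c * z) ` J" unfolding e1 by (simp add: image_image mult.left_commute)
  also have "... = (%z. (b * d) * z) ` L" unfolding e2 by (simp add: image_image mult.assoc)
  finally have "(%z. (c * a) * z) ` I = (%z. (b * d) * z) ` L" .
  from class_relI[OF ab(1) cd(2) quad_order_closed(3)[OF cd(3) ab(3)] quad_order_closed(3)[OF ab(4) cd(4)] _ _ this]
  show "(I, L) \<in> cl" using ab(5,6) cd(5,6) by simp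
 qed
qed

text \<open>Reduction theory for ideals: scaling by a shortest vector gives an equivalent ideal
  whose shortest vector is an integer, namely its own norm. Comparing this with the elements g m and
  s' + omega gives g = 1 and 4 m^2 \<le> m^2 + p.\<close>

lemma class_has_reduced:
 assumes I: "quad_ideal p I"
 obtains m x where "m \<le> p" "x \<in> quad_roots k m" "(I, std_ideal p 1 m x) \<in> cl"
proof -
 define N where "N = ideal_norm p I"
 have N: "dual_norm p I (real N)" "N > 0" using dual_norm_ideal_norm[OF I] by (auto simp: N_def)
 have IO: "z \<in> quad_order p" if "z \<in> I" for z using that I by (auto simp: quad_ideal_def)
 define P where "P = (%n :: nat. \<exists>\<alpha>\<in>I. \<alpha> ~= 0 & \<alpha> * cnj \<alpha> = of_nat n)"
 have exP: "\<exists>n. P n"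
 proof -
  obtain a where a: "a \<in> I" "a ~= 0" using I by (auto simp: quad_ideal_def)
  obtain n :: nat where n: "a * cnj a = of_nat n" using quad_order_norm[OF IO[OF a(1)]] .
  show ?thesis unfolding P_def by (intro exI[of _ n] bexI[of _ a] conjI a n)
 qed
 define n where "n = (LEAST n. P n)"
 have "P n" unfolding n_def by (rule LeastI_ex[OF exP])
 then obtain \<alpha> where \<alpha>: "\<alpha> \<in> I" "\<alpha> ~= 0" "\<alpha> * cnj \<alpha> = of_nat n" unfolding P_def by (elim bexE conjE)
 have least: "n \<le> l" if "P l" for l unfolding n_def using that by (rule Least_le)
 have n\<alpha>: "(norm \<alpha>)\<^sup>2 = real n" using arg_cong[OF \<alpha>(3), of Re] unfolding complex_norm_square[symmetric] by simp
 have small: "real n \<le> (norm z)\<^sup>2" if zI: "z \<in> I" "z ~= 0" for z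
 proof -
  obtain l :: nat where l: "z * cnj z = of_nat l" using quad_order_norm[OF IO[OF zI(1)]] .
  have "(norm z)\<^sup>2 = real l" using arg_cong[OF l, of Re] unfolding complex_norm_square[symmetric] by simp
  moreover have "P l" unfolding P_def by (intro bexI[of _ z] conjI zI l)
  ultimately show ?thesis using least[of l] by simp
 qed
 \<comment> \<open>By the duality in \<open>dual_norm\<close> this factor maps I into the order, and
   it maps \<alpha> itself to the rational number |\<alpha>|^2 / N, the norm of the new
   ideal.\<close>
 define \<delta> where "\<delta> = cnj \<alpha> / of_nat N"
 have d0: "\<delta> ~= 0" using \<alpha> N by (simp add: \<delta>_def)
 have d2: "(norm \<delta>)\<^sup>2 = real n / (real N)\<^sup>2" using n\<alpha> by (simp add: \<delta>_def norm_divide power_divide)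
 define J where "J = (%z. \<delta> * z) ` I"
 have "(%z. \<delta> * z) ` I \<subseteq> quad_order p"
 proof
  fix y assume "y \<in> (%z. \<delta> * z) ` I"
  then obtain z where z: "z \<in> I" "y = \<delta> * z" by blast
  obtain w where w: "w \<in> quad_order p" "z * cnj \<alpha> = of_real (real N) * w" using dual_normD[OF N(1) z(1) \<alpha>(1)] .
  have "y = w" using w(2) N(2) by (simp add: z(2) \<delta>_def field_simps)
  thus "y \<in> quad_order p" using w by simp
 qed
 from quad_ideal_scale[OF I d0 this] have J: "quad_ideal p J" by (simp add: J_def)
 obtain g m x where s: "g > 0" "x \<in> quad_roots k m" "J = std_ideal p g m x" using quad_ideal_is_std[OF J] .
 have m0: "m > 0" using quad_roots_pos[OF s(2)] by simp
 have "dual_norm p J ((norm \<delta>)\<^sup>2 * real N)" unfolding J_def by (rule dual_norm_scale[OF N(1) d0])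
 from dual_norm_unique[OF J this] dual_norm_std[OF s(1,2)] have gm: "real n / real N = real (g\<^sup>2 * m)"
  unfolding d2 s(3) using N(2) by (simp add: power2_eq_square)
 have big: "real (g\<^sup>2 * m) ^ 2 \<le> (norm y)\<^sup>2" if y: "y \<in> J" "y ~= 0" for y
 proof -
  obtain z where z: "z \<in> I" "y = \<delta> * z" using y unfolding J_def by blast
  have "real (g\<^sup>2 * m) ^ 2 = (norm \<delta>)\<^sup>2 * real n" unfolding gm[symmetric] d2 by (simp add: power2_eq_square)
  also have "... \<le> (norm \<delta>)\<^sup>2 * (norm z)\<^sup>2" by (intro mult_left_mono small) (use z y in auto)
  finally show ?thesis by (simp add: z(2) norm_mult power_mult_distrib)
 qed
 \<comment> \<open>The integer g m lies in J, but nothing nonzero in J is shorter than g^2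
   m.\<close>
 have "quad_int p (int (g * m)) 0 \<in> J" unfolding s(3) std_ideal_mem by simp
 from big[OF this] have "real (g\<^sup>2 * m) ^ 2 \<le> (real (g * m))\<^sup>2" using s(1) m0 by (simp add: quad_int_of_int norm_mult)
 hence "g\<^sup>2 * m \<le> g * m" by (simp only: of_nat_power[symmetric] of_nat_le_iff power2_nat_le_eq_le)
 hence "g \<le> 1" using m0 s(1) by (simp add: power2_eq_square)
 hence g1: "g = 1" using s(1) by simp
 \<comment> \<open>The representative of x modulo m that makes |2 s' + 1| at most m.\<close>
 define s' where "s' = (if 2 * x + 1 \<le> m then int x else int x - int m)"
 have "quad_int p s' 1 \<in> J" unfolding s(3) std_ideal_mem g1 s'_def by auto
 moreover have "quad_int p s' 1 ~= 0" using quad_int_eq_iff[of s' 1 0 0] by (simp add: quad_int_of_int)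
 ultimately have b: "real m ^ 2 \<le> (norm (quad_int p s' 1))\<^sup>2" using big g1 by simp
 have "(norm (quad_int p s' 1))\<^sup>2 = real_of_int (s'\<^sup>2 + s' * 1 + int k * 1\<^sup>2)"
  using arg_cong[OF quad_int_norm[of s' 1], of Re] unfolding complex_norm_square[symmetric] by (simp only: Re_complex_of_real complex_Re_of_int)
 hence "real_of_int (int m ^ 2) \<le> real_of_int (s'\<^sup>2 + s' * 1 + int k * 1\<^sup>2)" using b by (simp only: of_int_power of_int_of_nat_eq)
 hence "int m ^ 2 \<le> s'\<^sup>2 + s' + int k" by (simp only: of_int_le_iff) simp
 hence "4 * (int m)\<^sup>2 \<le> (2 * s' + 1)\<^sup>2 + int p" using k by (simp add: power2_eq_square algebra_simps)
 moreover have "(2 * s' + 1)\<^sup>2 \<le> (int m)\<^sup>2"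
 proof -
  have "\<bar>2 * s' + 1\<bar> \<le> int m" using quad_roots_pos(2)[OF s(2)] by (auto simp: s'_def)
  thus ?thesis using abs_le_square_iff[of "2 * s' + 1" "int m"] by simp
 qed
 moreover have "int m \<le> (int m)\<^sup>2" using m0 by (simp add: power2_eq_square)
 ultimately have mp: "m \<le> p" using zero_le_power2[of "int m"] by linarith
 have "(%z. cnj \<alpha> * z) ` I = (%z. of_nat N * z) ` J"
  unfolding J_def image_image \<delta>_def using N(2) by (simp add: field_simps)
 from class_relI[OF I J quad_order_closed(4)[OF IO[OF \<alpha>(1)]] quad_order_simps(3)[of N] _ _ this]
 have "(I, J) \<in> cl" using \<alpha>(2) N(2) by simp
 thus thesis using that[OF mp s(2)] s(3) g1 by simp
qed

text \<open>Finiteness permits summation over the classes, and it guards against \<open>card\<close>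
  being 0 on an infinite set.\<close>

lemma finite_classes: "finite (ideals // cl)"
proof -
 have "ideals // cl \<subseteq> (%(m, x). cl `` {std_ideal p 1 m x}) ` (SIGMA m:{..p}. quad_roots k m)"
 proof
  fix X assume "X \<in> ideals // cl"
  then obtain I where I: "quad_ideal p I" "X = cl `` {I}" by (auto simp: quotient_def nonzero_ideals_iff)
  obtain m x where mx: "m \<le> p" "x \<in> quad_roots k m" "(I, std_ideal p 1 m x) \<in> cl" using class_has_reduced[OF I(1)] .
  have "X = cl `` {std_ideal p 1 m x}" unfolding I(2) by (rule equiv_class_eq[OF equiv_class_rel mx(3)])
  thus "X \<in> (%(m, x). cl `` {std_ideal p 1 m x}) ` (SIGMA m:{..p}. quad_roots k m)"
   using mx by (intro image_eqI[of _ _ "(m, x)"]) auto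
 qed
 thus ?thesis by (rule finite_subset) auto
qed

definition class_rep :: "complex set set => complex set" where
 "class_rep X = (SOME I. I \<in> X)"

lemma class_rep:
 assumes "X \<in> ideals // cl"
 shows "quad_ideal p (class_rep X)" "X = cl `` {class_rep X}"
proof -
 obtain I where I: "I \<in> ideals" "X = cl `` {I}" using assms by (auto simp: quotient_def)
 have "I \<in> X" unfolding I(2) by (rule equiv_class_self[OF equiv_class_rel I(1)])
 hence "class_rep X \<in> X" unfolding class_rep_def by (rule someI)
 hence r: "(I, class_rep X) \<in> cl" unfolding I(2) by blast
 thus "quad_ideal p (class_rep X)" by (simp add: ideal_class_rel_iff)
 show "X = cl `` {class_rep X}" unfolding I(2) using equiv_class_eq[OF equiv_class_rel r] I(2) by simp
qed

definition norm_elements :: "complex set => nat => complex set" where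
 "norm_elements I n = {\<alpha>\<in>I. \<alpha> * cnj \<alpha> = of_nat (n * ideal_norm p I)}"

text \<open>Since conj(I) is N times the inverse of I, this is the integral ideal \<alpha>
  I^(-1).\<close>

definition ideal_quotient :: "complex set => complex => complex set" where
 "ideal_quotient I \<alpha> = (%z. \<alpha> / of_nat (ideal_norm p I) * z) ` cnj ` I"

text \<open>The conjugate of the quotient lies in the class of I, so the quotient remembers the
  class from which it was formed.\<close>

lemma ideal_quotient:
 assumes I: "quad_ideal p I" and n: "n > 0" and \<alpha>: "\<alpha> \<in> norm_elements I n"
 shows "quad_ideal p (ideal_quotient I \<alpha>)" "ideal_norm p (ideal_quotient I \<alpha>) = n" "(I, cnj ` ideal_quotient I \<alpha>) \<in> cl" "\<alpha> ~= 0"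
proof -
 define N where "N = ideal_norm p I"
 have N: "dual_norm p I (real N)" "N > 0" using dual_norm_ideal_norm[OF I] by (auto simp: N_def)
 have a: "\<alpha> \<in> I" "\<alpha> * cnj \<alpha> = of_nat (n * N)" using \<alpha> by (auto simp: norm_elements_def N_def)
 show a0: "\<alpha> ~= 0"
 proof
  assume "\<alpha> = 0"
  hence "of_nat (n * N) = (0 :: complex)" using a(2) by simp
  thus False using n N(2) by (simp only: of_nat_eq_0_iff) simp
 qed
 have na: "(norm \<alpha>)\<^sup>2 = real (n * N)" using arg_cong[OF a(2), of Re] unfolding complex_norm_square[symmetric] by simp
 define \<delta> where "\<delta> = \<alpha> / of_nat N"
 have d0: "\<delta> ~= 0" using a0 N by (simp add: \<delta>_def)
 have d2: "(norm \<delta>)\<^sup>2 * real N = real n" using na N(2) by (simp add: \<delta>_def norm_divide power_divide power2_eq_square)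
 have Jd: "ideal_quotient I \<alpha> = (%z. \<delta> * z) ` cnj ` I" by (simp add: ideal_quotient_def \<delta>_def N_def)
 have sub: "(%z. \<delta> * z) ` cnj ` I \<subseteq> quad_order p"
 proof
  fix y assume "y \<in> (%z. \<delta> * z) ` cnj ` I"
  then obtain z where z: "z \<in> I" "y = \<delta> * cnj z" by blast
  obtain w where w: "w \<in> quad_order p" "\<alpha> * cnj z = of_real (real N) * w" using dual_normD[OF N(1) a(1) z(1)] .
  have "y = w" using w(2) N(2) by (simp add: z(2) \<delta>_def field_simps)
  thus "y \<in> quad_order p" using w by simp
 qed
 show J: "quad_ideal p (ideal_quotient I \<alpha>)" unfolding Jd by (rule quad_ideal_scale[OF quad_ideal_cnj[OF I] d0 sub])
 have "dual_norm p (ideal_quotient I \<alpha>) (real n)"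
  using dual_norm_scale[OF dual_norm_cnj[OF N(1)] d0] unfolding Jd d2 .
 thus "ideal_norm p (ideal_quotient I \<alpha>) = n" by (rule ideal_norm_eq[OF J])
 have "(%z. cnj \<alpha> * z) ` I = (%z. of_nat N * z) ` cnj ` ideal_quotient I \<alpha>"
  unfolding Jd image_image \<delta>_def using N(2) by (simp add: field_simps)
 moreover have "\<alpha> \<in> quad_order p" using a(1) I by (auto simp: quad_ideal_def)
 ultimately show "(I, cnj ` ideal_quotient I \<alpha>) \<in> cl"
  using class_relI[OF I quad_ideal_cnj[OF J] quad_order_closed(4) quad_order_simps(3)[of N]] a0 N(2) by simp
qed

lemma ideal_quotient_surj:
 assumes J: "quad_ideal p J" "ideal_norm p J = n" "n > 0"
 obtains X \<alpha> where "X \<in> ideals // cl" "\<alpha> \<in> norm_elements (class_rep X) n" "ideal_quotient (class_rep X) \<alpha> = J"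
proof -
 define X where "X = cl `` {cnj ` J}"
 have Jc: "quad_ideal p (cnj ` J)" by (rule quad_ideal_cnj[OF J(1)])
 have X: "X \<in> ideals // cl" unfolding X_def by (rule quotientI) (simp add: nonzero_ideals_iff Jc)
 define R where "R = class_rep X"
 have R: "quad_ideal p R" "X = cl `` {R}" using class_rep[OF X] by (auto simp: R_def)
 have "(cnj ` J, R) \<in> cl" using R X_def equiv_class_self[OF equiv_class_rel, of R] by (auto simp: nonzero_ideals_iff)
 then obtain a b where ab: "a \<in> quad_order p" "b \<in> quad_order p" "a ~= 0" "b ~= 0" "(%z. a * z) ` cnj ` J = (%z. b * z) ` R"
  unfolding ideal_class_rel_iff by blast
 define N where "N = ideal_norm p R"
 have N: "dual_norm p R (real N)" "N > 0" using dual_norm_ideal_norm[OF R(1)] by (auto simp: N_def)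
 \<comment> \<open>Conjugating a conj(J) = b R gives J = \<delta> conj(R); comparison with the form
   of \<open>ideal_quotient\<close> dictates \<alpha> = N \<delta>.\<close>
 define \<delta> where "\<delta> = cnj b / cnj a"
 have d0: "\<delta> ~= 0" using ab by (simp add: \<delta>_def)
 define \<alpha> where "\<alpha> = of_nat N * \<delta>"
 have Jd: "J = (%z. \<delta> * z) ` cnj ` R"
 proof -
  have "cnj ` (%z. a * z) ` cnj ` J = cnj ` (%z. b * z) ` R" unfolding ab(5) ..
  hence e: "(%z. cnj a * z) ` J = (%z. cnj b * cnj z) ` R" by (simp add: image_image)
  have "J = (%z. z / cnj a) ` (%z. cnj a * z) ` J" using ab(3) by (simp add: image_image)
  thus ?thesis unfolding e by (simp add: image_image \<delta>_def)
 qed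
 have aN: "\<alpha> / of_nat N = \<delta>" using N(2) by (simp add: \<alpha>_def)
 have "\<forall>u\<in>R. \<exists>w\<in>quad_order p. \<alpha> * cnj u = of_real (real N) * w"
 proof
  fix u assume u: "u \<in> R"
  have "\<delta> * cnj u \<in> J" unfolding Jd using u by blast
  hence "\<delta> * cnj u \<in> quad_order p" using J(1) by (auto simp: quad_ideal_def)
  thus "\<exists>w\<in>quad_order p. \<alpha> * cnj u = of_real (real N) * w" by (intro bexI[of _ "\<delta> * cnj u"]) (simp_all add: \<alpha>_def mult.assoc)
 qed
 hence aR: "\<alpha> \<in> R" by (rule dual_norm_memI[OF N(1)])
 have "dual_norm p J ((norm \<delta>)\<^sup>2 * real N)" unfolding Jd by (rule dual_norm_scale[OF dual_norm_cnj[OF N(1)] d0])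
 hence dn: "(norm \<delta>)\<^sup>2 * real N = real n" using dual_norm_unique[OF J(1)] dual_norm_ideal_norm(1)[OF J(1)] J(2) by simp
 have "(norm \<alpha>)\<^sup>2 = real (n * N)" using dn by (simp add: \<alpha>_def norm_mult power_mult_distrib power2_eq_square mult_ac)
 hence "\<alpha> * cnj \<alpha> = of_nat (n * N)" unfolding complex_norm_square[symmetric] by (simp only: of_real_of_nat_eq)
 hence "\<alpha> \<in> norm_elements R n" using aR by (simp add: norm_elements_def N_def)
 moreover have "ideal_quotient R \<alpha> = J" unfolding ideal_quotient_def N_def[symmetric] aN by (rule Jd[symmetric])
 ultimately show thesis using that X R_def by blast
qed

lemma ideal_uminus: "quad_ideal p I ==> z \<in> I ==> - z \<in> I"
proof -
 assume "quad_ideal p I" "z \<in> I"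
 moreover have "- 1 \<in> quad_order p" using quad_order_uminus[OF quad_order_simps(2)] .
 ultimately have "- 1 * z \<in> I" unfolding quad_ideal_def by blast
 thus "- z \<in> I" by simp
qed

lemma ideal_quotient_uminus:
 assumes I: "quad_ideal p I" and \<alpha>: "\<alpha> \<in> norm_elements I n"
 shows "- \<alpha> \<in> norm_elements I n" "ideal_quotient I (- \<alpha>) = ideal_quotient I \<alpha>"
proof -
 show "- \<alpha> \<in> norm_elements I n" using \<alpha> ideal_uminus[OF I] by (simp add: norm_elements_def)
 have "uminus ` I = I"
 proof (intro equalityI subsetI)
  fix z assume "z \<in> I"
  thus "z \<in> uminus ` I" using ideal_uminus[OF I] by (intro image_eqI[of _ _ "- z"]) auto
 qed (use ideal_uminus[OF I] in auto)
 hence "ideal_quotient I (- \<alpha>) = (%z. - \<alpha> / of_nat (ideal_norm p I) * z) ` cnj ` uminus ` I" unfolding ideal_quotient_def by simp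
 thus "ideal_quotient I (- \<alpha>) = ideal_quotient I \<alpha>" by (simp add: ideal_quotient_def image_image)
qed

lemma ideal_quotient_inj:
 assumes p3: "p > 3" and I: "quad_ideal p I" and n: "n > 0" and \<alpha>: "\<alpha> \<in> norm_elements I n" "\<beta> \<in> norm_elements I n"
  and e: "ideal_quotient I \<alpha> = ideal_quotient I \<beta>"
 shows "\<beta> = \<alpha> \<or> \<beta> = - \<alpha>"
proof -
 define N where "N = ideal_norm p I"
 have N: "N > 0" using dual_norm_ideal_norm[OF I] by (auto simp: N_def)
 have a0: "\<alpha> ~= 0" by (rule ideal_quotient(4)[OF I n \<alpha>(1)])
 have "(%z. \<beta> / \<alpha> * z) ` cnj ` I = (%z. of_nat N / \<alpha> * z) ` ideal_quotient I \<beta>"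
  using N by (simp add: ideal_quotient_def image_image N_def)
 also have "... = cnj ` I" unfolding e[symmetric] using N a0 by (simp add: ideal_quotient_def image_image N_def)
 finally have "(%z. \<beta> / \<alpha> * z) ` cnj ` I = cnj ` I" .
 from quad_ideal_unit[OF quad_ideal_cnj[OF I] this p3] show ?thesis using a0 by (auto simp: field_simps)
qed

text \<open>Each ideal of norm n is \<alpha> R^(-1) for the representative R of exactly one class
  and for exactly two elements, \<alpha> and -\<alpha>, the only units being 1 and -1.\<close>

theorem card_norm_elements:
 assumes p3: "p > 3" and n: "n > 0"
 shows "(\<Sum>X\<in>ideals // cl. card (norm_elements (class_rep X) n)) = 2 * ideal_count k n"
proof -
 define S where "S = (SIGMA X:ideals // cl. norm_elements (class_rep X) n)"
 define Id where "Id = {I. quad_ideal p I & ideal_norm p I = n}"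
 have "\<forall>J\<in>Id. \<exists>w. w \<in> S & ideal_quotient (class_rep (fst w)) (snd w) = J"
 proof
  fix J assume "J \<in> Id"
  hence J: "quad_ideal p J" "ideal_norm p J = n" by (auto simp: Id_def)
  obtain X \<alpha> where "X \<in> ideals // cl" "\<alpha> \<in> norm_elements (class_rep X) n" "ideal_quotient (class_rep X) \<alpha> = J"
   using ideal_quotient_surj[OF J n] .
  thus "\<exists>w. w \<in> S & ideal_quotient (class_rep (fst w)) (snd w) = J" by (intro exI[of _ "(X, \<alpha>)"]) (simp add: S_def)
 qed
 then obtain f where f: "!!J. J \<in> Id ==> f J \<in> S" "!!J. J \<in> Id ==> ideal_quotient (class_rep (fst (f J))) (snd (f J)) = J"
  by metis
 \<comment> \<open>The Boolean selects one of the two elements that give the ideal J.\<close>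
 define h where "h = (%(J, s :: bool). (fst (f J), if s then snd (f J) else - snd (f J)))"
 have hq: "ideal_quotient (class_rep (fst (h (J, s)))) (snd (h (J, s))) = J" "h (J, s) \<in> S" if J: "J \<in> Id" for J s
 proof -
  obtain X \<alpha> where w: "f J = (X, \<alpha>)" by (cases "f J")
  have X: "X \<in> ideals // cl" and \<alpha>: "\<alpha> \<in> norm_elements (class_rep X) n" using f(1)[OF J] by (auto simp: w S_def)
  note m = ideal_quotient_uminus[OF class_rep(1)[OF X] \<alpha>]
  show "ideal_quotient (class_rep (fst (h (J, s)))) (snd (h (J, s))) = J" using f(2)[OF J] m by (simp add: h_def w)
  show "h (J, s) \<in> S" using X \<alpha> m by (simp add: h_def w S_def)
 qed
 have inj: "inj_on h (Id \<times> UNIV)"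
 proof (rule inj_onI)
  fix u v assume uv: "u \<in> Id \<times> UNIV" "v \<in> Id \<times> UNIV" "h u = h v"
  obtain J s where u: "u = (J, s)" by (cases u)
  obtain J' s' where v: "v = (J', s')" by (cases v)
  have JJ: "J \<in> Id" "J' \<in> Id" using uv u v by auto
  have "J = J'" using hq(1)[OF JJ(1), of s] hq(1)[OF JJ(2), of s'] uv(3) by (simp add: u v)
  moreover have "s = s'"
  proof -
   obtain X \<alpha> where w: "f J = (X, \<alpha>)" by (cases "f J")
   have X: "X \<in> ideals // cl" and \<alpha>: "\<alpha> \<in> norm_elements (class_rep X) n" using f(1)[OF JJ(1)] by (auto simp: w S_def)
   have "\<alpha> ~= 0" by (rule ideal_quotient(4)[OF class_rep(1)[OF X] n \<alpha>])
   hence "\<alpha> ~= - \<alpha>" by simp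
   thus ?thesis using uv(3) unfolding u v \<open>J = J'\<close>[symmetric] by (auto simp: h_def w split: if_splits)
  qed
  ultimately show "u = v" by (simp add: u v)
 qed
 have im: "h ` (Id \<times> UNIV) = S"
 proof (intro equalityI subsetI)
  fix w assume "w \<in> h ` (Id \<times> UNIV)"
  thus "w \<in> S" using hq(2) by auto
 next
  fix w assume w: "w \<in> S"
  obtain X \<alpha> where wX: "w = (X, \<alpha>)" by (cases w)
  have X: "X \<in> ideals // cl" and \<alpha>: "\<alpha> \<in> norm_elements (class_rep X) n" using w by (auto simp: wX S_def)
  define J where "J = ideal_quotient (class_rep X) \<alpha>"
  note q = ideal_quotient[OF class_rep(1)[OF X] n \<alpha>, folded J_def]
  have J: "J \<in> Id" using q by (simp add: Id_def)
  obtain Y \<beta> where v: "f J = (Y, \<beta>)" by (cases "f J")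
  have Y: "Y \<in> ideals // cl" and \<beta>: "\<beta> \<in> norm_elements (class_rep Y) n" and JY: "ideal_quotient (class_rep Y) \<beta> = J"
   using f[OF J] by (auto simp: v S_def)
  note q' = ideal_quotient[OF class_rep(1)[OF Y] n \<beta>, unfolded JY]
  \<comment> \<open>J determines the class through its conjugate, so the chosen preimage of J has
    the same first component as w.\<close>
  have "X = cl `` {cnj ` J}" using class_rep(2)[OF X] equiv_class_eq[OF equiv_class_rel q(3)] by simp
  moreover have "Y = cl `` {cnj ` J}" using class_rep(2)[OF Y] equiv_class_eq[OF equiv_class_rel q'(3)] by simp
  ultimately have XY: "Y = X" by simp
  have "\<alpha> = \<beta> \<or> \<alpha> = - \<beta>"
   by (rule ideal_quotient_inj[OF p3 class_rep(1)[OF X] n \<beta>[unfolded XY] \<alpha>]) (use JY in \<open>simp add: XY J_def\<close>)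
  hence "w = h (J, True) \<or> w = h (J, False)" by (auto simp: h_def v wX XY)
  thus "w \<in> h ` (Id \<times> UNIV)" using J by auto
 qed
 have Id: "finite Id" "card Id = ideal_count k n" unfolding Id_def by (rule card_ideals_of_norm[OF n])+
 have S: "finite S" "card S = 2 * ideal_count k n"
  unfolding im[symmetric] card_image[OF inj] using Id by (simp_all add: card_cartesian_product)
 have "finite (norm_elements (class_rep X) n)" if "X \<in> ideals // cl" for X
 proof (rule finite_subset[OF _ finite_imageI[OF S(1), of snd]])
  show "norm_elements (class_rep X) n \<subseteq> snd ` S"
  proof
   fix a assume "a \<in> norm_elements (class_rep X) n"
   thus "a \<in> snd ` S" unfolding S_def using that by (intro image_eqI[of _ _ "(X, a)"]) auto
  qed
 qed
 hence "card S = (\<Sum>X\<in>ideals // cl. card (norm_elements (class_rep X) n))"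
  unfolding S_def by (intro card_SigmaI finite_classes) auto
 thus ?thesis using S(2) by simp
qed

text \<open>In coordinates along the two generators the norm form is N times the form (m, 2x + 1,
  e), of discriminant -p.\<close>

lemma norm_elements_form:
 assumes "quad_ideal p I"
 obtains A B C where "A > 0" "4 * A * C - B\<^sup>2 > 0" "!!n. card (norm_elements I n) = card {z. bqf A B C z = int n}"
proof -
 obtain g m x where g: "g > 0" and x: "x \<in> quad_roots k m" and I: "I = std_ideal p g m x" using quad_ideal_is_std[OF assms] .
 have m: "m > 0" using quad_roots_pos[OF x] by simp
 obtain e where e: "(int x)\<^sup>2 + int x + int k = int m * e" by (rule quad_roots_cofactor[OF x])
 have k': "int k = int m * e - (int x)\<^sup>2 - int x" using e by simp
 define N where "N = g\<^sup>2 * m"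
 have N: "ideal_norm p I = N" "N > 0" using ideal_norm_std[OF g x] g m by (auto simp: I N_def)
 define Q where "Q = bqf (int m) (2 * int x + 1) e"
 define f where "f = (%(v, u). quad_int p (int g * (u * int m + v * int x)) (int g * v))"
 have nf: "f (v, u) * cnj (f (v, u)) = of_int (int N * Q (v, u))" for v u
  unfolding f_def case_prod_conv quad_int_norm k' by (simp add: Q_def N_def bqf_def power2_eq_square algebra_simps)
 have inj: "inj f"
 proof (rule injI)
  fix z w assume "f z = f w"
  moreover obtain v u where z: "z = (v, u)" by (cases z)
  moreover obtain v' u' where w: "w = (v', u')" by (cases w)
  ultimately have "int g * v = int g * v'" "int g * (u * int m + v * int x) = int g * (u' * int m + v' * int x)"
   by (auto simp: f_def quad_int_eq_iff)
  hence "v = v'" "u * int m + v * int x = u' * int m + v' * int x" using g by simp_all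
  thus "z = w" using m by (simp add: z w)
 qed
 have card: "card (norm_elements I n) = card {z. Q z = int n}" for n
 proof -
  have "norm_elements I n = f ` {z. Q z = int n}"
  proof (intro equalityI subsetI)
   fix a assume a: "a \<in> norm_elements I n"
   then obtain s t where st: "a = quad_int p s t" "int g dvd t" "int (g * m) dvd s - int x * t"
    by (auto simp: norm_elements_def I std_ideal_def)
   obtain v c where v: "t = int g * v" and c: "s - int x * t = int (g * m) * c" using st by (auto elim!: dvdE)
   have "s = int g * (c * int m + v * int x)" using c v by (simp add: algebra_simps)
   hence af: "a = f (v, c)" by (simp add: st(1) f_def v)
   have "of_int (int N * Q (v, c)) = (of_int (int (n * N)) :: complex)"
    using a unfolding nf[symmetric] af[symmetric] by (simp add: norm_elements_def N)
   hence "int N * Q (v, c) = int N * int n" by (simp only: of_int_eq_iff) (simp add: mult.commute)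
   hence "Q (v, c) = int n" using N(2) by simp
   thus "a \<in> f ` {z. Q z = int n}" using af by blast
  next
   fix a assume "a \<in> f ` {z. Q z = int n}"
   then obtain v u where a: "a = f (v, u)" "Q (v, u) = int n" by auto
   have "int g * (u * int m + v * int x) - int x * (int g * v) = int (g * m) * u" by (simp add: algebra_simps)
   hence "a \<in> I" unfolding a(1) f_def case_prod_conv I std_ideal_mem by (metis dvd_triv_left)
   moreover have "a * cnj a = of_nat (n * N)" unfolding a(1) nf a(2) by (simp add: mult.commute)
   ultimately show "a \<in> norm_elements I n" by (simp add: norm_elements_def N)
  qed
  thus ?thesis using inj by (simp add: card_image inj_on_subset)
 qed
 show thesis
 proof (rule that[of "int m" e "2 * int x + 1"])
  show "int m > 0" using m by simp
  have "4 * int m * e - (2 * int x + 1)\<^sup>2 = 4 * (int m * e) - (2 * int x + 1)\<^sup>2" by simp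
  also have "... = int p" unfolding e[symmetric] using k by (simp add: power2_eq_square algebra_simps)
  finally show "4 * int m * e - (2 * int x + 1)\<^sup>2 > 0" using p0 by simp
 qed (use card in \<open>simp add: Q_def\<close>)
qed

lemma card_norm_elements_0:
 assumes "quad_ideal p I"
 shows "card (norm_elements I 0) = 1"
proof -
 have "norm_elements I 0 = {0}" using assms by (auto simp: norm_elements_def quad_ideal_def)
 thus ?thesis by simp
qed

end

section \<open>Lambert series, Dirichlet's class number formula and Mordell's congruence\<close>

text \<open>Both series rearrange the absolutely convergent double sum of f(d) y^(de), grouped once
  by the product d e and once by d.\<close>

lemma lambert_series:
 fixes f :: "nat => real"
 assumes f: "!!d. \<bar>f d\<bar> \<le> 1" and y: "0 < y" "y < 1"
 obtains S where "(%n. (\<Sum>d | d dvd Suc n. f d) * y ^ Suc n) sums S"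
  "(%d. f (Suc d) * (y ^ Suc d / (1 - y ^ Suc d))) sums S"
proof -
 define F where "F = (%(d, e). f (Suc d) * y ^ (Suc d * Suc e))"
 have prod: "(%(d, e). y ^ d * y ^ e) summable_on (UNIV :: (nat \<times> nat) set)"
 proof (rule nonneg_bdd_above_summable_on)
  show "bdd_above (sum (%(d, e). y ^ d * y ^ e) ` {G. G \<subseteq> (UNIV :: (nat \<times> nat) set) & finite G})"
  proof (intro bdd_aboveI2)
   fix G :: "(nat \<times> nat) set" assume "G \<in> {G. G \<subseteq> UNIV & finite G}"
   hence G: "finite G" by simp
   have geo: "sum (%d. y ^ d) A \<le> 1 / (1 - y)" if "finite A" for A
   proof -
    have "sum (%d. y ^ d) A \<le> (\<Sum>d. y ^ d)" using that y by (intro sum_le_suminf summable_geometric) auto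
    thus ?thesis using y by (simp add: suminf_geometric)
   qed
   have "(\<Sum>(d, e)\<in>G. y ^ d * y ^ e) \<le> (\<Sum>(d, e)\<in>fst ` G \<times> snd ` G. y ^ d * y ^ e)"
    using G y by (intro sum_mono2) (force, force, auto)
   also have "... = sum (%d. y ^ d) (fst ` G) * sum (%d. y ^ d) (snd ` G)"
    by (simp add: sum_product sum.cartesian_product)
   also have "... \<le> 1 / (1 - y) * (1 / (1 - y))"
    using G y by (intro mult_mono geo) (auto intro: sum_nonneg)
   finally show "sum (%(d, e). y ^ d * y ^ e) G \<le> 1 / (1 - y) * (1 / (1 - y))" .
  qed
 qed (use y in auto)
 have F: "F summable_on UNIV"
 proof (rule abs_summable_summable, rule summable_on_comparison_test[OF prod])
  fix z :: "nat \<times> nat"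
  obtain d e where z: "z = (d, e)" by (cases z)
  have "\<bar>f (Suc d)\<bar> * y ^ (Suc d * Suc e) \<le> 1 * y ^ (d + e)"
   using y by (intro mult_mono f power_decreasing) auto
  thus "norm (F z) \<le> (case z of (d, e) => y ^ d * y ^ e)"
   using y by (simp add: z F_def abs_mult power_add)
 qed simp
 define S where "S = infsum F UNIV"
 have "(%d. f (Suc d) * (y ^ Suc d / (1 - y ^ Suc d))) sums S"
 proof -
  have sm: "(%(d, e). f (Suc d) * y ^ (Suc d * Suc e)) summable_on (SIGMA d:UNIV. UNIV)"
   using F by (simp add: F_def)
  have inner: "(\<Sum>\<^sub>\<infinity>e. f (Suc d) * y ^ (Suc d * Suc e)) = f (Suc d) * (y ^ Suc d / (1 - y ^ Suc d))" for d
  proof -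
   define w where "w = y ^ Suc d"
   have w: "0 < w" "w < 1" using y unfolding w_def by (auto simp: power_less_one_iff simp del: power_Suc)
   have e1: "y ^ (Suc d * Suc e) = w * w ^ e" for e unfolding w_def by (simp only: power_mult power_Suc)
   have "(%e. f (Suc d) * (w * w ^ e)) sums (f (Suc d) * (w * (1 / (1 - w))))"
    using w by (intro sums_mult geometric_sums) auto
   moreover have "summable (%e. norm (f (Suc d) * (w * w ^ e)))"
    unfolding norm_mult norm_power using w by (intro summable_mult summable_geometric) auto
   ultimately have "(\<Sum>\<^sub>\<infinity>e. f (Suc d) * (w * w ^ e)) = f (Suc d) * (w * (1 / (1 - w)))"
    by (intro infsumI norm_summable_imp_has_sum)
   thus ?thesis unfolding e1 w_def by simp
  qed
  have "S = (\<Sum>\<^sub>\<infinity>d. f (Suc d) * (y ^ Suc d / (1 - y ^ Suc d)))"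
   using infsum_Sigma'_banach[OF sm] unfolding inner by (simp add: S_def F_def)
  moreover have "(%d. f (Suc d) * (y ^ Suc d / (1 - y ^ Suc d))) summable_on UNIV"
   using summable_on_Sigma_banach[OF sm] unfolding inner .
  ultimately show ?thesis by (simp only:) (intro has_sum_imp_sums has_sum_infsum)
 qed
 moreover have "(%n. (\<Sum>d | d dvd Suc n. f d) * y ^ Suc n) sums S"
 proof -
  define D where "D = (%n. {d. Suc d dvd Suc n})"
  define \<phi> where "\<phi> = (%(n, d). (d, Suc n div Suc d - 1))"
  have bij: "bij_betw \<phi> (SIGMA n:UNIV. D n) UNIV"
  proof (rule bij_betw_byWitness[of _ "%(d, e). (Suc d * Suc e - 1, d)"])
   show "\<forall>a\<in>SIGMA n:UNIV. D n. (case \<phi> a of (d, e) => (Suc d * Suc e - 1, d)) = a"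
   proof
    fix a assume "a \<in> (SIGMA n:UNIV. D n)"
    then obtain n d where a: "a = (n, d)" "Suc d dvd Suc n" by (auto simp: D_def)
    have "Suc n div Suc d > 0" using dvd_imp_le[OF a(2) zero_less_Suc] by (simp add: div_greater_zero_iff)
    hence "Suc d * Suc (Suc n div Suc d - 1) = Suc n" using a(2) by (simp only: Suc_pred' dvd_mult_div_cancel Suc_diff_1)
    thus "(case \<phi> a of (d, e) => (Suc d * Suc e - 1, d)) = a" unfolding a \<phi>_def by simp
   qed
   show "\<forall>a'\<in>UNIV. \<phi> (case a' of (d, e) => (Suc d * Suc e - 1, d)) = a'"
   proof
    fix a' :: "nat \<times> nat"
    obtain d e where a: "a' = (d, e)" by (cases a')
    have "Suc (Suc d * Suc e - 1) = Suc d * Suc e" by simp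
    hence "Suc (Suc d * Suc e - 1) div Suc d = Suc e" by (simp only: nonzero_mult_div_cancel_left nat.distinct simp_thms)
    thus "\<phi> (case a' of (d, e) => (Suc d * Suc e - 1, d)) = a'" unfolding a \<phi>_def by simp
   qed
   show "(%(d, e). (Suc d * Suc e - 1, d)) ` UNIV \<subseteq> (SIGMA n:UNIV. D n)"
   proof
    fix z assume "z \<in> (%(d, e). (Suc d * Suc e - 1, d)) ` UNIV"
    then obtain d e where z: "z = (Suc d * Suc e - 1, d)" by auto
    have "Suc (Suc d * Suc e - 1) = Suc d * Suc e" by simp
    thus "z \<in> (SIGMA n:UNIV. D n)" unfolding z D_def by (simp only: mem_Sigma_iff UNIV_I mem_Collect_eq dvd_triv_left simp_thms)
   qed
  qed simp
  have Fphi: "F (\<phi> (n, d)) = f (Suc d) * y ^ Suc n" if "d \<in> D n" for n d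
  proof -
   have "Suc d dvd Suc n" using that by (simp add: D_def)
   moreover from dvd_imp_le[OF this zero_less_Suc] have "Suc n div Suc d > 0" by (simp add: div_greater_zero_iff)
   ultimately have "Suc d * Suc (Suc n div Suc d - 1) = Suc n" by (simp only: Suc_pred' dvd_mult_div_cancel Suc_diff_1)
   thus ?thesis unfolding F_def \<phi>_def case_prod_conv by (simp only:)
  qed
  have sm0: "(%z. F (\<phi> z)) summable_on (SIGMA n:UNIV. D n)"
   using summable_on_reindex_bij_betw[OF bij, of F] F by simp
  hence sm: "(%(n, d). F (\<phi> (n, d))) summable_on (SIGMA n:UNIV. D n)" by (simp add: case_prod_unfold)
  have inner: "(\<Sum>\<^sub>\<infinity>d\<in>D n. F (\<phi> (n, d))) = (\<Sum>d | d dvd Suc n. f d) * y ^ Suc n" for n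
  proof -
   have "d \<le> n" if "d \<in> D n" for d
   proof -
    have "Suc d dvd Suc n" using that by (simp only: D_def mem_Collect_eq)
    from dvd_imp_le[OF this zero_less_Suc] show ?thesis by simp
   qed
   hence "D n \<subseteq> {..n}" by (intro subsetI) (simp only: atMost_iff)
   hence fin: "finite (D n)" by (rule finite_subset) simp
   have im: "{d. d dvd Suc n} = Suc ` D n"
   proof (intro equalityI subsetI)
    fix d assume "d \<in> {d. d dvd Suc n}"
    thus "d \<in> Suc ` D n" by (cases d) (auto simp: D_def)
   qed (auto simp: D_def)
   have "(\<Sum>\<^sub>\<infinity>d\<in>D n. F (\<phi> (n, d))) = (\<Sum>d\<in>D n. F (\<phi> (n, d)))" using fin by simp
   also have "... = (\<Sum>d\<in>D n. f (Suc d) * y ^ Suc n)" by (rule sum.cong[OF refl Fphi])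
   also have "... = (\<Sum>d | d dvd Suc n. f d) * y ^ Suc n"
    unfolding im by (simp add: sum.reindex sum_distrib_right)
   finally show ?thesis .
  qed
  have "S = (\<Sum>\<^sub>\<infinity>n. (\<Sum>d | d dvd Suc n. f d) * y ^ Suc n)"
  proof -
   have "S = (\<Sum>\<^sub>\<infinity>z\<in>(SIGMA n:UNIV. D n). F (\<phi> z))" unfolding S_def by (rule infsum_reindex_bij_betw[OF bij, symmetric])
   also have "... = (\<Sum>\<^sub>\<infinity>(n, d)\<in>(SIGMA n:UNIV. D n). F (\<phi> (n, d)))" by (simp add: case_prod_unfold)
   finally show ?thesis unfolding infsum_Sigma'_banach[OF sm, symmetric] inner .
  qed
  moreover have "(%n. (\<Sum>d | d dvd Suc n. f d) * y ^ Suc n) summable_on UNIV"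
   using summable_on_Sigma_banach[OF sm] unfolding inner .
  ultimately show ?thesis by (simp only:) (intro has_sum_imp_sums has_sum_infsum)
 qed
 ultimately show thesis using that by blast
qed

lemma Legendre_cong: "[a = b] (mod q) ==> Legendre a q = Legendre b q"
proof -
 assume ab: "[a = b] (mod q)"
 have "[a = 0] (mod q) \<longleftrightarrow> [b = 0] (mod q)" "QuadRes q a \<longleftrightarrow> QuadRes q b"
  unfolding QuadRes_def using ab cong_trans cong_sym by blast+
 thus ?thesis by (simp add: Legendre_def)
qed

context
 fixes p k :: nat
 assumes p: "prime p" "p mod 4 = 3" and k: "4 * k = p + 1"
begin

lemma Legendre_reflect:
 assumes "0 < a" "a < p"
 shows "Legendre (int (p - a)) (int p) = - Legendre (int a) (int p)"
proof -
 have "[int (p - a) = - int a] (mod int p)" using assms by (simp add: of_nat_diff cong_iff_dvd_diff)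
 hence "Legendre (int (p - a)) (int p) = Legendre (- int a) (int p)" by (rule Legendre_cong)
 also have "... = - Legendre (int a) (int p)"
  by (rule Legendre_neg_one[OF p k]) (use assms in \<open>auto dest: dvd_imp_le\<close>)
 finally show ?thesis .
qed

lemma Legendre_p_zero: "Legendre (int p) (int p) = 0"
 by (simp add: Legendre_def cong_0_iff)

lemma p_half: "p = 2 * (2 * k - 1) + 1" "2 * k - 1 < p" "k > 0"
 using k p(2) by auto

lemma sum_halves: "(\<Sum>a=1..p. f a) = (\<Sum>a=1..2 * k - 1. f a) + (\<Sum>a=1..2 * k - 1. f (p - a)) + (f p :: int)"
proof -
 have "{1..p} = {1..2 * k - 1} \<union> {2 * k..p - 1} \<union> {p}" using p_half by auto
 moreover have "(\<Sum>a\<in>{1..2 * k - 1} \<union> {2 * k..p - 1} \<union> {p}. f a) = (\<Sum>a\<in>{1..2 * k - 1} \<union> {2 * k..p - 1}. f a) + sum f {p}"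
  by (rule sum.union_disjoint) (use p_half in auto)
 moreover have "(\<Sum>a\<in>{1..2 * k - 1} \<union> {2 * k..p - 1}. f a) = (\<Sum>a=1..2 * k - 1. f a) + (\<Sum>a\<in>{2 * k..p - 1}. f a)"
  by (rule sum.union_disjoint) (use p_half in auto)
 moreover have "(\<Sum>a\<in>{2 * k..p - 1}. f a) = (\<Sum>a=1..2 * k - 1. f (p - a))"
  by (rule sum.reindex_bij_witness[of _ "%a. p - a" "%a. p - a"]) (use p_half in auto)
 ultimately show ?thesis by simp
qed

text \<open>The odd numbers below p are p - 2b. Together with the reflection of the Legendre symbol
  this gives an evaluation of the character sum independent of the one from
  \<open>sum_halves\<close>.\<close>

lemma sum_parity: "(\<Sum>a=1..p. f a) = (\<Sum>b=1..2 * k - 1. f (2 * b)) + (\<Sum>b=1..2 * k - 1. f (p - 2 * b)) + (f p :: int)"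
proof -
 have "{1..p} = {a\<in>{1..p - 1}. even a} \<union> {a\<in>{1..p - 1}. odd a} \<union> {p}" using p_half by auto
 moreover have "(\<Sum>a\<in>{a\<in>{1..p - 1}. even a} \<union> {a\<in>{1..p - 1}. odd a} \<union> {p}. f a)
   = (\<Sum>a\<in>{a\<in>{1..p - 1}. even a} \<union> {a\<in>{1..p - 1}. odd a}. f a) + sum f {p}"
  by (rule sum.union_disjoint) (use p_half in auto)
 moreover have "(\<Sum>a\<in>{a\<in>{1..p - 1}. even a} \<union> {a\<in>{1..p - 1}. odd a}. f a)
   = (\<Sum>a\<in>{a\<in>{1..p - 1}. even a}. f a) + (\<Sum>a\<in>{a\<in>{1..p - 1}. odd a}. f a)"
  by (rule sum.union_disjoint) auto
 moreover have "(\<Sum>a\<in>{a\<in>{1..p - 1}. even a}. f a) = (\<Sum>b=1..2 * k - 1. f (2 * b))"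
  by (rule sum.reindex_bij_witness[of _ "%b. 2 * b" "%a. a div 2"]) (use p_half in \<open>auto elim!: evenE\<close>)
 moreover have "(\<Sum>a\<in>{a\<in>{1..p - 1}. odd a}. f a) = (\<Sum>b=1..2 * k - 1. f (p - 2 * b))"
  by (rule sum.reindex_bij_witness[of _ "%b. p - 2 * b" "%a. (p - a) div 2"]) (use p_half in \<open>auto elim!: oddE simp: diff_mult_distrib2[symmetric]\<close>)
 ultimately show ?thesis by simp
qed

lemma Legendre_sum_zero: "(\<Sum>a=1..p. Legendre (int a) (int p)) = 0"
proof -
 have "(\<Sum>a=1..2 * k - 1. Legendre (int (p - a)) (int p)) = (\<Sum>a=1..2 * k - 1. - Legendre (int a) (int p))"
  by (rule sum.cong[OF refl], rule Legendre_reflect) (use p_half in auto)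
 thus ?thesis unfolding sum_halves Legendre_p_zero by (simp add: sum_negf)
qed

text \<open>Mordell's argument. Two evaluations of the character sum give (2 - (2/p)) h as the sum
  of the symbols up to (p - 1)/2, which ties h to the parity of the number M of nonresidues there.
  By Wilson the factorial squares to 1, so it is 1 or -1; its Legendre symbol (-1)^M tells which,
  because -1 is a nonresidue.\<close>

theorem half_factorial_class_number:
 fixes h :: nat
 assumes h: "int h * int p = - (\<Sum>a=1..p. int a * Legendre (int a) (int p))"
 shows "odd h" "[int (fact ((p - 1) div 2)) = (- 1) ^ ((h + 1) div 2)] (mod int p)"
proof -
 define X where "X = (%a. Legendre (int a) (int p))"
 define n where "n = 2 * k - 1"
 have n: "p = 2 * n + 1" "n < p" using p_half by (auto simp: n_def)
 hence n_half: "n = (p - 1) div 2" by simp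
 have p2: "p > 2" using p prime_ge_2_nat[of p] by (cases "p = 2") auto
 define S T W where "S = (\<Sum>a=1..p. int a * X a)" and "T = (\<Sum>a=1..n. X a)" and "W = (\<Sum>a=1..n. int a * X a)"
 have refl': "X (p - a) = - X a" if "a \<in> {1..p - 1}" for a unfolding X_def by (rule Legendre_reflect) (use that in auto)
 have Xp: "X p = 0" by (simp add: X_def Legendre_p_zero)
 have S1: "S = 2 * W - int p * T"
 proof -
  have "(\<Sum>a=1..n. int (p - a) * X (p - a)) = (\<Sum>a=1..n. int a * X a - int p * X a)"
  proof (rule sum.cong[OF refl])
   fix a assume a: "a \<in> {1..n}"
   have "X (p - a) = - X a" by (rule refl') (use a n in simp)
   moreover have "int (p - a) = int p - int a" using a n by (simp add: of_nat_diff)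
   ultimately show "int (p - a) * X (p - a) = int a * X a - int p * X a" by (simp only:) (simp add: algebra_simps)
  qed
  thus ?thesis unfolding S_def sum_halves[folded n_def] Xp W_def T_def by (simp add: sum_subtractf sum_distrib_left)
 qed
 define \<epsilon> where "\<epsilon> = X 2"
 have eps: "\<epsilon> = (- 1) ^ k" unfolding \<epsilon>_def X_def using Legendre_2_cong[OF p k] by simp
 have X2: "X (2 * b) = \<epsilon> * X b" for b using Legendre_mult[OF p(1) p2, of 2 "int b"] by (simp add: X_def \<epsilon>_def)
 have S2: "S = \<epsilon> * (4 * W - int p * T)"
 proof -
  have "(\<Sum>b=1..n. int (2 * b) * X (2 * b)) = (\<Sum>b=1..n. \<epsilon> * (2 * (int b * X b)))"
   unfolding X2 by (rule sum.cong[OF refl]) simp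
  moreover have "(\<Sum>b=1..n. int (p - 2 * b) * X (p - 2 * b)) = (\<Sum>b=1..n. \<epsilon> * (2 * (int b * X b) - int p * X b))"
  proof (rule sum.cong[OF refl])
   fix b assume b: "b \<in> {1..n}"
   have "X (p - 2 * b) = - X (2 * b)" by (rule refl') (use b n in simp)
   hence "X (p - 2 * b) = - (\<epsilon> * X b)" by (simp only: X2)
   moreover have "int (p - 2 * b) = int p - 2 * int b" using b n by (simp add: of_nat_diff)
   ultimately show "int (p - 2 * b) * X (p - 2 * b) = \<epsilon> * (2 * (int b * X b) - int p * X b)" by (simp add: algebra_simps)
  qed
  ultimately show ?thesis unfolding S_def sum_parity[folded n_def] Xp W_def T_def
   by (simp only: sum_distrib_left[symmetric] sum_subtractf) (simp add: algebra_simps)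
 qed
 have hS: "S = - (int h * int p)" using h by (simp add: S_def X_def)
 have ee: "\<epsilon> * \<epsilon> = 1" unfolding eps by (simp add: power_mult_distrib[symmetric])
 have eS: "\<epsilon> * S = 4 * W - int p * T" unfolding S2 mult.assoc[symmetric] ee by simp
 \<comment> \<open>The first evaluation gives 2 S and the second \<epsilon> S, both with the term 4
   W, which drops out of the difference.\<close>
 have "(2 - \<epsilon>) * S = 2 * S - \<epsilon> * S" by (rule left_diff_distrib)
 hence "(2 - \<epsilon>) * S = - (int p * T)" using eS S1 by linarith
 hence "int p * ((2 - \<epsilon>) * int h) = int p * T" unfolding hS by (simp add: algebra_simps)
 hence hT: "(2 - \<epsilon>) * int h = T" using p2 by simp
 define M where "M = card {a\<in>{1..n}. X a = - 1}"
 have Xv: "X a = 1 \<or> X a = - 1" if "a \<in> {1..n}" for a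
 proof -
  have "\<not> p dvd a" using that n by (auto dest: dvd_imp_le)
  hence "\<not> [int a = 0] (mod int p)" by (simp add: cong_0_iff)
  thus ?thesis by (simp add: X_def Legendre_def)
 qed
 have TM: "T = int n - 2 * int M"
 proof -
  have "T = (\<Sum>a=1..n. 1 - 2 * (if X a = - 1 then 1 else 0))"
   unfolding T_def by (rule sum.cong[OF refl]) (use Xv in fastforce)
  also have "... = int n - 2 * (\<Sum>a=1..n. if X a = - 1 then 1 else 0)" by (simp add: sum_subtractf sum_distrib_left)
  also have "(\<Sum>a=1..n. if X a = - 1 then 1 else (0 :: int)) = int M"
   unfolding M_def by (simp add: sum.inter_filter[symmetric])
  finally show ?thesis .
 qed
 have nk: "int n = 2 * int k - 1" using p_half by (simp add: n_def of_nat_diff)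
 \<comment> \<open>With n = 2k - 1 and \<epsilon> = (-1)^k the relation (2 - \<epsilon>) h = n - 2 M
   is linear in each parity of k, and it is read modulo 4.\<close>
 have par: "odd h & (even ((h + 1) div 2) \<longleftrightarrow> even M)"
 proof (cases "even k")
  case True
  hence e: "int h = 2 * int k - 1 - 2 * int M" using hT TM nk eps by simp
  have "even (int k)" using True by simp
  thus ?thesis using e by presburger
 next
  case False
  hence e: "3 * int h = 2 * int k - 1 - 2 * int M" using hT TM nk eps by simp
  have "odd (int k)" using False by simp
  thus ?thesis using e by presburger
 qed
 thus "odd h" by simp
 have sgn: "(- 1 :: int) ^ ((h + 1) div 2) = (- 1) ^ M" using par by (simp only: minus_one_power_iff)
 define F where "F = int (fact n)"
 have XF: "Legendre F (int p) = (- 1) ^ M"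
 proof -
  have "X (fact j) = (\<Prod>a=1..j. X a)" for j
  proof (induction j)
   case 0
   have "X 1 * X 1 = X 1" using Legendre_mult[OF p(1) p2, of 1 1] by (simp add: X_def)
   moreover have "X 1 * X 1 = 1" unfolding X_def by (rule Legendre_mult_self) (use p2 in \<open>simp add: cong_0_iff\<close>)
   ultimately have "X 1 = 1" by (simp only:)
   thus ?case by simp
  next
   case (Suc j)
   have "fact (Suc j) = Suc j * (fact j :: nat)" by simp
   hence "X (fact (Suc j)) = X (Suc j) * X (fact j)" unfolding X_def by (simp only: of_nat_mult Legendre_mult[OF p(1) p2])
   thus ?case using Suc by simp
  qed
  hence "Legendre F (int p) = (\<Prod>a=1..n. X a)" by (simp add: F_def X_def)
  also have "... = (\<Prod>a=1..n. if X a = - 1 then - 1 else 1)" by (rule prod.cong[OF refl]) (use Xv in fastforce)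
  also have "... = (- 1) ^ M" unfolding M_def by (simp add: prod.inter_filter[symmetric])
  finally show ?thesis .
 qed
 have F2: "[F * F = 1] (mod int p)"
 proof -
  have e1: "fact (p - 1) = (fact n :: int) * (\<Prod>a=1..n. int (p - a))"
  proof -
   have "(fact (p - 1) :: int) = (\<Prod>a=1..p - 1. int a)" by (simp add: fact_prod)
   also have "{1..p - 1} = {1..n} \<union> {n + 1..p - 1}" using n by auto
   also have "(\<Prod>a\<in>{1..n} \<union> {n + 1..p - 1}. int a) = (\<Prod>a=1..n. int a) * (\<Prod>a\<in>{n + 1..p - 1}. int a)"
    by (rule prod.union_disjoint) auto
   also have "(\<Prod>a\<in>{n + 1..p - 1}. int a) = (\<Prod>a=1..n. int (p - a))"
    by (rule prod.reindex_bij_witness[of _ "%a. p - a" "%a. p - a"]) (use n in auto)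
   finally show ?thesis by (simp add: fact_prod)
  qed
  have c1: "[(\<Prod>a=1..n. int (p - a)) = (\<Prod>a=1..n. - int a)] (mod int p)"
   by (rule cong_prod) (use n in \<open>simp add: of_nat_diff cong_iff_dvd_diff\<close>)
  have e2: "(\<Prod>a=1..n. - int a) = - F"
  proof -
   have "odd n" unfolding n_def using p_half(3) by simp
   hence "(\<Prod>a=1..n. - int a) = - (\<Prod>a=1..n. int a)" by (simp add: prod_uminus)
   thus ?thesis by (simp add: F_def fact_prod)
  qed
  have "fact (p - 1) = F * (\<Prod>a=1..n. int (p - a))" unfolding e1 F_def by simp
  hence "[fact (p - 1) = F * (- F)] (mod int p)" using cong_scalar_left[OF c1[unfolded e2], of F] by (simp only:)
  moreover have "[fact (p - 1) = - 1] (mod int p)" using wilson_theorem[OF p(1)] by simp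
  ultimately have "[F * (- F) = - 1] (mod int p)" using cong_trans cong_sym by blast
  hence "int p dvd - (F * F - 1)" by (simp add: cong_iff_dvd_diff)
  thus ?thesis unfolding cong_iff_dvd_diff by (simp only: dvd_minus_iff)
 qed
 hence "int p dvd (F - 1) * (F + 1)" by (simp add: cong_iff_dvd_diff algebra_simps)
 hence "int p dvd F - 1 \<or> int p dvd F + 1" using p(1) by (simp add: prime_dvd_mult_iff)
 hence "[F = (- 1) ^ M] (mod int p)"
 proof
  assume "int p dvd F - 1"
  hence c: "[F = 1] (mod int p)" by (simp add: cong_iff_dvd_diff)
  have "Legendre 1 (int p) = 1" using Legendre_mult[OF p(1) p2, of 1 1] Legendre_mult_self[of 1 "int p"] p2 by (simp add: cong_0_iff)
  hence "(- 1 :: int) ^ M = 1" using XF Legendre_cong[OF c] by simp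
  thus ?thesis using c by simp
 next
  assume "int p dvd F + 1"
  hence c: "[F = - 1] (mod int p)" by (simp add: cong_iff_dvd_diff)
  have "Legendre 1 (int p) = 1" using Legendre_mult[OF p(1) p2, of 1 1] Legendre_mult_self[of 1 "int p"] p2 by (simp add: cong_0_iff)
  moreover have "Legendre (- int 1) (int p) = - Legendre (int 1) (int p)" by (rule Legendre_neg_one[OF p k]) (use p2 in simp)
  ultimately have "(- 1 :: int) ^ M = - 1" using XF Legendre_cong[OF c] by simp
  thus ?thesis using c by simp
 qed
 thus "[int (fact ((p - 1) div 2)) = (- 1) ^ ((h + 1) div 2)] (mod int p)" unfolding sgn F_def n_half .
qed

end

context prime_3_mod_4
begin

lemma norm_elements_theta:
 assumes I: "quad_ideal p I"
 defines "r \<equiv> %n. real (card (norm_elements I n))"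
 shows "0 < x ==> x < 1 ==> summable (%n. r n * x ^ n)"
  and "((%x. (\<Sum>n. r n * x ^ n) - 4 * (\<Sum>n. r n * (x ^ 4) ^ n)) \<longlongrightarrow> 0) (at_left 1)"
proof -
 obtain A C B where f: "A > 0" "4 * A * C - B\<^sup>2 > 0" and c: "!!n. card (norm_elements I n) = card {z. bqf A B C z = int n}"
  by (rule norm_elements_form[OF I]) ((rule that; assumption) | blast)
 show "summable (%n. r n * x ^ n)" if "0 < x" "x < 1"
  unfolding r_def c by (rule sums_summable[OF bqf_count_sums[OF f that]])
 show "((%x. (\<Sum>n. r n * x ^ n) - 4 * (\<Sum>n. r n * (x ^ 4) ^ n)) \<longlongrightarrow> 0) (at_left 1)"
  unfolding r_def c by (rule bqf_count_limit[OF f])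
qed

text \<open>The zero element contributes 1 to the series of each class; these constant terms are how
  the class number enters.\<close>

lemma class_theta_sum:
 assumes p3: "p > 3" and x: "0 < x" "x < 1"
 shows "(\<Sum>X\<in>ideals // cl. \<Sum>n. real (card (norm_elements (class_rep X) n)) * x ^ n)
  = real (class_number (quadratic_field (- int p))) + 2 * (\<Sum>n. real (ideal_count k (Suc n)) * x ^ Suc n)"
  and "summable (%n. real (ideal_count k (Suc n)) * x ^ Suc n)"
proof -
 define r where "r = (%X n. real (card (norm_elements (class_rep X) n)))"
 have sm: "summable (%n. r X n * x ^ n)" if "X \<in> ideals // cl" for X
  unfolding r_def by (rule norm_elements_theta(1)[OF class_rep(1)[OF that] x])
 have r0: "r X 0 = 1" if "X \<in> ideals // cl" for X
  unfolding r_def using card_norm_elements_0[OF class_rep(1)[OF that]] by simp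
 have rs: "(\<Sum>X\<in>ideals // cl. r X (Suc n) * x ^ Suc n) = 2 * (real (ideal_count k (Suc n)) * x ^ Suc n)" for n
 proof -
  have "(\<Sum>X\<in>ideals // cl. r X (Suc n)) = real (2 * ideal_count k (Suc n))"
   unfolding r_def card_norm_elements[OF p3 zero_less_Suc, symmetric] by (rule of_nat_sum[symmetric])
  thus ?thesis unfolding sum_distrib_right[symmetric] by simp
 qed
 have sS: "summable (%n. r X (Suc n) * x ^ Suc n)" if "X \<in> ideals // cl" for X
  by (rule summable_ignore_initial_segment[OF sm[OF that], of 1, simplified add.right_neutral, unfolded Suc_eq_plus1[symmetric]])
 have "summable (%n. \<Sum>X\<in>ideals // cl. r X (Suc n) * x ^ Suc n)" by (rule summable_sum) (rule sS)
 hence s2: "summable (%n. 2 * (real (ideal_count k (Suc n)) * x ^ Suc n))" unfolding rs .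
 from summable_mult[OF s2, of "1 / 2"] show s1: "summable (%n. real (ideal_count k (Suc n)) * x ^ Suc n)" by simp
 have "(\<Sum>X\<in>ideals // cl. \<Sum>n. r X n * x ^ n) = (\<Sum>X\<in>ideals // cl. 1 + (\<Sum>n. r X (Suc n) * x ^ Suc n))"
 proof (rule sum.cong[OF refl])
  fix X assume X: "X \<in> ideals // cl"
  have "(\<Sum>n. r X (Suc n) * x ^ Suc n) = (\<Sum>n. r X n * x ^ n) - r X 0 * x ^ 0" by (rule suminf_split_head[OF sm[OF X]])
  thus "(\<Sum>n. r X n * x ^ n) = 1 + (\<Sum>n. r X (Suc n) * x ^ Suc n)" unfolding r0[OF X] by simp
 qed
 also have "... = real (card (ideals // cl)) + (\<Sum>X\<in>ideals // cl. \<Sum>n. r X (Suc n) * x ^ Suc n)"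
  by (simp only: sum.distrib) simp
 also have "(\<Sum>X\<in>ideals // cl. \<Sum>n. r X (Suc n) * x ^ Suc n) = (\<Sum>n. \<Sum>X\<in>ideals // cl. r X (Suc n) * x ^ Suc n)"
  by (rule suminf_sum[symmetric]) (rule sS)
 also have "... = 2 * (\<Sum>n. real (ideal_count k (Suc n)) * x ^ Suc n)" unfolding rs by (rule suminf_mult[OF s1])
 finally show "(\<Sum>X\<in>ideals // cl. \<Sum>n. real (card (norm_elements (class_rep X) n)) * x ^ n)
  = real (class_number (quadratic_field (- int p))) + 2 * (\<Sum>n. real (ideal_count k (Suc n)) * x ^ Suc n)"
  unfolding r_def class_number_def .
qed

text \<open>The combination of the theta series, summed over the classes, tends to 0. Its constant
  terms give h - 4 h, and the rest is twice a sum of the character against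
  \<open>theta_kernel\<close>, with known limit.\<close>

theorem class_number_formula:
 assumes p3: "p > 3"
 shows "int (class_number (quadratic_field (- int p))) * int p = - (\<Sum>a=1..p. int a * Legendre (int a) (int p))"
proof -
 define h where "h = class_number (quadratic_field (- int p))"
 define f where "f = (%n. real_of_int (Legendre (int n) (int p)))"
 define G where "G = (%y. \<Sum>n. real (ideal_count k (Suc n)) * y ^ Suc n)"
 define R where "R = (%X y. \<Sum>n. real (card (norm_elements (class_rep X) n)) * y ^ n)"
 have fb: "\<bar>f n\<bar> \<le> 1" for n
  unfolding f_def using abs_Legendre_le_1[of "int n" "int p"] by (simp only: of_int_abs[symmetric] of_int_le_1_iff)
 have ic: "real (ideal_count k (Suc n)) = (\<Sum>d | d dvd Suc n. f d)" for n
  using arg_cong[OF ideal_count_eq[OF p k zero_less_Suc, of n], of real_of_int] by (simp add: f_def)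
 have lam: "(%d. f (Suc d) * (y ^ Suc d / (1 - y ^ Suc d))) sums G y" if y: "0 < y" "y < 1" for y
 proof -
  obtain S where S: "(%n. (\<Sum>d | d dvd Suc n. f d) * y ^ Suc n) sums S"
   "(%d. f (Suc d) * (y ^ Suc d / (1 - y ^ Suc d))) sums S" using lambert_series[of f, OF fb y] .
  have "G y = S" unfolding G_def ic by (rule sums_unique[OF S(1), symmetric])
  thus ?thesis using S(2) by simp
 qed
 have comb: "G x - 4 * G (x ^ 4) = (\<Sum>d. f (Suc d) * theta_kernel (x ^ Suc d))" if x: "0 < x" "x < 1" for x
 proof -
  have x4: "0 < x ^ 4" "x ^ 4 < 1" using x by (auto simp: power_less_one_iff)
  have "(%d. f (Suc d) * (x ^ Suc d / (1 - x ^ Suc d)) - 4 * (f (Suc d) * ((x ^ 4) ^ Suc d / (1 - (x ^ 4) ^ Suc d)))) sums (G x - 4 * G (x ^ 4))"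
   by (intro sums_diff sums_mult lam x x4)
  moreover have "f (Suc d) * (x ^ Suc d / (1 - x ^ Suc d)) - 4 * (f (Suc d) * ((x ^ 4) ^ Suc d / (1 - (x ^ 4) ^ Suc d)))
    = f (Suc d) * theta_kernel (x ^ Suc d)" for d
  proof -
   define y where "y = x ^ Suc d"
   have y: "0 \<le> y" "y < 1" using x unfolding y_def by (auto simp: power_less_one_iff simp del: power_Suc)
   have "(x ^ 4) ^ Suc d = y ^ 4" unfolding y_def by (simp only: power_mult[symmetric] mult.commute)
   thus ?thesis unfolding y_def[symmetric] theta_kernel_eq[OF y] by (simp add: right_diff_distrib)
  qed
  ultimately show ?thesis by (simp add: sums_iff)
 qed
 have lim1: "((%x. \<Sum>X\<in>ideals // cl. R X x - 4 * R X (x ^ 4)) \<longlongrightarrow> (\<Sum>X\<in>ideals // cl. 0)) (at_left 1)"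
  by (rule tendsto_sum, unfold R_def) (rule norm_elements_theta(2)[OF class_rep(1)])
 have ev: "(\<Sum>X\<in>ideals // cl. R X x - 4 * R X (x ^ 4)) = - 3 * real h + 2 * (\<Sum>d. f (Suc d) * theta_kernel (x ^ Suc d))"
  if x: "0 < x" "x < 1" for x
 proof -
  have x4: "0 < x ^ 4" "x ^ 4 < 1" using x by (auto simp: power_less_one_iff)
  have "(\<Sum>X\<in>ideals // cl. R X x - 4 * R X (x ^ 4)) = (\<Sum>X\<in>ideals // cl. R X x) - 4 * (\<Sum>X\<in>ideals // cl. R X (x ^ 4))"
   by (simp only: sum_subtractf sum_distrib_left)
  also have "... = (real h + 2 * G x) - 4 * (real h + 2 * G (x ^ 4))"
   unfolding R_def G_def h_def class_theta_sum(1)[OF p3 x] class_theta_sum(1)[OF p3 x4] ..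
  finally show ?thesis unfolding comb[OF x, symmetric] by simp
 qed
 have "((%x. - 3 * real h + 2 * (\<Sum>d. f (Suc d) * theta_kernel (x ^ Suc d))) \<longlongrightarrow> 0) (at_left 1)"
 proof (rule Lim_transform_eventually)
  show "((%x. \<Sum>X\<in>ideals // cl. R X x - 4 * R X (x ^ 4)) \<longlongrightarrow> 0) (at_left 1)" using lim1 by simp
  show "\<forall>\<^sub>F x in at_left 1. (\<Sum>X\<in>ideals // cl. R X x - 4 * R X (x ^ 4)) = - 3 * real h + 2 * (\<Sum>d. f (Suc d) * theta_kernel (x ^ Suc d))"
   by (rule eventually_mono[OF eventually_at_left_real[of 0 "1 :: real"]]) (simp, rule ev, simp_all only: greaterThanLessThan_iff)
 qed
 moreover have "((%x. \<Sum>d. f (Suc d) * theta_kernel (x ^ Suc d)) \<longlongrightarrow> - 3 / 2 * (\<Sum>a=1..p. real a * f a) / real p) (at_left 1)"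
 proof (rule periodic_kernel_sum_limit[OF p0])
  show "f (n + p) = f n" for n
   unfolding f_def by (subst Legendre_cong[of "int (n + p)" "int n"]) (simp_all add: cong_iff_dvd_diff)
  have "real_of_int (\<Sum>a=1..p. Legendre (int a) (int p)) = 0" unfolding Legendre_sum_zero[OF p k] by simp
  thus "(\<Sum>a=1..p. f a) = 0" by (simp add: f_def)
 qed
 hence "((%x. - 3 * real h + 2 * (\<Sum>d. f (Suc d) * theta_kernel (x ^ Suc d))) \<longlongrightarrow> - 3 * real h + 2 * (- 3 / 2 * (\<Sum>a=1..p. real a * f a) / real p)) (at_left 1)"
  by (intro tendsto_add tendsto_mult tendsto_const)
 ultimately have "- 3 * real h + 2 * (- 3 / 2 * (\<Sum>a=1..p. real a * f a) / real p) = 0"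
  using tendsto_unique[OF trivial_limit_at_left_real] by blast
 hence "real h * real p = - (\<Sum>a=1..p. real a * f a)" using p0 by (simp add: field_simps)
 hence "real_of_int (int h * int p) = real_of_int (- (\<Sum>a=1..p. int a * Legendre (int a) (int p)))"
  by (simp add: f_def)
 thus ?thesis unfolding h_def by (simp only: of_int_eq_iff)
qed

end

section \<open>Euler products and the theta identities of Gauss\<close>

definition euler_prod :: "complex => complex" where
 "euler_prod q = (\<Prod>n. 1 - q ^ (n + 1))"

lemma norm_power_Suc_lt_1: "norm q < 1 ==> norm (q ^ Suc n :: complex) < 1"
 by (metis norm_power norm_ge_zero power_Suc_le_self less_imp_le order_le_less_trans)

lemma one_minus_power_nz: "norm q < 1 ==> n > 0 ==> 1 - (q::complex) ^ n ~= 0"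
 using norm_power_Suc_lt_1[of q "n - 1"] by auto

lemma one_plus_power_nz: "norm q < 1 ==> n > 0 ==> 1 + (q::complex) ^ n ~= 0"
 using norm_power_Suc_lt_1[of q "n - 1"] by (auto simp: add_eq_0_iff)

lemma euler_prod_convergent:
 assumes "norm q < 1"
 shows "convergent_prod (%n. 1 - q ^ (n + 1) :: complex)"
proof (rule abs_convergent_prod_imp_convergent_prod)
 have "summable (%n. norm q * norm q ^ n)"
  using assms by (intro summable_mult summable_geometric) auto
 thus "abs_convergent_prod (%n. 1 - q ^ (n + 1))"
  by (simp add: abs_convergent_prod_conv_summable norm_mult norm_power)
qed

lemma euler_prod_nz: "norm q < 1 ==> euler_prod q ~= 0"
 unfolding euler_prod_def
proof (rule prodinf_nonzero[OF euler_prod_convergent])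
 fix i assume "norm q < 1"
 thus "1 - q ^ (i + 1) ~= 0" by (intro one_minus_power_nz) simp_all
qed

lemma euler_prod_LIMSEQ:
 assumes "norm q < 1"
 shows "(%n. \<Prod>s=1..n. 1 - q ^ s) \<longlonglongrightarrow> euler_prod q"
proof -
 have "(%n. \<Prod>i\<le>n. 1 - q ^ (i + 1)) \<longlonglongrightarrow> euler_prod q"
  unfolding euler_prod_def by (rule convergent_prod_LIMSEQ[OF euler_prod_convergent[OF assms]])
 also have "(%n. \<Prod>i\<le>n. 1 - q ^ (i + 1)) = (%n. \<Prod>s=1..Suc n. 1 - q ^ s)"
 proof
  fix n show "(\<Prod>i\<le>n. 1 - q ^ (i + 1)) = (\<Prod>s=1..Suc n. 1 - q ^ s)"
   by (rule prod.reindex_bij_witness[of _ "%s. s - 1" "%i. i + 1"]) auto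
 qed
 finally show ?thesis by (rule LIMSEQ_imp_Suc)
qed

lemma prod_even_odd_split:
 fixes f :: "nat => 'a::comm_monoid_mult"
 shows "(\<Prod>s=1..2*n. f s) = (\<Prod>s=1..n. f (2 * s - 1)) * (\<Prod>s=1..n. f (2 * s))"
 by (induction n) (auto simp: mult_ac)

lemma odd_prod_LIMSEQ:
 assumes "norm q < 1"
 shows "(%n. \<Prod>s=1..n. 1 - q ^ (2 * s - 1)) \<longlonglongrightarrow> euler_prod q / euler_prod (q\<^sup>2)"
proof -
 have q2: "norm (q\<^sup>2) < 1" using norm_power_Suc_lt_1[OF assms, of 1] by (simp add: power2_eq_square)
 have "(%n. \<Prod>s=1..2*n. 1 - q ^ s) \<longlonglongrightarrow> euler_prod q"
  using LIMSEQ_subseq_LIMSEQ[OF euler_prod_LIMSEQ[OF assms], of "%n. 2 * n"]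
  by (auto simp: strict_mono_def o_def)
 hence "(%n. (\<Prod>s=1..2*n. 1 - q ^ s) / (\<Prod>s=1..n. 1 - (q\<^sup>2) ^ s)) \<longlonglongrightarrow> euler_prod q / euler_prod (q\<^sup>2)"
  by (intro tendsto_divide euler_prod_LIMSEQ q2 euler_prod_nz)
 moreover have "(\<Prod>s=1..2*n. 1 - q ^ s) / (\<Prod>s=1..n. 1 - (q\<^sup>2) ^ s) = (\<Prod>s=1..n. 1 - q ^ (2 * s - 1))" for n
 proof -
  have "(\<Prod>s=1..n. 1 - (q\<^sup>2) ^ s) ~= 0" using one_minus_power_nz[OF q2] by auto
  moreover have "(\<Prod>s=1..n. 1 - (q\<^sup>2) ^ s) = (\<Prod>s=1..n. 1 - q ^ (2 * s))" by (simp add: power_mult)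
  ultimately show ?thesis unfolding prod_even_odd_split[of "%s. 1 - q ^ s"]
   by (simp only: nonzero_mult_div_cancel_right not_False_eq_True)
 qed
 ultimately show ?thesis by simp
qed

text \<open>Only the odd factors differ between q and -q, and for them (1 - q^n)(1 + q^n) = 1 -
  q^(2n). All product relations between the theta functions reduce to this one.\<close>

lemma euler_prod_minus:
 assumes "norm q < 1"
 shows "euler_prod q * euler_prod (- q) * euler_prod (q ^ 4) = euler_prod (q\<^sup>2) ^ 3"
proof -
 have q2: "norm (q\<^sup>2) < 1" using norm_power_Suc_lt_1[OF assms, of 1] by (simp add: power2_eq_square)
 have q4: "norm (q^4) < 1" using norm_power_Suc_lt_1[OF assms, of 3] by simp
 have 1: "(%n. (\<Prod>s=1..n. 1 - q ^ (2 * s - 1)) * (\<Prod>s=1..n. 1 - (- q) ^ (2 * s - 1)))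
   \<longlonglongrightarrow> euler_prod q / euler_prod (q\<^sup>2) * (euler_prod (-q) / euler_prod ((-q)\<^sup>2))"
  by (intro tendsto_mult odd_prod_LIMSEQ) (use assms in auto)
 have "(\<Prod>s=1..n. 1 - q ^ (2 * s - 1)) * (\<Prod>s=1..n. 1 - (- q) ^ (2 * s - 1)) = (\<Prod>s=1..n. 1 - (q\<^sup>2) ^ (2 * s - 1))" for n
  unfolding prod.distrib[symmetric]
 proof (rule prod.cong)
  fix s assume "s \<in> {1..n}"
  hence "odd (2 * s - 1)" by auto
  hence "(- q) ^ (2 * s - 1) = - (q ^ (2 * s - 1))" by simp
  thus "(1 - q ^ (2 * s - 1)) * (1 - (- q) ^ (2 * s - 1)) = 1 - (q\<^sup>2) ^ (2 * s - 1)"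
   by (simp add: algebra_simps power2_eq_square power_mult_distrib)
 qed simp
 with 1 have "(%n. (\<Prod>s=1..n. 1 - (q\<^sup>2) ^ (2 * s - 1)))
   \<longlonglongrightarrow> euler_prod q / euler_prod (q\<^sup>2) * (euler_prod (-q) / euler_prod (q\<^sup>2))" by simp
 moreover have "(%n. (\<Prod>s=1..n. 1 - (q\<^sup>2) ^ (2 * s - 1))) \<longlonglongrightarrow> euler_prod (q\<^sup>2) / euler_prod ((q\<^sup>2)\<^sup>2)"
  by (rule odd_prod_LIMSEQ[OF q2])
 ultimately have "euler_prod q / euler_prod (q\<^sup>2) * (euler_prod (-q) / euler_prod (q\<^sup>2)) = euler_prod (q\<^sup>2) / euler_prod (q^4)"
  using LIMSEQ_unique by (fastforce simp flip: power_mult)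
 thus ?thesis using euler_prod_nz[OF q2] euler_prod_nz[OF q4]
  by (simp add: field_simps power3_eq_cube)
qed

text \<open>The finite identities of Shanks; the sums on the right tend to their \<open>s = 0\<close> terms.\<close>

lemma shanks_theta:
 fixes x :: "'a::field" and Q :: "nat => 'a"
 assumes nz: "!!n. 1 + x ^ n ~= 0" "!!n. n > 0 ==> 1 - x ^ n ~= 0"
 defines "Q \<equiv> %n. \<Prod>s=1..n. (1 - x ^ s) / (1 + x ^ s)"
 shows "(\<Sum>s\<le>n. (-1) ^ s * (2 / (1 + x ^ s)) * (Q n / Q s) * x ^ (s * (n + 1)))
   = 1 + 2 * (\<Sum>s=1..n. (-1) ^ s * x ^ s\<^sup>2)"
proof (induction n)
 case 0
 have "(1::'a) + 1 ~= 0" using nz(1)[of 0] by simp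
 hence "(2::'a) ~= 0" by simp
 thus ?case by (simp add: Q_def)
next
 case (Suc n)
 have Q0: "Q s ~= 0" for s using nz by (auto simp: Q_def)
 have QS: "Q (Suc s) = Q s * ((1 - x ^ Suc s) / (1 + x ^ Suc s))" for s by (simp add: Q_def)
 define c where "c = 2 * Q n / (1 + x ^ Suc n)"
 \<comment> \<open>The change from n to n + 1 is, term by term, the difference of consecutive values
   of a single expression in s.\<close>
 have tel: "(\<Sum>s\<le>m. (-1) ^ s * (2 / (1 + x ^ s)) * (Q (Suc n) / Q s) * x ^ (s * (Suc n + 1))
    - (-1) ^ s * (2 / (1 + x ^ s)) * (Q n / Q s) * x ^ (s * (n + 1)))
   = - c * ((-1) ^ m * x ^ (Suc m * Suc n) / Q m)" for m
 proof (induction m)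
  case 0
  have "(2::'a) ~= 0" using nz(1)[of 0] by simp
  show ?case using nz(1)[of "Suc n"] \<open>2 ~= 0\<close> by (simp add: c_def QS) (simp add: Q_def field_simps)
 next
  case (Suc m)
  define y where "y = x ^ Suc m"
  define z where "z = x ^ Suc n"
  define w where "w = z ^ Suc m"
  have w: "x ^ (Suc m * (n + 1)) = w" "x ^ (Suc m * Suc n) = w" "x ^ (Suc m * (Suc n + 1)) = y * w" "x ^ (Suc (Suc m) * Suc n) = z * w"
   by (simp_all add: w_def z_def y_def power_add power_mult [symmetric] algebra_simps)
  have n0: "1 + y ~= 0" "1 - y ~= 0" "1 + z ~= 0" using nz by (simp_all add: y_def z_def del: power_Suc)
  have "(-1) ^ Suc m * (2 / (1 + y)) * (Q n * ((1 - z) / (1 + z)) / (Q m * ((1 - y) / (1 + y)))) * (y * w)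
    - (-1) ^ Suc m * (2 / (1 + y)) * (Q n / (Q m * ((1 - y) / (1 + y)))) * w
    = - c * ((-1) ^ Suc m * (z * w) / (Q m * ((1 - y) / (1 + y)))) + c * ((-1) ^ m * w / Q m)"
   unfolding c_def z_def[symmetric] using n0 Q0[of m] Q0[of n]
   by (simp add: divide_simps) (simp add: algebra_simps)
  thus ?case
   unfolding sum.atMost_Suc Suc.IH unfolding w QS[of m] QS[of n] y_def[symmetric] z_def[symmetric]
   by (rule trans[OF arg_cong2[where f = "(+)", OF refl]]) simp
 qed
 have "(\<Sum>s\<le>Suc n. (-1) ^ s * (2 / (1 + x ^ s)) * (Q (Suc n) / Q s) * x ^ (s * (Suc n + 1)))
   = (\<Sum>s\<le>n. (-1) ^ s * (2 / (1 + x ^ s)) * (Q n / Q s) * x ^ (s * (n + 1)))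
    - c * ((-1) ^ n * x ^ (Suc n * Suc n) / Q n)
    + (-1) ^ Suc n * (2 / (1 + x ^ Suc n)) * x ^ (Suc n * (Suc n + 1))"
  unfolding sum.atMost_Suc tel[of n, unfolded sum_subtractf diff_eq_eq] using Q0[of "Suc n"]
  by (simp del: power_Suc)
 also have "... = 1 + 2 * (\<Sum>s=1..n. (-1) ^ s * x ^ s\<^sup>2) + 2 * (-1) ^ Suc n * x ^ (Suc n)\<^sup>2"
 proof -
  define z where "z = x ^ Suc n"
  define w where "w = x ^ (Suc n)\<^sup>2"
  have w: "x ^ (Suc n * (Suc n + 1)) = z * w" "x ^ (Suc n * Suc n) = w"
   by (simp_all add: w_def z_def power_add power2_eq_square algebra_simps)
  have n0: "1 + z ~= 0" using nz by (simp add: z_def del: power_Suc)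
  show ?thesis unfolding Suc.IH w c_def z_def[symmetric] w_def[symmetric] using n0 Q0[of n]
   by (simp add: divide_simps) (simp add: algebra_simps)
 qed
 finally show ?case by (simp add: algebra_simps del: power_Suc)
qed

lemma shanks_triangular:
 fixes x :: "'a::field" and P :: "nat => 'a"
 assumes nz: "!!n. n > 0 ==> 1 - x ^ n ~= 0"
 defines "P \<equiv> %n. \<Prod>s=1..n. (1 - x ^ (2 * s)) / (1 - x ^ (2 * s - 1))"
 shows "(\<Sum>s<n. (P n / P s) * x ^ (s * (2 * n + 1))) = (\<Sum>s<2*n. x ^ (s * (s + 1) div 2))"
proof (induction n)
 case (Suc n)
 have P0: "P s ~= 0" for s using nz by (auto simp: P_def)
 have PS: "P (Suc s) = P s * ((1 - x ^ (2 * s + 2)) / (1 - x ^ (2 * s + 1)))" for s by (simp add: P_def)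
 define c where "c = P n / (1 - x ^ (2 * n + 1))"
 \<comment> \<open>One step in n adds two triangular exponents: one from the term s = n adjoined to
   the old sum, the other from this telescoped difference.\<close>
 have tel: "(\<Sum>s\<le>m. (P (Suc n) / P s) * x ^ (s * (2 * Suc n + 1)) - (P n / P s) * x ^ (s * (2 * n + 1)))
   = c * (x ^ (Suc m * (2 * n + 1)) * (1 - x ^ (2 * m + 1)) / P m)" for m
 proof (induction m)
  case 0
  show ?case using nz[of "2 * n + 1"] by (simp add: c_def PS) (simp add: P_def field_simps)
 next
  case (Suc m)
  define y where "y = x ^ m"
  define z where "z = x ^ n"
  define w where "w = x ^ (Suc m * (2 * n + 1))"
  have e: "Suc m * (2 * Suc n + 1) = Suc m * (2 * n + 1) + m * 2 + 2"
   "Suc (Suc m) * (2 * n + 1) = Suc m * (2 * n + 1) + n * 2 + 1"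
   "2 * n + 1 = n * 2 + 1" "2 * n + 2 = n * 2 + 2" "2 * m + 1 = m * 2 + 1" "2 * m + 2 = m * 2 + 2"
   "2 * Suc m + 1 = m * 2 + 3" by (simp_all add: algebra_simps)
  have w: "x ^ (Suc m * (2 * Suc n + 1)) = w * y^2 * x^2"
   unfolding e(1) power_add power_mult[of x m 2] w_def y_def ..
  have w2: "x ^ (Suc (Suc m) * (2 * n + 1)) = w * z^2 * x"
   unfolding e(2) power_add[of x _ 1] power_add[of x _ "n * 2"] power_mult[of x n 2] w_def z_def by simp
  have w3: "x ^ (2 * n + 1) = z^2 * x" "x ^ (2 * n + 2) = z^2 * x^2"
   "x ^ (2 * m + 1) = y^2 * x" "x ^ (2 * m + 2) = y^2 * x^2" "x ^ (2 * Suc m + 1) = y^2 * x^3"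
   unfolding e(3-7) power_add power_mult z_def y_def by simp_all
  note w = w w2 w3
  have n0: "1 - y^2 * x ~= 0" "1 - y^2 * x^2 ~= 0" "1 - z^2 * x ~= 0"
   using nz[of "2 * m + 1"] nz[of "2 * m + 2"] nz[of "2 * n + 1"] unfolding w by auto
  have "P n * ((1 - z^2 * x^2) / (1 - z^2 * x)) / (P m * ((1 - y^2 * x^2) / (1 - y^2 * x))) * (w * y^2 * x^2)
    - P n / (P m * ((1 - y^2 * x^2) / (1 - y^2 * x))) * w
    = c * (w * z^2 * x * (1 - y^2 * x^3) / (P m * ((1 - y^2 * x^2) / (1 - y^2 * x)))) - c * (w * (1 - y^2 * x) / P m)"
   unfolding c_def w using n0 P0[of m] P0[of n]
   by (simp add: divide_simps) (simp add: algebra_simps power2_eq_square power3_eq_cube)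
  thus ?case
   unfolding sum.atMost_Suc Suc.IH unfolding PS[of m] PS[of n] w_def[symmetric] w
   by (rule trans[OF arg_cong2[where f = "(+)", OF refl]]) simp
 qed
 have "(\<Sum>s<Suc n. (P (Suc n) / P s) * x ^ (s * (2 * Suc n + 1))) =
   (\<Sum>s\<le>n. (P (Suc n) / P s) * x ^ (s * (2 * Suc n + 1)) - (P n / P s) * x ^ (s * (2 * n + 1)))
   + (\<Sum>s\<le>n. (P n / P s) * x ^ (s * (2 * n + 1)))"
  by (simp add: sum_subtractf lessThan_Suc_atMost)
 also have "(\<Sum>s\<le>n. (P n / P s) * x ^ (s * (2 * n + 1))) = (\<Sum>s<2*n. x ^ (s * (s + 1) div 2)) + x ^ (n * (2 * n + 1))"
  using Suc.IH P0[of n] by (simp add: lessThan_Suc_atMost[symmetric])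
 also have "c * (x ^ (Suc n * (2 * n + 1)) * (1 - x ^ (2 * n + 1)) / P n) = x ^ (Suc n * (2 * n + 1))"
  unfolding c_def using P0[of n] nz[of "2 * n + 1"] by simp
 ultimately have "(\<Sum>s<Suc n. (P (Suc n) / P s) * x ^ (s * (2 * Suc n + 1))) =
   (\<Sum>s<2*n. x ^ (s * (s + 1) div 2)) + x ^ (n * (2 * n + 1)) + x ^ (Suc n * (2 * n + 1))"
  unfolding tel c_def using P0[of n] nz[of "2 * n + 1"] by (simp add: add_ac)
 moreover have "2 * n * (2 * n + 1) div 2 = n * (2 * n + 1)" by simp
 moreover have "(2 * n + 1) * (2 * n + 1 + 1) div 2 = Suc n * (2 * n + 1)"
 proof -
  have "(2 * n + 1) * (2 * n + 1 + 1) = 2 * (Suc n * (2 * n + 1))" by (simp add: algebra_simps)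
  thus ?thesis by simp
 qed
 moreover have "(\<Sum>s<2 * Suc n. x ^ (s * (s + 1) div 2)) =
   (\<Sum>s<2*n. x ^ (s * (s + 1) div 2)) + x ^ (2 * n * (2 * n + 1) div 2) + x ^ ((2 * n + 1) * (2 * n + 1 + 1) div 2)"
  by simp
 ultimately show ?case by (simp only:)
qed simp

lemma sum_atMost_head: fixes n :: nat shows "(\<Sum>s\<le>n. f s) = f 0 + (\<Sum>s=1..n. f s :: 'a::comm_monoid_add)"
 by (induction n) (auto simp: add_ac)

text \<open>Every term with s > 0 carries a power of q with exponent at least n, while the quotients
  R n / R s stay bounded because the limit is not 0. The perturbation is thus O(n |q|^n).\<close>

lemma tendsto_perturbed_head:
 fixes R :: "nat => complex" and c :: "nat => complex"
 assumes q: "norm q < 1" and R: "R \<longlonglongrightarrow> l" "l ~= 0" "!!n. R n ~= 0" "R 0 = 1"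
  and c: "!!s. norm (c s) \<le> K" "c 0 = 1" and e: "!!s n. s > 0 ==> e s n \<ge> n"
  and e0: "!!n. e 0 n = 0" and N: "!!n. N n \<le> n"
 shows "(%n. \<Sum>s\<le>N n. c s * (R n / R s) * q ^ e s n) \<longlonglongrightarrow> l"
proof -
 obtain A where A: "!!n. norm (R n) \<le> A"
  using convergent_imp_Bseq[of R] R(1) unfolding Bseq_def by (auto simp: convergent_def)
 have "(%n. inverse (R n)) \<longlonglongrightarrow> inverse l" using R by (intro tendsto_intros)
 then obtain B where B: "!!n. norm (inverse (R n)) \<le> B"
  using convergent_imp_Bseq[of "%n. inverse (R n)"] unfolding Bseq_def by (auto simp: convergent_def)
 have K: "K \<ge> 0" using c(1)[of 0] norm_ge_zero[of "c 0"] by linarith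
 have A0: "A \<ge> 0" using A[of 0] norm_ge_zero[of "R 0"] by linarith
 have bound: "norm ((\<Sum>s\<le>N n. c s * (R n / R s) * q ^ e s n) - R n) \<le> (K * A * B) * (of_nat n * norm q ^ n)" for n
 proof -
  have "(\<Sum>s\<le>N n. c s * (R n / R s) * q ^ e s n) = R n + (\<Sum>s=1..N n. c s * (R n / R s) * q ^ e s n)"
   using c(2) R(4) by (simp add: sum_atMost_head e0)
  hence "norm ((\<Sum>s\<le>N n. c s * (R n / R s) * q ^ e s n) - R n) = norm (\<Sum>s=1..N n. c s * (R n / R s) * q ^ e s n)"
   by simp
  also have "... \<le> (\<Sum>s=1..N n. (K * A * B) * norm q ^ n)"
  proof (rule sum_norm_le)
   fix s assume s: "s \<in> {1..N n}"
   have B0: "B \<ge> 0" using B[of 0] norm_ge_zero[of "inverse (R 0)"] by linarith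
   have "norm (c s * (R n / R s) * q ^ e s n) = norm (c s) * norm (R n) * norm (inverse (R s)) * norm q ^ e s n"
    by (simp add: norm_mult norm_divide norm_inverse norm_power divide_inverse)
   also have "... \<le> K * A * B * norm q ^ n"
    by (intro mult_mono mult_nonneg_nonneg power_decreasing A B c e) (use s q K A0 B0 in auto)
   finally show "norm (c s * (R n / R s) * q ^ e s n) \<le> (K * A * B) * norm q ^ n" .
  qed
  also have "... = of_nat (N n) * ((K * A * B) * norm q ^ n)" by simp
  also have "... \<le> of_nat n * ((K * A * B) * norm q ^ n)"
  proof (rule mult_right_mono)
   have "B \<ge> 0" using B[of 0] norm_ge_zero[of "inverse (R 0)"] by linarith
   thus "0 \<le> K * A * B * norm q ^ n" using K A0 by auto
  qed (use N in auto)
  finally show ?thesis by (simp add: mult_ac)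
 qed
 have "(%n. (K * A * B) * (of_nat n * norm q ^ n)) \<longlonglongrightarrow> (K * A * B) * 0"
  using powser_times_n_limit_0[of "norm q"] q by (intro tendsto_mult) auto
 hence lim: "(%n. (K * A * B) * (of_nat n * norm q ^ n)) \<longlonglongrightarrow> 0" by simp
 have "(%n. (\<Sum>s\<le>N n. c s * (R n / R s) * q ^ e s n) - R n) \<longlonglongrightarrow> 0"
  by (rule Lim_null_comparison[OF always_eventually lim]) (rule allI, rule bound)
 from tendsto_add[OF this R(1)] show ?thesis by simp
qed

lemma theta_product_sums:
 assumes q: "norm q < 1"
 shows "(%n. if n = 0 then 1 else 2 * (-1) ^ n * q ^ n\<^sup>2) sums ((euler_prod q)\<^sup>2 / euler_prod (q\<^sup>2))"
proof -
 have q2: "norm (q\<^sup>2) < 1" using norm_power_Suc_lt_1[OF q, of 1] by (simp add: power2_eq_square)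
 define Q where "Q = (%n. \<Prod>s=1..n. (1 - q ^ s) / (1 + q ^ s))"
 have nzm: "1 - q ^ n ~= 0" if "n > 0" for n using one_minus_power_nz[OF q that] .
 have nzp: "1 + q ^ n ~= 0" for n using one_plus_power_nz[OF q, of n] by (cases "n = 0") auto
 have "(%n. (\<Prod>s=1..n. 1 - q ^ s)\<^sup>2 / (\<Prod>s=1..n. 1 - (q\<^sup>2) ^ s)) \<longlonglongrightarrow> (euler_prod q)\<^sup>2 / euler_prod (q\<^sup>2)"
  by (intro tendsto_divide tendsto_power euler_prod_LIMSEQ q q2 euler_prod_nz)
 also have "(%n. (\<Prod>s=1..n. 1 - q ^ s)\<^sup>2 / (\<Prod>s=1..n. 1 - (q\<^sup>2) ^ s)) = Q"
 proof
  fix n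
  show "(\<Prod>s=1..n. 1 - q ^ s)\<^sup>2 / (\<Prod>s=1..n. 1 - (q\<^sup>2) ^ s) = Q n"
   unfolding Q_def prod_power_distrib prod_dividef[symmetric]
  proof (rule prod.cong)
   fix s assume "s \<in> {1..n}"
   hence "1 - q ^ s ~= 0" "1 + q ^ s ~= 0" using nzm nzp by auto
   moreover have "1 - (q\<^sup>2) ^ s = (1 - q ^ s) * (1 + q ^ s)"
    by (simp add: algebra_simps power2_eq_square power_mult_distrib)
   ultimately show "(1 - q ^ s)\<^sup>2 / (1 - (q\<^sup>2) ^ s) = (1 - q ^ s) / (1 + q ^ s)"
    by (simp add: power2_eq_square)
  qed simp
 qed
 finally have lim: "Q \<longlonglongrightarrow> (euler_prod q)\<^sup>2 / euler_prod (q\<^sup>2)" .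
 have "(%n. \<Sum>s\<le>n. ((-1) ^ s * (2 / (1 + q ^ s))) * (Q n / Q s) * q ^ (s * (n + 1))) \<longlonglongrightarrow> (euler_prod q)\<^sup>2 / euler_prod (q\<^sup>2)"
 proof (rule tendsto_perturbed_head[OF q lim, where K = "2 / (1 - norm q)"])
  show "(euler_prod q)\<^sup>2 / euler_prod (q\<^sup>2) ~= 0" using euler_prod_nz[OF q] euler_prod_nz[OF q2] by simp
  show "Q n ~= 0" for n using nzm nzp by (auto simp: Q_def)
  show "norm ((- 1) ^ s * (2 / (1 + q ^ s))) \<le> 2 / (1 - norm q)" for s
  proof (cases "s = 0")
   case True
   have "1 * (1 - norm q) \<le> 2" using norm_ge_zero[of q] by (auto simp del: norm_ge_zero)
   thus ?thesis using True q by (simp add: pos_le_divide_eq)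
  next
   case False
   have "norm q ^ s \<le> norm q" using False q power_decreasing[of 1 s "norm q"] by auto
   hence "1 - norm q \<le> norm (1 + q ^ s)" using norm_diff_ineq[of 1 "q^s"] by (simp add: norm_power)
   thus ?thesis using q nzp[of s] by (auto simp: norm_mult norm_divide norm_power intro!: divide_left_mono mult_pos_pos)
  qed
  show "n \<le> s * (n + 1)" if "0 < s" for s n :: nat using that by (cases s) auto
 qed (auto simp: Q_def)
 also have "(%n. \<Sum>s\<le>n. ((-1) ^ s * (2 / (1 + q ^ s))) * (Q n / Q s) * q ^ (s * (n + 1)))
   = (%n. 1 + 2 * (\<Sum>s=1..n. (-1) ^ s * q ^ s\<^sup>2))"
  using shanks_theta[of q] nzp nzm by (simp add: Q_def)
 also have "... = (%n. \<Sum>s\<le>n. if s = 0 then 1 else 2 * (-1) ^ s * q ^ s\<^sup>2)"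
  by (auto simp: sum_atMost_head sum_distrib_left mult_ac intro!: sum.cong)
 finally show ?thesis unfolding sums_def_le .
qed

lemma triangular_product_sums:
 assumes q: "norm q < 1"
 shows "(%n. q ^ (n * (n + 1) div 2)) sums ((euler_prod (q\<^sup>2))\<^sup>2 / euler_prod q)"
proof -
 have q2: "norm (q\<^sup>2) < 1" using norm_power_Suc_lt_1[OF q, of 1] by (simp add: power2_eq_square)
 define P where "P = (%n. \<Prod>s=1..n. (1 - q ^ (2 * s)) / (1 - q ^ (2 * s - 1)))"
 have nzm: "1 - q ^ n ~= 0" if "n > 0" for n using one_minus_power_nz[OF q that] .
 have "(%n. (\<Prod>s=1..n. 1 - (q\<^sup>2) ^ s) / (\<Prod>s=1..n. 1 - q ^ (2 * s - 1))) \<longlonglongrightarrow> euler_prod (q\<^sup>2) / (euler_prod q / euler_prod (q\<^sup>2))"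
  by (intro tendsto_divide odd_prod_LIMSEQ euler_prod_LIMSEQ q q2) (use euler_prod_nz[OF q] euler_prod_nz[OF q2] in auto)
 also have "(%n. (\<Prod>s=1..n. 1 - (q\<^sup>2) ^ s) / (\<Prod>s=1..n. 1 - q ^ (2 * s - 1))) = P"
  by (simp add: P_def prod_dividef power_mult)
 also have "euler_prod (q\<^sup>2) / (euler_prod q / euler_prod (q\<^sup>2)) = (euler_prod (q\<^sup>2))\<^sup>2 / euler_prod q"
  by (simp add: power2_eq_square)
 finally have lim: "P \<longlonglongrightarrow> (euler_prod (q\<^sup>2))\<^sup>2 / euler_prod q" .
 have "(%n. \<Sum>s\<le>n-1. 1 * (P n / P s) * q ^ (s * (2 * n + 1))) \<longlonglongrightarrow> (euler_prod (q\<^sup>2))\<^sup>2 / euler_prod q"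
 proof (rule tendsto_perturbed_head[OF q lim, where K = 1])
  show "(euler_prod (q\<^sup>2))\<^sup>2 / euler_prod q ~= 0" using euler_prod_nz[OF q] euler_prod_nz[OF q2] by simp
  show "P n ~= 0" for n using nzm by (auto simp: P_def)
  show "n \<le> s * (2 * n + 1)" if "0 < s" for s n :: nat using that by (cases s) auto
 qed (auto simp: P_def)
 hence "(%n. \<Sum>s\<le>Suc n-1. 1 * (P (Suc n) / P s) * q ^ (s * (2 * Suc n + 1))) \<longlonglongrightarrow> (euler_prod (q\<^sup>2))\<^sup>2 / euler_prod q"
  by (rule LIMSEQ_Suc)
 also have "(%n. \<Sum>s\<le>Suc n-1. 1 * (P (Suc n) / P s) * q ^ (s * (2 * Suc n + 1))) = (%n. \<Sum>s<2*Suc n. q ^ (s * (s + 1) div 2))"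
 proof
  fix n
  show "(\<Sum>s\<le>Suc n-1. 1 * (P (Suc n) / P s) * q ^ (s * (2 * Suc n + 1))) = (\<Sum>s<2*Suc n. q ^ (s * (s + 1) div 2))"
   unfolding mult_1 diff_Suc_1 P_def lessThan_Suc_atMost[symmetric]
   by (rule shanks_triangular[of q "Suc n"]) (rule nzm)
 qed
 finally have "(%n. \<Sum>s<2*Suc n. q ^ (s * (s + 1) div 2)) \<longlonglongrightarrow> (euler_prod (q\<^sup>2))\<^sup>2 / euler_prod q" .
 hence sub: "(%n. \<Sum>s<2*n. q ^ (s * (s + 1) div 2)) \<longlonglongrightarrow> (euler_prod (q\<^sup>2))\<^sup>2 / euler_prod q"
  by (rule LIMSEQ_imp_Suc)
 \<comment> \<open>The finite identity sees only partial sums of even length; convergence of the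
   full series comes from comparison with a geometric one.\<close>
 have "summable (%n. q ^ (n * (n + 1) div 2))"
 proof (rule summable_comparison_test[OF _ summable_geometric[of "norm q"]])
  have "n \<le> n * (n + 1) div 2" for n :: nat by (induction n) auto
  thus "\<exists>N. \<forall>n\<ge>N. norm (q ^ (n * (n + 1) div 2)) \<le> norm q ^ n"
   using q by (auto simp: norm_power intro!: power_decreasing)
 qed (use q in auto)
 hence s: "(%n. q ^ (n * (n + 1) div 2)) sums (\<Sum>n. q ^ (n * (n + 1) div 2))" by (rule summable_sums)
 have "(%n. \<Sum>s<2*n. q ^ (s * (s + 1) div 2)) \<longlonglongrightarrow> (\<Sum>n. q ^ (n * (n + 1) div 2))"
  using LIMSEQ_subseq_LIMSEQ[OF s[unfolded sums_def], of "%n. 2 * n"]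
  by (auto simp: strict_mono_def o_def)
 with sub have "(\<Sum>n. q ^ (n * (n + 1) div 2)) = (euler_prod (q\<^sup>2))\<^sup>2 / euler_prod q"
  using LIMSEQ_unique by blast
 with s show ?thesis by simp
qed

section \<open>Theta functions as formal power series and their identities\<close>

text \<open>The series 1 + 2q + 2q^4 + ..., over an arbitrary field of characteristic 0 so that it
  serves over the rational, the complex and the p-adic numbers alike.\<close>

definition theta_fps :: "'a::field_char_0 fps" where
 "theta_fps = Abs_fps (%n. if n = 0 then 1 else if \<exists>k. n = k\<^sup>2 then 2 else 0)"

definition psi_fps :: "'a::field_char_0 fps" where
 "psi_fps = Abs_fps (%n. if \<exists>k. n = k * (k + 1) div 2 then 1 else 0)"

text \<open>Gauss's product belongs to the series with alternating signs; the argument -q makes all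
  signs positive.\<close>

definition theta_prod :: "complex => complex" where
 "theta_prod q = (euler_prod (- q))\<^sup>2 / euler_prod (q\<^sup>2)"

definition psi_prod :: "complex => complex" where
 "psi_prod q = (euler_prod (q\<^sup>2))\<^sup>2 / euler_prod q"

lemma theta_fps_0 [simp]: "fps_nth theta_fps 0 = 1" by (simp add: theta_fps_def)
lemma psi_fps_0 [simp]: "fps_nth psi_fps 0 = 1"
 by (simp add: psi_fps_def) (rule exI[of _ 0], simp)

lemma strict_mono_triangular: "strict_mono (%k::nat. k * (k + 1) div 2)"
 by (rule strict_monoI_Suc) auto

lemma eventually_norm_lt_1: "eventually (%q::complex. norm q < 1) (nhds 0)"
 using eventually_nhds_in_open[of "ball 0 1" "0::complex"] by (simp add: eventually_mono)

lemma theta_fps_expansion: "theta_prod has_fps_expansion theta_fps"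
proof (rule has_fps_expansionI, rule eventually_mono[OF eventually_norm_lt_1])
 fix q :: complex assume q: "norm q < 1"
 have "(%n. if n = 0 then 1 else 2 * (-1) ^ n * (-q) ^ n\<^sup>2) sums theta_prod q"
  using theta_product_sums[of "-q"] q by (simp add: theta_prod_def)
 also have "(%n. if n = 0 then 1 else 2 * (-1) ^ n * (-q) ^ n\<^sup>2) = (%n. fps_nth theta_fps (n\<^sup>2) * q ^ n\<^sup>2)"
  by (auto simp: fun_eq_iff theta_fps_def power_minus[of q] minus_one_power_iff)
 finally have "(%n. fps_nth theta_fps (n\<^sup>2) * q ^ n\<^sup>2) sums theta_prod q" .
 thus "(%n. fps_nth theta_fps n * q ^ n) sums theta_prod q"
  by (subst (asm) sums_mono_reindex[of "%n. n\<^sup>2" "%n. fps_nth theta_fps n * q ^ n"])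
    (auto simp: theta_fps_def strict_mono_def power_strict_mono)
qed

lemma psi_fps_expansion: "psi_prod has_fps_expansion psi_fps"
proof (rule has_fps_expansionI, rule eventually_mono[OF eventually_norm_lt_1])
 fix q :: complex assume q: "norm q < 1"
 have "(%n. q ^ (n * (n + 1) div 2)) sums psi_prod q"
  using triangular_product_sums[of q] q by (simp add: psi_prod_def)
 also have "(%n. q ^ (n * (n + 1) div 2)) = (%n. fps_nth psi_fps (n * (n + 1) div 2) * q ^ (n * (n + 1) div 2))"
  by (auto simp: fun_eq_iff psi_fps_def)
 finally have "(%n. fps_nth psi_fps (n * (n + 1) div 2) * q ^ (n * (n + 1) div 2)) sums psi_prod q" .
 thus "(%n. fps_nth psi_fps n * q ^ n) sums psi_prod q"
  by (subst (asm) sums_mono_reindex[OF strict_mono_triangular, of "%n. fps_nth psi_fps n * q ^ n"])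
    (auto simp: psi_fps_def)
qed

lemma fps_eq_if_expansions_eq:
 assumes "f has_fps_expansion F" "g has_fps_expansion G" "!!q::complex. norm q < 1 ==> f q = g q"
 shows "F = G"
proof -
 have "eventually (%q. f q = g q) (nhds 0)"
  using eventually_norm_lt_1 by eventually_elim (use assms(3) in auto)
 hence "f has_fps_expansion G" using has_fps_expansion_cong[OF _ refl] assms(2) by metis
 thus ?thesis using fps_expansion_unique_complex[OF assms(1)] fps_expansion_unique_complex by metis
qed

lemma has_fps_expansion_dilate:
 fixes f :: "complex => complex"
 assumes "f has_fps_expansion F" "k > 0"
 shows "(%q. f (q ^ k)) has_fps_expansion (F oo fps_X ^ k)"
 using has_fps_expansion_compose[OF assms(1), of "%q. q ^ k" "fps_X ^ k"] assms(2)
  has_fps_expansion_fps_X_power[of k] by (simp add: o_def)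

lemma has_fps_expansion_reflect:
 fixes f :: "complex => complex"
 assumes "f has_fps_expansion F"
 shows "(%q. f (- q)) has_fps_expansion (F oo - fps_X)"
 using has_fps_expansion_compose[OF assms(1), of "%q. - q" "- fps_X"]
  has_fps_expansion_minus[OF has_fps_expansion_fps_X] by (simp add: o_def)

lemma norm_power_lt_1: "norm (q::complex) < 1 ==> k > 0 ==> norm (q ^ k) < 1"
 using norm_power_Suc_lt_1[of q "k - 1"] by simp

lemma theta_psi_prod_rels:
 assumes q: "norm q < 1"
 shows "theta_prod q * psi_prod (q\<^sup>2) = (psi_prod q)\<^sup>2"
  "theta_prod q * theta_prod (- q) = (theta_prod (- q\<^sup>2))\<^sup>2"
  "psi_prod q * psi_prod (- q) = psi_prod (q\<^sup>2) * theta_prod (- q\<^sup>2)"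
proof -
 have q2: "norm (q\<^sup>2) < 1" and q4: "norm (q ^ 4) < 1" using norm_power_lt_1[OF q] by auto
 have nq: "norm (-q) < 1" using q by simp
 note nz = euler_prod_nz[OF q] euler_prod_nz[OF q2] euler_prod_nz[OF q4] euler_prod_nz[OF nq]
 have e: "euler_prod (- q) = euler_prod (q\<^sup>2) ^ 3 / (euler_prod q * euler_prod (q ^ 4))"
  using euler_prod_minus[OF q] nz by (simp add: field_simps)
 have 4: "(q\<^sup>2)\<^sup>2 = q ^ 4" by (simp flip: power_mult)
 show "theta_prod q * psi_prod (q\<^sup>2) = (psi_prod q)\<^sup>2"
  unfolding theta_prod_def psi_prod_def 4 e using nz
  by (simp add: power_divide power_mult_distrib divide_simps) (simp add: eval_nat_numeral)
 show "theta_prod q * theta_prod (- q) = (theta_prod (- q\<^sup>2))\<^sup>2"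
  unfolding theta_prod_def psi_prod_def power2_minus 4 minus_minus e using nz
  by (simp add: power_divide power_mult_distrib divide_simps eval_nat_numeral)
 show "psi_prod q * psi_prod (- q) = psi_prod (q\<^sup>2) * theta_prod (- q\<^sup>2)"
  unfolding theta_prod_def psi_prod_def power2_minus 4 minus_minus e using nz
  by (simp add: power_divide power_mult_distrib divide_simps eval_nat_numeral)
qed

lemma fps_nth_compose_minus_X: "fps_nth (F oo - fps_X) n = (- 1) ^ n * fps_nth (F :: 'a::comm_ring_1 fps) n"
 using fps_nth_compose_linear[of F "-1" n] by (simp add: fps_const_neg[symmetric] del: fps_const_neg)

lemma compose_minus_X_X_even [simp]:
 fixes F :: "'a::idom fps"
 assumes "even k" "k > 0"
 shows "(F oo fps_X ^ k) oo - fps_X = F oo fps_X ^ k"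
proof (rule fps_ext)
 fix n show "fps_nth ((F oo fps_X ^ k) oo - fps_X) n = fps_nth (F oo fps_X ^ k) n"
  using assms by (auto simp: fps_nth_compose_minus_X fps_nth_compose_X_power minus_one_power_iff)
qed

lemma compose_X_power_X_power [simp]:
 fixes F :: "'a::idom fps"
 assumes "j > 0" "k > 0"
 shows "(F oo fps_X ^ k) oo fps_X ^ j = F oo fps_X ^ (j * k)"
proof (rule fps_ext)
 fix n show "fps_nth ((F oo fps_X ^ k) oo fps_X ^ j) n = fps_nth (F oo fps_X ^ (j * k)) n"
  using assms by (auto simp: fps_nth_compose_X_power div_mult2_eq elim!: dvdE)
qed

lemma compose_minus_X_twice [simp]: "(F oo - fps_X) oo - fps_X = (F :: 'a::idom fps)"
 by (rule fps_ext) (simp add: fps_nth_compose_minus_X flip: mult.assoc power_mult_distrib)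

text \<open>The lowest nonzero coefficient would sit at some n > 0, yet the right side expresses it
  through the coefficient at n/2. This takes the place of a dimension count for modular
  forms.\<close>

lemma fps_zero_by_dilation:
 fixes F :: "'a::{idom,ring_char_0} fps"
 assumes "fps_nth F 0 = 0" "F = fps_const c * (F oo fps_X ^ 2)"
 shows "F = 0"
proof -
 have "fps_nth F n = 0" for n
 proof (induction n rule: less_induct)
  case (less n)
  have "fps_nth F n = c * (if 2 dvd n then fps_nth F (n div 2) else 0)"
   by (subst assms(2)) (simp add: fps_nth_compose_X_power)
  thus ?case using less[of "n div 2"] assms(1) by (cases "n = 0") auto
 qed
 thus ?thesis by (auto intro: fps_ext)
qed

context
begin

private abbreviation (input) th :: "complex fps" where "th \<equiv> theta_fps"
private abbreviation (input) ps :: "complex fps" where "ps \<equiv> psi_fps"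

lemma theta_psi_fps_rels:
 shows theta_mult_psi: "th * (ps oo fps_X ^ 2) = ps ^ 2"
  and theta_mult_reflect: "th * (th oo - fps_X) = ((th oo - fps_X) oo fps_X ^ 2) ^ 2"
  and psi_mult_reflect: "ps * (ps oo - fps_X) = (ps oo fps_X ^ 2) * ((th oo - fps_X) oo fps_X ^ 2)"
proof -
 note [fps_expansion_intros] = theta_fps_expansion psi_fps_expansion
 note 1 = has_fps_expansion_dilate[OF psi_fps_expansion, of 2]
  has_fps_expansion_reflect[OF theta_fps_expansion] has_fps_expansion_reflect[OF psi_fps_expansion]
  has_fps_expansion_dilate[OF has_fps_expansion_reflect[OF theta_fps_expansion], of 2]
 show "th * (ps oo fps_X ^ 2) = ps ^ 2"
  by (rule fps_eq_if_expansions_eq[OF has_fps_expansion_mult[OF theta_fps_expansion 1(1)]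
     has_fps_expansion_power[OF psi_fps_expansion, of 2]]) (simp_all add: theta_psi_prod_rels)
 show "th * (th oo - fps_X) = ((th oo - fps_X) oo fps_X ^ 2) ^ 2"
  by (rule fps_eq_if_expansions_eq[OF has_fps_expansion_mult[OF theta_fps_expansion 1(2)]
     has_fps_expansion_power[OF 1(4), of 2]]) (simp_all add: theta_psi_prod_rels)
 show "ps * (ps oo - fps_X) = (ps oo fps_X ^ 2) * ((th oo - fps_X) oo fps_X ^ 2)"
  by (rule fps_eq_if_expansions_eq[OF has_fps_expansion_mult[OF psi_fps_expansion 1(3)]
     has_fps_expansion_mult[OF 1(1) 1(4)]]) (simp_all add: theta_psi_prod_rels)
qed

text \<open>Even squares are 4 j^2, and odd squares are 8 t + 1 with t triangular.\<close>

lemma theta_dissect: "th = (th oo fps_X ^ 4) + 2 * fps_X * (ps oo fps_X ^ 8)"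
proof (rule fps_ext)
 fix n
 have R: "fps_nth ((th oo fps_X ^ 4) + 2 * fps_X * (ps oo fps_X ^ 8)) n
   = (if 4 dvd n then fps_nth th (n div 4) else 0) + 2 * (if n > 0 & 8 dvd (n - 1) then fps_nth ps ((n - 1) div 8) else 0)"
  by (simp add: fps_nth_compose_X_power mult.assoc numeral_fps_const)
 show "fps_nth th n = fps_nth ((th oo fps_X ^ 4) + 2 * fps_X * (ps oo fps_X ^ 8)) n"
 proof (cases "n = 0")
  case False
  show ?thesis
  proof (cases "\<exists>k. n = k\<^sup>2")
   case True
   then obtain k where k: "n = k\<^sup>2" by blast
   have k0: "k > 0" using False k by auto
   show ?thesis
   proof (cases "even k")
    case True
    then obtain j where j: "k = 2 * j" by blast
    have n: "n = 4 * j\<^sup>2" using k j by (simp add: power_mult_distrib)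
    have "\<not> 8 dvd (n - 1)" if "n > 0" using n that by presburger
    moreover have "fps_nth th n = 2" using False k by (auto simp: theta_fps_def)
    moreover have "fps_nth th (n div 4) = 2" using False n by (auto simp: theta_fps_def)
    moreover have "4 dvd n" using n by simp
    ultimately show ?thesis unfolding R by auto
   next
    case odd: False
    then obtain j where j: "k = 2 * j + 1" by (elim oddE)
    define t where "t = j * (j + 1) div 2"
    have t: "j * (j + 1) = 2 * t" by (simp add: t_def)
    have "n = 8 * t + 1" unfolding k j using t by (simp add: power2_eq_square algebra_simps)
    hence n: "n = 8 * (j * (j + 1) div 2) + 1" by (simp add: t_def)
    have "odd n" using k odd by simp
    hence "\<not> 4 dvd n" by presburger
    moreover have "fps_nth ps ((n - 1) div 8) = 1" unfolding n by (auto simp: psi_fps_def)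
    moreover have "fps_nth th n = 2" using False k by (auto simp: theta_fps_def)
    moreover have "8 dvd n - 1" "n > 0" using n by simp_all
    ultimately show ?thesis unfolding R by simp
   qed
  next
   case nosq: False
   have "fps_nth th (n div 4) = 0" if "4 dvd n"
   proof -
    from that obtain m where m: "n = 4 * m" by (rule dvdE)
    have "m ~= k\<^sup>2" for k
    proof
     assume "m = k\<^sup>2"
     hence "n = (2 * k)\<^sup>2" using m by (simp add: power_mult_distrib)
     thus False using nosq by blast
    qed
    thus ?thesis using m False by (auto simp: theta_fps_def)
   qed
   moreover have "fps_nth ps ((n - 1) div 8) = 0" if n8: "n > 0" "8 dvd (n - 1)"
   proof -
    obtain m where "n - 1 = 8 * m" using n8(2) by (rule dvdE)
    hence m: "n = 8 * m + 1" using n8(1) by simp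
    have "m ~= j * (j + 1) div 2" for j
    proof
     assume a: "m = j * (j + 1) div 2"
     have t: "j * (j + 1) = 2 * m" by (simp add: a)
     have "n = (2 * j + 1)\<^sup>2" unfolding m using t by (simp add: power2_eq_square algebra_simps)
     thus False using nosq by blast
    qed
    thus ?thesis using m by (auto simp: psi_fps_def)
   qed
   ultimately show ?thesis unfolding R using False nosq by (auto simp: theta_fps_def)
  qed
 qed (unfold R, simp)
qed

lemma theta_dissect_reflect: "th oo - fps_X = (th oo fps_X ^ 4) - 2 * fps_X * (ps oo fps_X ^ 8)"
proof -
 have "th oo - fps_X = ((th oo fps_X ^ 4) + 2 * fps_X * (ps oo fps_X ^ 8)) oo - fps_X"
  by (subst theta_dissect) simp
 also have "... = (th oo fps_X ^ 4) - 2 * fps_X * (ps oo fps_X ^ 8)"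
  by (simp add: fps_compose_add_distrib fps_compose_mult_distrib)
 finally show ?thesis .
qed

text \<open>The difference B of the two sides satisfies B(q) = -2 B(q^2), by squaring the even part
  from the dissection and inserting the product relation.\<close>

lemma theta_square_add_reflect: "th\<^sup>2 + (th oo - fps_X)\<^sup>2 = 2 * (th oo fps_X ^ 2)\<^sup>2"
proof -
 define B where "B = th\<^sup>2 + (th oo - fps_X)\<^sup>2 - 2 * (th oo fps_X ^ 2)\<^sup>2"
 have B2: "B oo fps_X ^ 2 = (th oo fps_X ^ 2)\<^sup>2 + ((th oo - fps_X) oo fps_X ^ 2)\<^sup>2 - 2 * (th oo fps_X ^ 4)\<^sup>2"
  by (simp add: B_def fps_compose_add_distrib fps_compose_sub_distrib fps_compose_mult_distrib flip: fps_compose_power)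
 have "(th + (th oo - fps_X))\<^sup>2 = 4 * (th oo fps_X ^ 4)\<^sup>2"
  unfolding theta_dissect_reflect by (subst theta_dissect) (simp add: power2_eq_square)
 hence "th\<^sup>2 + (th oo - fps_X)\<^sup>2 + 2 * ((th oo - fps_X) oo fps_X ^ 2)\<^sup>2 = 4 * (th oo fps_X ^ 4)\<^sup>2"
  unfolding theta_mult_reflect[symmetric] by (simp add: power2_eq_square algebra_simps)
 hence e: "th\<^sup>2 + (th oo - fps_X)\<^sup>2 = 4 * (th oo fps_X ^ 4)\<^sup>2 - 2 * ((th oo - fps_X) oo fps_X ^ 2)\<^sup>2"
  by (simp add: eq_diff_eq)
 have "B = - 2 * (B oo fps_X ^ 2)" unfolding B2 unfolding B_def e by (simp add: algebra_simps)
 hence "B = fps_const (-2) * (B oo fps_X ^ 2)" by (simp add: numeral_fps_const flip: fps_const_neg)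
 moreover have "fps_nth B 0 = 0" by (simp add: B_def fps_nth_power_0)
 ultimately have "B = 0" by (intro fps_zero_by_dilation)
 thus ?thesis by (simp add: B_def)
qed

lemma theta_square_sub_reflect: "th\<^sup>2 - (th oo - fps_X)\<^sup>2 = 8 * fps_X * (ps oo fps_X ^ 4)\<^sup>2"
proof -
 have "((th * (ps oo fps_X ^ 2)) oo fps_X ^ 4) = (ps ^ 2) oo fps_X ^ 4" by (simp only: theta_mult_psi)
 hence p: "(th oo fps_X ^ 4) * (ps oo fps_X ^ 8) = (ps oo fps_X ^ 4)\<^sup>2"
  by (simp add: fps_compose_mult_distrib flip: fps_compose_power)
 have "th\<^sup>2 - (th oo - fps_X)\<^sup>2 = (th + (th oo - fps_X)) * (th - (th oo - fps_X))"
  by (simp add: algebra_simps power2_eq_square)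
 also have "th + (th oo - fps_X) = 2 * (th oo fps_X ^ 4)" unfolding theta_dissect_reflect by (subst theta_dissect) simp
 also have "th - (th oo - fps_X) = 4 * fps_X * (ps oo fps_X ^ 8)" unfolding theta_dissect_reflect by (subst theta_dissect) simp
 also have "2 * (th oo fps_X ^ 4) * (4 * fps_X * (ps oo fps_X ^ 8)) = 8 * fps_X * ((th oo fps_X ^ 4) * (ps oo fps_X ^ 8))" by simp
 finally show ?thesis unfolding p .
qed

lemma theta_square_eq: "th\<^sup>2 = (th oo fps_X ^ 2)\<^sup>2 + 4 * fps_X * (ps oo fps_X ^ 4)\<^sup>2"
proof -
 have "2 * th\<^sup>2 = 2 * ((th oo fps_X ^ 2)\<^sup>2 + 4 * fps_X * (ps oo fps_X ^ 4)\<^sup>2)"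
  using arg_cong2[OF theta_square_add_reflect theta_square_sub_reflect, of "(+)"] by (simp add: algebra_simps)
 thus ?thesis by (metis mult_left_cancel zero_neq_numeral)
qed

lemma theta_compose_rels:
 shows theta_psi_4: "(th oo fps_X ^ 4) * (ps oo fps_X ^ 8) = (ps oo fps_X ^ 4)\<^sup>2"
  and theta_reflect_2: "(th oo fps_X ^ 2) * ((th oo - fps_X) oo fps_X ^ 2) = ((th oo - fps_X) oo fps_X ^ 4)\<^sup>2"
proof -
 have "((th * (ps oo fps_X ^ 2)) oo fps_X ^ 4) = (ps ^ 2) oo fps_X ^ 4" by (simp only: theta_mult_psi)
 thus "(th oo fps_X ^ 4) * (ps oo fps_X ^ 8) = (ps oo fps_X ^ 4)\<^sup>2"
  by (simp add: fps_compose_mult_distrib flip: fps_compose_power)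
 have "((th * (th oo - fps_X)) oo fps_X ^ 2) = (((th oo - fps_X) oo fps_X ^ 2) ^ 2) oo fps_X ^ 2" by (simp only: theta_mult_reflect)
 thus "(th oo fps_X ^ 2) * ((th oo - fps_X) oo fps_X ^ 2) = ((th oo - fps_X) oo fps_X ^ 4)\<^sup>2"
  by (simp add: fps_compose_mult_distrib flip: fps_compose_power)
qed

definition fps_logderiv :: "'a::field fps => 'a fps" where
 "fps_logderiv F = fps_X * fps_deriv F * inverse F"

lemma fps_logderiv_times_self: "fps_nth F 0 ~= 0 ==> fps_logderiv F * F = fps_X * fps_deriv (F :: 'a::field fps)"
 by (simp add: fps_logderiv_def mult.assoc inverse_mult_eq_1)

lemma fps_logderiv_mult:
 "fps_nth F 0 ~= 0 ==> fps_nth G 0 ~= 0 ==> fps_logderiv (F * G) = fps_logderiv F + fps_logderiv (G :: 'a::field fps)"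
proof -
 assume a: "fps_nth F 0 ~= 0" "fps_nth G 0 ~= 0"
 have "fps_logderiv (F * G) = fps_X * fps_deriv F * inverse F * (inverse G * G) + fps_X * fps_deriv G * inverse G * (inverse F * F)"
  by (simp add: fps_logderiv_def fps_inverse_mult algebra_simps)
 thus ?thesis using a by (simp add: inverse_mult_eq_1 fps_logderiv_def)
qed

lemma fps_logderiv_square: "fps_nth F 0 ~= 0 ==> fps_logderiv (F\<^sup>2) = 2 * fps_logderiv (F :: 'a::field fps)"
 by (simp add: power2_eq_square fps_logderiv_mult)

lemma fps_logderiv_compose:
 fixes F :: "'a::field fps"
 assumes "fps_nth F 0 ~= 0" "fps_nth G 0 = 0" "fps_X * fps_deriv G = c * G"
 shows "fps_logderiv (F oo G) = c * (fps_logderiv F oo G)"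
proof -
 have "fps_logderiv (F oo G) = (fps_deriv F oo G) * (fps_X * fps_deriv G) * (inverse F oo G)"
  using assms(1,2) by (simp add: fps_logderiv_def fps_compose_deriv fps_inverse_compose algebra_simps)
 also have "... = c * ((fps_X * fps_deriv F * inverse F) oo G)"
  using assms(2) unfolding assms(3) by (simp add: fps_compose_mult_distrib algebra_simps)
 finally show ?thesis by (simp add: fps_logderiv_def)
qed

lemma fps_logderiv_compose_X_power:
 fixes F :: "'a::field fps"
 assumes "fps_nth F 0 ~= 0" "k > 0"
 shows "fps_logderiv (F oo fps_X ^ k) = of_nat k * (fps_logderiv F oo fps_X ^ k)"
proof (rule fps_logderiv_compose)
 show "fps_X * fps_deriv (fps_X ^ k) = of_nat k * (fps_X ^ k :: 'a fps)"
  by (rule fps_ext) (auto simp: fps_X_power_nth simp flip: fps_of_nat)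
qed (use assms in auto)

lemma fps_logderiv_compose_minus:
 fixes F :: "'a::field fps"
 assumes "fps_nth F 0 ~= 0"
 shows "fps_logderiv (F oo - fps_X) = fps_logderiv F oo - fps_X"
 using fps_logderiv_compose[OF assms, of "- fps_X" 1] by simp

text \<open>
 Both sides satisfy the same two dilation equations, which express the even and odd
 parts of a series through its values at \<open>q\<^sup>2\<close> and \<open>q\<^sup>4\<close>; the difference then has no first
 nonzero coefficient.
\<close>

lemma logderiv_psi_theta: "1 + 8 * (fps_logderiv ps - fps_logderiv th) = (th oo - fps_X) ^ 4"
proof -
 define a b where "a = fps_logderiv ps" and "b = fps_logderiv th"
 define am bm a2 b2 a2m b2m where "am = a oo - fps_X" and "bm = b oo - fps_X" and "a2 = a oo fps_X ^ 2"
  and "b2 = b oo fps_X ^ 2" and "a2m = am oo fps_X ^ 2" and "b2m = bm oo fps_X ^ 2"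
 define tm t2 t2m where "tm = th oo - fps_X" and "t2 = th oo fps_X ^ 2" and "t2m = tm oo fps_X ^ 2"
 define p4 where "p4 = ps oo fps_X ^ 4"
 define L W where "L = 1 + 8 * (a - b)" and "W = tm ^ 4"
 \<comment> \<open>R1, R2 and R3 are the logarithmic derivatives of the three product relations;
   they settle the even part of the identity.\<close>
 have R1: "b + 2 * a2 = 2 * a"
 proof -
  have "fps_logderiv (th * (ps oo fps_X ^ 2)) = fps_logderiv (ps\<^sup>2)" by (simp only: theta_mult_psi)
  thus ?thesis by (simp add: fps_logderiv_mult fps_logderiv_square fps_logderiv_compose_X_power a_def b_def a2_def)
 qed
 have R2: "b + bm = 4 * b2m"
 proof -
  have "fps_logderiv (th * (th oo - fps_X)) = fps_logderiv (((th oo - fps_X) oo fps_X ^ 2) ^ 2)" by (simp only: theta_mult_reflect)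
  thus ?thesis by (simp add: fps_logderiv_mult fps_logderiv_square fps_logderiv_compose_X_power fps_logderiv_compose_minus b_def bm_def b2m_def)
 qed
 have R3: "a + am = 2 * a2 + 2 * b2m"
 proof -
  have "fps_logderiv (ps * (ps oo - fps_X)) = fps_logderiv ((ps oo fps_X ^ 2) * ((th oo - fps_X) oo fps_X ^ 2))" by (simp only: psi_mult_reflect)
  thus ?thesis by (simp add: fps_logderiv_mult fps_logderiv_compose_X_power fps_logderiv_compose_minus a_def b_def bm_def b2m_def a2_def am_def)
 qed
 have R1m: "bm + 2 * a2 = 2 * am"
  using arg_cong[OF R1, of "%F. F oo - fps_X"]
  by (simp add: fps_compose_add_distrib fps_compose_mult_distrib a2_def bm_def am_def)
 have D: "b - bm = 2 * a - 2 * am" using R1 R1m by (metis add_diff_cancel_right)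
 have D2: "b2 - b2m = 2 * a2 - 2 * a2m"
  using arg_cong[OF D, of "%F. F oo fps_X ^ 2"]
  by (simp add: fps_compose_sub_distrib fps_compose_mult_distrib a2_def b2_def a2m_def b2m_def)
 have Lm: "L oo - fps_X = 1 + 8 * (am - bm)"
  by (simp add: L_def am_def bm_def fps_compose_add_distrib fps_compose_sub_distrib fps_compose_mult_distrib)
 have L2: "L oo fps_X ^ 2 = 1 + 8 * (a2 - b2)"
  by (simp add: L_def a2_def b2_def fps_compose_add_distrib fps_compose_sub_distrib fps_compose_mult_distrib)
 have L2m: "(L oo - fps_X) oo fps_X ^ 2 = 1 + 8 * (a2m - b2m)"
  by (simp add: Lm a2m_def b2m_def fps_compose_add_distrib fps_compose_sub_distrib fps_compose_mult_distrib)
 have e1: "am = 2 * a2 + 2 * b2m - a" using R3 by (simp add: algebra_simps)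
 have e2: "bm = 4 * b2m - b" using R2 by (simp add: algebra_simps)
 have e3: "b2 = b2m + 2 * a2 - 2 * a2m" using D2 by (simp add: algebra_simps)
 have Leven: "L + (L oo - fps_X) = 4 * ((L oo - fps_X) oo fps_X ^ 2) - 2 * (L oo fps_X ^ 2)"
  unfolding L2m L2 unfolding Lm unfolding L_def e1 e2 e3 by (simp add: algebra_simps)
 have Wm: "W oo - fps_X = th ^ 4" by (simp add: W_def tm_def flip: fps_compose_power)
 have W2: "W oo fps_X ^ 2 = t2m ^ 4" by (simp add: W_def t2m_def tm_def flip: fps_compose_power)
 have W2m: "(W oo - fps_X) oo fps_X ^ 2 = t2 ^ 4" by (simp add: Wm t2_def flip: fps_compose_power)
 have A: "th\<^sup>2 + tm\<^sup>2 = 2 * t2\<^sup>2" using theta_square_add_reflect by (simp add: tm_def t2_def)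
 have A': "th\<^sup>2 - tm\<^sup>2 = 8 * fps_X * p4\<^sup>2" using theta_square_sub_reflect by (simp add: tm_def p4_def)
 have tt: "th * tm = t2m\<^sup>2" using theta_mult_reflect by (simp add: tm_def t2m_def)
 have Weven: "W + (W oo - fps_X) = 4 * ((W oo - fps_X) oo fps_X ^ 2) - 2 * (W oo fps_X ^ 2)"
 proof -
  have "(th\<^sup>2 + tm\<^sup>2)\<^sup>2 = W + th ^ 4 + 2 * (th * tm)\<^sup>2"
   by (simp add: W_def power2_eq_square power4_eq_xxxx algebra_simps)
  hence "4 * t2 ^ 4 = W + th ^ 4 + 2 * t2m ^ 4" unfolding A tt by (simp add: power_mult_distrib)
  thus ?thesis unfolding W2 W2m unfolding Wm by (simp add: eq_diff_eq)
 qed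
 have p8: "(th oo fps_X ^ 4) * (ps oo fps_X ^ 8) = p4\<^sup>2" using theta_psi_4 by (simp add: p4_def)
 have L4: "L oo fps_X ^ 4 = 1 + 8 * (a oo fps_X ^ 8) - 4 * (b oo fps_X ^ 4)"
 proof -
  have "(b oo fps_X ^ 4) + 2 * (a oo fps_X ^ 8) = 2 * (a oo fps_X ^ 4)"
   using arg_cong[OF R1, of "%F. F oo fps_X ^ 4"]
   by (simp add: fps_compose_add_distrib fps_compose_mult_distrib a2_def)
  hence e: "2 * (a oo fps_X ^ 8) = 2 * (a oo fps_X ^ 4) - (b oo fps_X ^ 4)" by (simp add: eq_diff_eq add.commute)
  have "8 * (a oo fps_X ^ 8) = 4 * (2 * (a oo fps_X ^ 8))" by simp
  also have "... = 8 * (a oo fps_X ^ 4) - 4 * (b oo fps_X ^ 4)" unfolding e by (simp add: algebra_simps)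
  finally show ?thesis
   by (simp add: L_def fps_compose_add_distrib fps_compose_sub_distrib fps_compose_mult_distrib algebra_simps)
 qed
 \<comment> \<open>The odd part needs more than the product relations: the theta series at q and at
   -q are differentiated through their dissection, whose pieces are series in q^4 and q^8.\<close>
 have Lodd: "((L oo - fps_X) - L) * t2m\<^sup>2 = 16 * fps_X * p4\<^sup>2 * (L oo fps_X ^ 4)"
 proof -
  define \<alpha> \<beta> where "\<alpha> = th oo fps_X ^ 4" and "\<beta> = ps oo fps_X ^ 8"
  have th: "th = \<alpha> + 2 * fps_X * \<beta>" unfolding \<alpha>_def \<beta>_def by (rule theta_dissect)
  have tm: "tm = \<alpha> - 2 * fps_X * \<beta>" unfolding \<alpha>_def \<beta>_def tm_def by (rule theta_dissect_reflect)
  have a0: "fps_nth \<alpha> 0 ~= 0" "fps_nth \<beta> 0 ~= 0" "fps_nth tm 0 ~= 0" by (simp_all add: \<alpha>_def \<beta>_def tm_def)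
  have \<alpha>': "fps_X * fps_deriv \<alpha> = 4 * (b oo fps_X ^ 4) * \<alpha>"
   unfolding fps_logderiv_times_self[OF a0(1), symmetric] by (simp add: \<alpha>_def b_def fps_logderiv_compose_X_power)
  have \<beta>': "fps_X * fps_deriv \<beta> = 8 * (a oo fps_X ^ 8) * \<beta>"
   unfolding fps_logderiv_times_self[OF a0(2), symmetric] by (simp add: \<beta>_def a_def fps_logderiv_compose_X_power)
  have bt: "b * th = fps_X * fps_deriv th" by (simp add: b_def fps_logderiv_times_self)
  have bmt: "bm * tm = fps_X * fps_deriv tm"
   unfolding fps_logderiv_times_self[OF a0(3), symmetric] by (simp add: tm_def bm_def b_def fps_logderiv_compose_minus)
  have Xd: "fps_X * fps_deriv (\<alpha> + 2 * fps_X * \<beta>) = fps_X * fps_deriv \<alpha> + 2 * fps_X * \<beta> + 2 * fps_X * (fps_X * fps_deriv \<beta>)"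
   by (simp add: algebra_simps)
  have Xd': "fps_X * fps_deriv (\<alpha> - 2 * fps_X * \<beta>) = fps_X * fps_deriv \<alpha> - 2 * fps_X * \<beta> - 2 * fps_X * (fps_X * fps_deriv \<beta>)"
   by (simp add: algebra_simps)
  have "(b - bm) * (th * tm) = (b * th) * tm - (bm * tm) * th" by (simp add: algebra_simps)
  also have "... = 4 * fps_X * (\<alpha> * \<beta>) * (1 + 8 * (a oo fps_X ^ 8) - 4 * (b oo fps_X ^ 4))"
   unfolding bt bmt unfolding tm unfolding th unfolding Xd Xd' \<alpha>' \<beta>' by (simp add: algebra_simps)
  finally have w: "(b - bm) * t2m\<^sup>2 = 4 * fps_X * p4\<^sup>2 * (L oo fps_X ^ 4)"
   unfolding tt L4 p8[folded \<alpha>_def \<beta>_def] .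
  have "(L oo - fps_X) - L = 4 * (2 * (b - bm)) - 4 * (2 * a - 2 * am)"
   unfolding Lm unfolding L_def by (simp add: algebra_simps)
  also have "... = 4 * (b - bm)" unfolding D[symmetric] by simp
  finally have "((L oo - fps_X) - L) * t2m\<^sup>2 = 4 * ((b - bm) * t2m\<^sup>2)" by (simp only: mult.assoc)
  thus ?thesis unfolding w by simp
 qed
 have Wodd: "((W oo - fps_X) - W) * t2m\<^sup>2 = 16 * fps_X * p4\<^sup>2 * (W oo fps_X ^ 4)"
 proof -
  have "(W oo - fps_X) - W = (th\<^sup>2 - tm\<^sup>2) * (th\<^sup>2 + tm\<^sup>2)"
   unfolding Wm by (simp add: W_def power2_eq_square power4_eq_xxxx algebra_simps)
  also have "... = 16 * fps_X * p4\<^sup>2 * t2\<^sup>2" unfolding A A' by simp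
  finally have "((W oo - fps_X) - W) * t2m\<^sup>2 = 16 * fps_X * p4\<^sup>2 * (t2 * t2m)\<^sup>2"
   by (simp add: power_mult_distrib mult.assoc)
  also have "t2 * t2m = (tm oo fps_X ^ 4)\<^sup>2" using theta_reflect_2 by (simp add: t2_def t2m_def tm_def)
  also have "((tm oo fps_X ^ 4)\<^sup>2)\<^sup>2 = W oo fps_X ^ 4" by (simp add: W_def flip: fps_compose_power power_mult)
  finally show ?thesis .
 qed
 define T where "T = L - W"
 have Teven: "T + (T oo - fps_X) = 4 * ((T oo - fps_X) oo fps_X ^ 2) - 2 * (T oo fps_X ^ 2)"
  using arg_cong2[OF Leven Weven, of "(-)"] by (simp add: T_def fps_compose_sub_distrib algebra_simps)
 have Todd: "((T oo - fps_X) - T) * t2m\<^sup>2 = 16 * fps_X * p4\<^sup>2 * (T oo fps_X ^ 4)"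
  using arg_cong2[OF Lodd Wodd, of "(-)"] by (simp add: T_def fps_compose_sub_distrib algebra_simps)
 have T0: "fps_nth T 0 = 0" by (simp add: T_def L_def W_def a_def b_def fps_logderiv_def tm_def fps_nth_power_0)
 have "T = 0"
 proof (rule ccontr)
  assume "T ~= 0"
  define d where "d = subdegree T"
  have Td: "fps_nth T d ~= 0" using \<open>T ~= 0\<close> by (simp add: d_def)
  have lt: "fps_nth T i = 0" if "i < d" for i using that unfolding d_def by (rule nth_less_subdegree_zero)
  have d0: "d > 0" by (rule ccontr) (use T0 Td in simp)
  show False
  proof (cases "even d")
   case True
   have "fps_nth (T + (T oo - fps_X)) d = 2 * fps_nth T d" using True by (simp add: fps_nth_compose_minus_X)
   moreover have "fps_nth (4 * ((T oo - fps_X) oo fps_X ^ 2) - 2 * (T oo fps_X ^ 2)) d = 0"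
    using lt[of "d div 2"] d0 by (simp add: numeral_fps_const fps_nth_compose_X_power fps_nth_compose_minus_X)
   ultimately show False using Teven Td by simp
  next
   case False
   \<comment> \<open>In odd degree d only the lowest coefficient of T contributes on the left, while
     the right side involves coefficients of T at indices at most d/4.\<close>
   have "fps_nth (((T oo - fps_X) - T) * t2m\<^sup>2) d = (\<Sum>i=0..d. fps_nth ((T oo - fps_X) - T) i * fps_nth (t2m\<^sup>2) (d - i))"
    by (simp add: fps_mult_nth)
   also have "... = (\<Sum>i\<in>{d}. fps_nth ((T oo - fps_X) - T) i * fps_nth (t2m\<^sup>2) (d - i))"
    by (rule sum.mono_neutral_right) (auto simp: fps_nth_compose_minus_X lt)
   also have "... = - 2 * fps_nth T d"
    using False by (simp add: fps_nth_compose_minus_X t2m_def tm_def fps_nth_power_0)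
   finally have 1: "fps_nth (((T oo - fps_X) - T) * t2m\<^sup>2) d = - 2 * fps_nth T d" .
   have "fps_nth (Y * (T oo fps_X ^ 4)) d = 0" for Y
    unfolding fps_mult_nth
   proof (rule sum.neutral, rule ballI)
    fix i assume "i \<in> {0..d}"
    hence "fps_nth (T oo fps_X ^ 4) (d - i) = 0"
     using lt[of "(d - i) div 4"] d0 by (simp add: fps_nth_compose_X_power)
    thus "fps_nth Y i * fps_nth (T oo fps_X ^ 4) (d - i) = 0" by simp
   qed
   thus False using 1 Td unfolding Todd by simp
  qed
 qed
 thus ?thesis by (simp add: T_def L_def W_def a_def b_def tm_def)
qed

end

section \<open>Transfer of coefficients and the q-expansions of the eta quotients\<close>

text \<open>Identities are proved over the complex numbers by analysis, pulled back to the rationals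
  by injectivity, and then carried to the p-adic numbers.\<close>

definition fps_of_rat :: "rat fps => 'a::field_char_0 fps" where
 "fps_of_rat F = Abs_fps (%n. of_rat (fps_nth F n))"

lemma fps_nth_of_rat [simp]: "fps_nth (fps_of_rat F) n = of_rat (fps_nth F n)"
 by (simp add: fps_of_rat_def)

lemma fps_of_rat_eq_iff [simp]: "fps_of_rat F = (fps_of_rat G :: 'a::field_char_0 fps) \<longleftrightarrow> F = G"
 by (auto simp: fps_eq_iff)

lemma fps_of_rat_add: "fps_of_rat (F + G) = fps_of_rat F + fps_of_rat G"
 by (rule fps_ext) (simp add: of_rat_add)
lemma fps_of_rat_minus: "fps_of_rat (- F) = - fps_of_rat F"
 by (rule fps_ext) (simp add: of_rat_minus)
lemma fps_of_rat_mult: "fps_of_rat (F * G) = fps_of_rat F * fps_of_rat G"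
 by (rule fps_ext) (simp add: fps_mult_nth of_rat_mult of_rat_sum)
lemma fps_of_rat_const: "fps_of_rat (fps_const c) = fps_const (of_rat c)"
 by (rule fps_ext) simp
lemma fps_of_rat_1: "fps_of_rat 1 = 1"
 by (rule fps_ext) simp
lemma fps_of_rat_numeral: "fps_of_rat (numeral n) = numeral n"
 by (rule fps_ext) (simp add: fps_numeral_nth)
lemma fps_of_rat_X: "fps_of_rat fps_X = fps_X"
 by (rule fps_ext) simp
lemma fps_of_rat_power: "fps_of_rat (F ^ n) = fps_of_rat F ^ n"
 by (induction n) (simp_all add: fps_of_rat_1 fps_of_rat_mult)
lemma fps_of_rat_deriv: "fps_of_rat (fps_deriv F) = fps_deriv (fps_of_rat F)"
 by (rule fps_ext) (simp add: of_rat_mult of_rat_add)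
lemma fps_of_rat_compose: "fps_of_rat (F oo G) = fps_of_rat F oo fps_of_rat G"
 by (rule fps_ext) (simp add: fps_compose_nth of_rat_sum of_rat_mult flip: fps_of_rat_power)
lemma fps_of_rat_theta: "fps_of_rat theta_fps = theta_fps"
 by (rule fps_ext) (simp add: theta_fps_def)
lemma fps_of_rat_psi: "fps_of_rat psi_fps = psi_fps"
 by (rule fps_ext) (simp add: psi_fps_def)

lemmas fps_of_rat_simps = fps_of_rat_add fps_of_rat_minus fps_of_rat_mult fps_of_rat_const fps_of_rat_1
 fps_of_rat_numeral fps_of_rat_X fps_of_rat_power fps_of_rat_deriv fps_of_rat_compose fps_of_rat_theta fps_of_rat_psi

lemma dedekind_eta_euler_prod:
 "dedekind_eta (of_nat k * \<tau>) = exp (2 * of_real pi * \<i> * \<tau> / 24) ^ k * euler_prod (exp (2 * of_real pi * \<i> * \<tau>) ^ k)"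
proof -
 have e: "exp (2 * of_real pi * \<i> * (of_nat k * \<tau>)) = exp (2 * of_real pi * \<i> * \<tau>) ^ k"
  by (simp flip: exp_of_nat_mult add: mult_ac)
 have e2: "exp (2 * of_real pi * \<i> * (of_nat k * \<tau>) / 24) = exp (2 * of_real pi * \<i> * \<tau> / 24) ^ k"
  by (simp flip: exp_of_nat_mult add: mult_ac)
 show ?thesis unfolding dedekind_eta_def euler_prod_def e e2 ..
qed

lemma nome_surj:
 assumes "q ~= 0" "norm q < 1"
 obtains \<tau> where "Im \<tau> > 0" "exp (2 * of_real pi * \<i> * \<tau>) = q"
proof
 define \<tau> where "\<tau> = Ln q / (2 * of_real pi * \<i>)"
 show "exp (2 * of_real pi * \<i> * \<tau>) = q" using assms by (simp add: \<tau>_def)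
 have "\<tau> = - \<i> * Ln q / of_real (2 * pi)" by (simp add: \<tau>_def field_simps)
 hence "Im \<tau> = - Re (Ln q) / (2 * pi)" by (simp add: Im_divide_of_real)
 thus "Im \<tau> > 0" using assms by (simp add: divide_neg_pos ln_less_zero)
qed

text \<open>Multiplication by q^N removes the polar part, so that the sum over all integers becomes
  a power series.\<close>

lemma has_q_expansion_sums:
 assumes "has_q_expansion f W" "W = fls_shift (int N) (fps_to_fls F)" "Im \<tau> > 0"
 defines "q \<equiv> exp (2 * of_real pi * \<i> * \<tau>)"
 shows "(%n. fps_nth (fps_of_rat F) n * q ^ n) sums (q ^ N * f \<tau>)"
proof -
 have q0: "q ~= 0" by (simp add: q_def)
 define h where "h = (%n. int n - int N)"
 have inj: "inj_on h UNIV" by (auto simp: h_def inj_on_def)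
 have "((%n::int. of_rat (fls_nth W n) * q powi n) has_sum f \<tau>) UNIV"
  using assms(1,3) by (auto simp: has_q_expansion_def q_def)
 also have "?this \<longleftrightarrow> ((%n::int. of_rat (fls_nth W n) * q powi n) has_sum f \<tau>) (range h)"
 proof (rule has_sum_cong_neutral)
  fix n assume "n \<in> UNIV - range h"
  hence "n + int N < 0"
   by (auto simp: h_def image_iff) (metis add_diff_cancel_right' linorder_not_less zero_le_imp_eq_int)
  thus "of_rat (fls_nth W n) * q powi n = 0" by (simp add: assms(2))
 qed auto
 also have "... \<longleftrightarrow> (((%n::int. of_rat (fls_nth W n) * q powi n) \<circ> h) has_sum f \<tau>) UNIV"
  by (rule has_sum_reindex[OF inj])
 finally have "((%n. q ^ N * ((%n::int. of_rat (fls_nth W n) * q powi n) \<circ> h) n) has_sum q ^ N * f \<tau>) UNIV"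
  by (rule has_sum_cmult_right)
 also have "(%n. q ^ N * ((%n::int. of_rat (fls_nth W n) * q powi n) \<circ> h) n) = (%n. fps_nth (fps_of_rat F) n * q ^ n)"
  using q0 by (auto simp: h_def assms(2) power_int_diff fun_eq_iff)
 finally show ?thesis by (rule has_sum_imp_sums)
qed

context
 fixes b :: "nat => rat" and W :: "rat fls"
 assumes b0: "b 0 = 0"
  and b: "has_q_expansion cusp_form_32 (fps_to_fls (Abs_fps b))"
  and W: "has_q_expansion (%\<tau>. - cusp_form_32 \<tau> * eta_L (2 * \<tau>)) W"
begin

private definition cusp_q :: "complex => complex" where
 "cusp_q q = q * euler_prod (q ^ 4) ^ 2 * euler_prod (q ^ 8) ^ 2"

private lemma cusp_form_nome: "cusp_form_32 \<tau> = cusp_q (exp (2 * of_real pi * \<i> * \<tau>))"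
proof -
 \<comment> \<open>A 24th root of q. The exponents 8 and 16 contributed by the two eta squares add
   up to 24, so the result is a function of q.\<close>
 define r where "r = exp (2 * of_real pi * \<i> * \<tau> / 24)"
 have r: "r ^ 24 = exp (2 * of_real pi * \<i> * \<tau>)" by (simp add: r_def mult_ac flip: exp_of_nat_mult)
 define q where "q = exp (2 * of_real pi * \<i> * \<tau>)"
 have e: "dedekind_eta (4 * \<tau>) = r ^ 4 * euler_prod (q ^ 4)" "dedekind_eta (8 * \<tau>) = r ^ 8 * euler_prod (q ^ 8)"
  using dedekind_eta_euler_prod[of 4 \<tau>] dedekind_eta_euler_prod[of 8 \<tau>] by (simp_all add: q_def r_def)
 have "cusp_form_32 \<tau> = r ^ 24 * euler_prod (q ^ 4) ^ 2 * euler_prod (q ^ 8) ^ 2"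
  unfolding cusp_form_32_def e by (simp add: power_mult_distrib mult_ac flip: power_mult power_add)
 thus ?thesis unfolding r q_def[symmetric] cusp_q_def .
qed

private lemma eta_L_nome:
 assumes "Im \<tau> > 0"
 defines "q \<equiv> exp (2 * of_real pi * \<i> * \<tau>)"
 shows "q\<^sup>2 * eta_L (2 * \<tau>) = psi_prod (q ^ 8) ^ 2 / psi_prod (q ^ 16) ^ 2"
proof -
 define r where "r = exp (2 * of_real pi * \<i> * \<tau> / 24)"
 have r: "r ^ 24 = q" by (simp add: r_def q_def mult_ac flip: exp_of_nat_mult)
 have r0: "r ~= 0" by (simp add: r_def)
 have q1: "norm q < 1" using assms by (simp add: q_def norm_exp_eq_Re)
 have nz: "euler_prod (q ^ 8) ~= 0" "euler_prod (q ^ 16) ~= 0" "euler_prod (q ^ 32) ~= 0"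
  by (intro euler_prod_nz norm_power_lt_1 q1; simp)+
 have e: "dedekind_eta (8 * (2 * \<tau>)) = r ^ 16 * euler_prod (q ^ 16)"
  "dedekind_eta (4 * (2 * \<tau>)) = r ^ 8 * euler_prod (q ^ 8)"
  "dedekind_eta (16 * (2 * \<tau>)) = r ^ 32 * euler_prod (q ^ 32)"
  using dedekind_eta_euler_prod[of 16 \<tau>] dedekind_eta_euler_prod[of 8 \<tau>] dedekind_eta_euler_prod[of 32 \<tau>]
  by (simp_all add: q_def r_def)
 \<comment> \<open>Both numerator and denominator carry r to the power 144, the factor q^2 supplying
   48 of it above.\<close>
 have "q\<^sup>2 * eta_L (2 * \<tau>) = (r ^ 48 * r ^ 96) * euler_prod (q ^ 16) ^ 6 / ((r ^ 16 * r ^ 128) * (euler_prod (q ^ 8) ^ 2 * euler_prod (q ^ 32) ^ 4))"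
  unfolding eta_L_def e r[symmetric] by (simp add: power_mult_distrib mult_ac flip: power_mult)
 also have "... = euler_prod (q ^ 16) ^ 6 / (euler_prod (q ^ 8) ^ 2 * euler_prod (q ^ 32) ^ 4)"
  using r0 by (simp flip: power_add)
 also have "... = psi_prod (q ^ 8) ^ 2 / psi_prod (q ^ 16) ^ 2"
  using nz by (simp add: psi_prod_def power_divide divide_simps flip: power_mult power_add)
 finally show ?thesis .
qed

private lemma norm_nome: "Im \<tau> > 0 ==> norm (exp (2 * of_real pi * \<i> * \<tau>)) < 1"
 by (simp add: norm_exp_eq_Re)

private lemma cusp_q_expansion: "cusp_q has_fps_expansion fps_of_rat (Abs_fps b)"
proof (rule has_fps_expansionI, rule eventually_mono[OF eventually_norm_lt_1])
 fix q :: complex assume q: "norm q < 1"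
 show "(%n. fps_nth (fps_of_rat (Abs_fps b)) n * q ^ n) sums cusp_q q"
 proof (cases "q = 0")
  case True
  thus ?thesis using powser_sums_zero[of "fps_nth (fps_of_rat (Abs_fps b) :: complex fps)"] b0 by (simp add: cusp_q_def)
 next
  case False
  then obtain \<tau> where \<tau>: "Im \<tau> > 0" "exp (2 * of_real pi * \<i> * \<tau>) = q" using nome_surj q by blast
  show ?thesis using has_q_expansion_sums[OF b, of 0 "Abs_fps b" \<tau>] \<tau> cusp_form_nome[of \<tau>] by simp
 qed
qed

private abbreviation (input) thr :: "'a::field_char_0 fps" where "thr \<equiv> theta_fps oo - fps_X"

text \<open>Apart from the leading q everything is a series in q^4, which shows the exponents of g
  modulo 4; the arguments q^4 and q^8 are those of the derivative of the hauptmodul.\<close>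

lemma cusp_form_theta:
 "Abs_fps b = fps_X * (thr oo fps_X ^ 4) * (thr oo fps_X ^ 8)\<^sup>2 * (psi_fps oo fps_X ^ 8)"
proof -
 have "fps_of_rat (Abs_fps b) = fps_X * (thr oo fps_X ^ 4) * (thr oo fps_X ^ 8)\<^sup>2 * (psi_fps oo fps_X ^ 8 :: complex fps)"
 proof (rule fps_eq_if_expansions_eq[OF cusp_q_expansion])
  show "(%q. q * theta_prod (- (q ^ 4)) * (theta_prod (- (q ^ 8)))\<^sup>2 * psi_prod (q ^ 8)) has_fps_expansion
     fps_X * (thr oo fps_X ^ 4) * (thr oo fps_X ^ 8)\<^sup>2 * (psi_fps oo fps_X ^ 8)"
   by (intro has_fps_expansion_mult has_fps_expansion_power has_fps_expansion_fps_X
      has_fps_expansion_dilate[OF has_fps_expansion_reflect[OF theta_fps_expansion]]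
      has_fps_expansion_dilate[OF psi_fps_expansion]) auto
  fix q :: complex assume q: "norm q < 1"
  have nz: "euler_prod (q ^ 4) ~= 0" "euler_prod (q ^ 8) ~= 0" "euler_prod (q ^ 16) ~= 0"
   by (intro euler_prod_nz norm_power_lt_1 q; simp)+
  show "cusp_q q = q * theta_prod (- (q ^ 4)) * (theta_prod (- (q ^ 8)))\<^sup>2 * psi_prod (q ^ 8)"
   using nz by (simp add: cusp_q_def theta_prod_def psi_prod_def power_divide divide_simps flip: power_mult)
    (simp add: eval_nat_numeral)
 qed
 hence "fps_of_rat (Abs_fps b) = (fps_of_rat (fps_X * (thr oo fps_X ^ 4) * (thr oo fps_X ^ 8)\<^sup>2 * (psi_fps oo fps_X ^ 8)) :: complex fps)"
  by (simp add: fps_of_rat_simps)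
 thus ?thesis by (simp only: fps_of_rat_eq_iff)
qed

lemma W_times_psi:
 "W * fps_to_fls (fps_X\<^sup>2 * (psi_fps oo fps_X ^ 16)\<^sup>2) = - fps_to_fls (Abs_fps b * (psi_fps oo fps_X ^ 8)\<^sup>2)"
proof -
 \<comment> \<open>The order of the pole of W is not prescribed, so a sufficiently high power of q
   clears it.\<close>
 define N where "N = nat (- fls_subdegree W)"
 have "int N \<ge> - fls_subdegree W" by (simp add: N_def)
 then obtain F where F: "W = fls_shift (int N) (fps_to_fls F)" using fls_as_fps' by blast
 \<comment> \<open>The quotient is undefined at q = 0; its value there is taken from the expansion F
   itself.\<close>
 define f where "f = (%q. if q = 0 then fps_nth (fps_of_rat F) 0
   else - (q ^ N * cusp_q q * psi_prod (q ^ 8) ^ 2 / (q\<^sup>2 * psi_prod (q ^ 16) ^ 2)))"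
 have "f has_fps_expansion fps_of_rat F"
 proof (rule has_fps_expansionI, rule eventually_mono[OF eventually_norm_lt_1])
  fix q :: complex assume q: "norm q < 1"
  show "(%n. fps_nth (fps_of_rat F) n * q ^ n) sums f q"
  proof (cases "q = 0")
   case True
   thus ?thesis using powser_sums_zero[of "fps_nth (fps_of_rat F :: complex fps)"] by (simp add: f_def)
  next
   case False
   then obtain \<tau> where \<tau>: "Im \<tau> > 0" "exp (2 * of_real pi * \<i> * \<tau>) = q" using nome_surj q by blast
   have "eta_L (2 * \<tau>) = psi_prod (q ^ 8) ^ 2 / psi_prod (q ^ 16) ^ 2 / q\<^sup>2"
   proof -
    have "eta_L (2 * \<tau>) = q\<^sup>2 * eta_L (2 * \<tau>) / q\<^sup>2" using False by simp
    thus ?thesis using eta_L_nome[OF \<tau>(1)] unfolding \<tau>(2) by simp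
   qed
   hence "q ^ N * (- cusp_form_32 \<tau> * eta_L (2 * \<tau>)) = f q"
    using False \<tau> cusp_form_nome[of \<tau>] by (simp add: f_def field_simps)
   thus ?thesis using has_q_expansion_sums[OF W F \<tau>(1)] unfolding \<tau>(2) by simp
  qed
 qed
 have "fps_of_rat F * (fps_X\<^sup>2 * (psi_fps oo fps_X ^ 16)\<^sup>2) = - (fps_X ^ N * fps_of_rat (Abs_fps b) * (psi_fps oo fps_X ^ 8)\<^sup>2 :: complex fps)"
 proof (rule fps_eq_if_expansions_eq)
  show "(%q. f q * (q\<^sup>2 * (psi_prod (q ^ 16))\<^sup>2)) has_fps_expansion fps_of_rat F * (fps_X\<^sup>2 * (psi_fps oo fps_X ^ 16)\<^sup>2)"
   by (intro has_fps_expansion_mult has_fps_expansion_power has_fps_expansion_fps_X \<open>f has_fps_expansion _\<close>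
      has_fps_expansion_dilate[OF psi_fps_expansion]) auto
  show "(%q. - (q ^ N * cusp_q q * (psi_prod (q ^ 8))\<^sup>2)) has_fps_expansion - (fps_X ^ N * fps_of_rat (Abs_fps b) * (psi_fps oo fps_X ^ 8)\<^sup>2)"
   by (intro has_fps_expansion_mult has_fps_expansion_minus has_fps_expansion_power has_fps_expansion_fps_X cusp_q_expansion
      has_fps_expansion_dilate[OF psi_fps_expansion]) auto
  fix q :: complex assume q: "norm q < 1"
  have nz: "euler_prod (q ^ 16) ~= 0" "euler_prod (q ^ 32) ~= 0"
   by (intro euler_prod_nz norm_power_lt_1 q; simp)+
  have "psi_prod (q ^ 16) ~= 0" using nz by (simp add: psi_prod_def flip: power_mult)
  thus "f q * (q\<^sup>2 * (psi_prod (q ^ 16))\<^sup>2) = - (q ^ N * cusp_q q * (psi_prod (q ^ 8))\<^sup>2)"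
   by (cases "q = 0") (simp_all add: f_def cusp_q_def)
 qed
 hence "fps_of_rat (F * (fps_X\<^sup>2 * (psi_fps oo fps_X ^ 16)\<^sup>2)) = (fps_of_rat (- (fps_X ^ N * Abs_fps b * (psi_fps oo fps_X ^ 8)\<^sup>2)) :: complex fps)"
  by (simp add: fps_of_rat_simps)
 hence e: "F * (fps_X\<^sup>2 * (psi_fps oo fps_X ^ 16)\<^sup>2) = - (fps_X ^ N * (Abs_fps b * (psi_fps oo fps_X ^ 8)\<^sup>2))"
  by (simp only: fps_of_rat_eq_iff mult.assoc)
 have "fps_to_fls (fps_X ^ N) * W = fps_to_fls F"
  unfolding F fps_to_fls_power by (simp add: fls_X_power_times_conv_shift)
 hence "fps_to_fls (fps_X ^ N) * (W * fps_to_fls (fps_X\<^sup>2 * (psi_fps oo fps_X ^ 16)\<^sup>2)) =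
   fps_to_fls (F * (fps_X\<^sup>2 * (psi_fps oo fps_X ^ 16)\<^sup>2))"
  by (simp only: mult.assoc[symmetric] fls_times_fps_to_fls)
 also have "... = fps_to_fls (fps_X ^ N) * - fps_to_fls (Abs_fps b * (psi_fps oo fps_X ^ 8)\<^sup>2)"
  unfolding e by (simp only: fls_times_fps_to_fls fps_to_fls_uminus mult_minus_right)
 finally show ?thesis by (rule mult_left_cancel[THEN iffD1, rotated]) simp
qed

end

section \<open>The hauptmodul and the lemniscatic differential\<close>

text \<open>The function x = q + ... with L(2 tau) = x^(-2): the ratio of psi(q^8) to psi(q^16) in
  L(2 tau) equals that of theta(q^8) to psi(q^8).\<close>

definition hauptmodul :: "'a::field_char_0 fps" where
 "hauptmodul = fps_X * (psi_fps oo fps_X ^ 8) * inverse (theta_fps oo fps_X ^ 8)"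

text \<open>The coefficients of (1 + 4 z)^(-1/2), so that \<open>lemniscate_fps\<close> is (1 + 4
  x^4)^(-1/2).\<close>

definition central_coeff :: "nat => 'a::field_char_0" where
 "central_coeff k = (- 1) ^ k * of_nat ((2 * k) choose k)"

definition lemniscate_fps :: "'a::field_char_0 fps" where
 "lemniscate_fps = Abs_fps (%n. if 4 dvd n then central_coeff (n div 4) else 0)"

lemma central_coeff_eq_gbinomial: "central_coeff k = (4 :: 'a::field_char_0) ^ k * ((- (1/2)) gchoose k)"
proof (induction k)
 case (Suc k)
 have "Suc k * (2 * Suc k choose Suc k) = (2 * Suc k) * (2 * k + 1 choose k)"
  using Suc_times_binomial_eq[of "2 * k + 1" k] by simp
 moreover have "Suc k * (2 * k + 1 choose k) = (2 * k + 1) * (2 * k choose k)"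
  using Suc_times_binomial_eq[of "2 * k" k] binomial_symmetric[of k "2 * k + 1"] by (simp add: mult_ac)
 ultimately have "Suc k * (Suc k * (2 * Suc k choose Suc k)) = 2 * Suc k * ((2 * k + 1) * (2 * k choose k))"
  by (metis mult.left_commute)
 hence "Suc k * (Suc k * (2 * Suc k choose Suc k)) = Suc k * (2 * ((2 * k + 1) * (2 * k choose k)))"
  by (simp only: mult_ac)
 hence "Suc k * (2 * Suc k choose Suc k) = 2 * ((2 * k + 1) * (2 * k choose k))"
  by (simp only: mult_cancel1) blast
 hence "of_nat (Suc k * (2 * Suc k choose Suc k)) = (of_nat (2 * ((2 * k + 1) * (2 * k choose k))) :: 'a)"
  by (simp only:)
 hence 1: "of_nat (Suc k) * of_nat (2 * Suc k choose Suc k) = (2 * (2 * of_nat k + 1) * of_nat (2 * k choose k) :: 'a)"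
  by (simp add: algebra_simps)
 define a where "a = (- (1/2) :: 'a)"
 have "of_nat (Suc k) * (a gchoose Suc k) = (a - of_nat k) * (a gchoose k)"
  using gbinomial_mult_1[of a k] by (simp add: algebra_simps)
 hence "4 ^ Suc k * (of_nat (Suc k) * (a gchoose Suc k)) = 4 ^ Suc k * ((a - of_nat k) * (a gchoose k))"
  by (simp only:)
 hence "of_nat (Suc k) * (4 ^ Suc k * (a gchoose Suc k)) = 4 * (a - of_nat k) * (4 ^ k * (a gchoose k))"
  by (simp only: mult_ac power_Suc)
 hence "of_nat (Suc k) * (4 ^ Suc k * ((- (1/2)) gchoose Suc k)) = 4 * (- (1/2) - of_nat k) * (4 ^ k * ((- (1/2) :: 'a) gchoose k))"
  unfolding a_def .
 also have "... = (- 1) ^ Suc k * (2 * (2 * of_nat k + 1) * of_nat (2 * k choose k))"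
  unfolding Suc.IH[symmetric] by (simp add: central_coeff_def algebra_simps)
 also have "... = of_nat (Suc k) * central_coeff (Suc k)"
  unfolding 1[symmetric] central_coeff_def by (simp only: mult_ac)
 finally show ?case by (metis mult_left_cancel of_nat_neq_0)
qed (simp add: central_coeff_def)

lemma lemniscate_fps_eq:
 "lemniscate_fps = (fps_binomial (- (1/2)) oo (fps_const 4 * fps_X)) oo (fps_X ^ 4 :: 'a::field_char_0 fps)"
 by (rule fps_ext) (simp add: lemniscate_fps_def fps_nth_compose_X_power central_coeff_eq_gbinomial)

lemma lemniscate_fps_square: "lemniscate_fps\<^sup>2 * (1 + 4 * fps_X ^ 4) = (1 :: 'a::field_char_0 fps)"
proof -
 have "(fps_binomial (- (1/2)))\<^sup>2 = inverse (1 + fps_X :: 'a fps)"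
  by (simp add: fps_binomial_power fps_binomial_minus_one)
 hence b: "(fps_binomial (- (1/2)))\<^sup>2 * (1 + fps_X) = (1 :: 'a fps)" by (simp add: inverse_mult_eq_1)
 have "(((fps_binomial (- (1/2)))\<^sup>2 * (1 + fps_X)) oo (fps_const 4 * fps_X)) oo (fps_X ^ 4 :: 'a fps) = 1"
  unfolding b by simp
 thus ?thesis unfolding lemniscate_fps_eq
  by (simp add: fps_compose_mult_distrib fps_compose_add_distrib flip: fps_compose_power numeral_fps_const)
qed

lemma hauptmodul_theta: "hauptmodul * (theta_fps oo fps_X ^ 8) = fps_X * (psi_fps oo fps_X ^ 8 :: 'a::field_char_0 fps)"
 by (simp add: hauptmodul_def mult.assoc inverse_mult_eq_1)

lemma fps_of_rat_eqI: "fps_of_rat F = (fps_of_rat G :: complex fps) ==> F = G" by simp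

lemma rat_theta_rels:
 fixes t p :: "rat fps"
 defines "t \<equiv> theta_fps" and "p \<equiv> psi_fps"
 shows "t * (p oo fps_X ^ 2) = p ^ 2"
  and "t * (t oo - fps_X) = ((t oo - fps_X) oo fps_X ^ 2) ^ 2"
  and "t\<^sup>2 = (t oo fps_X ^ 2)\<^sup>2 + 4 * fps_X * (p oo fps_X ^ 4)\<^sup>2"
  and "p * t + 8 * (fps_X * fps_deriv p * t - fps_X * fps_deriv t * p) = (t oo - fps_X) ^ 4 * p * t"
proof -
 show "t * (p oo fps_X ^ 2) = p ^ 2"
  by (rule fps_of_rat_eqI) (simp add: t_def p_def fps_of_rat_simps theta_mult_psi)
 show "t * (t oo - fps_X) = ((t oo - fps_X) oo fps_X ^ 2) ^ 2"
  by (rule fps_of_rat_eqI) (simp add: t_def p_def fps_of_rat_simps theta_mult_reflect)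
 show "t\<^sup>2 = (t oo fps_X ^ 2)\<^sup>2 + 4 * fps_X * (p oo fps_X ^ 4)\<^sup>2"
  by (rule fps_of_rat_eqI) (simp add: t_def p_def fps_of_rat_simps theta_square_eq)
 have "(psi_fps * theta_fps :: complex fps) + 8 * (fps_X * fps_deriv psi_fps * theta_fps - fps_X * fps_deriv theta_fps * psi_fps)
  = (1 + 8 * (fps_logderiv psi_fps - fps_logderiv theta_fps)) * psi_fps * theta_fps"
  by (simp add: fps_logderiv_times_self[symmetric] algebra_simps)
 also have "... = (theta_fps oo - fps_X) ^ 4 * psi_fps * theta_fps" unfolding logderiv_psi_theta ..
 finally have c: "(psi_fps * theta_fps :: complex fps) + 8 * (fps_X * fps_deriv psi_fps * theta_fps - fps_X * fps_deriv theta_fps * psi_fps)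
  = (theta_fps oo - fps_X) ^ 4 * psi_fps * theta_fps" .
 have sub: "fps_of_rat (F - G) = (fps_of_rat F - fps_of_rat G :: complex fps)" for F G
  by (rule fps_ext) (simp add: of_rat_diff)
 show "p * t + 8 * (fps_X * fps_deriv p * t - fps_X * fps_deriv t * p) = (t oo - fps_X) ^ 4 * p * t"
  by (rule fps_of_rat_eqI) (use c in \<open>simp add: t_def p_def fps_of_rat_simps sub\<close>)
qed

text \<open>By the expression of the theta square at q^4 through arguments q^8 and q^16, 1 + 4 x^4
  is the square of theta(q^4)/theta(q^8). The constant coefficients decide the sign of the
  root.\<close>

lemma lemniscate_hauptmodul:
 "(lemniscate_fps oo hauptmodul) * (theta_fps oo fps_X ^ 4) = (theta_fps oo fps_X ^ 8 :: rat fps)"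
proof -
 define t8 t4 p8 p16 U S where "t8 = (theta_fps oo fps_X ^ 8 :: rat fps)" and "t4 = (theta_fps oo fps_X ^ 4 :: rat fps)"
  and "p8 = (psi_fps oo fps_X ^ 8 :: rat fps)" and "p16 = (psi_fps oo fps_X ^ 16 :: rat fps)"
  and "U = (hauptmodul :: rat fps)" and "S = (lemniscate_fps oo U :: rat fps)"
 have U0: "fps_nth U 0 = 0" by (simp add: U_def hauptmodul_def)
 have Ut: "U * t8 = fps_X * p8" using hauptmodul_theta by (simp add: U_def t8_def p8_def)
 have p8: "p8\<^sup>2 = t8 * p16"
  using arg_cong[OF rat_theta_rels(1), of "%F. F oo fps_X ^ 8"]
  by (simp add: fps_compose_mult_distrib t8_def p8_def p16_def flip: fps_compose_power)
 have t4: "t4\<^sup>2 = t8\<^sup>2 + 4 * fps_X ^ 4 * p16\<^sup>2"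
  using arg_cong[OF rat_theta_rels(3), of "%F. F oo fps_X ^ 4"]
  by (simp add: fps_compose_mult_distrib fps_compose_add_distrib t8_def t4_def p16_def flip: fps_compose_power)
 have nz: "t8 ~= 0" "t4 ~= 0" by (auto simp: t8_def t4_def fps_eq_iff intro!: exI[of _ 0])
 have "U ^ 4 * t8\<^sup>2 * t8\<^sup>2 = (U * t8) ^ 4" by (simp add: power2_eq_square power4_eq_xxxx mult_ac)
 also have "... = fps_X ^ 4 * (p8\<^sup>2)\<^sup>2" unfolding Ut by (simp add: power_mult_distrib)
 also have "... = fps_X ^ 4 * p16\<^sup>2 * t8\<^sup>2" unfolding p8 by (simp add: power_mult_distrib)
 finally have U4: "U ^ 4 * t8\<^sup>2 = fps_X ^ 4 * p16\<^sup>2" using nz by simp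
 have "(lemniscate_fps\<^sup>2 * (1 + 4 * fps_X ^ 4)) oo U = 1 oo U" by (simp only: lemniscate_fps_square)
 hence S: "S\<^sup>2 * (1 + 4 * U ^ 4) = 1"
  using U0 by (simp add: S_def fps_compose_mult_distrib fps_compose_add_distrib flip: fps_compose_power)
 have "(S * t4)\<^sup>2 = S\<^sup>2 * (t8\<^sup>2 + 4 * (U ^ 4 * t8\<^sup>2))" unfolding U4 power_mult_distrib t4 by (simp add: mult.assoc)
 also have "... = S\<^sup>2 * (1 + 4 * U ^ 4) * t8\<^sup>2" by (simp add: algebra_simps)
 finally have "(S * t4)\<^sup>2 = t8\<^sup>2" unfolding S by simp
 hence "S * t4 = t8 \<or> S * t4 = - t8" by (simp add: power2_eq_iff)
 moreover have "S * t4 ~= - t8"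
 proof
  assume "S * t4 = - t8"
  hence "fps_nth (S * t4) 0 = - fps_nth t8 0" by simp
  thus False by (simp add: S_def t4_def t8_def lemniscate_fps_def central_coeff_def)
 qed
 ultimately show ?thesis by (simp add: S_def U_def t4_def t8_def)
qed

text \<open>By \<open>logderiv_psi_theta\<close> the logarithmic derivative of x is theta(-q^8)^4,
  which gives the first identity; psi(q^8)^2 = theta(q^8) psi(q^16) identifies L(2 tau) with x^(-2)
  and gives the second.\<close>

theorem cusp_form_hauptmodul:
 fixes b :: "nat => rat" and f :: "rat fls"
 assumes b0: "b 0 = 0"
  and b: "has_q_expansion cusp_form_32 (fps_to_fls (Abs_fps b))"
  and f: "has_q_expansion (%\<tau>. - cusp_form_32 \<tau> * eta_L (2 * \<tau>)) W"
 defines "U \<equiv> hauptmodul"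
 shows "Abs_fps b = fps_X * fps_deriv U * (lemniscate_fps oo U)"
  and "W * fps_to_fls (U\<^sup>2) = - fps_to_fls (Abs_fps b)"
proof -
 define t8 t4 t4m t8m p8 p16 where "t8 = (theta_fps oo fps_X ^ 8 :: rat fps)" and "t4 = (theta_fps oo fps_X ^ 4 :: rat fps)"
  and "t4m = ((theta_fps oo - fps_X) oo fps_X ^ 4 :: rat fps)" and "t8m = ((theta_fps oo - fps_X) oo fps_X ^ 8 :: rat fps)"
  and "p8 = (psi_fps oo fps_X ^ 8 :: rat fps)" and "p16 = (psi_fps oo fps_X ^ 16 :: rat fps)"
 have nz: "t8 ~= 0" "t4 ~= 0" "p8 ~= 0" by (auto simp: t8_def t4_def p8_def fps_eq_iff intro!: exI[of _ 0])
 have Ut: "U * t8 = fps_X * p8" using hauptmodul_theta by (simp add: U_def t8_def p8_def)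
 have p8: "p8\<^sup>2 = t8 * p16"
  using arg_cong[OF rat_theta_rels(1), of "%F. F oo fps_X ^ 8"]
  by (simp add: fps_compose_mult_distrib t8_def p8_def p16_def flip: fps_compose_power)
 have tt: "t4 * t4m = t8m\<^sup>2"
  using arg_cong[OF rat_theta_rels(2), of "%F. F oo fps_X ^ 4"]
  by (simp add: fps_compose_mult_distrib t4_def t4m_def t8m_def flip: fps_compose_power)
 have B: "Abs_fps b = fps_X * t4m * t8m\<^sup>2 * p8"
  using cusp_form_theta[OF b0 b f] by (simp add: t4m_def t8m_def p8_def)
 define t p where "t = (theta_fps :: rat fps)" and "p = (psi_fps :: rat fps)"
 have d8: "fps_X * fps_deriv (F oo fps_X ^ 8) = 8 * ((fps_X * fps_deriv F) oo fps_X ^ 8)" for F :: "rat fps"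
 proof (rule fps_ext)
  fix n show "fps_nth (fps_X * fps_deriv (F oo fps_X ^ 8)) n = fps_nth (8 * ((fps_X * fps_deriv F) oo fps_X ^ 8)) n"
   by (cases "8 dvd n") (auto simp: fps_nth_compose_X_power numeral_fps_const elim!: dvdE)
 qed
 have J: "p8 * t8 + (fps_X * fps_deriv p8 * t8 - fps_X * fps_deriv t8 * p8) = t8m ^ 4 * p8 * t8"
  using arg_cong[OF rat_theta_rels(4), of "%F. F oo fps_X ^ 8"] unfolding p8_def t8_def d8
  by (simp add: fps_compose_mult_distrib fps_compose_add_distrib fps_compose_sub_distrib t8m_def algebra_simps flip: fps_compose_power)
 have "fps_X * fps_deriv (U * t8) = fps_X * fps_deriv (fps_X * p8)" unfolding Ut ..
 hence dU: "fps_X * fps_deriv U * t8 = fps_X * p8 + fps_X * (fps_X * fps_deriv p8) - U * (fps_X * fps_deriv t8)"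
  by (simp add: algebra_simps)
 have "(fps_X * fps_deriv U * t8) * t8 = fps_X * (p8 * t8) + fps_X * (fps_X * fps_deriv p8 * t8) - (U * t8) * (fps_X * fps_deriv t8)"
  unfolding dU by (simp add: algebra_simps)
 also have "... = fps_X * (p8 * t8 + (fps_X * fps_deriv p8 * t8 - fps_X * fps_deriv t8 * p8))"
  unfolding Ut by (simp add: algebra_simps)
 also have "... = (fps_X * t8m ^ 4 * p8) * t8" unfolding J by (simp add: algebra_simps)
 finally have dU2: "fps_X * fps_deriv U * t8 = fps_X * t8m ^ 4 * p8" using nz by simp
 have "fps_X * fps_deriv U * (lemniscate_fps oo U) * t4 = fps_X * fps_deriv U * t8"
  using lemniscate_hauptmodul by (simp add: U_def t4_def t8_def mult.assoc)
 also have "... = fps_X * (t4 * t4m) * t8m\<^sup>2 * p8" unfolding dU2 tt by (simp add: power2_eq_square power4_eq_xxxx mult_ac)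
 also have "... = Abs_fps b * t4" unfolding B by (simp add: mult_ac)
 finally show "Abs_fps b = fps_X * fps_deriv U * (lemniscate_fps oo U)" using nz by simp
 have W: "W * fps_to_fls (fps_X\<^sup>2 * p16\<^sup>2) = - fps_to_fls (Abs_fps b * p8\<^sup>2)"
  using W_times_psi[OF b0 b f] by (simp add: p16_def p8_def)
 have "fps_X\<^sup>2 * p16\<^sup>2 * t8\<^sup>2 = fps_X\<^sup>2 * p8\<^sup>2 * p8\<^sup>2" unfolding power2_eq_square[of "p8\<^sup>2"] using p8
  by (simp add: power2_eq_square mult_ac)
 also have "... = (U * t8)\<^sup>2 * p8\<^sup>2" unfolding Ut by (simp add: power_mult_distrib)
 also have "... = U\<^sup>2 * (t8\<^sup>2 * p8\<^sup>2)" by (simp add: power_mult_distrib mult.assoc)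
 finally have e: "fps_X\<^sup>2 * p16\<^sup>2 * t8\<^sup>2 = U\<^sup>2 * (t8\<^sup>2 * p8\<^sup>2)" .
 have "W * fps_to_fls (U\<^sup>2) * fps_to_fls (t8\<^sup>2 * p8\<^sup>2) = W * fps_to_fls (fps_X\<^sup>2 * p16\<^sup>2 * t8\<^sup>2)"
  unfolding e by (simp only: fls_times_fps_to_fls mult.assoc)
 also have "... = (W * fps_to_fls (fps_X\<^sup>2 * p16\<^sup>2)) * fps_to_fls (t8\<^sup>2)"
  by (simp only: fls_times_fps_to_fls mult.assoc)
 also have "... = - fps_to_fls (Abs_fps b) * fps_to_fls (t8\<^sup>2 * p8\<^sup>2)"
  unfolding W by (simp only: fls_times_fps_to_fls mult_ac mult_minus_left mult_minus_right)
 finally have "W * fps_to_fls (U\<^sup>2) * fps_to_fls (t8\<^sup>2 * p8\<^sup>2) = - fps_to_fls (Abs_fps b) * fps_to_fls (t8\<^sup>2 * p8\<^sup>2)" .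
 moreover have "fps_to_fls (t8\<^sup>2 * p8\<^sup>2) ~= 0" using nz by simp
 ultimately show "W * fps_to_fls (U\<^sup>2) = - fps_to_fls (Abs_fps b)"
  by (rule mult_right_cancel[THEN iffD1, rotated])
qed

lemma cusp_form_support:
 assumes b0: "b 0 = 0"
  and b: "has_q_expansion cusp_form_32 (fps_to_fls (Abs_fps b))"
  and f: "has_q_expansion (%\<tau>. - cusp_form_32 \<tau> * eta_L (2 * \<tau>)) W"
  and n: "n mod 4 ~= 1"
 shows "b n = 0"
proof (cases n)
 case (Suc m)
 define t p where "t = (theta_fps oo - fps_X :: rat fps)" and "p = (psi_fps :: rat fps)"
 have "b n = fps_nth (Abs_fps b) n" by simp
 also have "... = fps_nth (fps_X * ((t * (t oo fps_X ^ 2)\<^sup>2 * (p oo fps_X ^ 2)) oo fps_X ^ 4)) n"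
  unfolding cusp_form_theta[OF b0 b f] t_def p_def
  by (simp add: fps_compose_mult_distrib mult.assoc flip: fps_compose_power)
 also have "... = 0" using n Suc by (auto simp: fps_nth_compose_X_power)
 finally show ?thesis .
qed (use b0 in simp)

section \<open>Morita's Gamma function at natural numbers\<close>

text \<open>The value of Gamma_p at n, kept as an integer so that congruences can be stated.\<close>

definition morita :: "nat => nat => int" where
 "morita p n = (- 1) ^ n * (\<Prod>j | 1 \<le> j & j < n & \<not> p dvd j. int j)"

lemma morita_Suc:
 assumes "\<not> p dvd n"
 shows "morita p (Suc n) = - int n * morita p n"
proof -
 have n: "n \<ge> 1" using assms by (cases n) auto
 have "{j. 1 \<le> j & j < Suc n & \<not> p dvd j} = insert n {j. 1 \<le> j & j < n & \<not> p dvd j}"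
  using assms n by auto
 thus ?thesis by (simp add: morita_def)
qed

lemma morita_Suc_dvd:
 assumes "p dvd n"
 shows "morita p (Suc n) = - morita p n"
proof -
 have "{j. 1 \<le> j & j < Suc n & \<not> p dvd j} = {j. 1 \<le> j & j < n & \<not> p dvd j}"
  using assms less_Suc_eq by auto
 thus ?thesis by (simp add: morita_def)
qed

lemma morita_0 [simp]: "morita p 0 = 1"
 by (simp add: morita_def)

lemma morita_not_dvd:
 assumes "prime p"
 shows "\<not> int p dvd morita p n"
proof (induction n)
 case 0 thus ?case using assms by (auto simp: prime_nat_iff)
next
 case (Suc n)
 show ?case
  by (cases "p dvd n") (use Suc assms in \<open>auto simp: morita_Suc morita_Suc_dvd prime_dvd_mult_iff\<close>)
qed

text \<open>The factors of n! prime to p form Gamma_p(n + 1) up to sign, and the multiples of p form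
  p^m m!.\<close>

lemma fact_morita:
 assumes "prime p" "n = p * m + r" "r < p"
 shows "(fact n :: int) = (- 1) ^ Suc n * morita p (Suc n) * int p ^ m * fact m"
 using assms(2,3)
proof (induction n arbitrary: m r)
 case 0
 hence "m = 0" "r = 0" using assms(1) by (auto simp: prime_gt_0_nat)
 thus ?case by (simp add: morita_Suc_dvd)
next
 case (Suc n)
 have p: "p > 1" using assms(1) by (rule prime_gt_1_nat)
 show ?case
 proof (cases r)
  case 0
  have m: "m > 0" using Suc.prems 0 by (cases m) auto
  have "n = p * (m - 1) + (p - 1)" using Suc.prems 0 m p by (cases m) auto
  from Suc.IH[OF this] p have IH: "(fact n :: int) = (- 1) ^ Suc n * morita p (Suc n) * int p ^ (m - 1) * fact (m - 1)" by simp
  have d: "p dvd Suc n" using Suc.prems 0 by simp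
  have sn: "Suc n = p * m" using Suc.prems 0 by simp
  have "(fact (Suc n) :: int) = int (p * m) * fact n"
   using fact_Suc[of n, where 'a = int] arg_cong[OF sn, of int] by metis
  also have "... = (- 1) ^ Suc n * morita p (Suc n) * int p ^ m * (fact m)"
   unfolding IH using m by (cases m) (simp_all add: algebra_simps)
  finally show ?thesis by (simp add: morita_Suc_dvd[OF d])
 next
  case (Suc r')
  have "n = p * m + r'" using Suc.prems(1) Suc by simp
  from Suc.IH[OF this] Suc.prems Suc have IH: "(fact n :: int) = (- 1) ^ Suc n * morita p (Suc n) * int p ^ m * fact m" by simp
  have d: "\<not> p dvd Suc n"
  proof
   assume "p dvd Suc n"
   hence "p dvd r" using Suc.prems(1) by (metis dvd_add_right_iff dvd_triv_left)
   thus False using Suc.prems(2) Suc by (auto dest: dvd_imp_le)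
  qed
  show ?thesis unfolding fact_Suc IH morita_Suc[OF d] by (simp add: algebra_simps)
 qed
qed

text \<open>The condition \<open>2 * s < p\<close> says that doubling k causes no carry out of the
  last digit in base p, so the powers of p cancel.\<close>

lemma binomial_morita:
 assumes "prime p" "k = p * j + s" "2 * s < p"
 shows "int ((2 * k) choose k) * morita p (Suc k) ^ 2 = - morita p (Suc (2 * k)) * int ((2 * j) choose j)"
proof -
 have f2: "(fact (2 * k) :: int) = (- 1) ^ Suc (2 * k) * morita p (Suc (2 * k)) * int p ^ (2 * j) * fact (2 * j)"
  by (rule fact_morita[OF assms(1), of _ _ "2 * s"]) (use assms in auto)
 have f1: "(fact k :: int) = (- 1) ^ Suc k * morita p (Suc k) * int p ^ j * fact j"
  by (rule fact_morita[OF assms(1), of _ _ s]) (use assms in auto)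
 have b: "(fact k :: int) * fact k * int ((2 * k) choose k) = fact (2 * k)" for k
 proof -
  have "fact k * fact k * ((2 * k) choose k) = (fact (2 * k) :: nat)"
   using binomial_fact_lemma[of k "2 * k"] by (simp add: mult_2)
  from arg_cong[OF this, of int] show ?thesis by (simp only: of_nat_mult of_nat_fact)
 qed
 have "(int p ^ (2 * j) * (fact j * fact j)) * (int ((2 * k) choose k) * morita p (Suc k) ^ 2)
   = (int p ^ (2 * j) * (fact j * fact j)) * (- morita p (Suc (2 * k)) * int ((2 * j) choose j))"
 proof -
  have "(int p ^ (2 * j) * (fact j * fact j)) * (int ((2 * k) choose k) * morita p (Suc k) ^ 2)
   = fact k * fact k * int ((2 * k) choose k)"
  proof -
   have pp: "int p ^ (2 * j) = int p ^ j * int p ^ j" by (simp add: mult_2 power_add)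
   show ?thesis unfolding f1 pp by (simp add: power2_eq_square mult_ac)
  qed
  also have "... = - morita p (Suc (2 * k)) * int p ^ (2 * j) * fact (2 * j)" unfolding b f2 by simp
  also have "... = (int p ^ (2 * j) * (fact j * fact j)) * (- morita p (Suc (2 * k)) * int ((2 * j) choose j))"
   unfolding b[of j, symmetric] by (simp add: mult_ac)
  finally show ?thesis .
 qed
 moreover have "int p ^ (2 * j) * (fact j * fact j) ~= (0 :: int)" using assms(1) by (auto simp: prime_gt_0_nat)
 ultimately show ?thesis by (metis mult_left_cancel)
qed

lemma square_cong_1_prime_power:
 fixes x :: int
 assumes p: "prime p" "odd p" and x: "[x * x = 1] (mod int p ^ m)"
 shows "[x = 1] (mod int p ^ m) \<or> [x = - 1] (mod int p ^ m)"
proof (cases "m = 0")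
 case False
 have pr: "prime (int p)" using p by simp
 have d: "int p ^ m dvd (x - 1) * (x + 1)" using x by (simp add: cong_iff_dvd_diff algebra_simps)
 have "\<not> (int p dvd x - 1 & int p dvd x + 1)"
 proof
  assume "int p dvd x - 1 & int p dvd x + 1"
  hence "int p dvd (x + 1) - (x - 1)" using dvd_diff by blast
  hence "int p dvd int 2" by simp
  hence "p dvd 2" by (simp only: int_dvd_int_iff)
  hence "p = 2" using p(1) by (simp add: primes_dvd_imp_eq)
  thus False using p by simp
 qed
 hence "coprime (int p) (x - 1) \<or> coprime (int p) (x + 1)"
  using pr prime_imp_coprime by blast
 hence "coprime (int p ^ m) (x - 1) \<or> coprime (int p ^ m) (x + 1)" by auto
 hence "int p ^ m dvd x + 1 \<or> int p ^ m dvd x - 1"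
  using d by (auto simp: coprime_dvd_mult_right_iff coprime_dvd_mult_left_iff)
 thus ?thesis by (auto simp: cong_iff_dvd_diff)
qed auto

lemma prod_pairing_trivial:
 fixes f :: "'a => int" and N :: int
 assumes "finite A" "!!x. x \<in> A ==> \<sigma> x \<in> A" "!!x. x \<in> A ==> \<sigma> (\<sigma> x) = x" "!!x. x \<in> A ==> \<sigma> x ~= x"
  "!!x. x \<in> A ==> [f x * f (\<sigma> x) = 1] (mod N)"
 shows "[(\<Prod>x\<in>A. f x) = 1] (mod N)"
 using assms
proof (induction "card A" arbitrary: A rule: less_induct)
 case less
 show ?case
 proof (cases "A = {}")
  case False
  then obtain x where x: "x \<in> A" by blast
  define B where "B = A - {x, \<sigma> x}"
  have s: "\<sigma> x \<in> A" "\<sigma> x ~= x" using x less.prems by auto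
  have B: "A = insert x (insert (\<sigma> x) B)" "x \<notin> insert (\<sigma> x) B" "\<sigma> x \<notin> B" "finite B"
   using x s less.prems(1) by (auto simp: B_def)
  have "card B < card A" using B by (simp add: card_insert_if)
  moreover have "\<sigma> y \<in> B" if "y \<in> B" for y
  proof -
   have "y \<in> A" "y ~= x" "y ~= \<sigma> x" using that by (auto simp: B_def)
   thus ?thesis using less.prems(2)[of y] less.prems(3)[of y] less.prems(3)[of x] x by (auto simp: B_def)
  qed
  ultimately have IH: "[(\<Prod>x\<in>B. f x) = 1] (mod N)"
   by (intro less.hyps) (use less.prems B in auto)
  have "(\<Prod>x\<in>A. f x) = (f x * f (\<sigma> x)) * (\<Prod>x\<in>B. f x)"
   unfolding B(1) using B by (simp add: mult.assoc)
  also have "[(f x * f (\<sigma> x)) * (\<Prod>x\<in>B. f x) = 1 * 1] (mod N)"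
   by (intro cong_mult IH less.prems(5) x)
  finally show ?thesis by simp
 qed auto
qed

text \<open>Units pair off with their inverses; the self-inverse ones are 1 and -1 because p is
  odd.\<close>

lemma wilson_prime_power:
 assumes p: "prime p" "odd p" and m: "m > 0"
 shows "[(\<Prod>j | 1 \<le> j & j < p ^ m & \<not> p dvd j. int j) = - 1] (mod int p ^ m)"
proof -
 define N where "N = p ^ m"
 define A where "A = {j. 1 \<le> j & j < N & \<not> p dvd j}"
 have p2: "p > 2" using p prime_ge_2_nat[of p] by (cases "p = 2") auto
 have N3: "N > 2"
 proof -
  have "p ^ 1 \<le> p ^ m" using m p2 by (intro power_increasing) auto
  thus ?thesis using p2 by (simp add: N_def)
 qed
 have cop: "coprime j N \<longleftrightarrow> \<not> p dvd j" for j
  using m p prime_imp_coprime[OF p(1), of j] by (auto simp: N_def coprime_commute dest: coprime_absorb_left)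
 define \<sigma> where "\<sigma> = (%j. SOME i. i \<in> A & [j * i = 1] (mod N))"
 have ex: "\<exists>i. i \<in> A & [j * i = 1] (mod N)" if "j \<in> A" for j
 proof -
  have "coprime j N" using that cop by (auto simp: A_def)
  then obtain i where "[j * i = 1] (mod N)" using cong_solve_coprime_nat[of j N] by auto
  hence i: "[j * (i mod N) = 1] (mod N)" by (simp add: cong_def mod_mult_right_eq)
  have "coprime (j * (i mod N)) N" using cong_imp_coprime[OF cong_sym[OF i]] by simp
  hence "coprime (i mod N) N" by simp
  hence "\<not> p dvd (i mod N)" using cop by simp
  hence "i mod N \<in> A" using N3 by (auto simp: A_def Suc_le_eq intro!: Nat.gr0I)
  thus ?thesis using i by blast
 qed
 have \<sigma>: "\<sigma> j \<in> A" "[j * \<sigma> j = 1] (mod N)" if "j \<in> A" for j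
  using someI_ex[OF ex[OF that]] by (auto simp: \<sigma>_def)
 have uniq: "i = k" if "i \<in> A" "k \<in> A" "j \<in> A" "[j * i = 1] (mod N)" "[j * k = 1] (mod N)" for i j k
 proof -
  have "[j * i = j * k] (mod N)" using that cong_trans cong_sym by blast
  hence "[i = k] (mod N)" using cop[of j] that by (auto simp: A_def cong_mult_lcancel_nat)
  thus ?thesis using that by (auto simp: A_def cong_less_modulus_unique_nat)
 qed
 have \<sigma>\<sigma>: "\<sigma> (\<sigma> j) = j" if "j \<in> A" for j
  using uniq[of "\<sigma> (\<sigma> j)" j "\<sigma> j"] \<sigma>[OF that] \<sigma>[of "\<sigma> j"] that by (simp add: mult.commute)
 have fin: "finite A" by (simp add: A_def)
 have fixpt: "j = 1 \<or> j = N - 1" if "j \<in> A" "\<sigma> j = j" for j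
 proof -
  have "[int j * int j = 1] (mod int p ^ m)"
   using \<sigma>(2)[OF that(1)] that(2) cong_int_iff[of "j * j" 1 N] by (simp add: N_def)
  from square_cong_1_prime_power[OF p this] show ?thesis
  proof
   assume "[int j = 1] (mod int p ^ m)"
   hence "[j = 1] (mod N)" using cong_int_iff[of j 1 N] by (simp add: N_def)
   thus ?thesis using that(1) N3 by (auto simp: A_def cong_less_modulus_unique_nat)
  next
   assume "[int j = - 1] (mod int p ^ m)"
   hence "int N dvd int j + 1" by (simp add: cong_iff_dvd_diff N_def)
   hence "int N dvd int (j + 1)" by (simp add: add.commute)
   hence "N dvd j + 1" by (simp only: int_dvd_int_iff)
   moreover have "j + 1 \<le> N" using that(1) by (auto simp: A_def)
   ultimately have "j + 1 = N" by (auto dest: dvd_imp_le)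
   thus ?thesis by auto
  qed
 qed
 have pN: "p dvd N" using m by (simp add: N_def)
 have mem: "1 \<in> A" "N - 1 \<in> A"
 proof -
  show "1 \<in> A" using p2 N3 by (auto simp: A_def)
  have "\<not> p dvd N - 1"
  proof
   assume "p dvd N - 1"
   hence "p dvd N - (N - 1)" by (rule dvd_diff_nat[OF pN])
   thus False using N3 p2 by (simp)
  qed
  thus "N - 1 \<in> A" using N3 by (auto simp: A_def)
 qed
 have s1: "\<sigma> 1 = 1" using uniq[of "\<sigma> 1" 1 1] \<sigma>[OF mem(1)] mem by simp
 have sN: "\<sigma> (N - 1) = N - 1"
 proof (rule uniq[OF \<sigma>(1)[OF mem(2)] mem(2) mem(2) \<sigma>(2)[OF mem(2)]])
  have "(N - 1) * (N - 1) = N * (N - 2) + 1" using N3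
   by (cases N; cases "N - 1") (auto simp: algebra_simps)
  thus "[(N - 1) * (N - 1) = 1] (mod N)" by (simp only: cong_def mod_mult_self4)
 qed
 define B where "B = A - {1, N - 1}"
 have "[(\<Prod>j\<in>B. int j) = 1] (mod int N)"
 proof (rule prod_pairing_trivial[of _ \<sigma>])
  show "finite B" using fin by (simp add: B_def)
  fix x assume x: "x \<in> B"
  hence xA: "x \<in> A" by (simp add: B_def)
  show "\<sigma> x \<in> B" using \<sigma>(1)[OF xA] \<sigma>\<sigma>[OF xA] s1 sN x by (auto simp: B_def)
  show "\<sigma> (\<sigma> x) = x" by (rule \<sigma>\<sigma>[OF xA])
  show "\<sigma> x ~= x" using fixpt[OF xA] x by (auto simp: B_def)
  show "[int x * int (\<sigma> x) = 1] (mod int N)"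
   using \<sigma>(2)[OF xA] cong_int_iff[of "x * \<sigma> x" 1 N] by simp
 qed
 moreover have "(\<Prod>j\<in>A. int j) = int (N - 1) * (\<Prod>j\<in>B. int j)"
 proof -
  have A: "A = insert 1 (insert (N - 1) B)" using mem by (auto simp: B_def)
  have "1 \<notin> insert (N - 1) B" "N - 1 \<notin> B" "finite B" using N3 fin by (auto simp: B_def)
  thus ?thesis unfolding A by (subst prod.insert; simp)
 qed
 moreover have "[int (N - 1) = - 1] (mod int N)" using N3 by (simp add: cong_iff_dvd_diff of_nat_diff)
 ultimately have "[(\<Prod>j\<in>A. int j) = - 1 * 1] (mod int N)" by (metis cong_mult)
 thus ?thesis by (simp add: A_def N_def)
qed

lemma morita_prime_power:
 assumes p: "prime p" "odd p"
 shows "[morita p (p ^ m) = 1] (mod int p ^ m)"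
proof (cases "m = 0")
 case False
 have "[morita p (p ^ m) = (- 1) ^ (p ^ m) * (- 1)] (mod int p ^ m)"
  unfolding morita_def by (intro cong_mult wilson_prime_power p cong_refl) (use False in auto)
 thus ?thesis using p by simp
qed auto

lemma morita_add_prime_power:
 assumes p: "prime p" "odd p"
 shows "[morita p (n + p ^ m) = morita p n] (mod int p ^ m)"
proof (cases "m = 0")
 case False
 show ?thesis
 proof (induction n)
  case 0 show ?case using morita_prime_power[OF p] by simp
 next
  case (Suc n)
  have d: "p dvd n + p ^ m \<longleftrightarrow> p dvd n" using False by (metis dvd_add_left_iff dvd_power_same dvd_triv_left power_eq_if)
  show ?case
  proof (cases "p dvd n")
   case True
   thus ?thesis using Suc d by (simp add: morita_Suc_dvd cong_minus_minus_iff)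
  next
   case F: False
   have "[- int (n + p ^ m) = - int n] (mod int p ^ m)" by (simp add: cong_iff_dvd_diff)
   hence "[- int (n + p ^ m) * morita p (n + p ^ m) = - int n * morita p n] (mod int p ^ m)"
    by (rule cong_mult[OF _ Suc])
   thus ?thesis using F d by (simp add: morita_Suc)
  qed
 qed
qed auto

text \<open>The p-adic continuity of Gamma_p on the natural numbers, without loss of
  precision.\<close>

lemma morita_cong:
 assumes p: "prime p" "odd p" and mn: "[n = k] (mod p ^ m)"
 shows "[morita p n = morita p k] (mod int p ^ m)"
proof -
 have *: "[morita p (n + j * p ^ m) = morita p n] (mod int p ^ m)" for n j
 proof (induction j)
  case (Suc j)
  have "[morita p ((n + j * p ^ m) + p ^ m) = morita p (n + j * p ^ m)] (mod int p ^ m)"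
   by (rule morita_add_prime_power[OF p])
  from cong_trans[OF this Suc] show ?case by (simp add: algebra_simps)
 qed auto
 have "[morita p n = morita p (n mod p ^ m)] (mod int p ^ m)"
  using *[of "n mod p ^ m" "n div p ^ m"] by (simp only: mod_div_mult_eq)
 moreover have "[morita p k = morita p (k mod p ^ m)] (mod int p ^ m)"
  using *[of "k mod p ^ m" "k div p ^ m"] by (simp only: mod_div_mult_eq)
 ultimately show ?thesis using mn unfolding cong_def by simp
qed

text \<open>The finite form of Gamma_p(1/2)^2 = 1. The reflection j -> p^m - j carries the lower
  half of the units to the upper half with the sign (-1)^\<open>card A\<close>; this number is odd
  as p = 3 mod 4, which turns Wilson's -1 into a square congruent to 1.\<close>

lemma morita_half_square:
 assumes p: "prime p" "p mod 4 = 3"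
 shows "[morita p ((p ^ m + 1) div 2) ^ 2 = 1] (mod int p ^ m)"
proof (cases "m = 0")
 case False
 have op: "odd p" using p(2) by presburger
 have op2: "odd (p ^ m)" using op by simp
 define N where "N = p ^ m"
 define H where "H = (N - 1) div 2"
 have NH: "N = 2 * H + 1" using op2 by (simp add: H_def N_def)
 have h: "(p ^ m + 1) div 2 = Suc H" using NH by (simp add: N_def)
 define A where "A = {j. 1 \<le> j & j < Suc H & \<not> p dvd j}"
 define B where "B = {j. Suc H \<le> j & j < N & \<not> p dvd j}"
 have pN: "p dvd N" using False by (simp add: N_def)
 have nd: "p dvd N - j \<longleftrightarrow> p dvd j" if "j \<le> N" for j
  using pN that by (metis dvd_diffD1 dvd_diff_nat)
 have bij: "(\<Prod>j\<in>B. int j) = (\<Prod>j\<in>A. int (N - j))"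
 proof (rule prod.reindex_bij_witness[of _ "%j. N - j" "%j. N - j"])
  fix j assume "j \<in> B" thus "N - (N - j) = j" "N - j \<in> A" "int (N - (N - j)) = int j" using nd[of j] NH by (auto simp: A_def B_def)
 next
  fix j assume "j \<in> A" thus "N - (N - j) = j" "N - j \<in> B" using nd[of j] NH by (auto simp: A_def B_def)
 qed
 \<comment> \<open>The set A is half of the units, hence has p^(m-1) (p - 1)/2 elements, a product
   of odd numbers; it is counted by removing the multiples of p from 1, ..., H.\<close>
 have cardA: "odd (card A)"
 proof -
  have "{1..H} = A \<union> {j \<in> {1..H}. p dvd j}" by (auto simp: A_def)
  moreover have "card {j \<in> {1..H}. p dvd j} = H div p"
  proof -
   have "{j \<in> {1..H}. p dvd j} = (%i. p * i) ` {1..H div p}"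
    using p by (auto simp: less_eq_div_iff_mult_less_eq prime_gt_0_nat mult.commute Suc_le_eq elim!: dvdE intro!: imageI)
   thus ?thesis using p by (simp add: card_image inj_on_def prime_gt_0_nat)
  qed
  moreover have "A \<inter> {j \<in> {1..H}. p dvd j} = {}" by (auto simp: A_def)
  moreover have "finite A" by (simp add: A_def)
  ultimately have c: "H = card A + H div p" by (metis (no_types, lifting) card_Un_disjoint card_atLeastAtMost diff_Suc_1 finite_Un finite_atLeastAtMost)
  define M where "M = p ^ (m - 1)"
  have NM: "N = p * M" using False by (cases m) (auto simp: N_def M_def)
  have "odd M" using op by (simp add: M_def)
  then obtain k where k: "M = 2 * k + 1" by (elim oddE)
  obtain l where l: "p = 4 * l + 3" using p(2) by (metis mult_div_mod_eq)
  have "H = p * k + (2 * l + 1)" using NH NM k l by (simp add: algebra_simps)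
  hence "H div p = k" using l by (intro div_nat_eqI) auto
  hence "card A = (p - 1) * k + (2 * l + 1)" using c \<open>H = p * k + (2 * l + 1)\<close> l by (simp add: algebra_simps)
  thus ?thesis using l by simp
 qed
 have "[(\<Prod>j\<in>B. int j) = (- 1) ^ card A * (\<Prod>j\<in>A. int j)] (mod int N)"
 proof -
  have "[(\<Prod>j\<in>A. int (N - j)) = (\<Prod>j\<in>A. (- 1) * int j)] (mod int N)"
   by (rule cong_prod) (use NH in \<open>auto simp: A_def cong_iff_dvd_diff of_nat_diff\<close>)
  thus ?thesis unfolding bij prod.distrib by simp
 qed
 hence B: "[(\<Prod>j\<in>B. int j) = - (\<Prod>j\<in>A. int j)] (mod int N)" using cardA by simp
 have "{j. 1 \<le> j & j < N & \<not> p dvd j} = A \<union> B" using NH by (auto simp: A_def B_def)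
 hence "(\<Prod>j | 1 \<le> j & j < N & \<not> p dvd j. int j) = (\<Prod>j\<in>A. int j) * (\<Prod>j\<in>B. int j)"
  by (simp add: prod.union_disjoint A_def B_def disjoint_iff)
 hence "[(\<Prod>j\<in>A. int j) * (\<Prod>j\<in>B. int j) = - 1] (mod int N)"
  using wilson_prime_power[OF p(1) op, of m] False by (simp add: N_def)
 moreover have "[(\<Prod>j\<in>A. int j) * (\<Prod>j\<in>B. int j) = (\<Prod>j\<in>A. int j) * - (\<Prod>j\<in>A. int j)] (mod int N)"
  by (intro cong_mult B cong_refl)
 ultimately have "[- ((\<Prod>j\<in>A. int j) ^ 2) = - 1] (mod int N)"
  by (metis cong_sym cong_trans mult_minus_right power2_eq_square)
 hence "[(\<Prod>j\<in>A. int j) ^ 2 = 1] (mod int N)" by (simp add: cong_minus_minus_iff)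
 moreover have "morita p (Suc H) ^ 2 = (\<Prod>j\<in>A. int j) ^ 2"
  by (simp add: morita_def A_def power_mult_distrib power_mult[symmetric] mult.commute[of _ 2])
 ultimately show ?thesis unfolding h by (simp add: N_def)
qed auto

section \<open>The p-adic absolute value, integer limits and values of Gamma_p\<close>

lemma padic_abs_0 [simp]: "padic_abs 0 = 0" by simp

lemma padic_abs_1 [simp]: "padic_abs (1 :: 'p::prime_card padic) = 1"
 using padic_abs_of_nat[of 1, where 'p = 'p] prime_card[where 'a = 'p] by simp

lemma padic_abs_power: "padic_abs (x ^ n) = padic_abs x ^ n"
 by (induction n) (auto simp: padic_abs_mult)

lemma padic_abs_inverse: "padic_abs (inverse x) = inverse (padic_abs x)"
proof (cases "x = 0")
 case False
 hence "padic_abs x * padic_abs (inverse x) = 1" by (simp flip: padic_abs_mult)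
 thus ?thesis by (metis inverse_unique)
qed auto

lemma padic_abs_divide: "padic_abs (x / y) = padic_abs x / padic_abs y"
 by (simp add: divide_inverse padic_abs_mult padic_abs_inverse)

lemma padic_abs_diff_ultra: "padic_abs (x - y) \<le> max (padic_abs x) (padic_abs y)"
 using padic_abs_ultra[of x "- y"] by simp

lemma padic_abs_add_le: "padic_abs x \<le> r ==> padic_abs y \<le> r ==> padic_abs (x + y) \<le> r"
 using padic_abs_ultra[of x y] by linarith

lemma padic_abs_diff_le: "padic_abs x \<le> r ==> padic_abs y \<le> r ==> padic_abs (x - y) \<le> r"
 using padic_abs_diff_ultra[of x y] by linarith

lemma padic_abs_commute: "padic_abs (x - y) = padic_abs (y - x)"
 using padic_abs_minus[of "x - y"] by simp

lemma padic_abs_triangle_le: "padic_abs (x - y) \<le> r ==> padic_abs (y - z) \<le> r ==> padic_abs (x - z) \<le> r"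
 using padic_abs_add_le[of "x - y" r "y - z"] by simp

lemma padic_abs_sum_le:
 assumes "r \<ge> 0" "!!i. i \<in> A ==> padic_abs (f i) \<le> r"
 shows "padic_abs (sum f A) \<le> r"
 using assms(2) by (induction A rule: infinite_finite_induct) (auto intro!: padic_abs_add_le assms(1))

lemma padic_abs_mult_le: "padic_abs x \<le> r ==> padic_abs y \<le> s ==> padic_abs (x * y) \<le> r * s"
 unfolding padic_abs_mult by (intro mult_mono) (auto intro: order_trans[OF padic_abs_nonneg])

lemma padic_abs_of_int_le_1 [simp]: "padic_abs (of_int z :: 'p::prime_card padic) \<le> 1"
proof -
 have n: "padic_abs (of_nat n :: 'p padic) \<le> 1" for n
  by (induction n) (auto intro!: padic_abs_add_le)
 show ?thesis by (cases z rule: int_cases2) (auto simp: n)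
qed

lemma padic_abs_of_nat_le_1 [simp]: "padic_abs (of_nat n :: 'p::prime_card padic) \<le> 1"
 using padic_abs_of_int_le_1[of "int n", where 'p = 'p] by simp

lemma padic_abs_p: "padic_abs (of_nat CARD('p) :: 'p::prime_card padic) = 1 / real CARD('p)"
proof -
 let ?p = "CARD('p)"
 have p: "prime ?p" by (rule prime_card)
 have pr: "prime_elem (int ?p)" using p by auto
 have u: "\<not> is_unit (int ?p)" using p by (auto simp: prime_nat_iff)
 have "rat_ord ?p (of_int (int ?p) / of_int 1) = int (multiplicity (int ?p) (int ?p)) - int (multiplicity (int ?p) 1)"
  by (rule rat_ord_frac[OF p]) (use p in auto)
 hence "rat_ord ?p (of_nat ?p) = 1" using u p by (simp add: multiplicity_self)
 thus ?thesis using p by (simp add: padic_abs_of_nat rat_pabs_def power_int_minus field_simps)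
qed

lemma card_pos: "real CARD('p::prime_card) > 0" using prime_gt_0_nat[OF prime_card[where 'a = 'p]] by simp
lemma card_gt_1: "real CARD('p::prime_card) > 1" using prime_gt_1_nat[OF prime_card[where 'a = 'p]] by simp

lemma padic_abs_of_int_unit:
 assumes "\<not> int CARD('p) dvd z"
 shows "padic_abs (of_int z :: 'p::prime_card padic) = 1"
proof -
 let ?p = "CARD('p)"
 have "coprime (int ?p) z" using assms prime_card[where 'a = 'p] by (intro prime_imp_coprime) auto
 then obtain a b where "a * int ?p + b * z = 1" by (metis bezout_int coprime_iff_gcd_eq_1)
 hence e: "(of_int a * of_nat ?p + of_int b * of_int z :: 'p padic) = 1"
  by (metis of_int_1 of_int_add of_int_mult of_int_of_nat_eq)
 have "padic_abs (of_int a * of_nat ?p :: 'p padic) \<le> 1 / real ?p"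
  using padic_abs_mult_le[OF padic_abs_of_int_le_1 order_refl, of a "of_nat ?p :: 'p padic"] by (simp add: padic_abs_p)
 moreover have "1 / real ?p < 1" using card_gt_1[where 'p = 'p] by simp
 ultimately have lt: "padic_abs (of_int a * of_nat ?p :: 'p padic) < 1" by linarith
 have "1 \<le> max (padic_abs (of_int a * of_nat ?p :: 'p padic)) (padic_abs (of_int b * of_int z :: 'p padic))"
  using padic_abs_ultra[of "of_int a * of_nat ?p :: 'p padic" "of_int b * of_int z"] unfolding e by simp
 hence "1 \<le> padic_abs (of_int b * of_int z :: 'p padic)" using lt by linarith
 also have "... \<le> 1 * padic_abs (of_int z :: 'p padic)"
  unfolding padic_abs_mult by (intro mult_right_mono) auto
 finally show ?thesis using padic_abs_of_int_le_1[of z, where 'p = 'p] by linarith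
qed

lemma padic_abs_of_nat_unit:
 "\<not> CARD('p) dvd n ==> padic_abs (of_nat n :: 'p::prime_card padic) = 1"
 using padic_abs_of_int_unit[of "int n", where 'p = 'p] by simp

lemma padic_abs_of_int_dvd:
 assumes "int CARD('p) ^ m dvd z"
 shows "padic_abs (of_int z :: 'p::prime_card padic) \<le> 1 / real CARD('p) ^ m"
proof -
 obtain w where w: "z = int CARD('p) ^ m * w" using assms by blast
 have "padic_abs (of_int z :: 'p padic) = (1 / real CARD('p)) ^ m * padic_abs (of_int w :: 'p padic)"
  unfolding w by (simp add: padic_abs_mult padic_abs_power padic_abs_p)
 also have "... \<le> (1 / real CARD('p)) ^ m * 1" by (intro mult_left_mono) auto
 finally show ?thesis by (simp add: power_one_over)
qed

lemma padic_abs_of_int_dvd_iff: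
 "padic_abs (of_int z :: 'p::prime_card padic) \<le> 1 / real CARD('p) ^ m \<longleftrightarrow> int CARD('p) ^ m dvd z"
proof (cases "z = 0")
 case False
 let ?p = "CARD('p)"
 have u: "\<not> is_unit (int ?p)" using prime_card[where 'a = 'p] by (auto simp: prime_nat_iff)
 obtain w where w: "z = int ?p ^ multiplicity (int ?p) z * w" "\<not> int ?p dvd w"
  using multiplicity_decompose'[OF False u] by metis
 have "padic_abs (of_int z :: 'p padic) = (1 / real ?p) ^ multiplicity (int ?p) z"
  by (subst w(1)) (simp add: padic_abs_mult padic_abs_power padic_abs_p padic_abs_of_int_unit[OF w(2)])
 hence e: "padic_abs (of_int z :: 'p padic) = 1 / real ?p ^ multiplicity (int ?p) z" by (simp add: power_one_over)
 have "padic_abs (of_int z :: 'p padic) \<le> 1 / real ?p ^ m \<longleftrightarrow> real ?p ^ m \<le> real ?p ^ multiplicity (int ?p) z"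
  unfolding e using card_pos[where 'p = 'p] by (simp add: divide_simps)
 also have "... \<longleftrightarrow> m \<le> multiplicity (int ?p) z" using card_gt_1[where 'p = 'p] by simp
 also have "... \<longleftrightarrow> int ?p ^ m dvd z" using False u by (simp add: power_dvd_iff_le_multiplicity)
 finally show ?thesis .
qed auto

lemma padic_abs_cong:
 assumes "[a = b] (mod int CARD('p) ^ m)"
 shows "padic_abs (of_int a - of_int b :: 'p::prime_card padic) \<le> 1 / real CARD('p) ^ m"
 using padic_abs_of_int_dvd[of m "a - b", where 'p = 'p] assms by (simp add: cong_iff_dvd_diff)

lemma padic_cong_of_nat:
 assumes "padic_abs (of_nat a - of_nat b :: 'p::prime_card padic) \<le> 1 / real CARD('p) ^ m"
 shows "[a = b] (mod CARD('p) ^ m)"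
proof -
 have "padic_abs (of_int (int a - int b) :: 'p padic) \<le> 1 / real CARD('p) ^ m" using assms by simp
 hence "[int a = int b] (mod int CARD('p) ^ m)" unfolding padic_abs_of_int_dvd_iff by (simp add: cong_iff_dvd_diff)
 thus ?thesis using cong_int_iff[of a b "CARD('p) ^ m"] by simp
qed

lemma inverse_card_power_tendsto_0: "(%m. 1 / real CARD('p::prime_card) ^ m) \<longlonglongrightarrow> 0"
 using LIMSEQ_inverse_realpow_zero[OF card_gt_1[where 'p = 'p]] by (simp add: divide_inverse)

lemma ex_inverse_card_power_less: "e > 0 ==> \<exists>m. 1 / real CARD('p::prime_card) ^ m < e"
 using order_tendstoD(2)[OF inverse_card_power_tendsto_0[where 'p = 'p], of e] by (auto simp: eventually_sequentially)

lemma of_int_padic: "(of_int z :: 'p::prime_card padic) = abs_padic (pc_const (of_int z))"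
proof (cases z rule: int_cases2)
 case (nonpos n)
 have "(of_int z :: 'p padic) = - of_nat n" by (simp add: nonpos)
 also have "... = abs_padic (pc_minus (pc_const (of_nat n)))" by (simp add: of_nat_padic uminus_padic.abs_eq)
 also have "... = abs_padic (pc_const (of_int z))"
  by (simp add: padic.abs_eq_iff padic_rel_def pc_minus.rep_eq pc_const.rep_eq nonpos)
 finally show ?thesis .
qed (simp add: of_nat_padic)

text \<open>The sequence itself represents its limit in the completion, and the congruences survive
  as bounds on the distance to it.\<close>

lemma padic_complete_of_int:
 fixes X :: "nat => int"
 assumes "!!k m. k \<ge> m ==> [X k = X m] (mod int CARD('p) ^ m)"
 obtains z :: "'p::prime_card padic" where "!!m. padic_abs (of_int (X m) - z) \<le> 1 / real CARD('p) ^ m"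
proof -
 let ?p = "CARD('p)"
 have p: "prime ?p" by (rule prime_card)
 have b: "rat_pabs ?p (of_int (X m) - of_int (X k)) \<le> 1 / real ?p ^ m" if "k \<ge> m" for m k
 proof -
  have d: "int ?p ^ m dvd X m - X k" using assms[OF that] by (metis cong_iff_dvd_diff cong_sym)
  have "rat_pabs ?p (of_int (X m - X k)) \<le> 1 / real ?p ^ m"
  proof -
   have "padic_abs (of_int (X m - X k) :: 'p padic) = rat_pabs ?p (of_int (X m - X k))"
    by (simp only: of_int_padic padic_abs.abs_eq pc_const.rep_eq limI[OF tendsto_const])
   thus ?thesis using padic_abs_of_int_dvd[OF d] by simp
  qed
  thus ?thesis by simp
 qed
 have "pcauchy_seq ?p (%n. of_int (X n))"
  unfolding pcauchy_seq_def
 proof (intro allI impI)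
  fix e :: real assume "e > 0"
  then obtain N where N: "1 / real ?p ^ N < e"
   using ex_inverse_card_power_less[where 'p = 'p] by blast
  have "rat_pabs ?p (of_int (X m) - of_int (X n)) < e" if "m \<ge> N" "n \<ge> N" for m n
  proof -
   have 1: "rat_pabs ?p (of_int (X N) - of_int (X n)) \<le> 1 / real ?p ^ N" by (rule b) fact
   have "rat_pabs ?p (of_int (X N) - of_int (X m)) \<le> 1 / real ?p ^ N" by (rule b) fact
   hence 2: "rat_pabs ?p (of_int (X m) - of_int (X N)) \<le> 1 / real ?p ^ N"
    using rat_pabs_minus[OF p, of "of_int (X N) - of_int (X m)"] by simp
   show ?thesis
    using rat_pabs_ultra[OF p, of "of_int (X m) - of_int (X N)" "of_int (X N) - of_int (X n)"] 1 2 N by simp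
  qed
  thus "\<exists>N. \<forall>m\<ge>N. \<forall>n\<ge>N. rat_pabs ?p (of_int (X m) - of_int (X n)) < e" by blast
 qed
 then obtain Y :: "'p pcauchy" where Y: "Rep_pcauchy Y = (%n. of_int (X n))"
  using Abs_pcauchy_inverse[of "%n. of_int (X n)"] by blast
 show thesis
 proof (rule that[of "abs_padic Y"])
  fix m
  have e: "of_int (X m) - abs_padic Y = abs_padic (pc_add (pc_const (of_int (X m))) (pc_minus Y))"
   by (simp add: of_int_padic minus_padic_def uminus_padic.abs_eq plus_padic.abs_eq)
  have "(%n. rat_pabs ?p (of_int (X m) - of_int (X n))) \<longlonglongrightarrow> padic_abs (of_int (X m) - abs_padic Y)"
   using padic_abs_limit[of "pc_add (pc_const (of_int (X m))) (pc_minus Y)"]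
   unfolding e by (simp add: pc_add.rep_eq pc_const.rep_eq pc_minus.rep_eq Y)
  thus "padic_abs (of_int (X m) - abs_padic Y) \<le> 1 / real ?p ^ m"
   by (rule LIMSEQ_le_const2) (use b in blast)
 qed
qed

text \<open>The naturals N m tending to x make the filter in the definition nontrivial and produce
  the limit. By \<open>morita_cong\<close>, knowing x modulo p^m determines the value modulo
  p^m.\<close>

lemma padic_Gamma_approx:
 fixes x :: "'p::prime_card padic"
 assumes odd: "odd CARD('p)" and N: "!!m. padic_abs (of_nat (N m) - x) \<le> 1 / real CARD('p) ^ m"
  and n: "padic_abs (of_nat n - x) \<le> 1 / real CARD('p) ^ m"
 shows "padic_abs (of_int (morita CARD('p) n) - padic_Gamma x) \<le> 1 / real CARD('p) ^ m"
proof -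
 let ?p = "CARD('p)"
 have p: "prime ?p" by (rule prime_card)
 have mono: "1 / real ?p ^ k \<le> 1 / real ?p ^ m" if "k \<ge> m" for k m
  using that card_gt_1[where 'p = 'p] by (simp add: field_simps power_increasing)
 have cong: "[a = b] (mod ?p ^ m)"
  if "padic_abs (of_nat a - x) \<le> 1 / real ?p ^ m" "padic_abs (of_nat b - x) \<le> 1 / real ?p ^ m" for a b m
  by (rule padic_cong_of_nat, rule padic_abs_triangle_le[OF that(1)]) (subst padic_abs_commute, rule that(2))
 have NN: "[N k = N m] (mod ?p ^ m)" if "k \<ge> m" for k m
  by (rule cong) (use N[of k] N[of m] mono[OF that] in auto)
 obtain z :: "'p padic" where z: "!!m. padic_abs (of_int (morita ?p (N m)) - z) \<le> 1 / real ?p ^ m"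
  by (rule padic_complete_of_int[of "%m. morita ?p (N m)", where 'p = 'p]) (use morita_cong[OF p odd NN] in auto)
 have approx: "padic_abs (of_int (morita ?p n) - z) \<le> 1 / real ?p ^ m"
  if "padic_abs (of_nat n - x) \<le> 1 / real ?p ^ m" for n m
 proof -
  have "[morita ?p n = morita ?p (N m)] (mod int ?p ^ m)" by (intro morita_cong p odd cong that N)
  from padic_abs_cong[OF this] show ?thesis using z[of m] by (rule padic_abs_triangle_le)
 qed
 have "padic_Gamma x = z"
  unfolding padic_Gamma_def
 proof (rule tendsto_Lim)
  show "\<not> trivial_limit (filtercomap (of_nat :: nat => 'p padic) (nhds x))"
  proof (rule filtercomap_neq_bot)
   fix P assume "eventually P (nhds x)"
   then obtain d where d: "d > 0" "!!y. dist y x < d ==> P y" by (auto simp: eventually_nhds_metric)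
   obtain m where "1 / real ?p ^ m < d"
    using ex_inverse_card_power_less[where 'p = 'p] d(1) by blast
   hence "P (of_nat (N m))" using N[of m] by (intro d(2)) (simp add: dist_padic_def)
   thus "\<exists>n. P (of_nat n)" ..
  qed
  have "((%n. of_int (morita ?p n)) \<longlongrightarrow> z) (filtercomap (of_nat :: nat => 'p padic) (nhds x))"
  proof (rule tendstoI)
   fix e :: real assume e: "e > 0"
   obtain m where m: "1 / real ?p ^ m < e"
    using ex_inverse_card_power_less[where 'p = 'p] e by blast
   have "eventually (%y. dist y x < 1 / real ?p ^ m) (nhds x)"
    unfolding eventually_nhds_metric using card_pos[where 'p = 'p] by (intro exI[of _ "1 / real ?p ^ m"]) auto
   hence "eventually (%n. dist (of_nat n) x < 1 / real ?p ^ m) (filtercomap (of_nat :: nat => 'p padic) (nhds x))"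
    by (rule eventually_filtercomapI)
   thus "eventually (%n. dist (of_int (morita ?p n)) z < e) (filtercomap (of_nat :: nat => 'p padic) (nhds x))"
   proof eventually_elim
    case (elim n)
    hence "padic_abs (of_int (morita ?p n) - z) \<le> 1 / real ?p ^ m" by (intro approx) (simp add: dist_padic_def)
    thus ?case using m by (simp add: dist_padic_def)
   qed
  qed
  thus "((%n. (- 1) ^ n * (\<Prod>j | 1 \<le> j & j < n & \<not> ?p dvd j. of_nat j)) \<longlongrightarrow> z)
    (filtercomap (of_nat :: nat => 'p padic) (nhds x))"
   by (simp add: morita_def)
 qed
 thus ?thesis using approx[OF n] by simp
qed

context
 assumes p3: "CARD('p::prime_card) mod 4 = 3"
begin

private lemma odd_card: "odd CARD('p)" using p3 by presburger

private lemma abs_2: "padic_abs (2 :: 'p padic) = 1"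
proof -
 have "\<not> CARD('p) dvd 2" using odd_card prime_card[where 'a = 'p] by (metis dvd_antisym even_numeral primes_dvd_imp_eq two_is_prime_nat)
 from padic_abs_of_nat_unit[OF this] show ?thesis by simp
qed

private lemma abs_4: "padic_abs (4 :: 'p padic) = 1"
 using padic_abs_mult[of "2 :: 'p padic" 2] abs_2 by simp

lemma padic_Gamma_half_approx:
 assumes "padic_abs (of_nat n - 1 / 2 :: 'p padic) \<le> 1 / real CARD('p) ^ m"
 shows "padic_abs (of_int (morita CARD('p) n) - padic_Gamma (1 / 2 :: 'p padic)) \<le> 1 / real CARD('p) ^ m"
proof (rule padic_Gamma_approx[OF odd_card _ assms, of "%m. (CARD('p) ^ m + 1) div 2"])
 fix m
 have "even (CARD('p) ^ m + 1)" using odd_card by simp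
 hence "2 * ((CARD('p) ^ m + 1) div 2) = CARD('p) ^ m + 1" by simp
 hence "2 * of_nat ((CARD('p) ^ m + 1) div 2) = (of_nat CARD('p) ^ m + 1 :: 'p padic)"
  by (metis of_nat_1 of_nat_add of_nat_mult of_nat_numeral of_nat_power)
 hence "of_nat ((CARD('p) ^ m + 1) div 2) - 1 / 2 = (of_nat CARD('p) ^ m / 2 :: 'p padic)" by (simp add: field_simps)
 thus "padic_abs (of_nat ((CARD('p) ^ m + 1) div 2) - 1 / 2 :: 'p padic) \<le> 1 / real CARD('p) ^ m"
  by (simp only: padic_abs_divide padic_abs_power padic_abs_p abs_2 power_one_over div_by_1)
qed

text \<open>Odd powers of p are 3 modulo 4, so the numbers (p^(2m+1) + 1)/4 are naturals tending to
  1/4.\<close>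

lemma padic_Gamma_quarter_approx:
 assumes "padic_abs (of_nat n - 1 / 4 :: 'p padic) \<le> 1 / real CARD('p) ^ m"
 shows "padic_abs (of_int (morita CARD('p) n) - padic_Gamma (1 / 4 :: 'p padic)) \<le> 1 / real CARD('p) ^ m"
proof (rule padic_Gamma_approx[OF odd_card _ assms, of "%m. (CARD('p) ^ (2 * m + 1) + 1) div 4"])
 fix m
 have "CARD('p) ^ (2 * m + 1) mod 4 = 3"
 proof -
  have "[CARD('p) ^ (2 * m + 1) = 3 ^ (2 * m + 1)] (mod 4)" by (rule cong_pow) (simp add: cong_def p3)
  moreover have "[3 * 9 ^ m = 3 * 1 ^ m] (mod (4 :: nat))" by (intro cong_mult cong_pow cong_refl) (simp add: cong_def)
  hence "[3 ^ (2 * m + 1) = 3] (mod (4 :: nat))" by (simp add: power_mult)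
  ultimately have "[CARD('p) ^ (2 * m + 1) = 3] (mod 4)" by (rule cong_trans)
  thus ?thesis by (simp add: cong_def)
 qed
 hence "4 * ((CARD('p) ^ (2 * m + 1) + 1) div 4) = CARD('p) ^ (2 * m + 1) + 1" by presburger
 hence "4 * of_nat ((CARD('p) ^ (2 * m + 1) + 1) div 4) = (of_nat CARD('p) ^ (2 * m + 1) + 1 :: 'p padic)"
  by (metis of_nat_1 of_nat_add of_nat_mult of_nat_numeral of_nat_power)
 hence "of_nat ((CARD('p) ^ (2 * m + 1) + 1) div 4) - 1 / 4 = (of_nat CARD('p) ^ (2 * m + 1) / 4 :: 'p padic)" by (simp add: field_simps)
 hence "padic_abs (of_nat ((CARD('p) ^ (2 * m + 1) + 1) div 4) - 1 / 4 :: 'p padic) = 1 / real CARD('p) ^ (2 * m + 1)"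
  by (simp only: padic_abs_divide padic_abs_power padic_abs_p abs_4 power_one_over div_by_1)
 also have "... \<le> 1 / real CARD('p) ^ m"
  using card_gt_1[where 'p = 'p] by (intro divide_left_mono power_increasing mult_pos_pos) auto
 finally show "padic_abs (of_nat ((CARD('p) ^ (2 * m + 1) + 1) div 4) - 1 / 4 :: 'p padic) \<le> 1 / real CARD('p) ^ m" .
qed

end

section \<open>Bounded p-adic power series and Frobenius congruences\<close>

definition fps_bdd :: "real => 'p::prime_card padic fps => bool" where
 "fps_bdd r F \<longleftrightarrow> (\<forall>n. padic_abs (fps_nth F n) \<le> r)"

lemma fps_bddD: "fps_bdd r F ==> padic_abs (fps_nth F n) \<le> r" by (simp add: fps_bdd_def)

lemma fps_bdd_nonneg: "fps_bdd r F ==> r \<ge> 0"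
 using fps_bddD[of r F 0] padic_abs_nonneg[of "fps_nth F 0"] by linarith

lemma fps_bdd_mono: "fps_bdd r F ==> r \<le> s ==> fps_bdd s F"
 unfolding fps_bdd_def using order_trans by blast

lemma fps_bdd_0 [simp]: "r \<ge> 0 ==> fps_bdd r 0" by (simp add: fps_bdd_def)

lemma fps_bdd_1 [simp]: "fps_bdd 1 1" by (simp add: fps_bdd_def)

lemma fps_bdd_of_nat: "padic_abs (of_nat n :: 'p::prime_card padic) \<le> r ==> fps_bdd r (of_nat n :: 'p padic fps)"
 using order_trans[OF padic_abs_nonneg] by (force simp: fps_bdd_def fps_of_nat[symmetric])

lemma fps_bdd_add: "fps_bdd r F ==> fps_bdd r G ==> fps_bdd r (F + G)"
 by (simp add: fps_bdd_def padic_abs_add_le)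

lemma fps_bdd_sum: "r \<ge> 0 ==> (!!i. i \<in> A ==> fps_bdd r (f i)) ==> fps_bdd r (sum f A)"
 by (auto simp: fps_bdd_def fps_sum_nth intro!: padic_abs_sum_le)

lemma fps_bdd_mult: "fps_bdd r F ==> fps_bdd s G ==> fps_bdd (r * s) (F * G)"
 using fps_bdd_nonneg[of r F] fps_bdd_nonneg[of s G]
 by (auto simp: fps_bdd_def fps_mult_nth intro!: padic_abs_sum_le padic_abs_mult_le)

lemma fps_bdd_power: "fps_bdd 1 F ==> fps_bdd 1 (F ^ n)"
 by (induction n) (use fps_bdd_mult[of 1 F 1] in auto)

lemma fps_bdd_compose:
 assumes "fps_bdd r F" "fps_bdd 1 G" shows "fps_bdd r (F oo G)"
 unfolding fps_bdd_def fps_compose_nth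
 using padic_abs_mult_le[OF fps_bddD[OF assms(1)] fps_bddD[OF fps_bdd_power[OF assms(2)]]]
 by (auto intro!: padic_abs_sum_le fps_bdd_nonneg[OF assms(1)])

definition fps_int :: "'a::ring_1 fps => bool" where
 "fps_int F \<longleftrightarrow> (\<forall>n. fps_nth F n \<in> \<int>)"

lemma fps_int_mult: "fps_int F ==> fps_int G ==> fps_int (F * G)"
 by (auto simp: fps_int_def fps_mult_nth intro!: Ints_sum)

lemma fps_int_inverse:
 fixes F :: "'a::field fps"
 assumes "fps_int F" "fps_nth F 0 = 1" shows "fps_int (inverse F)"
proof -
 have "fps_nth (inverse F) n \<in> \<int>" for n
 proof (induction n rule: less_induct)
  case (less n)
  show ?case
  proof (cases "n = 0")
   case False
   have "F * inverse F = 1" using assms(2) by (simp add: inverse_mult_eq_1')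
   hence "(\<Sum>i=0..n. fps_nth F i * fps_nth (inverse F) (n - i)) = 0" using False by (simp flip: fps_mult_nth)
   hence "fps_nth (inverse F) n = - (\<Sum>i=Suc 0..n. fps_nth F i * fps_nth (inverse F) (n - i))"
    using assms(2) by (subst (asm) sum.atLeast_Suc_atMost) (auto simp: eq_neg_iff_add_eq_0)
   also have "... \<in> \<int>" using assms(1) less.IH by (auto simp: fps_int_def intro!: Ints_sum)
   finally show ?thesis .
  qed (use assms in simp)
 qed
 thus ?thesis by (simp add: fps_int_def)
qed

lemma fps_int_compose_X_power: "fps_int F ==> k > 0 ==> fps_int (F oo fps_X ^ k)" for F :: "'a::idom fps"
 by (auto simp: fps_int_def fps_nth_compose_X_power)

lemma fps_int_theta: "fps_int theta_fps" and fps_int_psi: "fps_int psi_fps"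
 by (auto simp: fps_int_def theta_fps_def psi_fps_def)

lemma fps_int_X: "fps_int fps_X" by (auto simp: fps_int_def)

lemma fps_int_hauptmodul: "fps_int (hauptmodul :: 'a::field_char_0 fps)"
 unfolding hauptmodul_def
 by (intro fps_int_mult fps_int_X fps_int_compose_X_power fps_int_inverse fps_int_theta fps_int_psi) simp_all

lemma fps_int_bdd: "fps_int F ==> fps_bdd 1 (F :: 'p::prime_card padic fps)"
 unfolding fps_int_def fps_bdd_def by (metis Ints_cases padic_abs_of_int_le_1)

lemma fps_bdd_binomial:
 assumes "0 < k" "k < CARD('p)"
 shows "fps_bdd (1 / real CARD('p)) (of_nat (CARD('p) choose k) :: 'p::prime_card padic fps)"
proof (rule fps_bdd_of_nat)
 have "CARD('p) dvd (CARD('p) choose k)" using assms by (intro dvd_choose_prime prime_card) auto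
 hence "int CARD('p) ^ 1 dvd int (CARD('p) choose k)" by simp
 from padic_abs_of_int_dvd[OF this] show "padic_abs (of_nat (CARD('p) choose k) :: 'p padic) \<le> 1 / real CARD('p)" by simp
qed

text \<open>The inner binomial coefficients are divisible by p, and each inner term still contains a
  factor B; together this gives r / p.\<close>

lemma freshman_dream_gen:
 fixes A B :: "'p::prime_card padic fps"
 assumes A: "fps_bdd 1 A" and B: "fps_bdd r B" and r: "r \<le> 1"
 shows "fps_bdd (r / real CARD('p)) ((A + B) ^ CARD('p) - A ^ CARD('p) - B ^ CARD('p))"
proof -
 let ?p = "CARD('p)"
 have p1: "?p > 1" using prime_gt_1_nat[OF prime_card[where 'a = 'p]] .
 have r0: "r \<ge> 0" by (rule fps_bdd_nonneg[OF B])
 have "(A + B) ^ ?p = (\<Sum>k\<le>?p. of_nat (?p choose k) * A ^ k * B ^ (?p - k))" by (rule binomial_ring)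
 also have "{..?p} = insert 0 (insert ?p {1..<?p})" using p1 by auto
 finally have e: "(A + B) ^ ?p - A ^ ?p - B ^ ?p = (\<Sum>k=1..<?p. of_nat (?p choose k) * A ^ k * B ^ (?p - k))"
  using p1 by simp
 show ?thesis unfolding e
 proof (rule fps_bdd_sum)
  fix k assume k: "k \<in> {1..<?p}"
  have "B ^ (?p - k) = B * B ^ (?p - k - 1)" using k by (cases "?p - k") auto
  moreover have "fps_bdd (r * 1) (B * B ^ (?p - k - 1))"
   by (intro fps_bdd_mult B fps_bdd_power fps_bdd_mono[OF B r])
  ultimately have 1: "fps_bdd r (B ^ (?p - k))" by simp
  have "fps_bdd (1 / real ?p * 1 * r) (of_nat (?p choose k) * A ^ k * B ^ (?p - k))"
   by (intro fps_bdd_mult fps_bdd_binomial fps_bdd_power A 1) (use k in auto)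
  thus "fps_bdd (r / real ?p) (of_nat (?p choose k) * A ^ k * B ^ (?p - k))" by simp
 qed (use r0 in auto)
qed

lemma padic_fermat:
 "padic_abs (of_int a ^ CARD('p) - of_int a :: 'p::prime_card padic) \<le> 1 / real CARD('p)"
proof -
 let ?p = "CARD('p)"
 have pr: "prime ?p" by (rule prime_card)
 define r where "r = nat (a mod int ?p)"
 have r: "int r = a mod int ?p" using prime_gt_0_nat[OF pr] by (simp add: r_def)
 have ar: "[a = int r] (mod int ?p)" by (simp add: r cong_def)
 have "[r ^ ?p = r] (mod ?p)"
 proof (cases "?p dvd r")
  case True
  thus ?thesis using prime_gt_0_nat[OF pr] by (auto simp: cong_def mod_eq_0_iff_dvd dvd_power dvd_mult2 intro: dvd_trans[OF True] dvd_power)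
 next
  case False
  have "[r ^ (?p - 1) * r = 1 * r] (mod ?p)" by (intro cong_mult fermat_theorem pr False cong_refl)
  moreover have "r ^ (?p - 1) * r = r ^ ?p" using prime_gt_0_nat[OF pr] by (simp flip: power_Suc2)
  ultimately show ?thesis by simp
 qed
 hence "[int r ^ ?p = int r] (mod int ?p)" by (metis cong_int_iff of_nat_power)
 hence "[a ^ ?p = a] (mod int ?p ^ 1)" using cong_pow[OF ar, of ?p] ar
  by (metis cong_sym cong_trans power_one_right)
 from padic_abs_cong[OF this] show ?thesis by simp
qed

text \<open>Writing F = a + q G, the p-th power is a^p + q^p G^p modulo p. Fermat's theorem handles
  a, and the coefficient at n of F is reduced to the coefficient at n - p of G.\<close>

lemma frobenius_congruence:
 fixes F :: "'p::prime_card padic fps"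
 assumes "fps_int F"
 shows "fps_bdd (1 / real CARD('p)) (F ^ CARD('p) - (F oo fps_X ^ CARD('p)))"
proof -
 let ?p = "CARD('p)"
 have pr: "prime ?p" by (rule prime_card)
 have p0: "?p > 0" using prime_gt_0_nat[OF pr] .
 have "padic_abs (fps_nth (F ^ ?p) n - fps_nth (F oo fps_X ^ ?p) n) \<le> 1 / real ?p" if "fps_int F" for n and F :: "'p padic fps"
  using that
 proof (induction n arbitrary: F rule: less_induct)
  case (less n)
  define G where "G = fps_shift 1 F"
  have GI: "fps_int G" using less.prems by (auto simp: fps_int_def G_def)
  obtain a where a: "fps_nth F 0 = of_int a" using less.prems by (auto simp: fps_int_def elim!: Ints_cases)
  have F: "F = fps_const (of_int a) + fps_X * G"
   by (rule fps_ext) (auto simp: G_def a)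
  define err where "err = F ^ ?p - fps_const (of_int a) ^ ?p - (fps_X * G) ^ ?p"
  have "fps_bdd (1 / real ?p) err"
   unfolding err_def by (subst F, rule freshman_dream_gen)
    (auto simp: fps_bdd_def intro!: fps_bddD[OF fps_int_bdd] fps_int_mult fps_int_X GI)
  hence err: "padic_abs (fps_nth err n) \<le> 1 / real ?p" by (rule fps_bddD)
  have Fp: "fps_nth (F ^ ?p) n = fps_nth err n + fps_nth (fps_const (of_int a ^ ?p)) n + (if n < ?p then 0 else fps_nth (G ^ ?p) (n - ?p))"
   by (simp add: err_def power_mult_distrib fps_X_power_mult_nth)
  show ?case
  proof (cases "n < ?p")
   case True
   show ?thesis
   proof (cases "n = 0")
    case True
    have "fps_nth (F ^ ?p) n - fps_nth (F oo fps_X ^ ?p) n = fps_nth err n + (of_int a ^ ?p - of_int a)"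
     unfolding Fp using True p0 a by simp
    thus ?thesis using padic_abs_add_le[OF err padic_fermat[of a]] by simp
   next
    case False
    hence "\<not> ?p dvd n" using True by (auto dest: dvd_imp_le)
    thus ?thesis unfolding Fp using True False err p0 by (simp add: fps_nth_compose_X_power)
   qed
  next
   case False
   have "fps_nth (F oo fps_X ^ ?p) n = fps_nth (G oo fps_X ^ ?p) (n - ?p)"
   proof (cases "?p dvd n")
    case True
    then obtain k where k: "n = ?p * k" by blast
    with False p0 have "k \<ge> 1" by (cases k) auto
    moreover have "n - ?p = ?p * (k - 1)" using k by (simp add: diff_mult_distrib2)
    ultimately show ?thesis using p0 k by (simp add: fps_nth_compose_X_power G_def)
   next
    case F: False
    hence "\<not> ?p dvd (n - ?p)" using False by (metis dvd_diffD1 dvd_refl linorder_not_less dvd_minus_self)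
    thus ?thesis using F p0 by (simp add: fps_nth_compose_X_power)
   qed
   hence "fps_nth (F ^ ?p) n - fps_nth (F oo fps_X ^ ?p) n = fps_nth err n + (fps_nth (G ^ ?p) (n - ?p) - fps_nth (G oo fps_X ^ ?p) (n - ?p))"
   proof -
    have n0: "n ~= 0" using False p0 by metis
    have "fps_nth (F ^ ?p) n = fps_nth err n + fps_nth (G ^ ?p) (n - ?p)" unfolding Fp using False n0 by simp
    thus ?thesis using \<open>fps_nth (F oo fps_X ^ ?p) n = _\<close> by simp
   qed
   moreover have "padic_abs (fps_nth (G ^ ?p) (n - ?p) - fps_nth (G oo fps_X ^ ?p) (n - ?p)) \<le> 1 / real ?p"
   proof (rule less.IH[OF _ GI])
    have "0 < n" using False p0 by (metis gr0I)
    thus "n - ?p < n" using p0 by (rule diff_less[rotated])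
   qed
   ultimately show ?thesis using padic_abs_add_le[OF err] by simp
  qed
 qed
 thus ?thesis using assms by (simp add: fps_bdd_def)
qed

lemma fps_bdd_power_diff:
 fixes A B :: "'p::prime_card padic fps"
 assumes "fps_bdd 1 A" "fps_bdd 1 B" "fps_bdd r (A - B)"
 shows "fps_bdd r (A ^ n - B ^ n)"
proof (induction n)
 case (Suc n)
 have "A ^ Suc n - B ^ Suc n = A * (A ^ n - B ^ n) + (A - B) * B ^ n" by (simp add: algebra_simps)
 moreover have "fps_bdd (1 * r) (A * (A ^ n - B ^ n))" by (intro fps_bdd_mult assms Suc)
 moreover have "fps_bdd (r * 1) ((A - B) * B ^ n)" by (intro fps_bdd_mult assms fps_bdd_power)
 ultimately show ?case by (simp add: fps_bdd_add)
qed (use fps_bdd_nonneg[OF assms(3)] in simp)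

text \<open>For r \<le> 1/p the p-th power of A - B is at most r^2 \<le> r/p, so the p-th power map
  gains a factor 1/p at every step.\<close>

lemma fps_bdd_power_p_diff:
 fixes A B :: "'p::prime_card padic fps"
 assumes A: "fps_bdd 1 A" and B: "fps_bdd 1 B" and r: "fps_bdd r (A - B)" "r \<le> 1 / real CARD('p)"
 shows "fps_bdd (r / real CARD('p)) (A ^ CARD('p) - B ^ CARD('p))"
proof -
 let ?p = "CARD('p)"
 have p1: "?p > 1" using prime_gt_1_nat[OF prime_card[where 'a = 'p]] .
 have r0: "r \<ge> 0" by (rule fps_bdd_nonneg[OF r(1)])
 have "1 / real ?p \<le> 1" using p1 by simp
 hence r1: "r \<le> 1" using r(2) by linarith
 have "fps_bdd (r / real ?p) ((B + (A - B)) ^ ?p - B ^ ?p - (A - B) ^ ?p)"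
  by (rule freshman_dream_gen[OF B r(1) r1])
 moreover have "fps_bdd (r / real ?p) ((A - B) ^ ?p)"
 proof -
  have "(A - B) ^ ?p = (A - B) * (A - B) * (A - B) ^ (?p - 2)"
   using p1 by (metis add_2_eq_Suc le_add_diff_inverse mult.assoc power_Suc Suc_leI one_add_one plus_1_eq_Suc)
  moreover have "fps_bdd (r * r * 1) ((A - B) * (A - B) * (A - B) ^ (?p - 2))"
   by (intro fps_bdd_mult r fps_bdd_power fps_bdd_mono[OF r(1) r1])
  moreover have "r * r \<le> r / real ?p" using mult_left_mono[OF r(2) r0] by simp
  ultimately show ?thesis using fps_bdd_mono by (metis mult.right_neutral)
 qed
 ultimately have "fps_bdd (r / real ?p) (((B + (A - B)) ^ ?p - B ^ ?p - (A - B) ^ ?p) + (A - B) ^ ?p)" by (rule fps_bdd_add)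
 thus ?thesis by simp
qed

text \<open>If A = B modulo p then A^n = B^n modulo p n. The factor n compensates the denominators
  of the logarithm, and the factor p that of \<open>\<gamma> / p\<close>.\<close>

lemma fps_bdd_power_diff_padic:
 fixes A B :: "'p::prime_card padic fps"
 assumes A: "fps_bdd 1 A" and B: "fps_bdd 1 B" and d: "fps_bdd (1 / real CARD('p)) (A - B)" and n: "n > 0"
 shows "fps_bdd (padic_abs (of_nat n :: 'p padic) / real CARD('p)) (A ^ n - B ^ n)"
proof -
 let ?p = "CARD('p)"
 have pr: "prime ?p" by (rule prime_card)
 have p1: "?p > 1" by (rule prime_gt_1_nat[OF pr])
 have pw: "fps_bdd (1 / real ?p ^ Suc m) (A ^ (?p ^ m) - B ^ (?p ^ m))" for m
 proof (induction m)
  case (Suc m)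
  have "1 / real ?p ^ Suc m \<le> 1 / real ?p"
   using p1 by (simp add: field_simps power_increasing[of 0 m "real ?p"])
  from fps_bdd_power_p_diff[OF fps_bdd_power[OF A] fps_bdd_power[OF B] Suc this]
  show ?case by (simp add: power_mult[symmetric] mult.commute)
 qed (use d in simp)
 obtain m w where w: "n = ?p ^ m * w" "\<not> ?p dvd w"
  using multiplicity_decompose'[of n ?p] n p1 by (metis less_irrefl not_less_iff_gr_or_eq nat_dvd_1_iff_1)
 have "padic_abs (of_nat n :: 'p padic) = 1 / real ?p ^ m"
  by (simp add: w(1) padic_abs_mult padic_abs_power padic_abs_p padic_abs_of_nat_unit[OF w(2)] power_one_over)
 moreover have "fps_bdd (1 / real ?p ^ Suc m) ((A ^ (?p ^ m)) ^ w - (B ^ (?p ^ m)) ^ w)"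
  by (intro fps_bdd_power_diff fps_bdd_power A B pw)
 moreover have "1 / real ?p ^ m / real ?p = 1 / real ?p ^ Suc m" by simp
 moreover have "A ^ n = (A ^ (?p ^ m)) ^ w" "B ^ n = (B ^ (?p ^ m)) ^ w" unfolding w(1) by (rule power_mult)+
 ultimately show ?thesis by (simp only:)
qed

section \<open>The lemniscatic logarithm, the quasi-period series and the supercongruence\<close>

text \<open>The integral of (1 + 4 x^4)^(-1/2).\<close>

definition log_fps :: "'a::field_char_0 fps" where
 "log_fps = Abs_fps (%n. if n mod 4 = 1 then central_coeff (n div 4) / of_nat n else 0)"

text \<open>The integral of x^(-2) ((1 + 4 x^4)^(-1/2) - 1). The coefficient of index k sits at the
  exponent 4k - 1, and the subtracted 1 accounts for the polar term 1/x of f^+.\<close>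

definition quasilog_fps :: "'a::field_char_0 fps" where
 "quasilog_fps = Abs_fps (%n. if n mod 4 = 3 then central_coeff ((n + 1) div 4) / of_nat n else 0)"

lemma fps_deriv_log: "fps_deriv log_fps = lemniscate_fps"
proof (rule fps_ext)
 fix n :: nat
 have "(n + 1) mod 4 = 1 \<longleftrightarrow> 4 dvd n" by presburger
 moreover have "(n + 1) div 4 = n div 4" if "4 dvd n" using that by presburger
 ultimately show "fps_nth (fps_deriv log_fps :: 'a fps) n = fps_nth lemniscate_fps n"
  by (auto simp: log_fps_def lemniscate_fps_def simp del: of_nat_Suc)
qed

lemma fps_deriv_quasilog: "fps_X\<^sup>2 * fps_deriv quasilog_fps = lemniscate_fps - 1"
proof (rule fps_ext)
 fix n
 consider "n = 0" | "n = 1" | m where "n = Suc (Suc m)" by (metis One_nat_def not0_implies_Suc)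
 thus "fps_nth (fps_X\<^sup>2 * fps_deriv quasilog_fps :: 'a fps) n = fps_nth (lemniscate_fps - 1) n"
 proof cases
  case (3 m)
  have "Suc m mod 4 = 3 \<longleftrightarrow> 4 dvd n" using 3 by presburger
  moreover have "Suc m + 1 = n" using 3 by simp
  ultimately show ?thesis
   by (auto simp: fps_X_power_mult_nth quasilog_fps_def lemniscate_fps_def 3 simp del: of_nat_Suc)
 qed (auto simp: fps_X_power_mult_nth lemniscate_fps_def central_coeff_def)
qed

lemma of_rat_central_coeff [simp]: "of_rat (central_coeff k) = central_coeff k"
 by (simp add: central_coeff_def of_rat_mult of_rat_power of_rat_minus)

lemma fps_of_rat_log: "fps_of_rat log_fps = log_fps" and fps_of_rat_quasilog: "fps_of_rat quasilog_fps = quasilog_fps"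
 by (rule fps_ext, simp add: log_fps_def quasilog_fps_def of_rat_divide)+

lemma fls_ord_bounded_iff:
 fixes F :: "'p::prime_card padic fls"
 shows "fls_ord F > - \<infinity> \<longleftrightarrow> (\<exists>B. \<forall>n. padic_abs (fls_nth F n) \<le> B)"
proof
 have p1: "real CARD('p) > 1" by (rule card_gt_1)
 assume "fls_ord F > - \<infinity>"
 then obtain r where r: "ereal r < fls_ord F" using ereal_dense2[of "- \<infinity>" "fls_ord F"] by auto
 have "padic_abs (fls_nth F n) \<le> real CARD('p) powr (- r)" for n
 proof (cases "fls_nth F n = 0")
  case False
  hence pos: "padic_abs (fls_nth F n) > 0" using padic_abs_nonneg[of "fls_nth F n"] padic_abs_0_iff[of "fls_nth F n"] by linarith
  have "ereal r < padic_ord (fls_nth F n)" using r unfolding fls_ord_def by (rule less_INF_D) simp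
  hence "log (real CARD('p)) (padic_abs (fls_nth F n)) < - r" using False by (simp add: padic_ord_def)
  thus ?thesis using pos p1 by (simp add: log_less_iff less_imp_le)
 qed auto
 thus "\<exists>B. \<forall>n. padic_abs (fls_nth F n) \<le> B" by blast
next
 have p1: "real CARD('p) > 1" by (rule card_gt_1)
 assume "\<exists>B. \<forall>n. padic_abs (fls_nth F n) \<le> B"
 then obtain B0 where B0: "!!n. padic_abs (fls_nth F n) \<le> B0" by blast
 \<comment> \<open>The maximum with 1 makes the bound positive, so that its logarithm is
   meaningful.\<close>
 define B where "B = max B0 1"
 have B: "!!n. padic_abs (fls_nth F n) \<le> B" "B > 0" using B0 by (auto simp: B_def le_max_iff_disj)
 have "ereal (- log (real CARD('p)) B) \<le> fls_ord F"
  unfolding fls_ord_def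
 proof (rule INF_greatest)
  fix n show "ereal (- log (real CARD('p)) B) \<le> padic_ord (fls_nth F n)"
  proof (cases "fls_nth F n = 0")
   case False
   hence pos: "padic_abs (fls_nth F n) > 0" using padic_abs_nonneg[of "fls_nth F n"] padic_abs_0_iff[of "fls_nth F n"] by linarith
   show ?thesis using False pos p1 B by (simp add: padic_ord_def log_le_cancel_iff)
  qed (simp add: padic_ord_def)
 qed
 thus "fls_ord F > - \<infinity>" by (rule less_le_trans[rotated]) simp
qed

text \<open>Composition with U = q + ... is triangular with unit diagonal and entries of absolute
  value at most 1, so the coefficients of F are recovered recursively within the same bound.\<close>

lemma fps_unbounded_compose:
 fixes F U :: "'p::prime_card padic fps"
 assumes U: "fps_bdd 1 U" "fps_nth U 0 = 0" "fps_nth U 1 = 1" and B: "fps_bdd B (F oo U)"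
 shows "fps_bdd B F"
proof -
 have Un: "fps_nth (U ^ n) n = 1" for n
  using U by (simp add: fps_nth_power_0 startsby_zero_power_nth_same)
 have "padic_abs (fps_nth F n) \<le> B" for n
 proof (induction n rule: less_induct)
  case (less n)
  have "fps_nth (F oo U) n = (\<Sum>i<n. fps_nth F i * fps_nth (U ^ i) n) + fps_nth F n"
   using Un[of n] by (simp add: fps_compose_nth atLeast0AtMost lessThan_Suc_atMost[symmetric])
  hence "fps_nth F n = fps_nth (F oo U) n - (\<Sum>i<n. fps_nth F i * fps_nth (U ^ i) n)" by simp
  moreover have "padic_abs (\<Sum>i<n. fps_nth F i * fps_nth (U ^ i) n) \<le> B"
  proof (rule padic_abs_sum_le)
   show "B \<ge> 0" by (rule fps_bdd_nonneg[OF B])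
   fix i assume "i \<in> {..<n}"
   hence "padic_abs (fps_nth F i * fps_nth (U ^ i) n) \<le> B * 1"
    by (intro padic_abs_mult_le less.IH fps_bddD[OF fps_bdd_power[OF U(1)]]) auto
   thus "padic_abs (fps_nth F i * fps_nth (U ^ i) n) \<le> B" by simp
  qed
  ultimately show ?case using fps_bddD[OF B, of n] padic_abs_diff_le by metis
 qed
 thus ?thesis by (simp add: fps_bdd_def)
qed

context
 assumes p3: "CARD('p::prime_card) mod 4 = 3"
begin

private abbreviation (input) "\<Gamma>h \<equiv> padic_Gamma (1 / 2 :: 'p padic)"
private abbreviation (input) "\<Gamma>q \<equiv> padic_Gamma (1 / 4 :: 'p padic)"

lemma odd_CARD: "odd CARD('p)" using p3 by presburger

lemma abs_two: "padic_abs (2 :: 'p padic) = 1"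
proof -
 have "\<not> CARD('p) dvd 2"
 proof
  assume "CARD('p) dvd 2"
  hence "CARD('p) = 2" using prime_card[where 'a = 'p] by (simp add: primes_dvd_imp_eq)
  thus False using odd_CARD by simp
 qed
 from padic_abs_of_nat_unit[OF this] show ?thesis by simp
qed

lemma abs_four: "padic_abs (4 :: 'p padic) = 1"
 using padic_abs_mult[of "2 :: 'p padic" 2] abs_two by simp

lemma abs_eight: "padic_abs (8 :: 'p padic) = 1"
 using padic_abs_mult[of "2 :: 'p padic" 4] abs_two abs_four by simp

lemma abs_morita: "padic_abs (of_int (morita CARD('p) n) :: 'p padic) = 1"
 by (rule padic_abs_of_int_unit) (rule morita_not_dvd[OF prime_card])

lemma padic_abs_eq_of_close:
 assumes "padic_abs (x - y) < padic_abs (x :: 'p padic)"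
 shows "padic_abs y = padic_abs x"
proof -
 have "padic_abs y \<le> max (padic_abs x) (padic_abs (x - y))" using padic_abs_diff_ultra[of x "x - y"] by simp
 moreover have "padic_abs x \<le> max (padic_abs (x - y)) (padic_abs y)" using padic_abs_ultra[of "x - y" y] by simp
 ultimately show ?thesis using assms by auto
qed

text \<open>The index k satisfies 4k - 1 = p (4j + 1): it belongs to the exponent p n of the
  quasi-logarithm when j belongs to the exponent n = 4j + 1 of the logarithm. Passing from Gamma_p(k
  + 1) to Gamma_p(k) brings in the factor 4k = p n + 1.\<close>

lemma binomial_morita_int:
 fixes j :: nat
 defines "k \<equiv> CARD('p) * j + ((CARD('p) + 1) div 4)"
 shows "4 * k = CARD('p) * (4 * j + 1) + 1"
  and "int ((2 * k) choose k) * (int CARD('p) * (4 * int j + 1) + 1) * morita CARD('p) k ^ 2 = 8 * morita CARD('p) (2 * k) * int ((2 * j) choose j)"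
proof -
 have pr: "prime CARD('p)" by (rule prime_card)
 have p2: "CARD('p) \<ge> 3" using p3 by presburger
 have s: "4 * ((CARD('p) + 1) div 4) = CARD('p) + 1" using p3 by presburger
 show k4: "4 * k = CARD('p) * (4 * j + 1) + 1" unfolding k_def using s by (simp add: algebra_simps)
 have s2: "2 * ((CARD('p) + 1) div 4) < CARD('p)" using s p2 by linarith
 have nd: "\<not> CARD('p) dvd k"
 proof
  assume "CARD('p) dvd k"
  hence "CARD('p) dvd ((CARD('p) + 1) div 4)" unfolding k_def by (simp add: dvd_add_right_iff)
  thus False using s s2 by (auto dest!: dvd_imp_le)
 qed
 have nd2: "\<not> CARD('p) dvd 2 * k"
  using nd odd_CARD pr by (metis prime_dvd_mult_iff primes_dvd_imp_eq two_is_prime_nat dvd_refl)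
 have "int ((2 * k) choose k) * morita CARD('p) (Suc k) ^ 2 = - morita CARD('p) (Suc (2 * k)) * int ((2 * j) choose j)"
  by (rule binomial_morita[OF pr k_def[THEN meta_eq_to_obj_eq] s2])
 hence "int k * (int ((2 * k) choose k) * int k * morita CARD('p) k ^ 2) = int k * (2 * morita CARD('p) (2 * k) * int ((2 * j) choose j))"
  unfolding morita_Suc[OF nd] morita_Suc[OF nd2] by (simp add: power2_eq_square mult_ac)
 moreover have "int k ~= 0" using nd by (cases k) auto
 ultimately have "int ((2 * k) choose k) * int k * morita CARD('p) k ^ 2 = 2 * morita CARD('p) (2 * k) * int ((2 * j) choose j)"
  by (simp add: mult_ac)
 hence "int ((2 * k) choose k) * (4 * int k) * morita CARD('p) k ^ 2 = 8 * morita CARD('p) (2 * k) * int ((2 * j) choose j)"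
  by (simp add: mult_ac)
 moreover have "4 * int k = int CARD('p) * (4 * int j + 1) + 1" using arg_cong[OF k4, of int] by (simp add: algebra_simps)
 ultimately show "int ((2 * k) choose k) * (int CARD('p) * (4 * int j + 1) + 1) * morita CARD('p) k ^ 2 = 8 * morita CARD('p) (2 * k) * int ((2 * j) choose j)"
  by (simp only:)
qed

lemma padic_abs_of_nat_power_form:
 assumes "n > 0"
 obtains m where "padic_abs (of_nat n :: 'p padic) = 1 / real CARD('p) ^ m"
proof -
 have p1: "CARD('p) > 1" by (rule prime_gt_1_nat[OF prime_card])
 obtain m w where w: "n = CARD('p) ^ m * w" "\<not> CARD('p) dvd w"
  using multiplicity_decompose'[of n "CARD('p)"] assms p1 by (metis less_irrefl not_less_iff_gr_or_eq nat_dvd_1_iff_1)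
 have "padic_abs (of_nat n :: 'p padic) = 1 / real CARD('p) ^ m"
  by (simp add: w(1) padic_abs_mult padic_abs_power padic_abs_p padic_abs_of_nat_unit[OF w(2)] power_one_over)
 thus thesis by (rule that)
qed

text \<open>With n = 4j + 1 the numbers 2k - 1/2 and k - 1/4 are p n/2 and p n/4, and 2 is a unit.
  The precision is therefore exactly that of the denominator p n to be cancelled.\<close>

lemma Gamma_close:
 fixes j :: nat
 defines "k \<equiv> CARD('p) * j + ((CARD('p) + 1) div 4)"
 defines "\<delta> \<equiv> padic_abs (of_nat (CARD('p) * (4 * j + 1)) :: 'p padic)"
 shows "padic_abs (of_int (morita CARD('p) (2 * k)) - \<Gamma>h) \<le> \<delta>"
  and "padic_abs (of_int (morita CARD('p) k) - \<Gamma>q) \<le> \<delta>"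
  and "\<delta> < 1"
proof -
 have p1: "CARD('p) > 1" by (rule prime_gt_1_nat[OF prime_card])
 have k4: "4 * k = CARD('p) * (4 * j + 1) + 1" unfolding k_def by (rule binomial_morita_int(1))
 hence k4': "(4 * of_nat k :: 'p padic) = of_nat (CARD('p) * (4 * j + 1)) + 1"
  by (metis of_nat_1 of_nat_add of_nat_mult of_nat_numeral)
 obtain m where m: "\<delta> = 1 / real CARD('p) ^ m"
  unfolding \<delta>_def by (rule padic_abs_of_nat_power_form[of "CARD('p) * (4 * j + 1)"]) (use p1 in auto)
 have "(of_nat (2 * k) - 1 / 2 :: 'p padic) = of_nat (CARD('p) * (4 * j + 1)) / 2"
  using k4' by (simp add: field_simps)
 hence "padic_abs (of_nat (2 * k) - 1 / 2 :: 'p padic) = 1 / real CARD('p) ^ m"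
  unfolding m[symmetric] \<delta>_def by (simp only: padic_abs_divide abs_two div_by_1)
 thus "padic_abs (of_int (morita CARD('p) (2 * k)) - \<Gamma>h) \<le> \<delta>"
  unfolding m by (intro padic_Gamma_half_approx p3) simp
 have "(of_nat k - 1 / 4 :: 'p padic) = of_nat (CARD('p) * (4 * j + 1)) / 4"
  using k4' by (simp add: field_simps)
 hence "padic_abs (of_nat k - 1 / 4 :: 'p padic) = 1 / real CARD('p) ^ m"
  unfolding m[symmetric] \<delta>_def by (simp only: padic_abs_divide abs_four div_by_1)
 thus "padic_abs (of_int (morita CARD('p) k) - \<Gamma>q) \<le> \<delta>"
  unfolding m by (intro padic_Gamma_quarter_approx p3) simp
 have "\<delta> \<le> 1 / real CARD('p) * 1"
  unfolding \<delta>_def of_nat_mult padic_abs_mult padic_abs_p by (intro mult_left_mono) (simp_all del: of_nat_mult of_nat_add of_nat_Suc)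
 also have "... < 1" using p1 by simp
 finally show "\<delta> < 1" .
qed

lemma abs_Gamma: "padic_abs \<Gamma>h = 1" "padic_abs \<Gamma>q = 1"
 using Gamma_close[of 0] padic_abs_eq_of_close[of "of_int (morita CARD('p) (2 * ((CARD('p) + 1) div 4)))" \<Gamma>h]
  padic_abs_eq_of_close[of "of_int (morita CARD('p) ((CARD('p) + 1) div 4))" \<Gamma>q] abs_morita by auto

text \<open>The sign is (2/p), by \<open>Legendre_2_cong\<close>.\<close>

definition gamma_unit :: "'p padic" where
 "gamma_unit = (- 1) ^ ((CARD('p) + 1) div 4) * (8 * (\<Gamma>h / \<Gamma>q\<^sup>2))"

lemma abs_gamma_unit: "padic_abs gamma_unit = 1"
 by (simp add: gamma_unit_def padic_abs_mult padic_abs_divide padic_abs_power abs_Gamma abs_eight)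

text \<open>The two coefficients are divided by p n and n in the series, n = 4j + 1, and their
  combination carries the denominator p n; this is the modulus that makes it integral.\<close>

lemma central_coeff_congruence:
 fixes j :: nat
 shows "padic_abs (central_coeff (CARD('p) * j + ((CARD('p) + 1) div 4)) - gamma_unit * central_coeff j) \<le> padic_abs (of_nat (CARD('p) * (4 * j + 1)) :: 'p padic)"
proof -
 define k where "k = CARD('p) * j + ((CARD('p) + 1) div 4)"
 define \<delta> where "\<delta> = padic_abs (of_nat (CARD('p) * (4 * j + 1)) :: 'p padic)"
 define C where "C = (of_nat ((2 * k) choose k) :: 'p padic)"
 define Cj where "Cj = (of_nat ((2 * j) choose j) :: 'p padic)"
 define G2 G where "G2 = (of_int (morita CARD('p) (2 * k)) :: 'p padic)" and "G = (of_int (morita CARD('p) k) :: 'p padic)"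
 define N where "N = (of_nat (CARD('p) * (4 * j + 1)) :: 'p padic)"
 have close: "padic_abs (G2 - \<Gamma>h) \<le> \<delta>" "padic_abs (G - \<Gamma>q) \<le> \<delta>" "\<delta> < 1"
  using Gamma_close[of j] by (simp_all add: G2_def G_def k_def \<delta>_def)
 have ab: "padic_abs C \<le> 1" "padic_abs Cj \<le> 1" "padic_abs G2 = 1" "padic_abs G = 1" "padic_abs N = \<delta>"
  by (simp_all add: C_def Cj_def G2_def G_def abs_morita N_def \<delta>_def)
 have "of_int (int ((2 * k) choose k) * (int CARD('p) * (4 * int j + 1) + 1) * morita CARD('p) k ^ 2) = (of_int (8 * morita CARD('p) (2 * k) * int ((2 * j) choose j)) :: 'p padic)"
  unfolding k_def by (simp only: binomial_morita_int(2))
 hence rel: "C * (N + 1) * G\<^sup>2 = 8 * G2 * Cj" by (simp add: C_def N_def G_def G2_def Cj_def algebra_simps)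
 \<comment> \<open>The exact relation between integers is rewritten with the limits of the Gamma
   values; each of the three remaining terms contains one factor of size at most \<delta>.\<close>
 have "C * \<Gamma>q\<^sup>2 - 8 * \<Gamma>h * Cj = (C * (\<Gamma>q + G)) * (\<Gamma>q - G) - (C * G\<^sup>2) * N + (8 * Cj) * (G2 - \<Gamma>h)"
  using rel by (simp add: algebra_simps power2_eq_square)
 moreover have "padic_abs ((C * (\<Gamma>q + G)) * (\<Gamma>q - G)) \<le> (1 * 1) * \<delta>"
  by (intro padic_abs_mult_le ab padic_abs_add_le)
   (use ab abs_Gamma close padic_abs_commute[of "padic_Gamma (1 / 4)" G] in auto)
 moreover have "padic_abs ((C * G\<^sup>2) * N) \<le> (1 * 1) * \<delta>"
  by (intro padic_abs_mult_le ab) (use ab in \<open>auto simp: padic_abs_power\<close>)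
 moreover have "padic_abs ((8 * Cj) * (G2 - \<Gamma>h)) \<le> (1 * 1) * \<delta>"
  by (intro padic_abs_mult_le ab close) (simp add: abs_eight)
 ultimately have b: "padic_abs (C * \<Gamma>q\<^sup>2 - 8 * \<Gamma>h * Cj) \<le> \<delta>" by (simp add: padic_abs_add_le padic_abs_diff_le)
 have q0: "\<Gamma>q ~= 0" using abs_Gamma(2) by auto
 have "(-1) ^ (CARD('p) * j) = ((-1) ^ j :: 'p padic)" using odd_CARD by (simp add: power_mult)
 hence "central_coeff k - gamma_unit * central_coeff j = (-1) ^ j * (-1) ^ ((CARD('p) + 1) div 4) * (C - 8 * (\<Gamma>h / \<Gamma>q\<^sup>2) * Cj)"
  by (simp add: central_coeff_def k_def[symmetric] gamma_unit_def C_def Cj_def)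
    (simp add: k_def power_add algebra_simps)
 hence "padic_abs (central_coeff k - gamma_unit * central_coeff j) = padic_abs (C - 8 * (\<Gamma>h / \<Gamma>q\<^sup>2) * Cj)"
  by (simp add: padic_abs_mult padic_abs_power)
 also have "C - 8 * (\<Gamma>h / \<Gamma>q\<^sup>2) * Cj = (C * \<Gamma>q\<^sup>2 - 8 * \<Gamma>h * Cj) / \<Gamma>q\<^sup>2" using q0 by (simp add: field_simps)
 also have "padic_abs ... \<le> \<delta>" using b by (simp add: padic_abs_divide padic_abs_power abs_Gamma)
 finally show ?thesis by (simp add: k_def \<delta>_def)
qed

end

section \<open>The Eichler integral and f^+ in terms of the hauptmodul\<close>

lemma fps_of_rat_inverse:
 assumes "fps_nth F 0 ~= 0"
 shows "fps_of_rat (inverse F) = (inverse (fps_of_rat F) :: 'a::field_char_0 fps)"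
proof -
 have "fps_of_rat F * fps_of_rat (inverse F) = (1 :: 'a fps)"
  using assms by (simp add: fps_of_rat_mult[symmetric] inverse_mult_eq_1' fps_of_rat_1)
 thus ?thesis using fps_inverse_unique by metis
qed

lemma fps_of_rat_hauptmodul: "fps_of_rat hauptmodul = hauptmodul"
 by (simp add: hauptmodul_def fps_of_rat_simps fps_of_rat_inverse)

lemma hauptmodul_0 [simp]: "fps_nth hauptmodul 0 = 0" and hauptmodul_1 [simp]: "fps_nth hauptmodul (Suc 0) = 1"
 by (simp_all add: hauptmodul_def mult.assoc)

text \<open>The power series q/x; its coefficients are integers, so the polar term 1/x of f^+ is
  harmless.\<close>

definition hauptmodul_inv :: "'a::field_char_0 fps" where
 "hauptmodul_inv = inverse ((psi_fps oo fps_X ^ 8) * inverse (theta_fps oo fps_X ^ 8))"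

lemma fps_int_hauptmodul_inv: "fps_int (hauptmodul_inv :: 'a::field_char_0 fps)"
 unfolding hauptmodul_inv_def
 by (intro fps_int_mult fps_int_X fps_int_compose_X_power fps_int_inverse fps_int_theta fps_int_psi) simp_all

lemma hauptmodul_inv_mult:
 "fls_shift 1 (fps_to_fls hauptmodul_inv) * fps_to_fls (hauptmodul :: 'a::field_char_0 fps) = 1"
proof -
 define V where "V = (psi_fps oo fps_X ^ 8) * inverse (theta_fps oo fps_X ^ 8 :: 'a fps)"
 have V0: "fps_nth V 0 ~= 0" by (simp add: V_def)
 have U: "hauptmodul = fps_X * V" by (simp add: hauptmodul_def V_def mult.assoc)
 have "fps_to_fls hauptmodul = fls_shift (- 1) (fps_to_fls V)"
  unfolding U fls_times_fps_to_fls by (simp add: fls_X_times_conv_shift)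
 moreover have "fps_to_fls hauptmodul_inv * fps_to_fls V = 1"
  using V0 by (simp add: hauptmodul_inv_def V_def[symmetric] fls_times_fps_to_fls[symmetric] inverse_mult_eq_1)
 ultimately show ?thesis by (simp add: fls_times_both_shifted_simp)
qed

context
 fixes b :: "nat => rat" and f :: "rat fls"
 assumes b0: "b 0 = 0"
  and b: "has_q_expansion cusp_form_32 (fps_to_fls (Abs_fps b))"
  and f: "has_q_expansion (%\<tau>. - cusp_form_32 \<tau> * eta_L (2 * \<tau>)) (q_deriv f)"
begin

text \<open>Both sides have the derivative g/q and vanish at q = 0.\<close>

lemma eichler_fps: "Abs_fps (%n. b n / of_nat n) = (log_fps oo hauptmodul)"
proof -
 define E where "E = Abs_fps (%n. b n / of_nat n)"
 have "fps_X * fps_deriv E = Abs_fps b"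
 proof (rule fps_ext)
  fix n show "fps_nth (fps_X * fps_deriv E) n = fps_nth (Abs_fps b) n"
   using b0 by (cases n) (auto simp: E_def simp del: of_nat_Suc)
 qed
 also have "... = fps_X * fps_deriv (log_fps oo hauptmodul)"
  unfolding cusp_form_hauptmodul(1)[OF b0 b f]
  by (simp add: fps_compose_deriv fps_deriv_log mult_ac)
 finally have "fps_deriv E = fps_deriv (log_fps oo hauptmodul)" by simp
 hence "E = fps_const (fps_nth E 0 - fps_nth (log_fps oo hauptmodul) 0) + (log_fps oo hauptmodul)"
  using fps_deriv_eq_iff by blast
 thus ?thesis by (simp add: E_def log_fps_def)
qed

text \<open>Integrating -x^(-2) (1 + 4 x^4)^(-1/2) dx gives 1/x minus the quasi-logarithm of x, up
  to a constant: the derivative says nothing about the coefficient at 0, hence the hypothesis on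
  n.\<close>

lemma mock_fls:
 assumes "n ~= 0"
 shows "fls_nth f n = fls_nth (fls_shift 1 (fps_to_fls hauptmodul_inv) - fps_to_fls (quasilog_fps oo hauptmodul)) n"
proof -
 define U where "U = (hauptmodul :: rat fps)"
 define u where "u = fps_to_fls U"
 define iu where "iu = fls_shift 1 (fps_to_fls (hauptmodul_inv :: rat fps))"
 define Q where "Q = fps_to_fls (quasilog_fps oo U)"
 define Z where "Z = fps_to_fls ((lemniscate_fps oo U) * fps_deriv U)"
 have iu: "iu * u = 1" unfolding iu_def u_def U_def by (rule hauptmodul_inv_mult)
 have u0: "u ~= 0" using iu by auto
 have "fls_deriv (iu * u) = 0" unfolding iu by simp
 hence "iu * fls_deriv u + fls_deriv iu * u = 0" by simp
 hence "(iu * fls_deriv u + fls_deriv iu * u) * u = 0" by simp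
 hence "fls_deriv iu * u\<^sup>2 = - ((iu * u) * fls_deriv u)"
  by (simp add: power2_eq_square algebra_simps eq_neg_iff_add_eq_0)
 hence d1: "fls_deriv iu * u\<^sup>2 = - fls_deriv u" unfolding iu by simp
 have U0: "fps_nth U 0 = 0" by (simp add: U_def)
 have "fls_deriv Q * u\<^sup>2 = fps_to_fls ((fps_deriv quasilog_fps oo U) * fps_deriv U * U\<^sup>2)"
  using U0 by (simp add: Q_def u_def fls_deriv_fps_to_fls fps_compose_deriv fls_times_fps_to_fls fps_to_fls_power)
 also have "(fps_deriv quasilog_fps oo U) * fps_deriv U * U\<^sup>2 = ((fps_X\<^sup>2 * fps_deriv quasilog_fps) oo U) * fps_deriv U"
  using U0 by (simp add: fps_compose_mult_distrib mult_ac flip: fps_compose_power)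
 also have "... = (lemniscate_fps oo U) * fps_deriv U - fps_deriv U"
  unfolding fps_deriv_quasilog by (simp add: fps_compose_sub_distrib left_diff_distrib)
 finally have d2: "fls_deriv Q * u\<^sup>2 = Z - fls_deriv u"
  by (simp add: Z_def u_def fls_deriv_fps_to_fls)
 have "fls_X * (fls_deriv (iu - Q) * u\<^sup>2) = - (fls_X * Z)"
  by (simp add: left_diff_distrib d1 d2)
 also have "fls_X * Z = fps_to_fls (Abs_fps b)"
  unfolding cusp_form_hauptmodul(1)[OF b0 b f] Z_def U_def by (simp add: fls_times_fps_to_fls mult_ac)
 also have "- fps_to_fls (Abs_fps b) = fls_X * (fls_deriv f * u\<^sup>2)"
  using cusp_form_hauptmodul(2)[OF b0 b f] by (simp add: q_deriv_def u_def U_def fps_to_fls_power mult.assoc)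
 finally have "fls_X * (fls_deriv (iu - Q) * u\<^sup>2) = fls_X * (fls_deriv f * u\<^sup>2)" .
 hence "fls_deriv (iu - Q) = fls_deriv f" using u0 by simp
 hence "fls_nth (fls_deriv (iu - Q)) (n - 1) = fls_nth (fls_deriv f) (n - 1)" by simp
 hence "of_int n * fls_nth (iu - Q) n = of_int n * fls_nth f n" unfolding fls_deriv_nth by simp
 thus ?thesis using assms by (simp add: iu_def Q_def U_def)
qed

end

section \<open>Boundedness, unboundedness and the limit of Catalan quotients\<close>

context
 assumes p3: "CARD('p::prime_card) mod 4 = 3"
begin

private abbreviation (input) "U \<equiv> (hauptmodul :: 'p padic fps)"
private abbreviation (input) "c \<equiv> (gamma_unit :: 'p padic)"

lemma abs_central_coeff_le_1: "padic_abs (central_coeff k :: 'p padic) \<le> 1"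
 by (simp add: central_coeff_def padic_abs_mult padic_abs_power)

text \<open>Denominators occur only at exponents n = p n'. As p = 3 mod 4, n is 3 modulo 4 exactly
  when n' is 1 modulo 4, and there the supercongruence supplies the whole denominator p n'.\<close>

lemma quasilog_log_congruence:
 "fps_bdd 1 (quasilog_fps - fps_const (c / of_nat CARD('p)) * (log_fps oo fps_X ^ CARD('p)))"
 unfolding fps_bdd_def
proof
 fix n
 have p0: "CARD('p) > 0" by simp
 have s: "4 * ((CARD('p) + 1) div 4) = CARD('p) + 1" using p3 by presburger
 show "padic_abs (fps_nth (quasilog_fps - fps_const (c / of_nat CARD('p)) * (log_fps oo fps_X ^ CARD('p))) n) \<le> 1"
 proof (cases "CARD('p) dvd n")
  case False
  hence "padic_abs (of_nat n :: 'p padic) = 1" by (rule padic_abs_of_nat_unit)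
  thus ?thesis using False abs_central_coeff_le_1
   by (simp add: fps_nth_compose_X_power quasilog_fps_def padic_abs_divide)
 next
  case True
  then obtain n' where n': "n = CARD('p) * n'" by blast
  obtain l where l: "CARD('p) = 4 * l + 3" using p3 by (metis mult_div_mod_eq)
  have iff: "n mod 4 = 3 \<longleftrightarrow> n' mod 4 = 1"
  proof -
   have "n = 4 * (l * n') + 3 * n'" unfolding n' l by (simp add: algebra_simps)
   thus ?thesis by presburger
  qed
  show ?thesis
  proof (cases "n' mod 4 = 1")
   case False
   thus ?thesis using iff n' p0 by (simp add: fps_nth_compose_X_power quasilog_fps_def log_fps_def)
  next
   case True
   define j where "j = n' div 4"
   have j: "n' = 4 * j + 1" using True by (simp add: j_def) presburger
   define k where "k = CARD('p) * j + (CARD('p) + 1) div 4"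
   have k4: "4 * k = CARD('p) * (4 * j + 1) + 1" unfolding k_def by (rule binomial_morita_int(1)[OF p3])
   have nk: "(n + 1) div 4 = k" using k4 n' j by simp
   have "n' ~= 0" using j by simp
   hence nz: "(of_nat CARD('p) :: 'p padic) ~= 0" "(of_nat n' :: 'p padic) ~= 0"
    by simp_all
   have "fps_nth (quasilog_fps - fps_const (c / of_nat CARD('p)) * (log_fps oo fps_X ^ CARD('p))) n
     = central_coeff k / of_nat n - (c / of_nat CARD('p)) * (central_coeff j / of_nat n')"
    using iff True n' p0 nk by (simp add: fps_nth_compose_X_power quasilog_fps_def log_fps_def j_def)
   also have "... = (central_coeff k - c * central_coeff j) / of_nat (CARD('p) * (4 * j + 1))"
    unfolding n' j[symmetric] of_nat_mult using nz by (simp add: field_simps)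
   also have "padic_abs ... \<le> 1"
   proof -
    have "padic_abs (of_nat (CARD('p) * (4 * j + 1)) :: 'p padic) > 0"
     using padic_abs_nonneg padic_abs_0_iff by (metis j nz no_zero_divisors of_nat_mult order_less_le)
    thus ?thesis using central_coeff_congruence[OF p3, of j] by (simp add: padic_abs_divide k_def del: of_nat_mult)
   qed
   finally show ?thesis .
  qed
 qed
qed

text \<open>Composition with the integral series x preserves the bound but produces the logarithm of
  x(q)^p in place of that of x(q^p). These agree modulo p, so their i-th powers agree modulo p i,
  which cancels both 1/i and 1/p.\<close>

lemma quasilog_hauptmodul_bdd:
 "fps_bdd 1 ((quasilog_fps oo U) - fps_const (c / of_nat CARD('p)) * ((log_fps oo U) oo fps_X ^ CARD('p)))"
proof -
 let ?p = "CARD('p)"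
 have p0: "?p > 0" by simp
 define A B where "A = U ^ ?p" and "B = (U oo fps_X ^ ?p)"
 have Ub: "fps_bdd 1 U" by (rule fps_int_bdd[OF fps_int_hauptmodul])
 have Bb: "fps_bdd 1 B" unfolding B_def by (rule fps_int_bdd[OF fps_int_compose_X_power[OF fps_int_hauptmodul p0]])
 have A0: "fps_nth (fps_X ^ ?p :: 'p padic fps) 0 = 0" using p0 by (simp add: fps_X_power_nth)
 have 1: "fps_bdd 1 ((quasilog_fps - fps_const (c / of_nat ?p) * (log_fps oo fps_X ^ ?p)) oo U)"
  by (intro fps_bdd_compose quasilog_log_congruence Ub)
 have e1: "(log_fps oo fps_X ^ ?p) oo U = log_fps oo A"
 proof -
  have "(log_fps oo fps_X ^ ?p) oo U = log_fps oo (fps_X ^ ?p oo U)" by (rule fps_compose_assoc[symmetric]) (simp_all add: A0)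
  also have "fps_X ^ ?p oo U = A" by (simp add: A_def flip: fps_compose_power)
  finally show ?thesis .
 qed
 have e2: "(log_fps oo U) oo fps_X ^ ?p = log_fps oo B"
  unfolding B_def by (rule fps_compose_assoc[symmetric]) (simp_all add: A0)
 have AB: "fps_bdd (1 / real ?p) (A - B)" unfolding A_def B_def by (rule frobenius_congruence[OF fps_int_hauptmodul])
 have 2: "fps_bdd 1 (fps_const (c / of_nat ?p) * ((log_fps oo A) - (log_fps oo B)))"
  unfolding fps_bdd_def
 proof
  fix n
  have "fps_nth (fps_const (c / of_nat ?p) * ((log_fps oo A) - (log_fps oo B))) n
   = (\<Sum>i=0..n. (c / of_nat ?p) * (fps_nth log_fps i * fps_nth (A ^ i - B ^ i) n))"
   by (simp add: fps_compose_nth sum_subtractf[symmetric] right_diff_distrib[symmetric] sum_distrib_left)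
  also have "padic_abs ... \<le> 1"
  proof (rule padic_abs_sum_le)
   fix i
   show "padic_abs ((c / of_nat ?p) * (fps_nth log_fps i * fps_nth (A ^ i - B ^ i) n)) \<le> 1"
   proof (cases "i mod 4 = 1")
    case True
    hence i0: "i > 0" by (cases i) auto
    have "padic_abs (fps_nth (A ^ i - B ^ i) n) \<le> padic_abs (of_nat i :: 'p padic) / real ?p"
     by (intro fps_bddD[OF fps_bdd_power_diff_padic[OF _ Bb AB i0]]) (simp add: A_def fps_bdd_power Ub)
    moreover have "padic_abs (fps_nth log_fps i :: 'p padic) \<le> 1 / padic_abs (of_nat i :: 'p padic)"
     using True abs_central_coeff_le_1 by (auto simp: log_fps_def padic_abs_divide intro!: divide_right_mono)
    ultimately have "padic_abs (fps_nth log_fps i * fps_nth (A ^ i - B ^ i) n) \<le> 1 / padic_abs (of_nat i :: 'p padic) * (padic_abs (of_nat i :: 'p padic) / real ?p)"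
     by (rule padic_abs_mult_le[rotated])
    also have "... = 1 / real ?p" using i0 by simp
    finally have 3: "padic_abs (fps_nth log_fps i * fps_nth (A ^ i - B ^ i) n) \<le> 1 / real ?p" .
    have "padic_abs (c / of_nat ?p) \<le> real ?p" by (simp add: padic_abs_divide abs_gamma_unit[OF p3] padic_abs_p)
    from padic_abs_mult_le[OF this 3] show ?thesis by simp
   qed (simp add: log_fps_def)
  qed simp
  finally show "padic_abs (fps_nth (fps_const (c / of_nat ?p) * ((log_fps oo A) - (log_fps oo B))) n) \<le> 1" .
 qed
 have "(quasilog_fps oo U) - fps_const (c / of_nat ?p) * ((log_fps oo U) oo fps_X ^ ?p)
   = ((quasilog_fps - fps_const (c / of_nat ?p) * (log_fps oo fps_X ^ ?p)) oo U) + fps_const (c / of_nat ?p) * ((log_fps oo A) - (log_fps oo B))"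
  unfolding e2 by (simp add: fps_compose_sub_distrib fps_compose_mult_distrib e1 algebra_simps)
 thus ?thesis using fps_bdd_add[OF 1 2] by simp
qed

lemma padic_abs_fact_reduce:
 assumes "n = CARD('p) * m + r" "r < CARD('p)"
 shows "padic_abs (fact n :: 'p padic) = padic_abs (fact m :: 'p padic) / real CARD('p) ^ m"
proof -
 have "(of_int (fact n) :: 'p padic) = of_int ((- 1) ^ Suc n * morita CARD('p) (Suc n) * int CARD('p) ^ m * fact m)"
  using fact_morita[OF prime_card assms] by (simp only:)
 hence "(fact n :: 'p padic) = (- 1) ^ Suc n * of_int (morita CARD('p) (Suc n)) * of_nat CARD('p) ^ m * fact m" by simp
 hence "padic_abs (fact n :: 'p padic) = padic_abs ((- 1) ^ Suc n * of_int (morita CARD('p) (Suc n)) * of_nat CARD('p) ^ m * fact m :: 'p padic)"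
  by (simp only:)
 thus ?thesis
  by (simp add: padic_abs_mult padic_abs_power abs_morita[OF p3] padic_abs_p power_one_over)
qed

lemma padic_abs_central_binomial: "padic_abs (central_coeff n :: 'p padic) = padic_abs (fact (2 * n) :: 'p padic) / padic_abs (fact n :: 'p padic) ^ 2"
 by (simp add: central_coeff_def padic_abs_mult padic_abs_power binomial_fact padic_abs_divide power2_eq_square mult_2)

text \<open>Along the exponents n = 4j + 1, p n = 4k - 1, p^2 n = 4j' + 1, the first step causes no
  new carry when the index is doubled, while the second costs one factor p.\<close>

lemma abs_central_coeff_step:
 assumes k: "4 * k = CARD('p) * (4 * j + 1) + 1" and j': "4 * j' + 1 = CARD('p)\<^sup>2 * (4 * j + 1)"
 shows "padic_abs (central_coeff k :: 'p padic) = padic_abs (central_coeff j :: 'p padic)"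
  and "padic_abs (central_coeff j' :: 'p padic) = padic_abs (central_coeff j :: 'p padic) / real CARD('p)"
proof -
 let ?p = "CARD('p)"
 obtain l where l: "?p = 4 * l + 3" using p3 by (metis mult_div_mod_eq)
 have kj: "k = ?p * j + (l + 1)" using k l by (simp add: algebra_simps)
 have p0: "real ?p > 0" by simp
 have nd: "\<not> ?p dvd k"
 proof
  assume "?p dvd k"
  hence "?p dvd l + 1" unfolding kj by (metis dvd_add_right_iff dvd_triv_left)
  thus False using l by (auto dest!: dvd_imp_le)
 qed
 have "padic_abs (fact (2 * k) :: 'p padic) = padic_abs (fact (2 * j) :: 'p padic) / real ?p ^ (2 * j)"
  by (rule padic_abs_fact_reduce[of _ _ "2 * l + 2"]) (use kj l in \<open>simp_all add: algebra_simps\<close>)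
 moreover have "padic_abs (fact k :: 'p padic) = padic_abs (fact j :: 'p padic) / real ?p ^ j"
  by (rule padic_abs_fact_reduce[of _ _ "l + 1"]) (use kj l in simp_all)
 ultimately show 1: "padic_abs (central_coeff k :: 'p padic) = padic_abs (central_coeff j :: 'p padic)"
  using p0 by (simp add: padic_abs_central_binomial power_divide power_mult[symmetric] mult.commute)
 have "?p * (4 * k) = ?p\<^sup>2 * (4 * j + 1) + ?p" unfolding k by (simp add: power2_eq_square algebra_simps)
 hence "4 * (?p * k) = 4 * j' + 1 + ?p" using j' by (simp only: mult.left_commute[of ?p 4])
 moreover have "4 * (j' + (l + 1)) = 4 * j' + 1 + ?p" unfolding l by simp
 ultimately have "4 * (j' + (l + 1)) = 4 * (?p * k)" by (simp only:)
 hence jk: "j' + (l + 1) = ?p * k" by simp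
 have k0: "k > 0" using kj by simp
 \<comment> \<open>The last digit of j' in base p is 3l + 2, more than half of p = 4l + 3, so
   doubling j' carries into \<open>2 * k1 + 1\<close>. The factor 2k by which this factorial differs
   from that of 2k is a unit.\<close>
 define k1 where "k1 = k - 1"
 have k1: "k = Suc k1" using k0 by (simp add: k1_def)
 have j1: "j' = ?p * k1 + (3 * l + 2)" using jk unfolding k1 using l by simp
 have j2: "2 * j' = ?p * (2 * k1 + 1) + (2 * l + 1)" unfolding j1 using l by (simp add: algebra_simps)
 have a: "padic_abs (fact (2 * j') :: 'p padic) = padic_abs (fact (2 * k1 + 1) :: 'p padic) / real ?p ^ (2 * k1 + 1)"
  by (rule padic_abs_fact_reduce[OF j2]) (use l in simp)
 have b: "padic_abs (fact j' :: 'p padic) = padic_abs (fact k1 :: 'p padic) / real ?p ^ k1"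
  by (rule padic_abs_fact_reduce[OF j1]) (use l in simp)
 have ku: "padic_abs (of_nat k :: 'p padic) = 1" by (rule padic_abs_of_nat_unit[OF nd])
 have "(fact (2 * k) :: 'p padic) = 2 * of_nat k * fact (2 * k1 + 1)" by (simp add: k1 algebra_simps)
 hence "padic_abs (fact (2 * k) :: 'p padic) = padic_abs (fact (2 * k1 + 1) :: 'p padic)"
  by (simp only: padic_abs_mult abs_two[OF p3] ku mult_1)
 moreover have "(fact k :: 'p padic) = of_nat k * fact k1" by (simp add: k1)
 hence "padic_abs (fact k :: 'p padic) = padic_abs (fact k1 :: 'p padic)" by (simp only: padic_abs_mult ku mult_1)
 ultimately have "padic_abs (central_coeff k :: 'p padic) = padic_abs (fact (2 * k1 + 1) :: 'p padic) / padic_abs (fact k1 :: 'p padic) ^ 2"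
  unfolding padic_abs_central_binomial by (simp only:)
 moreover have "padic_abs (central_coeff j' :: 'p padic) = padic_abs (fact (2 * k1 + 1) :: 'p padic) / padic_abs (fact k1 :: 'p padic) ^ 2 / real ?p"
  unfolding padic_abs_central_binomial a b using p0
  by (simp add: power_divide power_mult[symmetric] mult.commute)
 ultimately show "padic_abs (central_coeff j' :: 'p padic) = padic_abs (central_coeff j :: 'p padic) / real ?p"
  using 1 by simp
qed

lemma p_even_power_mod_4: "CARD('p) ^ (2 * m) mod 4 = 1"
proof -
 have "[CARD('p) ^ (2 * m) = 3 ^ (2 * m)] (mod 4)" by (rule cong_pow) (simp add: cong_def p3)
 moreover have "[9 ^ m = 1 ^ m] (mod (4 :: nat))" by (intro cong_pow) (simp add: cong_def)
 hence "[3 ^ (2 * m) = 1] (mod (4 :: nat))" by (simp add: power_mult)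
 ultimately have "[CARD('p) ^ (2 * m) = 1] (mod 4)" by (rule cong_trans)
 thus ?thesis by (simp add: cong_def)
qed

lemma abs_central_coeff_power:
 "padic_abs (central_coeff ((CARD('p) ^ (2 * m) - 1) div 4) :: 'p padic) = 1 / real CARD('p) ^ m"
proof (induction m)
 case (Suc m)
 let ?j = "%m. (CARD('p) ^ (2 * m) - 1) div 4"
 have j: "4 * ?j m + 1 = CARD('p) ^ (2 * m)" for m using p_even_power_mod_4[of m] by presburger
 have "4 * (CARD('p) * ?j m + (CARD('p) + 1) div 4) = CARD('p) * (4 * ?j m + 1) + 1" by (rule binomial_morita_int(1)[OF p3])
 moreover have "4 * ?j (Suc m) + 1 = CARD('p)\<^sup>2 * (4 * ?j m + 1)" unfolding j by (simp add: power2_eq_square)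
 ultimately have "padic_abs (central_coeff (?j (Suc m)) :: 'p padic) = padic_abs (central_coeff (?j m) :: 'p padic) / real CARD('p)"
  by (rule abs_central_coeff_step(2))
 thus ?case unfolding Suc by simp
qed (simp add: central_coeff_def)

text \<open>At the exponent p^(2m) the denominator has valuation 2m, but the central binomial
  coefficient only m.\<close>

lemma log_fps_unbounded: "\<not> fps_bdd B (log_fps :: 'p padic fps)"
proof
 assume B: "fps_bdd B (log_fps :: 'p padic fps)"
 have "real CARD('p) ^ m \<le> B" for m
 proof -
  have "padic_abs (fps_nth log_fps (CARD('p) ^ (2 * m)) :: 'p padic) = real CARD('p) ^ m"
  proof -
   define j where "j = (CARD('p) ^ (2 * m) - 1) div 4"
   have aj: "padic_abs (central_coeff j :: 'p padic) = 1 / real CARD('p) ^ m" unfolding j_def by (rule abs_central_coeff_power)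
   have d: "CARD('p) ^ (2 * m) div 4 = j" using p_even_power_mod_4[of m] unfolding j_def by presburger
   have "padic_abs (fps_nth log_fps (CARD('p) ^ (2 * m)) :: 'p padic) = (1 / real CARD('p) ^ m) / padic_abs (of_nat (CARD('p) ^ (2 * m)) :: 'p padic)"
    using p_even_power_mod_4[of m] by (simp add: log_fps_def padic_abs_divide d aj del: of_nat_power)
   also have "... = real CARD('p) ^ m"
    by (simp add: padic_abs_mult padic_abs_power padic_abs_p power_one_over mult_2 power_add)
   finally show ?thesis .
  qed
  thus ?thesis using fps_bddD[OF B, of "CARD('p) ^ (2 * m)"] by simp
 qed
 moreover obtain m where "B < real CARD('p) ^ m" using real_arch_pow[OF card_gt_1[where 'p = 'p]] by blast
 ultimately show False by (meson not_le)
qed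

text \<open>The supercongruence holds modulo p^(2m+1), while the coefficient in the denominator has
  valuation only m, so enough precision remains after division.\<close>

lemma gamma_limit:
 "(%m. 5 * catalan ((CARD('p) ^ (2 * m + 1) + 1) div 4) / (3 * catalan ((CARD('p) ^ (2 * m) - 1) div 4)) :: 'p padic)
   \<longlonglongrightarrow> (- 1) ^ ((CARD('p) + 1) div 4) * c"
proof (rule tendstoI)
 let ?p = "CARD('p)"
 let ?s = "(?p + 1) div 4"
 define R where "R = (%m. 5 * catalan ((?p ^ (2 * m + 1) + 1) div 4) / (3 * catalan ((?p ^ (2 * m) - 1) div 4)) :: 'p padic)"
 have p1: "real ?p > 1" by (rule card_gt_1)
 have bound: "padic_abs (R m - (- 1) ^ ?s * c) \<le> real ?p * (1 / real ?p ^ m)" for m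
 proof -
  define j where "j = (?p ^ (2 * m) - 1) div 4"
  define k where "k = ?p * j + ?s"
  have j4: "4 * j + 1 = ?p ^ (2 * m)" using p_even_power_mod_4[of m] unfolding j_def by presburger
  have k4: "4 * k = ?p * (4 * j + 1) + 1" unfolding k_def by (rule binomial_morita_int(1)[OF p3])
  have k: "(?p ^ (2 * m + 1) + 1) div 4 = k" using k4 unfolding j4 by simp
  have aj: "padic_abs (central_coeff j :: 'p padic) = 1 / real ?p ^ m" unfolding j_def by (rule abs_central_coeff_power)
  have j0: "(central_coeff j :: 'p padic) ~= 0" using aj p1 by auto
  define x where "x = (central_coeff k / central_coeff j :: 'p padic)"
  define P where "P = (of_nat ?p :: 'p padic)"
  have aP: "padic_abs P = 1 / real ?p" unfolding P_def by (rule padic_abs_p)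
  have xc: "padic_abs (x - c) \<le> 1 / real ?p ^ m"
  proof -
   have "x - c = (central_coeff k - c * central_coeff j) / central_coeff j" using j0 by (simp add: x_def field_simps)
   hence "padic_abs (x - c) = padic_abs (central_coeff k - c * central_coeff j) * real ?p ^ m"
    by (simp add: padic_abs_divide aj)
   also have "... \<le> padic_abs (of_nat (?p * (4 * j + 1)) :: 'p padic) * real ?p ^ m"
    using central_coeff_congruence[OF p3, of j] unfolding k_def by (intro mult_right_mono) auto
   also have "... = 1 / real ?p * (1 / real ?p ^ m)"
    unfolding j4 of_nat_mult padic_abs_mult padic_abs_p of_nat_power padic_abs_power using p1
    by (simp add: power_one_over mult_2 power_add)
   also have "... \<le> 1 * (1 / real ?p ^ m)" using p1 by (intro mult_right_mono) auto
   finally show ?thesis by simp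
  qed
  \<comment> \<open>The origin of 5/3: the denominators of the two Catalan numbers are (p^(2m+1) +
    5)/4 and (p^(2m) + 3)/4, tending to 5/4 and 3/4. Thus \<rho> tends to 1.\<close>
  define \<rho> where "\<rho> = (5 * (P ^ (2 * m) + 3) / (3 * (P ^ (2 * m + 1) + 5)) :: 'p padic)"
  have a5: "padic_abs (5 :: 'p padic) = 1"
  proof -
   have "\<not> ?p dvd 5"
   proof
    assume "?p dvd 5"
    hence "?p = 5" using prime_card[where 'a = 'p] by (simp add: primes_dvd_imp_eq)
    thus False using p3 by simp
   qed
   from padic_abs_of_nat_unit[OF this] show ?thesis by simp
  qed
  \<comment> \<open>For p = 3 the divisor 3 is not a unit; this is the reason for the factor p in
    \<open>bound\<close>.\<close>
  have a3: "1 / real ?p \<le> padic_abs (3 :: 'p padic)"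
  proof (cases "?p = 3")
   case True
   thus ?thesis using padic_abs_p[where 'p = 'p] by simp
  next
   case False
   have "\<not> ?p dvd 3"
   proof
    assume "?p dvd 3"
    hence "?p = 3" using prime_card[where 'a = 'p] by (simp add: primes_dvd_imp_eq)
    thus False using False by simp
   qed
   from padic_abs_of_nat_unit[OF this] show ?thesis using p1 by simp
  qed
  have aP2: "padic_abs (P ^ (2 * m + 1) + 5) = 1"
  proof -
   have "padic_abs (P ^ (2 * m + 1)) < 1"
    unfolding padic_abs_power aP using p1 by (intro power_less_one_iff[THEN iffD2]) auto
   thus ?thesis using padic_abs_eq_of_close[OF p3, of 5 "P ^ (2 * m + 1) + 5"] a5 by simp
  qed
  have n3: "(3 :: 'p padic) ~= 0" "P ^ (2 * m + 1) + 5 ~= 0" using aP2 by auto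
  have r1: "padic_abs (\<rho> - 1) \<le> real ?p * (1 / real ?p ^ m)"
  proof -
   have "\<rho> - 1 = P ^ (2 * m) * (5 - 3 * P) / (3 * (P ^ (2 * m + 1) + 5))"
   proof -
    define Q S where "Q = P ^ (2 * m)" and "S = P ^ (2 * m + 1)"
    have nz: "3 * (S + 5) ~= 0" unfolding S_def using n3 by (simp only: mult_eq_0_iff) simp
    have "\<rho> - 1 = 5 * (Q + 3) / (3 * (S + 5)) - 3 * (S + 5) / (3 * (S + 5))"
     unfolding divide_self[OF nz] by (simp only: \<rho>_def Q_def S_def)
    also have "... = (5 * (Q + 3) - 3 * (S + 5)) / (3 * (S + 5))" by (rule diff_divide_distrib[symmetric])
    also have "5 * (Q + 3) - 3 * (S + 5) = Q * (5 - 3 * P)" by (simp add: Q_def S_def algebra_simps)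
    finally show ?thesis by (simp add: Q_def S_def)
   qed
   moreover have "padic_abs (5 - 3 * P) \<le> 1"
    using padic_abs_of_int_le_1[of "5 - 3 * int ?p", where 'p = 'p] by (simp add: P_def)
   ultimately have "padic_abs (\<rho> - 1) \<le> (1 / real ?p) ^ (2 * m) * 1 / padic_abs (3 :: 'p padic)"
    by (simp only: padic_abs_divide padic_abs_mult padic_abs_power aP aP2 mult_1_right) (intro divide_right_mono mult_left_mono, simp_all)
   also have "... \<le> (1 / real ?p) ^ (2 * m) * 1 / (1 / real ?p)"
    using a3 p1 by (intro divide_left_mono mult_pos_pos) (auto intro: less_le_trans[of 0 "1 / real ?p"])
   also have "... \<le> (1 / real ?p) ^ m * 1 / (1 / real ?p)"
    using p1 by (intro divide_right_mono mult_right_mono power_decreasing) auto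
   finally show ?thesis by (simp add: power_one_over mult.commute)
  qed
  have R: "R m = (- 1) ^ ?s * (x * \<rho>)"
  proof -
   have j': "4 * of_nat j + 1 = P ^ (2 * m)" using arg_cong[OF j4, of "of_nat :: nat => 'p padic"] by (simp add: P_def add.commute)
   have k': "4 * of_nat k = P ^ (2 * m + 1) + 1" using arg_cong[OF k4[unfolded j4], of "of_nat :: nat => 'p padic"] by (simp add: P_def)
   have cat: "(catalan n :: 'p padic) = (-1) ^ n * central_coeff n * 4 / (4 * of_nat n + 4)" for n
   proof -
    have "(4 * of_nat n + 4 :: 'p padic) = 4 * of_nat (n + 1)" by simp
    thus ?thesis by (simp add: catalan_def central_coeff_def power_mult_distrib[symmetric] del: of_nat_add of_nat_Suc)
   qed
   have ck: "catalan k = (-1) ^ k * central_coeff k * 4 / (P ^ (2 * m + 1) + 5)"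
    unfolding cat using k' by (simp add: add.assoc)
   have cj: "catalan j = (-1) ^ j * central_coeff j * 4 / (P ^ (2 * m) + 3)"
   proof -
    have "4 * of_nat j + 4 = P ^ (2 * m) + 3" unfolding j'[symmetric] by simp
    thus ?thesis unfolding cat by simp
   qed
   have sgn: "(-1) ^ k = (-1) ^ j * ((-1) ^ ?s :: 'p padic)"
   proof -
    have "odd ?p" by (rule odd_CARD[OF p3])
    thus ?thesis by (simp add: k_def power_add power_mult)
   qed
   have "R m = 5 * catalan k / (3 * catalan j)" unfolding R_def k j_def[symmetric] ..
   also have "... = (- 1) ^ ?s * (x * \<rho>)"
   proof -
    have "5 * (a * s * K * 4 / A) / (3 * (a * J * 4 / B)) = s * (K / J * (5 * B / (3 * A)))"
     if "a ~= 0" "J ~= 0" for a s K J A B :: "'p padic"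
     by (cases "B = 0"; cases "A = 0") (use that in \<open>simp_all add: divide_simps\<close>)
    from this[of "(- 1) ^ j" "central_coeff j", OF _ j0] show ?thesis
     unfolding ck cj sgn x_def \<rho>_def by (simp only: power_eq_0_iff neg_equal_0_iff_equal one_neq_zero simp_thms)
   qed
   finally show ?thesis .
  qed
  have "R m - (- 1) ^ ?s * c = (- 1) ^ ?s * ((x - c) * \<rho> + c * (\<rho> - 1))"
   unfolding R by (simp add: algebra_simps)
  hence "padic_abs (R m - (- 1) ^ ?s * c) = padic_abs ((x - c) * \<rho> + c * (\<rho> - 1))"
   by (simp add: padic_abs_mult padic_abs_power)
  also have "... \<le> real ?p * (1 / real ?p ^ m)"
  proof (rule padic_abs_add_le)
   have "padic_abs \<rho> \<le> real ?p"
   proof -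
    have "real ?p * (1 / real ?p ^ m) \<le> real ?p * 1" using p1 by (intro mult_left_mono) auto
    hence "padic_abs (\<rho> - 1) \<le> real ?p" using r1 by linarith
    thus ?thesis using padic_abs_add_le[of "\<rho> - 1" "real ?p" 1] p1 by simp
   qed
   from padic_abs_mult_le[OF xc this] show "padic_abs ((x - c) * \<rho>) \<le> real ?p * (1 / real ?p ^ m)" by simp
   show "padic_abs (c * (\<rho> - 1)) \<le> real ?p * (1 / real ?p ^ m)"
    using r1 by (simp add: padic_abs_mult abs_gamma_unit[OF p3])
  qed
  finally show ?thesis .
 qed
 fix e :: real assume e: "e > 0"
 have "(%m. real ?p * (1 / real ?p ^ m)) \<longlonglongrightarrow> real ?p * 0"
  by (intro tendsto_mult tendsto_const inverse_card_power_tendsto_0)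
 hence "eventually (%m. real ?p * (1 / real ?p ^ m) < e) sequentially"
  using e by (intro order_tendstoD(2)) auto
 thus "eventually (%m. dist (R m) ((- 1) ^ ?s * c) < e) sequentially"
  by eventually_elim (use bound in \<open>auto simp: dist_padic_def intro: le_less_trans\<close>)
qed

end

section \<open>The exceptional pair\<close>

context
 fixes b :: "nat => rat" and f :: "rat fls"
 assumes p3: "CARD('p::prime_card) mod 4 = 3"
  and b0: "b 0 = 0"
  and b: "has_q_expansion cusp_form_32 (fps_to_fls (Abs_fps b))"
  and f: "has_q_expansion (%\<tau>. - cusp_form_32 \<tau> * eta_L (2 * \<tau>)) (q_deriv f)"
  and f0: "fls_nth f 0 = 0"
begin

private definition E :: "'p padic fps" where "E = log_fps oo hauptmodul"

private lemma E_nth: "fps_nth E m = of_rat (b m / of_nat m)"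
proof -
 have "fps_of_rat (Abs_fps (%n. b n / of_nat n)) = E"
  unfolding eichler_fps[OF b0 b f] E_def by (simp add: fps_of_rat_compose fps_of_rat_log fps_of_rat_hauptmodul)
 thus ?thesis by (metis fps_nth_of_rat fps_nth_Abs_fps)
qed

private lemma eichler_fls: "fls_of_rat (eichler_integral b) = fps_to_fls E"
proof (rule fls_eqI)
 fix n show "fls_nth (fls_of_rat (eichler_integral b)) n = fls_nth (fps_to_fls E) n"
  by (cases n rule: int_cases) (auto simp: eichler_integral_def E_nth)
qed

private definition combo :: "'p padic => 'p padic => 'p padic fls" where
 "combo \<beta> \<gamma> = fls_of_rat f - fls_const \<beta> * fls_of_rat (eichler_integral b)
    - fls_const (\<gamma> * (1 / of_nat CARD('p))) * fls_compose_power (fls_of_rat (eichler_integral b)) CARD('p)"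

private lemma combo_nth:
 "fls_nth (combo \<beta> \<gamma>) n = of_rat (fls_nth f n) - \<beta> * fls_nth (fps_to_fls E) n
   - \<gamma> / of_nat CARD('p) * (if int CARD('p) dvd n then fls_nth (fps_to_fls E) (n div int CARD('p)) else 0)"
proof -
 have p0: "CARD('p) > 0" by simp
 show ?thesis unfolding combo_def eichler_fls by (simp add: fls_nth_compose_power[OF p0])
qed

private lemma E_support: "fps_nth E n = 0" if "n mod 4 ~= 1"
proof -
 have "b n = 0" by (rule cusp_form_support[OF b0 b f that])
 thus ?thesis by (simp add: E_nth)
qed

text \<open>The combination is 1/x minus the series bounded in
  \<open>quasilog_hauptmodul_bdd\<close>; the minus sign of the quasi-logarithm in f^+ is what makes
  the value of \<gamma> negative. At n = 0 all parts vanish.\<close>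

private lemma combo_bounded: "padic_abs (fls_nth (combo 0 (- gamma_unit)) n) \<le> 1"
proof (cases "n = 0")
 case True
 thus ?thesis using f0 by (simp add: combo_nth E_support)
next
 case False
 let ?p = "CARD('p)"
 define iu where "iu = fls_shift 1 (fps_to_fls (hauptmodul_inv :: rat fps))"
 define K where "K = ((quasilog_fps oo hauptmodul) - fps_const (gamma_unit / of_nat ?p) * ((log_fps oo hauptmodul) oo fps_X ^ ?p) :: 'p padic fps)"
 have K: "fps_bdd 1 K" unfolding K_def by (rule quasilog_hauptmodul_bdd[OF p3])
 have q: "of_rat (fps_nth (quasilog_fps oo hauptmodul) m) = (fps_nth (quasilog_fps oo hauptmodul) m :: 'p padic)" for m
  by (metis fps_nth_of_rat fps_of_rat_compose fps_of_rat_quasilog fps_of_rat_hauptmodul)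
 have fn: "fls_nth f n = fls_nth iu n - fls_nth (fps_to_fls (quasilog_fps oo hauptmodul)) n"
  using mock_fls[OF b0 b f False] by (simp add: iu_def)
 have "fls_nth (combo 0 (- gamma_unit)) n = of_rat (fls_nth iu n) - fls_nth (fps_to_fls K) n"
 proof (cases "n < 0")
  case True
  have "n div int ?p < 0" using True by (simp add: div_neg_pos_less0)
  thus ?thesis using True fn by (simp add: combo_nth)
 next
  case False
  then obtain m where m: "n = int m" using nonneg_int_cases[of n] by auto
  have p0: "?p > 0" by simp
  have "(if int ?p dvd n then fls_nth (fps_to_fls E) (n div int ?p) else 0) = fps_nth (E oo fps_X ^ ?p) m"
   unfolding m fps_nth_compose_X_power by (simp add: zdiv_int[symmetric])
  thus ?thesis unfolding combo_nth fn by (simp add: m of_rat_diff q K_def E_def)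
 qed
 moreover have "padic_abs (of_rat (fls_nth iu n) :: 'p padic) \<le> 1"
 proof -
  have "fls_nth iu n \<in> \<int>" using fps_int_hauptmodul_inv[where 'a = rat] by (auto simp: iu_def fps_int_def)
  thus ?thesis by (auto elim!: Ints_cases)
 qed
 moreover have "padic_abs (fls_nth (fps_to_fls K) n) \<le> 1" using fps_bddD[OF K] by simp
 ultimately show ?thesis by (simp add: padic_abs_diff_le)
qed

private lemma E_unbounded: "\<not> fps_bdd B E"
proof
 assume "fps_bdd B E"
 hence "fps_bdd B ((log_fps :: 'p padic fps) oo hauptmodul)" by (simp only: E_def)
 hence "fps_bdd B (log_fps :: 'p padic fps)"
  by (rule fps_unbounded_compose[OF fps_int_bdd[OF fps_int_hauptmodul], rotated 2]) simp_all
 thus False using log_fps_unbounded[OF p3] by blast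
qed

text \<open>Subtracting the bounded combination leaves a multiple of E(q) plus a multiple of E(q^p).
  Their exponents are 1 and 3 modulo 4, so each multiple is bounded by itself, hence zero because E
  is unbounded.\<close>

theorem exceptional_pair:
 "fls_ord (fls_of_rat f - fls_const \<beta> * fls_of_rat (eichler_integral b)
    - fls_const (\<gamma> * (1 / of_nat CARD('p))) * fls_compose_power (fls_of_rat (eichler_integral b)) CARD('p)) > - \<infinity>
   \<longleftrightarrow> \<beta> = 0 & \<gamma> = - (gamma_unit :: 'p padic)"
proof -
 let ?p = "CARD('p)"
 have p0: "?p > 0" by simp
 have "fls_ord (combo \<beta> \<gamma>) > - \<infinity> \<longleftrightarrow> \<beta> = 0 & \<gamma> = - gamma_unit"
 proof
  assume "\<beta> = 0 & \<gamma> = - gamma_unit"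
  thus "fls_ord (combo \<beta> \<gamma>) > - \<infinity>" using combo_bounded unfolding fls_ord_bounded_iff by blast
 next
  assume "fls_ord (combo \<beta> \<gamma>) > - \<infinity>"
  then obtain B where B: "!!n. padic_abs (fls_nth (combo \<beta> \<gamma>) n) \<le> B" unfolding fls_ord_bounded_iff by blast
  define C where "C = max B 1"
  \<comment> \<open>The coefficient left in front of E(q^p); its vanishing is the claim about
    \<gamma>.\<close>
  define g where "g = (\<gamma> + gamma_unit) / of_nat ?p"
  have diff: "padic_abs (\<beta> * fps_nth E m + g * fps_nth (E oo fps_X ^ ?p) m) \<le> C" for m
  proof -
   have "fls_nth (combo 0 (- gamma_unit)) (int m) - fls_nth (combo \<beta> \<gamma>) (int m) = \<beta> * fps_nth E m + g * fps_nth (E oo fps_X ^ ?p) m"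
    unfolding combo_nth fps_nth_compose_X_power
    by (simp add: g_def zdiv_int[symmetric] field_simps)
   moreover have "padic_abs (fls_nth (combo 0 (- gamma_unit)) (int m) - fls_nth (combo \<beta> \<gamma>) (int m)) \<le> C"
    using combo_bounded[of "int m"] B[of "int m"] by (intro padic_abs_diff_le) (auto simp: C_def le_max_iff_disj)
   ultimately show ?thesis by simp
  qed
  obtain l where l: "?p = 4 * l + 3" using p3 by (metis mult_div_mod_eq)
  have sup: "fps_nth (E oo fps_X ^ ?p) m = 0" if "m mod 4 = 1" for m
  proof (cases "?p dvd m")
   case True
   then obtain r where r: "m = ?p * r" by blast
   have "m = 4 * (l * r) + 3 * r" unfolding r l by (simp add: algebra_simps)
   hence "r mod 4 ~= 1" using that by presburger
   thus ?thesis using r p0 E_support by (simp add: fps_nth_compose_X_power)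
  qed (simp add: fps_nth_compose_X_power)
  have \<beta>0: "\<beta> = 0"
  proof (rule ccontr)
   assume nz: "\<beta> ~= 0"
   have "padic_abs (fps_nth E m) \<le> C / padic_abs \<beta>" for m
   proof (cases "m mod 4 = 1")
    case True
    have "padic_abs \<beta> * padic_abs (fps_nth E m) \<le> C" using diff[of m] sup[OF True] by (simp add: padic_abs_mult)
    moreover have "padic_abs \<beta> > 0" using nz padic_abs_nonneg[of \<beta>] padic_abs_0_iff[of \<beta>] by linarith
    ultimately show ?thesis by (simp add: field_simps)
   qed (auto simp: E_support C_def)
   thus False using E_unbounded by (auto simp: fps_bdd_def)
  qed
  have "g = 0"
  proof (rule ccontr)
   assume nz: "g ~= 0"
   have "padic_abs (fps_nth E m) \<le> C / padic_abs g" for m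
   proof -
    have "padic_abs g * padic_abs (fps_nth E m) \<le> C"
     using diff[of "?p * m"] p0 by (simp add: \<beta>0 padic_abs_mult fps_nth_compose_X_power)
    moreover have "padic_abs g > 0" using nz padic_abs_nonneg[of g] padic_abs_0_iff[of g] by linarith
    ultimately show ?thesis by (simp add: field_simps)
   qed
   thus False using E_unbounded by (auto simp: fps_bdd_def)
  qed
  hence "\<gamma> + gamma_unit = 0" using p0 by (simp add: g_def)
  thus "\<beta> = 0 & \<gamma> = - gamma_unit" using \<beta>0 by (simp add: eq_neg_iff_add_eq_0)
 qed
 thus ?thesis by (simp add: combo_def)
qed

end

section \<open>Gamma_p(1/2), the class number and the final formula\<close>

context
 assumes p3: "CARD('p::prime_card) mod 4 = 3"
begin

lemma padic_Gamma_half_square: "(padic_Gamma (1 / 2) :: 'p padic)\<^sup>2 = 1"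
proof -
 let ?p = "CARD('p)"
 define G where "G = (padic_Gamma (1 / 2) :: 'p padic)"
 have "padic_abs (G\<^sup>2 - 1) \<le> 1 / real ?p ^ m" for m
 proof -
  define n where "n = (?p ^ m + 1) div 2"
  define M where "M = morita ?p n"
  have "odd ?p" using p3 by presburger
  hence "even (?p ^ m + 1)" by simp
  hence "2 * n = ?p ^ m + 1" by (simp add: n_def)
  hence n2: "2 * of_nat n = (of_nat ?p ^ m + 1 :: 'p padic)" by (metis of_nat_mult of_nat_numeral of_nat_add of_nat_power of_nat_1)
  have "of_nat n - 1 / 2 = (of_nat ?p ^ m / 2 :: 'p padic)" using n2 by (simp add: field_simps)
  hence "padic_abs (of_nat n - 1 / 2 :: 'p padic) \<le> 1 / real ?p ^ m"
   by (simp only: padic_abs_divide padic_abs_power padic_abs_p abs_two[OF p3] power_one_over div_by_1 order_refl)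
  hence a: "padic_abs (of_int M - G) \<le> 1 / real ?p ^ m" unfolding M_def G_def by (rule padic_Gamma_half_approx[OF p3])
  have "int ?p ^ m dvd M ^ 2 - 1"
   using morita_half_square[OF prime_card[where 'a = 'p] p3, of m] by (simp add: M_def n_def cong_iff_dvd_diff)
  hence b: "padic_abs (of_int (M ^ 2 - 1) :: 'p padic) \<le> 1 / real ?p ^ m" by (rule padic_abs_of_int_dvd)
  have le1: "1 / real ?p ^ m \<le> 1" by simp
  have "padic_abs (of_int M - (of_int M - G)) \<le> 1" by (rule padic_abs_diff_le[OF _ order_trans[OF a le1]]) simp
  hence "padic_abs G \<le> 1" by simp
  hence "padic_abs (of_int M + G) \<le> 1" by (intro padic_abs_add_le) auto
  hence "padic_abs ((of_int M - G) * (of_int M + G)) \<le> 1 / real ?p ^ m * 1"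
   unfolding padic_abs_mult using a by (intro mult_mono) auto
  hence "padic_abs (of_int (M ^ 2 - 1) - (of_int M - G) * (of_int M + G)) \<le> 1 / real ?p ^ m"
   using b by (intro padic_abs_diff_le) auto
  also have "of_int (M ^ 2 - 1) - (of_int M - G) * (of_int M + G) = G\<^sup>2 - 1" by (simp add: power2_eq_square algebra_simps)
  finally show ?thesis .
 qed
 moreover have "(%m. 1 / real ?p ^ m) \<longlonglongrightarrow> 0" by (rule inverse_card_power_tendsto_0)
 ultimately have "padic_abs (G\<^sup>2 - 1) \<le> 0" by (intro LIMSEQ_le_const) auto
 hence "G\<^sup>2 - 1 = 0" using padic_abs_nonneg[of "G\<^sup>2 - 1"] padic_abs_0_iff[of "G\<^sup>2 - 1"] by linarith
 thus ?thesis by (simp add: G_def)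
qed

text \<open>Since (p + 1)/2 is even, Gamma_p((p + 1)/2) is the factorial of (p - 1)/2 without sign.
  It agrees with Gamma_p(1/2) modulo p, and this suffices because 1 and -1 differ by a unit.\<close>

lemma padic_Gamma_half_eq_sign:
 assumes s: "[int (fact ((CARD('p) - 1) div 2)) = s] (mod int CARD('p))" "s = 1 \<or> s = - 1"
 shows "(padic_Gamma (1 / 2) :: 'p padic) = of_int s"
proof -
 let ?p = "CARD('p)"
 define G where "G = (padic_Gamma (1 / 2) :: 'p padic)"
 have p1: "real ?p > 1" by (rule card_gt_1)
 obtain l where l: "?p = 4 * l + 3" using p3 by (metis mult_div_mod_eq)
 define n where "n = 2 * l + 2"
 have M: "morita ?p n = int (fact ((?p - 1) div 2))"
 proof -
  have "{j. 1 \<le> j & j < n & \<not> ?p dvd j} = {1..2 * l + 1}"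
  proof (intro equalityI subsetI)
   fix j assume j: "j \<in> {1..2 * l + 1}"
   hence "\<not> ?p dvd j" using l by (auto dest!: dvd_imp_le)
   thus "j \<in> {j. 1 \<le> j & j < n & \<not> ?p dvd j}" using j by (simp add: n_def)
  qed (auto simp: n_def)
  moreover have "(?p - 1) div 2 = 2 * l + 1" using l by simp
  moreover have "even n" by (simp add: n_def)
  ultimately show ?thesis unfolding morita_def by (simp only: power_even_eq fact_prod of_nat_prod minus_one_power_iff if_True mult_1 of_nat_id)
 qed
 have n2: "of_nat n * 2 = (of_nat ?p + 1 :: 'p padic)"
 proof -
  have "n * 2 = ?p + 1" using l by (simp add: n_def)
  hence "(of_nat (n * 2) :: 'p padic) = of_nat (?p + 1)" by (simp only:)
  thus ?thesis by (simp only: of_nat_mult of_nat_add of_nat_1 of_nat_numeral)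
 qed
 have "of_nat n - 1 / 2 = (of_nat ?p / 2 :: 'p padic)" using n2 by (simp add: field_simps)
 hence "padic_abs (of_nat n - 1 / 2 :: 'p padic) \<le> 1 / real ?p ^ 1"
  by (simp only: padic_abs_divide padic_abs_p abs_two[OF p3]) simp
 hence a: "padic_abs (of_int (morita ?p n) - G) \<le> 1 / real ?p ^ 1" unfolding G_def by (rule padic_Gamma_half_approx[OF p3])
 have "int ?p ^ 1 dvd morita ?p n - s" using s(1) unfolding M by (simp add: cong_iff_dvd_diff)
 hence b: "padic_abs (of_int (morita ?p n - s) :: 'p padic) \<le> 1 / real ?p ^ 1" by (rule padic_abs_of_int_dvd)
 have "padic_abs (of_int (morita ?p n - s) - (of_int (morita ?p n) - G)) \<le> 1 / real ?p ^ 1" by (rule padic_abs_diff_le[OF b a])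
 hence c: "padic_abs (G - of_int s) \<le> 1 / real ?p" by simp
 have "G = 1 \<or> G = - 1" using padic_Gamma_half_square by (simp add: G_def power2_eq_1_iff)
 hence "G = of_int s \<or> G = - of_int s" using s(2) by auto
 moreover have "G ~= - of_int s"
 proof
  assume "G = - of_int s"
  hence "G - of_int s = 2 \<or> G - of_int s = - 2" using s(2) by auto
  hence "padic_abs (G - of_int s) = 1" using abs_two[OF p3] by auto
  thus False using c p1 by simp
 qed
 ultimately show ?thesis by (simp add: G_def)
qed

end

text \<open>The minus sign is the passage from (h + 1)/2 in Mordell's congruence to (3 +
  h)/2.\<close>

lemma padic_Gamma_half_class_number:
 assumes p3: "CARD('p::prime_card) mod 4 = 3" and gt: "CARD('p) > 3"
 shows "(padic_Gamma (1 / 2) :: 'p padic) = - ((- 1) ^ ((3 + class_number (quadratic_field (- int CARD('p)))) div 2))"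
proof -
 define k where "k = (CARD('p) + 1) div 4"
 define h where "h = class_number (quadratic_field (- int CARD('p)))"
 have k: "4 * k = CARD('p) + 1" using p3 unfolding k_def by presburger
 note p = prime_card[where 'a = 'p] p3
 interpret prime_3_mod_4 "CARD('p)" k by unfold_locales (use p k in auto)
 have "[int (fact ((CARD('p) - 1) div 2)) = (- 1) ^ ((h + 1) div 2)] (mod int CARD('p))"
  unfolding h_def by (rule half_factorial_class_number(2)[OF p k class_number_formula[OF gt]])
 from padic_Gamma_half_eq_sign[OF p3 this]
 have "(padic_Gamma (1 / 2) :: 'p padic) = of_int ((- 1) ^ ((h + 1) div 2))" by (simp add: minus_one_power_iff)
 moreover have "(3 + h) div 2 = Suc ((h + 1) div 2)" by presburger
 ultimately show ?thesis unfolding h_def[symmetric] by simp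
qed

text \<open>The minus sign before the limit and before the Gamma quotient is that of the
  quasi-logarithm in f^+. In the last form it is absorbed, for p > 3 by Gamma_p(1/2) = -(-1)^((3 +
  h)/2) and for p = 3 by (2/3) = -1.\<close>

theorem theorem1p2:
  fixes p :: nat and b :: "nat \<Rightarrow> rat" and d :: "int \<Rightarrow> rat" and f_plus :: "rat fls"
  assumes "p = CARD('p::prime_card)" and "prime p" and "[p = 3] (mod 4)"
    and "b 0 = 0" and "has_q_expansion cusp_form_32 (fps_to_fls (Abs_fps b))"
    and "\<And>n. fls_nth f_plus n = d n / of_int n"
    and "has_q_expansion (\<lambda>\<tau>. - cusp_form_32 \<tau> * eta_L (2 * \<tau>)) (q_deriv f_plus)"
  shows "\<exists>\<beta> \<gamma> :: 'p padic.
    (\<forall>\<beta>' \<gamma>'. fls_ord (fls_of_rat f_plus - fls_const \<beta>' * fls_of_rat (eichler_integral b)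
        - fls_const (\<gamma>' * (1 / of_nat p)) * fls_compose_power (fls_of_rat (eichler_integral b)) p) > - \<infinity>
      \<longleftrightarrow> \<beta>' = \<beta> \<and> \<gamma>' = \<gamma>) \<and>
    convergent (\<lambda>m. 5 * catalan ((p ^ (2 * m + 1) + 1) div 4) / (3 * catalan ((p ^ (2 * m) - 1) div 4)) :: 'p padic) \<and>
    \<gamma> = - of_int (Legendre 2 (int p)) *
        lim (\<lambda>m. 5 * catalan ((p ^ (2 * m + 1) + 1) div 4) / (3 * catalan ((p ^ (2 * m) - 1) div 4))) \<and>
    \<gamma> = - (8 * of_int (Legendre 2 (int p)) * (padic_Gamma (1 / 2) / padic_Gamma (1 / 4) ^ 2)) \<and>
    \<gamma> = (if p > 3
         then of_int (Legendre 2 (int p)) * (- 1) ^ ((3 + class_number (quadratic_field (- int p))) div 2)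
              * (8 / padic_Gamma (1 / 4) ^ 2)
         else 8 / padic_Gamma (1 / 4) ^ 2)"
proof -
 have p3: "CARD('p) mod 4 = 3" using assms(1,3) by (simp add: cong_def)
 \<comment> \<open>Division by zero gives zero, so the hypothesis on the coefficients fixes the
   constant term, which the derivative leaves open.\<close>
 have f0: "fls_nth f_plus 0 = 0" using assms(6)[of 0] by simp
 define k where "k = (CARD('p) + 1) div 4"
 have k: "4 * k = CARD('p) + 1" using p3 unfolding k_def by presburger
 define \<epsilon> where "\<epsilon> = ((- 1) ^ k :: 'p padic)"
 define \<gamma> where "\<gamma> = - (gamma_unit :: 'p padic)"
 define X where "X = (%m. 5 * catalan ((CARD('p) ^ (2 * m + 1) + 1) div 4) / (3 * catalan ((CARD('p) ^ (2 * m) - 1) div 4)) :: 'p padic)"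
 define H where "H = (padic_Gamma (1 / 2) :: 'p padic)"
 define Q where "Q = (padic_Gamma (1 / 4) :: 'p padic)"
 have L: "of_int (Legendre 2 (int CARD('p))) = \<epsilon>"
  unfolding Legendre_2_cong[OF prime_card[where 'a = 'p] p3 k] \<epsilon>_def by simp
 have ee: "\<epsilon> * \<epsilon> = 1" unfolding \<epsilon>_def by (simp add: power_mult_distrib[symmetric])
 have gu: "\<gamma> = - (\<epsilon> * (8 * (H / Q\<^sup>2)))"
  unfolding \<gamma>_def \<epsilon>_def k_def H_def Q_def using p3 by (simp only: gamma_unit_def)
 have lim: "X \<longlonglongrightarrow> \<epsilon> * gamma_unit" unfolding X_def \<epsilon>_def k_def by (rule gamma_limit[OF p3])
 show ?thesis
  unfolding assms(1)
  unfolding L X_def[symmetric] H_def[symmetric] Q_def[symmetric]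
 proof (rule exI[of _ 0], rule exI[of _ \<gamma>], intro conjI allI)
  fix \<beta>' \<gamma>'
  show "fls_ord (fls_of_rat f_plus - fls_const \<beta>' * fls_of_rat (eichler_integral b)
    - fls_const (\<gamma>' * (1 / of_nat CARD('p))) * fls_compose_power (fls_of_rat (eichler_integral b)) CARD('p)) > - \<infinity>
   \<longleftrightarrow> \<beta>' = 0 & \<gamma>' = \<gamma>"
   unfolding \<gamma>_def by (rule exceptional_pair[OF p3 assms(4,5,7) f0])
  show "convergent X" using lim by (rule convergentI)
  have "- \<epsilon> * lim X = - (\<epsilon> * \<epsilon> * gamma_unit)" unfolding limI[OF lim] by simp
  thus "\<gamma> = - \<epsilon> * lim X" unfolding ee \<gamma>_def by simp
  show "\<gamma> = - (8 * \<epsilon> * (H / Q\<^sup>2))" unfolding gu by (simp only: mult.left_commute mult.assoc)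
  show "\<gamma> = (if CARD('p) > 3
     then \<epsilon> * (- 1) ^ ((3 + class_number (quadratic_field (- int CARD('p)))) div 2) * (8 / Q\<^sup>2)
     else 8 / Q\<^sup>2)"
  proof (cases "CARD('p) > 3")
   case True
   show ?thesis unfolding gu using padic_Gamma_half_class_number[OF p3 True] True by (simp add: H_def)
  next
   case False
   \<comment> \<open>Here the extra units put the prime outside \<open>class_number_formula\<close>;
     the factorial of (p - 1)/2 is 1, so Gamma_p(1/2) = 1 directly.\<close>
   hence c3: "CARD('p) = 3" using p3 by presburger
   have "[int (fact ((CARD('p) - 1) div 2)) = 1] (mod int CARD('p))" unfolding c3 by simp
   from padic_Gamma_half_eq_sign[OF p3 this] have "H = 1" by (simp add: H_def)
   moreover have "\<epsilon> = - 1" unfolding \<epsilon>_def k_def c3 by simp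
   ultimately show ?thesis unfolding gu using False by simp
  qed
 qed
qed

end
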